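(* Let $0<\alpha_1,\alpha_2<\pi/2$ and let $f\in Exp(\alpha_1,\alpha_2)$ be of finite exponential type $(h_1,h_2)$ in $\Delta_{\alpha_1}\times\Delta_{\alpha_2}$, with $h_1,h_2\ge0$. Let $A_1^{\pm},A_2^{\pm}$ be real numbers such that, for every choice of signs $s_1,s_2\in\{+,-\}$ and every $\varepsilon>0$, there is a constant $k_\varepsilon$ with $$|f(z_1,z_2)|\le k_\varepsilon e^{(A_1^{s_1}+\varepsilon)|z_1|+(A_2^{s_2}+\varepsilon)|z_2|}\quad\text{for }\arg z_1=s_1\alpha_1,\ \arg z_2=s_2\alpha_2.$$ Let $m$ be the two-dimensional concatenated Laplace transform of $f$, and let $p_1,p_2$ be real numbers with $p_1\cos(\alpha_1)<-h_1$ and $p_2\cos(\alpha_2)<-h_2$, defining the curves $\Gamma_1,\Gamma_2$ ($m$ and $\Gamma_1,\Gamma_2$ are defined in the context). Then the following Fourier inversion formula holds: $$f(z_1,z_2)=\int_{\Gamma_1}\int_{\Gamma_2}m(\omega_1,\omega_2)\,e^{-\omega_1z_1-\omega_2z_2}\,d\omega_2\,d\omega_1\qquad\text{for }z_1\in\Delta_{\alpha_1},\ z_2\in\Delta_{\alpha_2}.$$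
   Context: For $0<\alpha<\pi/2$ let $\Delta_{\alpha}=\{z\in\mathbb{C}\setminus\{0\}:|\arg z|<\alpha\}$. A function $f$ on $\Delta_{\alpha_1}\times\Delta_{\alpha_2}$ is of finite exponential type $(h_1,h_2)$, where $h_1,h_2\ge 0$, if for every $\varepsilon>0$ there is a constant $k_\varepsilon\ge 0$ with $|f(z_1,z_2)|\le k_\varepsilon e^{(h_1+\varepsilon)|z_1|+(h_2+\varepsilon)|z_2|}$ for all $z_j\in\Delta_{\alpha_j}$, $j=1,2$. $Exp(\alpha_1,\alpha_2)$ is the class of functions analytic and of finite exponential type in $\Delta_{\alpha_1}\times\Delta_{\alpha_2}$. The values of $f$ at points with $\arg z_1=\pm\alpha_1$, $\arg z_2=\pm\alpha_2$ are understood as non-tangential limits of $f$. For $j=1,2$ put $$\Omega_j^{+}=\{\omega\in\mathbb{C}:\mathrm{Re}(\omega e^{i\alpha_j})<-A_j^+\},\quad \Omega_j^{-}=\{\omega\in\mathbb{C}:\mathrm{Re}(\omega e^{-i\alpha_j})<-A_j^-\},\quad \Omega_j=\Omega_j^+\cup\Omega_j^-.$$ The two-dimensional concatenated Laplace transform $m$ of $f$ is the function with domain $\Omega_1\times\Omega_2$ given, for each $s_1,s_2\in\{+,-\}$, by $$m(\omega_1,\omega_2)=\frac{-1}{4\pi^2}\int_{e^{s_2i\alpha_2}[0,+\infty)}\int_{e^{s_1i\alpha_1}[0,+\infty)}f(\zeta_1,\zeta_2)\,e^{\omega_1\zeta_1+\omega_2\zeta_2}\,d\zeta_1\,d\zeta_2,\qquad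 \omega_1\in\Omega_1^{s_1},\ \omega_2\in\Omega_2^{s_2}.$$ (The four integrals converge absolutely and agree on the overlaps of their domains.) The curve $\Gamma_j$ ($j=1,2$) is given by the parametrization $\gamma_j:\mathbb{R}\to\mathbb{C}$, $$\gamma_j(t)=p_j-ie^{i\alpha_j}|t|\ \text{ for }t\le0,\qquad \gamma_j(t)=p_j+ie^{-i\alpha_j}|t|\ \text{ for }t>0.$$
   Formalization: The formal statement also assumes that each curve Γ_j lies in Ω_j (equivalently p_j cos α_j < -A_j^±), without which m is undefined on part of Γ_1×Γ_2, e.g. f = 1, h_j = 0, A_j^± = 5, p_j = -1/cos α_j. *)

theory Defs
  imports "HOL-Complex_Analysis.Complex_Analysis"
begin

definition sector :: "real \<Rightarrow> complex set" where
  "sector \<alpha> = {z. z \<noteq> 0 \<and> \<bar>Arg z\<bar> < \<alpha>}"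

text \<open>Analyticity in two complex variables: Frechet differentiability with a complex-linear
  derivative. It is only used on open sets.\<close>

definition analytic2_on :: "(complex \<times> complex \<Rightarrow> complex) \<Rightarrow> (complex \<times> complex) set \<Rightarrow> bool" where
  "analytic2_on f S \<longleftrightarrow>
     (\<forall>z\<in>S. \<exists>a b. (f has_derivative (\<lambda>h. a * fst h + b * snd h)) (at z within S))"

definition finite_exp_type ::
    "real \<Rightarrow> real \<Rightarrow> real \<Rightarrow> real \<Rightarrow> (complex \<times> complex \<Rightarrow> complex) \<Rightarrow> bool" where
  "finite_exp_type \<alpha>1 \<alpha>2 h1 h2 f \<longleftrightarrow>
     (\<forall>\<epsilon>>0. \<exists>k\<ge>0. \<forall>z1\<in>sector \<alpha>1. \<forall>z2\<in>sector \<alpha>2.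
        cmod (f (z1, z2)) \<le> k * exp ((h1 + \<epsilon>) * cmod z1 + (h2 + \<epsilon>) * cmod z2))"

definition Exp_class :: "real \<Rightarrow> real \<Rightarrow> (complex \<times> complex \<Rightarrow> complex) set" where
  "Exp_class \<alpha>1 \<alpha>2 = {f. analytic2_on f (sector \<alpha>1 \<times> sector \<alpha>2) \<and>
     (\<exists>h1\<ge>0. \<exists>h2\<ge>0. finite_exp_type \<alpha>1 \<alpha>2 h1 h2 f)}"

text \<open>Non-tangential limits at points of the product of the two boundaries. The approach region
  with aperture c at a boundary point of a sector consists of the points whose distance to
  the boundary point is less than c times their distance to the whole boundary (it is empty
  for c at most 1). The two variables approach their boundary points independently.\<close>

definition nontangential_region :: "real \<Rightarrow> real \<Rightarrow> complex \<Rightarrow> complex set" where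
  "nontangential_region \<alpha> c \<zeta> =
     {z \<in> sector \<alpha>. dist z \<zeta> < c * infdist z (frontier (sector \<alpha>))}"

definition has_nontangential_limit ::
    "real \<Rightarrow> real \<Rightarrow> (complex \<times> complex \<Rightarrow> complex) \<Rightarrow> complex \<times> complex \<Rightarrow> complex \<Rightarrow> bool" where
  "has_nontangential_limit \<alpha>1 \<alpha>2 f \<zeta> L \<longleftrightarrow>
     (\<forall>c>1. (f \<longlongrightarrow> L) (at \<zeta> within
        (nontangential_region \<alpha>1 c (fst \<zeta>) \<times> nontangential_region \<alpha>2 c (snd \<zeta>))))"

definition boundary_value ::
    "real \<Rightarrow> real \<Rightarrow> (complex \<times> complex \<Rightarrow> complex) \<Rightarrow> complex \<times> complex \<Rightarrow> complex" where
  "boundary_value \<alpha>1 \<alpha>2 f \<zeta> = (THE L. has_nontangential_limit \<alpha>1 \<alpha>2 f \<zeta> L)"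

datatype sign = Pos | Neg

fun sign_val :: "sign \<Rightarrow> real" where
  "sign_val Pos = 1"
| "sign_val Neg = -1"

definition half_plane :: "real \<Rightarrow> (sign \<Rightarrow> real) \<Rightarrow> sign \<Rightarrow> complex set" where
  "half_plane \<alpha> A s = {\<omega>. Re (\<omega> * cis (sign_val s * \<alpha>)) < - A s}"

definition Omega :: "real \<Rightarrow> (sign \<Rightarrow> real) \<Rightarrow> complex set" where
  "Omega \<alpha> A = half_plane \<alpha> A Pos \<union> half_plane \<alpha> A Neg"

text \<open>Integrals are taken with respect to the completed measure, because boundary values are
  determined only almost everywhere.\<close>

definition ray_integral :: "real \<Rightarrow> (complex \<Rightarrow> complex) \<Rightarrow> complex" where
  "ray_integral \<theta> g =
     set_lebesgue_integral lebesgue {0..} (\<lambda>t. g (cis \<theta> * of_real t) * cis \<theta>)"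

definition laplace_integral ::
    "real \<Rightarrow> real \<Rightarrow> (complex \<times> complex \<Rightarrow> complex) \<Rightarrow> sign \<Rightarrow> sign \<Rightarrow> complex \<Rightarrow> complex \<Rightarrow> complex" where
  "laplace_integral \<alpha>1 \<alpha>2 f s1 s2 \<omega>1 \<omega>2 = - 1 / (4 * of_real pi ^ 2) *
     ray_integral (sign_val s2 * \<alpha>2) (\<lambda>\<zeta>2.
       ray_integral (sign_val s1 * \<alpha>1) (\<lambda>\<zeta>1.
         boundary_value \<alpha>1 \<alpha>2 f (\<zeta>1, \<zeta>2) * exp (\<omega>1 * \<zeta>1 + \<omega>2 * \<zeta>2)))"

text \<open>The transform is only meaningful on Omega \<alpha>1 A1 \<times> Omega \<alpha>2 A2. There the description
  determines a value because the four integrals agree on the overlaps of their domains.\<close>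

definition concatenated_laplace ::
    "real \<Rightarrow> real \<Rightarrow> (sign \<Rightarrow> real) \<Rightarrow> (sign \<Rightarrow> real) \<Rightarrow> (complex \<times> complex \<Rightarrow> complex) \<Rightarrow>
     complex \<Rightarrow> complex \<Rightarrow> complex" where
  "concatenated_laplace \<alpha>1 \<alpha>2 A1 A2 f \<omega>1 \<omega>2 =
     (THE v. \<forall>s1 s2. \<omega>1 \<in> half_plane \<alpha>1 A1 s1 \<longrightarrow> \<omega>2 \<in> half_plane \<alpha>2 A2 s2 \<longrightarrow>
        v = laplace_integral \<alpha>1 \<alpha>2 f s1 s2 \<omega>1 \<omega>2)"

definition Gamma_curve :: "real \<Rightarrow> real \<Rightarrow> real \<Rightarrow> complex" where
  "Gamma_curve \<alpha> p t =
     (if t \<le> 0 then of_real p - \<i> * cis \<alpha> * of_real \<bar>t\<bar>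
      else of_real p + \<i> * cis (- \<alpha>) * of_real \<bar>t\<bar>)"

definition curve_integral :: "(real \<Rightarrow> complex) \<Rightarrow> (complex \<Rightarrow> complex) \<Rightarrow> complex" where
  "curve_integral \<gamma> g = (LINT t|lebesgue. g (\<gamma> t) * vector_derivative \<gamma> (at t))"

end

theory Submission imports Defs begin

text \<open>
  Mapping a neighbourhood of a boundary ray to the half-plane reduces the existence of the boundary
  values of \<open>f\<close> to Fatou's theorem in two variables: almost everywhere on the product of two boundary rays
  there is a non-tangential limit \<open>B\<close>, which is also the limit of the shifts \<open>f (z1 + \<eta>, z2 + \<eta>)\<close> as
  \<open>\<eta> \<rightarrow> 0\<close>. For the shifts, which are continuous up to the boundary, the inversion formula follows in each
  variable from Fubini's theorem, since integrating \<open>exp (\<omega> * (\<zeta> - z))\<close> over a leg of \<open>\<Gamma>\<close> gives the Cauchy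
  kernel of the sector. Dominated convergence carries it over to \<open>f\<close>. The transform of the shifts does not
  depend on the choice of rays where all of them are admissible, by Cauchy's theorem; this gives the
  agreement of the four integrals far to the left, and the identity theorem extends it to the overlaps.
\<close>

text \<open>The boundary values are the delicate point: they exist almost everywhere only, while the
  formula needs a Borel function that is a limit of objects analytic up to the boundary. A shift
  along the positive axis serves all purposes: it carries the closed sector into the open one, moves
  a boundary point nontangentially (\<eta> away from the point, at least \<eta> sin \<alpha> from
  the boundary), and costs only a constant factor in the exponential bounds. The conditions on
  \<open>p1\<close> and \<open>p2\<close> enter through one identity: for \<omega> on a leg of
  \<Gamma> and \<zeta> on the matching ray, Re (\<omega> \<zeta>) is p cos \<alpha> times |\<zeta>|,
  which beats the growth of f, while exp (-\<omega> z) decays along the leg at a rate equal to the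
  distance of z from the line through that ray. One leg yields only one side of a Cauchy integral;
  the formula appears for the sum of the two legs, and this dictates how the integrals are
  interchanged. The constant -1/(4 pi^2) is 1/(2 pi i)^2, one Cauchy factor per variable. The
  identity theorem is used in one complex variable: both arguments are translated by the same
  number.\<close>

subsection \<open>Differentiability almost everywhere\<close>

text \<open>The explicit differentiation theorem controls averages over [x, x + h] only, off a
  negligible set; applied to \<open>f\<close> and to its reflection it yields both one-sided
  derivatives. The base point \<open>a\<close> may be quantified inside because the increment from x
  to y does not depend on it.\<close>

lemma AE_indefinite_integral_has_vector_derivative:
  fixes f :: "real \<Rightarrow> 'b::euclidean_space"
  assumes int: "\<And>a b. f integrable_on {a..b}"
  shows "AE x in lborel. \<forall>a<x. ((\<lambda>s. integral {a..s} f) has_vector_derivative f x) (at x)"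
proof -
  have int': "\<And>a b. f integrable_on cbox a b"
    using int by simp
  obtain N1 where N1: "negligible N1" and
    d1: "\<And>x e. \<lbrakk>x \<notin> N1; 0 < e\<rbrakk> \<Longrightarrow> \<exists>d>0. \<forall>h. 0 < h \<and> h < d \<longrightarrow>
           norm (integral (cbox x (x + h *\<^sub>R One)) f /\<^sub>R h ^ DIM(real) - f x) < e"
    using integrable_ccontinuous_explicit[OF int'] by metis
  have intr: "(\<lambda>x. f (- x)) integrable_on cbox a b" for a b
    using Henstock_Kurzweil_Integration.integrable_reflect_real[of f "-a" "-b"] int by simp
  obtain N2 where N2: "negligible N2" and
    d2: "\<And>x e. \<lbrakk>x \<notin> N2; 0 < e\<rbrakk> \<Longrightarrow> \<exists>d>0. \<forall>h. 0 < h \<and> h < d \<longrightarrow>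
           norm (integral (cbox x (x + h *\<^sub>R One)) (\<lambda>x. f (- x)) /\<^sub>R h ^ DIM(real) - f (- x)) < e"
    using integrable_ccontinuous_explicit[OF intr] by metis
  have N3: "negligible (uminus ` N2)"
    by (rule negligible_differentiable_image_negligible[OF _ N2])
      (auto intro!: derivative_intros simp: differentiable_on_def)
  have ae: "AE x in lebesgue. x \<notin> N1 \<union> uminus ` N2"
    using negligible_Un[OF N1 N3] by (intro AE_not_in) (simp add: negligible_iff_null_sets)
  have "((\<lambda>s. integral {a..s} f) has_vector_derivative f x) (at x)"
    if x: "x \<notin> N1 \<union> uminus ` N2" and a: "a < x" for a x
  proof -
    have x1: "x \<notin> N1" and x2: "- x \<notin> N2" using x by force+
    have *: "\<exists>d>0. \<forall>y. 0 < norm (y - x) \<and> norm (y - x) < d \<longrightarrow>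
      norm (integral {a..y} f - integral {a..x} f - (y - x) *\<^sub>R f x) \<le> e * norm (y - x)" if e: "e > 0" for e
    proof -
      obtain r1 where r1: "r1 > 0" "\<And>h. 0 < h \<Longrightarrow> h < r1 \<Longrightarrow> norm (integral {x..x + h} f /\<^sub>R h - f x) < e"
        using d1[OF x1 e] by auto
      obtain r2 where r2: "r2 > 0" "\<And>h. 0 < h \<Longrightarrow> h < r2 \<Longrightarrow> norm (integral {-x..-x + h} (\<lambda>x. f (-x)) /\<^sub>R h - f x) < e"
        using d2[OF x2 e] by auto
      show ?thesis
      proof (intro exI conjI allI impI)
        show "min (min r1 r2) (x - a) > 0" using r1 r2 a by auto
        fix y assume y: "0 < norm (y - x) \<and> norm (y - x) < min (min r1 r2) (x - a)"
        consider "y > x" | "y < x" using y by fastforce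
        then show "norm (integral {a..y} f - integral {a..x} f - (y - x) *\<^sub>R f x) \<le> e * norm (y - x)"
        proof cases
          case 1
          define h where "h = y - x"
          have h: "0 < h" "h < r1" using y 1 by (auto simp: h_def)
          have i: "integral {a..x} f + integral {x..y} f = integral {a..y} f"
            by (rule Henstock_Kurzweil_Integration.integral_combine) (use a 1 int in auto)
          have "integral {a..y} f - integral {a..x} f - (y - x) *\<^sub>R f x = h *\<^sub>R (integral {x..x+h} f /\<^sub>R h - f x)"
            using h i by (simp add: scaleR_diff_right) (simp add: h_def algebra_simps)
          then have "norm (integral {a..y} f - integral {a..x} f - (y - x) *\<^sub>R f x) = h * norm (integral {x..x+h} f /\<^sub>R h - f x)"
            using h by (metis abs_of_pos norm_scaleR)
          also have "\<dots> \<le> h * e" using r1(2)[OF h] h by (intro mult_left_mono) auto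
          finally show ?thesis using h by (simp add: h_def mult.commute)
        next
          case 2
          define h where "h = x - y"
          have h: "0 < h" "h < r2" using y 2 by (auto simp: h_def)
          have i: "integral {a..y} f + integral {y..x} f = integral {a..x} f"
            by (rule Henstock_Kurzweil_Integration.integral_combine) (use a y 2 int in auto)
          have r: "integral {-x..-x+h} (\<lambda>x. f (-x)) = integral {y..x} f"
            using Henstock_Kurzweil_Integration.integral_reflect_real[of x y f] by (simp add: h_def)
          have "integral {a..y} f - integral {a..x} f - (y - x) *\<^sub>R f x = (-h) *\<^sub>R (integral {-x..-x+h} (\<lambda>x. f (-x)) /\<^sub>R h - f x)"
            using h i unfolding r by (simp add: scaleR_diff_right) (simp add: h_def algebra_simps)
          then have "norm (integral {a..y} f - integral {a..x} f - (y - x) *\<^sub>R f x) = h * norm (integral {-x..-x+h} (\<lambda>x. f (-x)) /\<^sub>R h - f x)"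
            using h by (metis abs_of_pos norm_scaleR abs_minus)
          also have "\<dots> \<le> h * e" using r2(2)[OF h] h by (intro mult_left_mono) auto
          finally show ?thesis using h 2 by (simp add: h_def mult.commute)
        qed
      qed
    qed
    show ?thesis
      unfolding has_vector_derivative_def has_derivative_at_alt
    proof (intro conjI allI impI bounded_linear_scaleR_left)
      fix e :: real assume "e > 0"
      then obtain d where "d > 0" and d: "\<And>y. 0 < norm (y - x) \<Longrightarrow> norm (y - x) < d \<Longrightarrow>
          norm (integral {a..y} f - integral {a..x} f - (y - x) *\<^sub>R f x) \<le> e * norm (y - x)"
        using * by metis
      show "\<exists>d>0. \<forall>y. norm (y - x) < d \<longrightarrow>
          norm (integral {a..y} f - integral {a..x} f - (y - x) *\<^sub>R f x) \<le> e * norm (y - x)"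
        by (intro exI[of _ d] conjI allI impI \<open>d > 0\<close>) (metis d diff_self eq_iff_diff_eq_0 mult_zero_right norm_zero order_refl scale_zero_left zero_less_norm_iff)
    qed
  qed
  then have "AE x in lebesgue. \<forall>a<x. ((\<lambda>s. integral {a..s} f) has_vector_derivative f x) (at x)"
    by (intro eventually_mono[OF ae]) blast
  then show ?thesis by (simp add: AE_completion_iff)
qed

text \<open>Adding a multiple of the identity makes the function an increasing homeomorphism; its
  Stieltjes measure is absolutely continuous, so the function is an indefinite integral.\<close>

lemma lipschitz_AE_differentiable:
  fixes \<phi> :: "real \<Rightarrow> real"
  assumes L: "\<And>s t. \<bar>\<phi> s - \<phi> t\<bar> \<le> M * \<bar>s - t\<bar>"
  shows "AE x in lborel. \<phi> differentiable at x"
proof -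
  \<comment> \<open>The slope exceeds the Lipschitz constant by one, so increments of
    \<open>F\<close> are at least those of the identity: it is strictly increasing and onto, with
    Lipschitz constant \<open>2 * M + 1\<close>.\<close>
  define F where "F = (\<lambda>x. \<phi> x + (M + 1) * x)"
  have incr: "F t - F s \<ge> t - s" if "s \<le> t" for s t
    using L[of t s] that by (auto simp: F_def algebra_simps abs_le_iff)
  have M0: "M \<ge> 0" using L[of 0 1] by (auto simp: abs_if split: if_splits)
  have lip: "\<bar>F t - F s\<bar> \<le> (2*M+1) * \<bar>t - s\<bar>" for s t
  proof -
    have "F t - F s = (\<phi> t - \<phi> s) + (M+1) * (t - s)" by (simp add: F_def algebra_simps)
    also have "\<bar>\<dots>\<bar> \<le> \<bar>\<phi> t - \<phi> s\<bar> + (M+1) * \<bar>t - s\<bar>"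
      using M0 by (intro order_trans[OF abs_triangle_ineq]) (simp add: abs_mult)
    finally show ?thesis using L[of t s] by (simp add: algebra_simps)
  qed
  have contF: "continuous_on UNIV F"
  proof -
    have "(2*M+1)-lipschitz_on UNIV F"
      using lip M0 by (intro lipschitz_onI) (auto simp: dist_real_def)
    then show ?thesis by (rule lipschitz_on_continuous_on)
  qed
  have less: "F s < F t \<longleftrightarrow> s < t" for s t
    using incr[of s t] incr[of t s] by (cases "s < t") (auto simp: not_less)
  have inj: "inj F" using less by (intro injI) (metis linorder_neq_iff)
  have surj: "\<exists>x. F x = y" for y
  proof -
    define l where "l = \<bar>y - F 0\<bar>"
    have "F (-l) \<le> y" "y \<le> F l" "-l \<le> l" using incr[of "-l" 0] incr[of 0 l] by (auto simp: l_def)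
    then show ?thesis using IVT'[of F "-l" y l] contF continuous_on_subset by blast
  qed
  define G where "G = inv F"
  have FG: "F (G y) = y" for y using surj unfolding G_def by (metis f_inv_into_f rangeI)
  have GF: "G (F x) = x" for x using inj by (simp add: G_def)
  have Gmono: "mono G"
    by (rule monoI) (metis FG less not_le)
  have Gmeas[measurable]: "G \<in> borel_measurable borel"
    using Gmono by (rule borel_measurable_mono)
  \<comment> \<open>The push-forward under the inverse of \<open>F\<close> gives the interval from s
    to t the mass \<open>F t - F s\<close>: this is the Stieltjes measure of
    \<open>F\<close>.\<close>
  define \<mu> where "\<mu> = distr lborel borel G"
  have sets\<mu>: "sets \<mu> = sets lborel" by (simp add: \<mu>_def)
  have ac: "absolutely_continuous lborel \<mu>"
    unfolding absolutely_continuous_def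
  proof
    fix A :: "real set" assume A: "A \<in> null_sets lborel"
    then have As: "A \<in> sets borel" by auto
    \<comment> \<open>The preimage under the inverse is an image under the Lipschitz function
      \<open>F\<close>, and such images of null sets are null.\<close>
    have "G -` A = F ` A" by (auto simp: GF image_iff) (metis FG)
    moreover have "negligible (F ` A)"
    proof (rule negligible_locally_Lipschitz_image)
      show "negligible A" using A by (simp add: negligible_iff_null_sets null_sets_completionI)
      fix x show "\<exists>T B. open T \<and> x \<in> T \<and> (\<forall>y\<in>A \<inter> T. norm (F y - F x) \<le> B * norm (y - x))"
        using lip by (intro exI[of _ UNIV] exI[of _ "2*M+1"]) auto
    qed simp
    ultimately have "negligible (G -` A)" by simp
    moreover have "G -` A \<in> sets borel"
      using measurable_sets[OF Gmeas As] by simp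
    ultimately have "emeasure lborel (G -` A) = 0"
      by (simp add: negligible_iff_null_sets null_sets_completion_iff null_sets_def)
    then show "A \<in> null_sets \<mu>"
      using As by (simp add: null_sets_def \<mu>_def emeasure_distr)
  qed
  obtain g where g[measurable]: "g \<in> borel_measurable lborel" and dens: "density lborel g = \<mu>"
    using sigma_finite_measure.Radon_Nikodym[OF sigma_finite_lborel ac sets\<mu>] by auto
  have em: "emeasure \<mu> {s..t} = ennreal (F t - F s)" if "s \<le> t" for s t
  proof -
    have "G -` {s..t} = {F s..F t}"
      using less by (auto simp: not_less[symmetric]) (metis FG)+
    then show ?thesis using that incr[of s t]
      by (simp add: \<mu>_def emeasure_distr)
  qed
  have nn: "(\<integral>\<^sup>+x. g x * indicator {s..t} x \<partial>lborel) = ennreal (F t - F s)" if "s \<le> t" for s t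
    using em[OF that] by (simp add: dens[symmetric] emeasure_density)
  \<comment> \<open>The density has finite mass on every bounded interval, so it is finite almost
    everywhere and can be replaced by a real function.\<close>
  have fin: "AE x in lborel. g x \<noteq> \<infinity>"
  proof -
    have "AE x in lborel. g x * indicator {- real n..real n} x \<noteq> \<infinity>" for n
      by (rule nn_integral_PInf_AE) (use nn[of "- real n" "real n"] in auto)
    then have "AE x in lborel. \<forall>n. g x * indicator {- real n..real n} x \<noteq> \<infinity>"
      by (simp add: AE_all_countable)
    then show ?thesis
    proof eventually_elim
      case (elim x)
      obtain n where "\<bar>x\<bar> \<le> real n" using real_arch_simple by blast
      then show ?case using elim[rule_format, of n] by (simp add: abs_le_iff)
    qed
  qed
  define b where "b = (\<lambda>x. enn2real (g x))"
  have [measurable]: "b \<in> borel_measurable borel" using g unfolding b_def by simp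
  have hi: "(b has_integral (F t - F s)) {s..t}" if "s \<le> t" for s t
  proof -
    have e: "(\<integral>\<^sup>+x. ennreal (b x * indicator {s..t} x) \<partial>lborel) = ennreal (F t - F s)"
      unfolding nn[OF that, symmetric]
      by (rule nn_integral_cong_AE) (use fin in eventually_elim, auto simp: b_def indicator_def less_top)
    have "integrable lborel (\<lambda>x. b x * indicator {s..t} x)"
      by (rule integrableI_nonneg) (use e in \<open>auto simp: b_def\<close>)
    moreover have "integral\<^sup>L lborel (\<lambda>x. b x * indicator {s..t} x) = F t - F s"
      by (rule integral_eq_nn_integral[THEN trans]) (use e that incr[of s t] in \<open>auto simp: b_def\<close>)
    ultimately have "((\<lambda>x. b x * indicator {s..t} x) has_integral (F t - F s)) UNIV"
      using has_integral_integral_lborel by metis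
    moreover have "(\<lambda>x. b x * indicator {s..t} x) = (\<lambda>x. if x \<in> {s..t} then b x else 0)" by auto
    ultimately show ?thesis by (metis has_integral_restrict_UNIV)
  qed
  have bint: "b integrable_on {s..t}" for s t
    using hi[of s t] by (cases "s \<le> t") (auto simp: integrable_on_def)
  have "AE x in lborel. \<forall>a<x. ((\<lambda>s. integral {a..s} b) has_vector_derivative b x) (at x)"
    by (rule AE_indefinite_integral_has_vector_derivative) (rule bint)
  then show ?thesis
  proof eventually_elim
    case (elim x)
    define a where "a = x - 1"
    have "((\<lambda>s. integral {a..s} b + F a - (M+1) * s) has_real_derivative b x - (M+1)) (at x)"
      using elim[rule_format, of a] unfolding a_def has_real_derivative_iff_has_vector_derivative[symmetric]
      by (auto intro!: derivative_eq_intros)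
    then have "(\<phi> has_real_derivative b x - (M+1)) (at x)"
    proof (rule has_field_derivative_transform_within_open[where S="{a<..}"])
      fix s assume "s \<in> {a<..}"
      then have "integral {a..s} b = F s - F a" using hi[of a s] by (auto intro: integral_unique)
      then show "integral {a..s} b + F a - (M+1) * s = \<phi> s" by (simp add: F_def)
    qed (auto simp: a_def)
    then show ?case by (auto simp: real_differentiable_def)
  qed
qed

subsection \<open>The Poisson kernel of the half-plane\<close>

text \<open>Approach region at the boundary point \<open>x\<close> of the upper half-plane (empty for \<open>0 < c \<le> 1\<close>).\<close>

definition stolz :: "real \<Rightarrow> real \<Rightarrow> complex set" where
  "stolz c x = {z. dist z (of_real x) < c * Im z}"

definition poisson :: "complex \<Rightarrow> real \<Rightarrow> real" where
  "poisson z t = Im z / (pi * ((t - Re z)\<^sup>2 + (Im z)\<^sup>2))"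

definition poisson_deriv :: "complex \<Rightarrow> real \<Rightarrow> real" where
  "poisson_deriv z t = - (2 * Im z * (t - Re z)) / (pi * ((t - Re z)\<^sup>2 + (Im z)\<^sup>2)\<^sup>2)"

lemma stolz_Im_pos:
  assumes "z \<in> stolz c x" "c > 0" shows "Im z > 0"
proof -
  have "dist z (of_real x) < c * Im z" using assms(1) by (simp add: stolz_def)
  with zero_le_dist[of z "of_real x"] have "0 < c * Im z" by (rule le_less_trans)
  then show ?thesis using assms(2) by (simp add: zero_less_mult_iff)
qed

lemma poisson_denom_pos: "Im z > 0 \<Longrightarrow> (t - Re z)\<^sup>2 + (Im z)\<^sup>2 > 0"
  by (simp add: add_nonneg_pos)

lemma poisson_nonneg: "Im z > 0 \<Longrightarrow> poisson z t \<ge> 0"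
  by (simp add: poisson_def)

lemma poisson_has_deriv:
  assumes "Im z > 0"
  shows "(poisson z has_real_derivative poisson_deriv z t) (at t within S)"
proof -
  define D where "D = (\<lambda>t. (t - Re z)\<^sup>2 + (Im z)\<^sup>2)"
  have D: "D t > 0" using poisson_denom_pos[OF assms] by (simp add: D_def)
  have "((\<lambda>t. pi * D t) has_real_derivative pi * (2 * (t - Re z))) (at t within S)"
    unfolding D_def by (auto intro!: derivative_eq_intros)
  then have d: "((\<lambda>t. Im z / (pi * D t)) has_real_derivative
      (0 * (pi * D t) - Im z * (pi * (2 * (t - Re z)))) / ((pi * D t) * (pi * D t))) (at t within S)"
    using D by (intro DERIV_divide DERIV_const) auto
  have "(0 * (pi * E) - y * (pi * (2 * u))) / ((pi * E) * (pi * E)) = - (2 * y * u) / (pi * E\<^sup>2)" if "E > 0" for E y u :: real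
    using that by (simp add: power2_eq_square ac_simps)
  from DERIV_cong[OF d this[OF D]] show ?thesis by (simp add: poisson_def[abs_def] poisson_deriv_def D_def)
qed

lemma continuous_on_poisson [continuous_intros]: "Im z > 0 \<Longrightarrow> continuous_on S (poisson z)"
  using poisson_has_deriv by (meson DERIV_continuous continuous_on_eq_continuous_within)

lemma continuous_on_poisson_deriv [continuous_intros]:
  assumes "Im z > 0" shows "continuous_on S (poisson_deriv z)"
proof -
  have ne: "pi * ((t - Re z)\<^sup>2 + (Im z)\<^sup>2)\<^sup>2 \<noteq> 0" for t
    using poisson_denom_pos[OF assms, of t] by (metis mult_eq_0_iff pi_neq_zero power_not_zero less_irrefl)
  have "continuous_on S (\<lambda>t. - (2 * Im z * (t - Re z)) / (pi * ((t - Re z)\<^sup>2 + (Im z)\<^sup>2)\<^sup>2))"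
    by (intro continuous_on_divide continuous_on_minus continuous_on_mult continuous_on_const continuous_on_diff
        continuous_on_id continuous_on_power continuous_on_add ballI ne)
  then show ?thesis by (simp only: poisson_deriv_def[abs_def])
qed

lemma poisson_has_integral:
  assumes "Im z > 0" "a \<le> b"
  shows "(poisson z has_integral (arctan ((b - Re z) / Im z) - arctan ((a - Re z) / Im z)) / pi) {a..b}"
proof -
  have "((\<lambda>t. arctan ((t - Re z) / Im z) / pi) has_real_derivative poisson z t) (at t within {a..b})" for t
  proof -
    define u where "u = t - Re z"
    define y where "y = Im z"
    have y: "y > 0" "u\<^sup>2 + y\<^sup>2 > 0" using assms by (auto simp: y_def add_nonneg_pos)
    have "((\<lambda>t. arctan ((t - Re z) / Im z) / pi) has_real_derivative (inverse (1 + (u / y)\<^sup>2) * (1 / y)) / pi) (at t within {a..b})"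
      using assms unfolding u_def y_def by (auto intro!: derivative_eq_intros)
    moreover have "1 + (u / y)\<^sup>2 = (u\<^sup>2 + y\<^sup>2) / y\<^sup>2" using y by (simp add: power_divide add_divide_distrib)
    then have "(inverse (1 + (u / y)\<^sup>2) * (1 / y)) / pi = y / (pi * (u\<^sup>2 + y\<^sup>2))"
      using y by (simp add: power2_eq_square)
    ultimately show ?thesis by (simp add: poisson_def u_def y_def)
  qed
  then have "(poisson z has_integral arctan ((b - Re z) / Im z) / pi - arctan ((a - Re z) / Im z) / pi) {a..b}"
    by (intro fundamental_theorem_of_calculus assms) (simp add: has_real_derivative_iff_has_vector_derivative)
  then show ?thesis by (simp add: diff_divide_distrib)
qed

lemma integral_poisson_le_1:
  assumes "Im z > 0"
  shows "integral {a..b} (poisson z) \<le> 1"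
proof (cases "a \<le> b")
  case True
  have "arctan ((b - Re z) / Im z) - arctan ((a - Re z) / Im z) \<le> pi"
    using arctan_ubound[of "(b - Re z) / Im z"] arctan_lbound[of "(a - Re z) / Im z"] by linarith
  then show ?thesis
    using integral_unique[OF poisson_has_integral[OF assms True]] by simp
qed simp

text \<open>In the approach region |t - x| is at most |t - Re z| + c Im z, while the derivative is
  the kernel times 2 |t - Re z| over the squared distance of t from z. Weighted with |t - x|, the
  derivative is thus dominated by the kernel itself, whose integral is at most 1.\<close>

lemma poisson_deriv_bound:
  assumes z: "z \<in> stolz c x" and c: "c > 0"
  shows "\<bar>poisson_deriv z t\<bar> * \<bar>t - x\<bar> \<le> 2 * (1 + c) * poisson z t"
proof -
  have y: "Im z > 0" using stolz_Im_pos[OF z c] .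
  define u y where "u = \<bar>t - Re z\<bar>" and "y = Im z"
  have "\<bar>Re z - x\<bar> \<le> dist z (of_real x)"
    using abs_Re_le_cmod[of "z - of_real x"] by (simp add: dist_norm)
  then have "\<bar>t - x\<bar> \<le> u + c * y" using z by (auto simp: stolz_def u_def y_def)
  then have "u * \<bar>t - x\<bar> \<le> u * (u + c * y)" by (intro mult_left_mono) (auto simp: u_def)
  also have "u * y \<le> u\<^sup>2 + y\<^sup>2"
  proof -
    have "0 \<le> u * y" using y by (simp add: u_def y_def)
    then show ?thesis using sum_squares_bound[of u y] by linarith
  qed
  then have "u * (u + c * y) \<le> u\<^sup>2 + c * (u\<^sup>2 + y\<^sup>2)"
    using mult_left_mono[of "u * y" "u\<^sup>2 + y\<^sup>2" c] c by (simp add: algebra_simps power2_eq_square)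
  also have "\<dots> \<le> (1 + c) * (u\<^sup>2 + y\<^sup>2)" by (simp add: algebra_simps)
  finally have *: "u * \<bar>t - x\<bar> \<le> (1 + c) * (u\<^sup>2 + y\<^sup>2)" .
  define D where "D = u\<^sup>2 + y\<^sup>2"
  have D: "D > 0" using y by (simp add: D_def y_def add_nonneg_pos)
  have "\<bar>poisson_deriv z t\<bar> * \<bar>t - x\<bar> = 2 * y / (pi * D\<^sup>2) * (u * \<bar>t - x\<bar>)"
    using y D by (simp add: poisson_deriv_def abs_mult u_def y_def D_def)
  also have "\<dots> \<le> 2 * y / (pi * D\<^sup>2) * ((1 + c) * D)"
    using * y by (intro mult_left_mono) (auto simp: D_def y_def)
  also have "\<dots> = 2 * (1 + c) * (y / (pi * D))"
    using D by (simp add: power2_eq_square field_simps)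
  finally show ?thesis by (simp add: poisson_def u_def y_def D_def)
qed

text \<open>Away from Re z the derivative is of order Im z, so the part of an integral that keeps
  its distance from the boundary point disappears in the limit.\<close>

lemma poisson_deriv_far:
  assumes y: "Im z > 0" and d: "d > 0" "\<bar>t - Re z\<bar> \<ge> d"
  shows "\<bar>poisson_deriv z t\<bar> \<le> 2 / (pi * d ^ 3) * Im z"
proof -
  define u where "u = \<bar>t - Re z\<bar>"
  have u: "u \<ge> d" "u > 0" using d by (auto simp: u_def)
  have "\<bar>poisson_deriv z t\<bar> = 2 * Im z * u / (pi * (u\<^sup>2 + (Im z)\<^sup>2)\<^sup>2)"
    using y by (simp add: poisson_deriv_def abs_mult u_def)
  also have "\<dots> \<le> 2 * Im z * u / (pi * (u\<^sup>2)\<^sup>2)"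
    using y u by (intro divide_left_mono mult_left_mono power_mono mult_pos_pos zero_less_power) (auto intro!: add_pos_pos)
  also have "\<dots> = 2 * Im z / (pi * u ^ 3)" using u by (simp add: power2_eq_square power3_eq_cube)
  also have "\<dots> \<le> 2 * Im z / (pi * d ^ 3)"
    using y u d by (intro divide_left_mono mult_left_mono power_mono mult_pos_pos zero_less_power) auto
  finally show ?thesis by (simp add: field_simps)
qed

lemma tendsto_Im_stolz: "((\<lambda>z. Im z) \<longlongrightarrow> 0) (at (of_real x) within S)"
  using tendsto_Im[OF tendsto_ident_at, of "of_real x" S] by simp

lemma tendsto_poisson_endpoint:
  assumes c: "c > 0" and ne: "a \<noteq> x"
  shows "((\<lambda>z. poisson z a) \<longlongrightarrow> 0) (at (of_real x) within stolz c x)"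
proof -
  have R: "((\<lambda>z. Re z) \<longlongrightarrow> x) (at (of_real x) within stolz c x)"
    using tendsto_Re[OF tendsto_ident_at, of "of_real x" "stolz c x"] by simp
  have "((\<lambda>z. poisson z a) \<longlongrightarrow> 0 / (pi * ((a - x)\<^sup>2 + 0\<^sup>2))) (at (of_real x) within stolz c x)"
    unfolding poisson_def
    by (rule tendsto_divide[OF tendsto_Im_stolz tendsto_mult[OF tendsto_const tendsto_add[OF tendsto_power[OF tendsto_diff[OF tendsto_const R]] tendsto_power[OF tendsto_Im_stolz]]]])
      (use ne in simp)
  then show ?thesis by simp
qed

lemma eventually_stolz:
  assumes "c > 0" shows "\<forall>\<^sub>F z in at (of_real x) within stolz c x. z \<in> stolz c x \<and> Im z > 0"
proof -
  have "\<forall>\<^sub>F z in at (of_real x) within stolz c x. z \<in> stolz c x"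
    unfolding eventually_at_filter by (rule always_eventually) iprover
  then show ?thesis
  proof (rule eventually_mono)
    fix z assume "z \<in> stolz c x"
    with stolz_Im_pos[OF this assms] show "z \<in> stolz c x \<and> Im z > 0" by iprover
  qed
qed

text \<open>The integral is the angle under which the interval is seen from z, divided by pi; both
  arctangents tend to their extreme values because x lies inside.\<close>

lemma tendsto_integral_poisson:
  assumes c: "c > 0" and x: "a < x" "x < b"
  shows "((\<lambda>z. integral {a..b} (poisson z)) \<longlongrightarrow> 1) (at (of_real x) within stolz c x)"
proof -
  let ?F = "at (of_real x) within stolz c x"
  have ev: "\<forall>\<^sub>F z in ?F. Im z > 0" using eventually_stolz[OF c, of x] by (auto elim: eventually_mono)
  have R: "((\<lambda>z. Re z) \<longlongrightarrow> x) ?F"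
    using tendsto_Re[OF tendsto_ident_at, of "of_real x" "stolz c x"] by simp
  have b: "filterlim (\<lambda>z. (b - Re z) / Im z) at_top ?F"
    by (rule LIM_at_top_divide[OF tendsto_diff[OF tendsto_const R] _ tendsto_Im_stolz ev]) (use x in simp)
  have a: "filterlim (\<lambda>z. (a - Re z) / Im z) at_bot ?F"
  proof -
    have "filterlim (\<lambda>z. (Re z - a) / Im z) at_top ?F"
      by (rule LIM_at_top_divide[OF tendsto_diff[OF R tendsto_const] _ tendsto_Im_stolz ev]) (use x in simp)
    then have "filterlim (\<lambda>z. - ((Re z - a) / Im z)) at_bot ?F" by (simp add: filterlim_uminus_at_bot)
    then show ?thesis by (simp add: minus_divide_left)
  qed
  have "((\<lambda>z. (arctan ((b - Re z) / Im z) - arctan ((a - Re z) / Im z)) / pi) \<longlongrightarrow> (pi/2 - (-(pi/2))) / pi) ?F"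
    by (intro tendsto_intros filterlim_compose[OF tendsto_arctan_at_top b] filterlim_compose[OF tendsto_arctan_at_bot a]) auto
  then have "((\<lambda>z. (arctan ((b - Re z) / Im z) - arctan ((a - Re z) / Im z)) / pi) \<longlongrightarrow> 1) ?F" by simp
  then show ?thesis
  proof (rule Lim_transform_eventually)
    show "\<forall>\<^sub>F z in ?F. (arctan ((b - Re z) / Im z) - arctan ((a - Re z) / Im z)) / pi = integral {a..b} (poisson z)"
      using ev by eventually_elim (use x in \<open>simp add: integral_unique[OF poisson_has_integral]\<close>)
  qed
qed

text \<open>The primitive \<open>U\<close>, not \<open>u\<close>, survives the passage to the
  boundary; this trades the one for the other, and integrability of the left side comes with
  it.\<close>

lemma integration_by_parts_poisson_diff:
  fixes U u :: "real \<Rightarrow> complex"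
  assumes y: "Im z > 0" and ab: "a \<le> b" and contU: "continuous_on {a..b} U"
    and U: "\<And>t. a < t \<Longrightarrow> t < b \<Longrightarrow> (U has_vector_derivative u t) (at t)"
  shows "((\<lambda>t. poisson z t *\<^sub>R u t) has_integral
     (poisson z b *\<^sub>R U b - poisson z a *\<^sub>R U a - integral {a..b} (\<lambda>t. poisson_deriv z t *\<^sub>R U t))) {a..b}"
proof -
  have "(\<lambda>t. poisson_deriv z t *\<^sub>R U t) integrable_on {a..b}"
    by (intro integrable_continuous_interval continuous_intros contU y)
  then have "((\<lambda>t. poisson_deriv z t *\<^sub>R U t) has_integral integral {a..b} (\<lambda>t. poisson_deriv z t *\<^sub>R U t)) {a..b}"
    by (rule integrable_integral)
  then show ?thesis
    using integration_by_parts_interior[OF bounded_bilinear.flip[OF bounded_bilinear_scaleR] ab contU continuous_on_poisson[OF y], of u "poisson_deriv z"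
        "poisson z b *\<^sub>R U b - poisson z a *\<^sub>R U a - integral {a..b} (\<lambda>t. poisson_deriv z t *\<^sub>R U t)"]
    by (simp add: U poisson_has_deriv[OF y] has_real_derivative_iff_has_vector_derivative[symmetric])
qed

text \<open>The expression is what integration by parts makes of the Poisson integral of the
  derivative of \<open>U\<close>, and it makes sense when only \<open>U\<close> is known. The
  tangent line at x contributes \<open>L\<close> times the mass of the kernel; the remainder is o(|t
  - x|), which the weighted bound on the derivative turns into o(1) near x, and far from x the
  derivative is O(Im z).\<close>

lemma poisson_by_parts_tendsto:
  fixes U :: "real \<Rightarrow> complex"
  assumes c: "c > 0" and x: "a < x" "x < b" and contU: "continuous_on {a..b} U"
    and der: "(U has_vector_derivative L) (at x)"
  shows "((\<lambda>z. poisson z b *\<^sub>R U b - poisson z a *\<^sub>R U a - integral {a..b} (\<lambda>t. poisson_deriv z t *\<^sub>R U t)) \<longlongrightarrow> L)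
           (at (of_real x) within stolz c x)"
proof -
  let ?F = "at (of_real x) within stolz c x"
  let ?E = "\<lambda>V z. poisson z b *\<^sub>R V b - poisson z a *\<^sub>R V a - integral {a..b} (\<lambda>t. poisson_deriv z t *\<^sub>R V t) :: complex"
  define l where "l = (\<lambda>t. U x + (t - x) *\<^sub>R L)"
  define V where "V = (\<lambda>t. U t - l t)"
  have contV: "continuous_on {a..b} V" unfolding V_def l_def using contU by (intro continuous_intros)
  have contl: "continuous_on {a..b} l" unfolding l_def by (intro continuous_intros)
  have ev: "\<forall>\<^sub>F z in ?F. z \<in> stolz c x \<and> Im z > 0" by (rule eventually_stolz[OF c])
  have split: "?E U z = ?E V z + integral {a..b} (poisson z) *\<^sub>R L" if "Im z > 0" for z
  proof -
    have "((\<lambda>t. poisson z t *\<^sub>R L) has_integral ?E l z) {a..b}"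
      by (rule integration_by_parts_poisson_diff[OF that _ contl]) (use x in \<open>auto intro!: derivative_eq_intros simp: l_def\<close>)
    moreover have "((\<lambda>t. poisson z t *\<^sub>R L) has_integral integral {a..b} (poisson z) *\<^sub>R L) {a..b}"
      using that by (intro has_integral_scaleR_left integrable_integral integrable_continuous_interval continuous_intros)
    ultimately have "?E l z = integral {a..b} (poisson z) *\<^sub>R L" by (rule has_integral_unique)
    moreover have "integral {a..b} (\<lambda>t. poisson_deriv z t *\<^sub>R U t) = integral {a..b} (\<lambda>t. poisson_deriv z t *\<^sub>R V t) + integral {a..b} (\<lambda>t. poisson_deriv z t *\<^sub>R l t)"
    proof -
      have iV: "(\<lambda>t. poisson_deriv z t *\<^sub>R V t) integrable_on {a..b}" and il: "(\<lambda>t. poisson_deriv z t *\<^sub>R l t) integrable_on {a..b}"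
        by (intro integrable_continuous_interval continuous_intros contV contl that)+
      show ?thesis unfolding integral_add[OF iV il, symmetric] by (simp add: V_def scaleR_add_right[symmetric])
    qed
    ultimately show ?thesis by (simp add: V_def algebra_simps)
  qed
  have V0: "(?E V \<longlongrightarrow> 0) ?F"
  proof (rule tendstoI)
    fix e :: real assume e: "e > 0"
    \<comment> \<open>Near x the remainder contributes at most \<open>e1 * 2 * (1 + c)\<close> times
      the mass of the kernel, that is at most e/2.\<close>
    define e1 where "e1 = e / (4 * (1 + c))"
    have e1: "e1 > 0" using e c by (simp add: e1_def)
    obtain d where d: "d > 0" "\<And>t. \<bar>t - x\<bar> < d \<Longrightarrow> norm (V t) \<le> e1 * \<bar>t - x\<bar>"
    proof -
      from der e1 obtain d where "d > 0" "\<forall>y. norm (y - x) < d \<longrightarrow> norm (U y - U x - (y - x) *\<^sub>R L) \<le> e1 * norm (y - x)"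
        unfolding has_vector_derivative_def has_derivative_at_alt by blast
      then show ?thesis using that[of d] by (auto simp: V_def l_def algebra_simps)
    qed
    obtain K where K: "\<And>t. t \<in> {a..b} \<Longrightarrow> norm (V t) \<le> K"
      using compact_imp_bounded[OF compact_continuous_image[OF contV compact_Icc]] unfolding bounded_iff by blast
    have K0: "K \<ge> 0" using order_trans[OF norm_ge_zero K[of x]] x by simp
    \<comment> \<open>The radius d/2 is what is left of |t - x| \<ge> d when Re z is within d/2 of
      x.\<close>
    define B where "B = 2 / (pi * (d/2) ^ 3) * K"
    have B0: "B \<ge> 0" using K0 d by (simp add: B_def)
    have lim: "((\<lambda>z. poisson z b * K + poisson z a * K + B * Im z * (b - a)) \<longlongrightarrow> 0) ?F"
      using x by (auto intro!: tendsto_eq_intros tendsto_poisson_endpoint c tendsto_Im_stolz)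
    have ev1: "\<forall>\<^sub>F z in ?F. poisson z b * K + poisson z a * K + B * Im z * (b - a) < e / 2"
      using order_tendstoD(2)[OF lim, of "e/2"] e by simp
    have ev2: "\<forall>\<^sub>F z in ?F. dist z (of_real x) < d / 2"
      using tendstoD[OF tendsto_ident_at, of "d/2"] d by auto
    show "\<forall>\<^sub>F z in ?F. dist (?E V z) 0 < e"
      using ev ev1 ev2
    proof eventually_elim
      case (elim z)
      have z: "z \<in> stolz c x" and y: "Im z > 0" using elim by auto
      have Rx: "\<bar>Re z - x\<bar> < d / 2"
        using abs_Re_le_cmod[of "z - of_real x"] elim by (simp add: dist_norm)
      have pt: "norm (poisson_deriv z t *\<^sub>R V t) \<le> e1 * (2 * (1 + c)) * poisson z t + B * Im z" if t: "t \<in> {a..b}" for t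
      proof (cases "\<bar>t - x\<bar> < d")
        case True
        have "norm (poisson_deriv z t *\<^sub>R V t) \<le> \<bar>poisson_deriv z t\<bar> * (e1 * \<bar>t - x\<bar>)"
          using d(2)[OF True] by (simp add: mult_left_mono)
        also have "\<dots> \<le> e1 * (2 * (1 + c) * poisson z t)"
          using mult_left_mono[OF poisson_deriv_bound[OF z c, of t], of e1] e1 by (simp add: mult_ac)
        also have "\<dots> \<le> e1 * (2 * (1 + c)) * poisson z t + B * Im z" using B0 y by simp
        finally show ?thesis .
      next
        case False
        have far: "d / 2 \<le> \<bar>t - Re z\<bar>" using False Rx by arith
        have "norm (poisson_deriv z t *\<^sub>R V t) \<le> (2 / (pi * (d/2) ^ 3) * Im z) * K"
          unfolding norm_scaleR
          by (intro mult_mono poisson_deriv_far K t y far) (use d y in auto)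
        also have "\<dots> = B * Im z" by (simp add: B_def)
        also have "\<dots> \<le> e1 * (2 * (1 + c)) * poisson z t + B * Im z" using e1 c poisson_nonneg[OF y] by simp
        finally show ?thesis .
      qed
      have "norm (integral {a..b} (\<lambda>t. poisson_deriv z t *\<^sub>R V t)) \<le> integral {a..b} (\<lambda>t. e1 * (2 * (1 + c)) * poisson z t + B * Im z)"
        by (rule integral_norm_bound_integral[OF _ _ pt])
          (intro integrable_continuous_interval continuous_intros contV y)+
      also have "\<dots> = e1 * (2 * (1 + c)) * integral {a..b} (poisson z) + B * Im z * (b - a)"
        using x by (subst integral_add) (auto intro!: integrable_continuous_interval continuous_intros y)
      also have "e1 * (2 * (1 + c)) * integral {a..b} (poisson z) \<le> e1 * (2 * (1 + c)) * 1"
        using integral_poisson_le_1[OF y] e1 c by (intro mult_left_mono) auto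
      also have "\<dots> = e / 2" using c by (simp add: e1_def field_simps)
      finally have i: "norm (integral {a..b} (\<lambda>t. poisson_deriv z t *\<^sub>R V t)) \<le> e / 2 + B * Im z * (b - a)" by simp
      have nb: "norm (poisson z b *\<^sub>R V b) \<le> poisson z b * K" "norm (poisson z a *\<^sub>R V a) \<le> poisson z a * K"
        using K[of a] K[of b] x poisson_nonneg[OF y] by (auto intro!: mult_left_mono)
      have "norm (?E V z) \<le> norm (poisson z b *\<^sub>R V b) + norm (poisson z a *\<^sub>R V a) + norm (integral {a..b} (\<lambda>t. poisson_deriv z t *\<^sub>R V t))"
        by (intro order_trans[OF norm_triangle_ineq4] add_mono order_refl)
      also have "\<dots> < e" using i nb elim by simp
      finally show ?case by simp
    qed
  qed
  have "((\<lambda>z. ?E V z + integral {a..b} (poisson z) *\<^sub>R L) \<longlongrightarrow> 0 + 1 *\<^sub>R L) ?F"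
    by (intro tendsto_intros V0 tendsto_integral_poisson c x)
  then have "((\<lambda>z. ?E V z + integral {a..b} (poisson z) *\<^sub>R L) \<longlongrightarrow> L) ?F" by simp
  then show ?thesis
    by (rule Lim_transform_eventually) (use ev in eventually_elim, auto simp: split)
qed

text \<open>The difference \<open>W\<close> of the two sides, as a function of the right endpoint, satisfies
  \<open>W t - W s = O((t - s)\<^sup>2)\<close> and is therefore constant.\<close>

lemma integral_by_parts_absolutely_continuous:
  fixes P P' u :: "real \<Rightarrow> real"
  assumes ab: "a \<le> b" and u: "u integrable_on {a..b}" and Pu: "\<And>s t. (\<lambda>t. P t * u t) integrable_on {s..t} \<or> \<not> {s..t} \<subseteq> {a..b}"
    and M: "\<And>t. t \<in> {a..b} \<Longrightarrow> \<bar>u t\<bar> \<le> M"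
    and P: "\<And>t. t \<in> {a..b} \<Longrightarrow> (P has_real_derivative P' t) (at t within {a..b})" and cP: "continuous_on {a..b} P'"
  shows "integral {a..b} (\<lambda>t. P t * u t) = P b * integral {a..b} u - integral {a..b} (\<lambda>t. P' t * integral {a..t} u)"
proof -
  define U where "U = (\<lambda>t. integral {a..t} u)"
  have contU: "continuous_on {a..b} U" unfolding U_def by (rule indefinite_integral_continuous_1[OF u])
  obtain B where B: "\<And>t. t \<in> {a..b} \<Longrightarrow> \<bar>P' t\<bar> \<le> B"
    using compact_imp_bounded[OF compact_continuous_image[OF cP compact_Icc]] unfolding bounded_iff real_norm_def by blast
  have M0: "M \<ge> 0" using M[of a] ab by auto
  have B0: "B \<ge> 0" using B[of a] ab by auto
  define W where "W = (\<lambda>s. P s * U s - integral {a..s} (\<lambda>t. P' t * U t) - integral {a..s} (\<lambda>t. P t * u t))"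
  have key: "\<bar>W t - W s\<bar> \<le> 2 * M * B * (t - s)^2" if st: "a \<le> s" "s \<le> t" "t \<le> b" for s t
  proof -
    have sub: "{s..t} \<subseteq> {a..b}" "{a..t} \<subseteq> {a..b}" "{a..s} \<subseteq> {a..b}" using st by auto
    have iu: "u integrable_on {p..q}" if "a \<le> p" "q \<le> b" for p q
      using u that by (meson integrable_on_subinterval atLeastatMost_subset_iff)
    have iP: "(\<lambda>t. P t * u t) integrable_on {p..q}" if "a \<le> p" "q \<le> b" for p q
      using Pu[of p q] that by auto
    have iPU: "(\<lambda>t. P' t * U t) integrable_on {p..q}" if "a \<le> p" "q \<le> b" for p q
      using that by (intro integrable_continuous_interval continuous_intros continuous_on_subset[OF cP] continuous_on_subset[OF contU]) auto
    have Us: "U t - U r = integral {r..t} u" if "s \<le> r" "r \<le> t" for r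
      using Henstock_Kurzweil_Integration.integral_combine[of a r t u] that st iu by (simp add: U_def)
    \<comment> \<open>The increment of \<open>W\<close> splits into the integrals of
      \<open>P' r * (U t - U r)\<close> and of \<open>(P s - P r) * u r\<close> over [s, t]. Both
      integrands are of order t - s, so the increment is of second order although \<open>u\<close>
      is merely bounded.\<close>
    have Wd: "W t - W s = (P t - P s) * U t + P s * (U t - U s) - integral {s..t} (\<lambda>t. P' t * U t) - integral {s..t} (\<lambda>t. P t * u t)"
      using Henstock_Kurzweil_Integration.integral_combine[of a s t "\<lambda>t. P' t * U t"] Henstock_Kurzweil_Integration.integral_combine[of a s t "\<lambda>t. P t * u t"] st iP iPU
      by (simp add: W_def algebra_simps)
    have ftc: "(P' has_integral P t - P s) {s..t}"
    proof (rule fundamental_theorem_of_calculus)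
      fix x assume x: "x \<in> {s..t}"
      show "(P has_vector_derivative P' x) (at x within {s..t})"
        unfolding has_real_derivative_iff_has_vector_derivative[symmetric]
        by (rule DERIV_subset[OF P]) (use x st in auto)
    qed (use st in simp)
    have h1: "((\<lambda>r. P' r * (U t - U r)) has_integral ((P t - P s) * U t - integral {s..t} (\<lambda>t. P' t * U t))) {s..t}"
      using has_integral_diff[OF has_integral_mult_left[OF ftc, of "U t"] integrable_integral[OF iPU[of s t]]] st
      by (simp add: algebra_simps)
    have h2: "((\<lambda>r. (P s - P r) * u r) has_integral (P s * (U t - U s) - integral {s..t} (\<lambda>t. P t * u t))) {s..t}"
      using has_integral_diff[OF has_integral_mult_right[OF integrable_integral[OF iu[of s t]], of "P s"] integrable_integral[OF iP[of s t]]] st Us[of s]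
      by (simp add: algebra_simps)
    have b1: "norm ((P t - P s) * U t - integral {s..t} (\<lambda>t. P' t * U t)) \<le> (B * (M * (t - s))) * measure lborel {s..t}"
    proof (rule has_integral_bound_real[OF _ finite.emptyI h1])
      fix r assume r: "r \<in> {s..t} - {}"
      have "norm (integral {r..t} u) \<le> M * measure lborel {r..t}"
        by (rule has_integral_bound_real[OF M0 finite.emptyI integrable_integral[OF iu]]) (use r st in \<open>auto intro: M\<close>)
      also have "\<dots> \<le> M * (t - s)" using r M0 by (auto intro!: mult_left_mono)
      finally have 1: "\<bar>U t - U r\<bar> \<le> M * (t - s)" using Us[of r] r by simp
      show "norm (P' r * (U t - U r)) \<le> B * (M * (t - s))"
        unfolding real_norm_def abs_mult by (rule mult_mono[OF B 1 B0]) (use r st in auto)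
    qed (use B0 M0 st in simp)
    have b2: "norm (P s * (U t - U s) - integral {s..t} (\<lambda>t. P t * u t)) \<le> (B * (t - s) * M) * measure lborel {s..t}"
    proof (rule has_integral_bound_real[OF _ finite.emptyI h2])
      fix r assume r: "r \<in> {s..t} - {}"
      have "norm (P s - P r) \<le> B * norm (s - r)"
        by (rule field_differentiable_bound[of "{a..b}" P P']) (use P B r st in auto)
      also have "\<dots> \<le> B * (t - s)" using r B0 by (auto intro!: mult_left_mono)
      finally have 1: "\<bar>P s - P r\<bar> \<le> B * (t - s)" by simp
      show "norm ((P s - P r) * u r) \<le> B * (t - s) * M"
        unfolding real_norm_def abs_mult by (rule mult_mono[OF 1 M]) (use r st B0 in auto)
    qed (use B0 M0 st in simp)
    have ms: "measure lborel {s..t} = t - s" using st by simp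
    note b1 = b1[unfolded ms real_norm_def] and b2 = b2[unfolded ms real_norm_def]
    have "W t - W s = ((P t - P s) * U t - integral {s..t} (\<lambda>t. P' t * U t)) + (P s * (U t - U s) - integral {s..t} (\<lambda>t. P t * u t))"
      unfolding Wd by simp
    also have "\<bar>\<dots>\<bar> \<le> (B * (M * (t - s))) * (t - s) + (B * (t - s) * M) * (t - s)"
      using b1 b2 by (intro order_trans[OF abs_triangle_ineq] add_mono)
    also have "\<dots> = 2 * M * B * (t - s)^2" by (simp add: power2_eq_square)
    finally show ?thesis .
  qed
  have key': "\<bar>W t - W s\<bar> \<le> 2 * M * B * (t - s)^2" if st: "s \<in> {a..b}" "t \<in> {a..b}" for s t
    using key[of s t] key[of t s] st by (cases "s \<le> t") (auto simp: abs_minus_commute power2_commute)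
  have "(W has_real_derivative 0) (at s within {a..b})" if s: "s \<in> {a..b}" for s
    unfolding has_field_derivative_def has_derivative_within
  proof (intro conjI)
    show "((\<lambda>y. (1 / norm (y - s)) *\<^sub>R (W y - (W s + 0 * (y - s)))) \<longlongrightarrow> 0) (at s within {a..b})"
    proof (rule Lim_null_comparison)
      show "\<forall>\<^sub>F y in at s within {a..b}. norm ((1 / norm (y - s)) *\<^sub>R (W y - (W s + 0 * (y - s)))) \<le> 2 * M * B * \<bar>y - s\<bar>"
        unfolding eventually_at_filter
      proof (intro always_eventually allI impI)
        fix y assume y: "y \<noteq> s" "y \<in> {a..b}"
        have "\<bar>W y - W s\<bar> \<le> 2 * M * B * \<bar>y - s\<bar> * \<bar>y - s\<bar>" using key'[OF s y(2)] by (simp add: power2_eq_square)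
        then show "norm ((1 / norm (y - s)) *\<^sub>R (W y - (W s + 0 * (y - s)))) \<le> 2 * M * B * \<bar>y - s\<bar>"
          using y by (simp add: field_simps)
      qed
      show "((\<lambda>y. 2 * M * B * \<bar>y - s\<bar>) \<longlongrightarrow> 0) (at s within {a..b})" by (auto intro!: tendsto_eq_intros)
    qed
  qed (rule bounded_linear_mult_right)
  then have "W b = W a"
    using has_field_derivative_zero_constant[of "{a..b}" W] ab by force
  then show ?thesis by (simp add: W_def U_def)
qed

lemma has_contour_integral_linepath_affine:
  fixes p u :: complex
  assumes "a < b"
  shows "(f has_contour_integral I) (linepath (p + u * of_real a) (p + u * of_real b)) \<longleftrightarrow>
         ((\<lambda>t. f (p + u * of_real t) * u) has_integral I) {a..b}"
proof -
  have "(f has_contour_integral I) (linepath (p + u * of_real a) (p + u * of_real b)) \<longleftrightarrow>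
          ((\<lambda>x. f (p + u * of_real (a + (b - a) * x)) * (u * of_real (b - a))) has_integral I) {0..1}"
    unfolding has_contour_integral_linepath
    by (intro has_integral_cong arg_cong2[of _ _ _ _ "(*)"] arg_cong[of _ _ f])
       (auto simp: linepath_def scaleR_conv_of_real algebra_simps)
  also have "{0..1} = (\<lambda>x. x / (b - a)) ` {0..b-a}"
    using assms by simp
  also have "((\<lambda>x. f (p + u * of_real (a + (b - a) * x)) * (u * of_real (b - a))) has_integral I) \<dots> \<longleftrightarrow>
             ((\<lambda>x. f (p + u * of_real (a + x)) * (u * of_real (b - a))) has_integral ((b-a) *\<^sub>R I)) {0..b-a}"
    by (subst has_integral_stretch_real_iff) (use assms in simp_all)
  also have "\<dots> \<longleftrightarrow> ((\<lambda>x. of_real (b - a) * (f (p + u * of_real x) * u)) has_integral (b-a) *\<^sub>R I) {a..b}"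
    by (subst has_integral_shift_real_ivl_iff[where c = "-a"]) (simp_all add: mult_ac)
  also have "\<dots> \<longleftrightarrow> ((\<lambda>t. f (p + u * of_real t) * u) has_integral I) {a..b}"
    by (subst has_integral_mult_right_iff) (use assms in \<open>auto simp: scaleR_conv_of_real\<close>)
  finally show ?thesis .
qed

lemma poisson_kernel_eq:
  assumes y: "Im z > 0"
  shows "1 / (of_real t - z) - 1 / (of_real t - cnj z) = 2 * pi * \<i> * poisson z t"
proof -
  have n1: "of_real t - z \<noteq> 0" "of_real t - cnj z \<noteq> 0" using y by (auto simp: complex_eq_iff)
  have "(of_real t - z) * (of_real t - cnj z) = of_real ((t - Re z)\<^sup>2 + (Im z)\<^sup>2)"
    by (simp add: complex_eq_iff power2_eq_square algebra_simps)
  moreover have "1 / (of_real t - z) - 1 / (of_real t - cnj z) = (z - cnj z) / ((of_real t - z) * (of_real t - cnj z))"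
    using n1 by (simp add: field_simps)
  moreover have "z - cnj z = 2 * \<i> * of_real (Im z)" by (simp add: complex_eq_iff)
  ultimately have "1 / (of_real t - z) - 1 / (of_real t - cnj z) = 2 * \<i> * of_real (Im z) / of_real ((t - Re z)\<^sup>2 + (Im z)\<^sup>2)"
    by simp
  also have "\<dots> = 2 * pi * \<i> * of_real (Im z / (pi * ((t - Re z)\<^sup>2 + (Im z)\<^sup>2)))"
    by (simp only: of_real_divide of_real_mult) simp
  finally show ?thesis by (simp only: poisson_def)
qed

text \<open>Cauchy's formula at \<open>z\<close> minus Cauchy's theorem for the pole reflected in the lower side of the
  rectangle: on that side the two kernels differ by the Poisson kernel, on the others by \<open>O(Im z)\<close>.\<close>

lemma poisson_rectangle_estimate:
  assumes S: "open S" "\<And>x y. a \<le> x \<Longrightarrow> x \<le> b \<Longrightarrow> 0 < y \<Longrightarrow> y \<le> d \<Longrightarrow> Complex x y \<in> S"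
    and h: "h holomorphic_on S" "\<And>w. w \<in> S \<Longrightarrow> norm (h w) \<le> M"
    and \<rho>: "\<rho> > 0" and \<eta>: "\<eta> > 0"
    and z: "Im z > 0" "a + \<rho> \<le> Re z" "Re z + \<rho> \<le> b" "Im z + \<eta> + \<rho> \<le> d"
  shows "norm (h (z + \<i> * \<eta>) - integral {a..b} (\<lambda>t. poisson z t *\<^sub>R h (Complex t \<eta>)))
           \<le> M * (b - a + 2 * d) / (pi * \<rho>\<^sup>2) * Im z"
proof -
  \<comment> \<open>\<open>z1\<close> lies inside the rectangle with lower side at height \<eta>;
    \<open>z2\<close>, its mirror image in that side, lies outside, so only the first pole
    contributes.\<close>
  define z1 z2 where "z1 = z + \<i> * \<eta>" and "z2 = cnj z + \<i> * \<eta>"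
  define G where "G = (\<lambda>w. h w / (w - z1) - h w / (w - z2))"
  define p1 p2 p3 p4 where "p1 = Complex a \<eta>" and "p2 = Complex b \<eta>" and "p3 = Complex b d" and "p4 = Complex a d"
  note pd = p1_def p2_def p3_def p4_def
  have rp: "rectpath p1 p3 = linepath p1 p2 +++ linepath p2 p3 +++ linepath p3 p4 +++ linepath p4 p1"
    by (simp add: rectpath_def Let_def pd)
  have le: "Re p1 \<le> Re p3" "Im p1 \<le> Im p3" using z \<rho> by (auto simp: pd)
  have KS: "cbox p1 p3 \<subseteq> S"
  proof
    fix w assume "w \<in> cbox p1 p3"
    then show "w \<in> S" using S(2)[of "Re w" "Im w"] \<eta> by (auto simp: in_cbox_complex_iff pd)
  qed
  have M0: "M \<ge> 0"
  proof -
    have "p3 \<in> S" using KS le by (auto simp: in_cbox_complex_iff)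
    from order_trans[OF norm_ge_zero h(2)[OF this]] show ?thesis .
  qed
  have z1box: "z1 \<in> box p1 p3" using z \<rho> by (auto simp: in_box_complex_iff pd z1_def)
  have z2n: "z2 \<notin> cbox p1 p3" using z by (auto simp: in_cbox_complex_iff pd z2_def)
  have hc: "h holomorphic_on cbox p1 p3" by (rule holomorphic_on_subset[OF h(1) KS])
  have c1: "((\<lambda>w. h w / (w - z1)) has_contour_integral (2 * pi * \<i> * h z1)) (rectpath p1 p3)"
  proof -
    have "((\<lambda>w. h w / (w - z1)) has_contour_integral (2 * pi * \<i> * winding_number (rectpath p1 p3) z1 * h z1)) (rectpath p1 p3)"
      by (rule Cauchy_integral_formula_convex_simple[OF convex_box(1) hc])
        (use z1box path_image_rectpath_cbox_minus_box[OF le] in auto)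
    then show ?thesis by (simp add: winding_number_rectpath[OF z1box])
  qed
  have c2: "((\<lambda>w. h w / (w - z2)) has_contour_integral 0) (rectpath p1 p3)"
  proof -
    have hol: "(\<lambda>w. h w / (w - z2)) holomorphic_on cbox p1 p3"
      using z2n by (intro holomorphic_on_divide hc holomorphic_on_diff holomorphic_on_ident holomorphic_on_const) auto
    show ?thesis
      by (rule Cauchy_theorem_convex_simple[OF hol convex_box(1) valid_path_rectpath path_image_rectpath_subset_cbox[OF le]]) simp
  qed
  have cG: "(G has_contour_integral (2 * pi * \<i> * h z1)) (rectpath p1 p3)"
    using has_contour_integral_diff[OF c1 c2] by (simp add: G_def)
  have im: "path_image (rectpath p1 p3) \<subseteq> cbox p1 p3 - {z1, z2}"
    using z1box z2n path_image_rectpath_cbox_minus_box[OF le] by auto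
  have contG: "continuous_on (path_image (rectpath p1 p3)) G"
    unfolding G_def using im
    by (intro continuous_intros continuous_on_subset[OF holomorphic_on_imp_continuous_on[OF hc]]) auto
  have segs: "closed_segment p1 p2 \<subseteq> path_image (rectpath p1 p3)" "closed_segment p2 p3 \<subseteq> path_image (rectpath p1 p3)"
    "closed_segment p3 p4 \<subseteq> path_image (rectpath p1 p3)" "closed_segment p4 p1 \<subseteq> path_image (rectpath p1 p3)"
    unfolding rp by (auto simp: path_image_join)
  have int: "G contour_integrable_on linepath p1 p2" "G contour_integrable_on linepath p2 p3"
     "G contour_integrable_on linepath p3 p4" "G contour_integrable_on linepath p4 p1"
    by (auto intro!: contour_integrable_continuous_linepath continuous_on_subset[OF contG] segs)
  define I2 I3 I4 where "I2 = contour_integral (linepath p2 p3) G" and "I3 = contour_integral (linepath p3 p4) G"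
    and "I4 = contour_integral (linepath p4 p1) G"
  have sum: "2 * pi * \<i> * h z1 = contour_integral (linepath p1 p2) G + (I2 + (I3 + I4))"
  proof -
    have "contour_integral (rectpath p1 p3) G = contour_integral (linepath p1 p2) G + (I2 + (I3 + I4))"
      unfolding rp I2_def I3_def I4_def using int by (simp add: contour_integrable_join)
    then show ?thesis using contour_integral_unique[OF cG] by simp
  qed
  have bottom: "contour_integral (linepath p1 p2) G = 2 * pi * \<i> * integral {a..b} (\<lambda>t. poisson z t *\<^sub>R h (Complex t \<eta>))"
  proof -
    have e: "p1 = \<i> * \<eta> + 1 * of_real a" "p2 = \<i> * \<eta> + 1 * of_real b" by (auto simp: pd complex_eq_iff)
    have "(G has_contour_integral contour_integral (linepath p1 p2) G) (linepath p1 p2)"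
      using int(1) by (rule has_contour_integral_integral)
    then have "((\<lambda>t. G (\<i> * \<eta> + 1 * of_real t) * 1) has_integral contour_integral (linepath p1 p2) G) {a..b}"
      unfolding e by (subst (asm) has_contour_integral_linepath_affine) (use z \<rho> in auto)
    moreover have "G (\<i> * \<eta> + 1 * of_real t) * 1 = 2 * pi * \<i> * (poisson z t *\<^sub>R h (Complex t \<eta>))" for t
    proof -
      have "G (\<i> * \<eta> + of_real t) = h (\<i> * \<eta> + of_real t) * (1 / (of_real t - z) - 1 / (of_real t - cnj z))"
        by (simp add: G_def z1_def z2_def right_diff_distrib)
      also have "\<i> * \<eta> + of_real t = Complex t \<eta>" by (simp add: complex_eq_iff)
      finally show ?thesis unfolding poisson_kernel_eq[OF z(1)] by (simp add: scaleR_conv_of_real \<open>\<i> * \<eta> + of_real t = Complex t \<eta>\<close>)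
    qed
    ultimately have "((\<lambda>t. 2 * pi * \<i> * (poisson z t *\<^sub>R h (Complex t \<eta>))) has_integral contour_integral (linepath p1 p2) G) {a..b}"
      by simp
    then show ?thesis
      by (metis integral_unique integral_mult_right)
  qed
  \<comment> \<open>On the three other sides both poles are at distance at least
    \<open>\<rho>\<close>, and the poles differ by 2 Im z.\<close>
  define B where "B = M * (2 * Im z / \<rho>\<^sup>2)"
  have B0: "B \<ge> 0" using M0 z by (simp add: B_def)
  have Gb: "norm (G w) \<le> B" if w: "w \<in> path_image (rectpath p1 p3)" and far: "Re w = a \<or> Re w = b \<or> Im w = d" for w
  proof -
    have wS: "w \<in> S" using im KS w by auto
    have n: "w - z1 \<noteq> 0" "w - z2 \<noteq> 0" using im w by auto
    have f1: "\<rho> \<le> norm (w - z1)" "\<rho> \<le> norm (w - z2)"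
    proof -
      have "\<rho> \<le> \<bar>Re (w - z1)\<bar> \<or> \<rho> \<le> \<bar>Im (w - z1)\<bar>" "\<rho> \<le> \<bar>Re (w - z2)\<bar> \<or> \<rho> \<le> \<bar>Im (w - z2)\<bar>"
        using far z by (auto simp: z1_def z2_def)
      then show "\<rho> \<le> norm (w - z1)" "\<rho> \<le> norm (w - z2)"
        using abs_Re_le_cmod[of "w - z1"] abs_Im_le_cmod[of "w - z1"] abs_Re_le_cmod[of "w - z2"] abs_Im_le_cmod[of "w - z2"] by linarith+
    qed
    have "G w = h w * ((z1 - z2) / ((w - z1) * (w - z2)))"
      using n by (simp add: G_def field_simps)
    also have "norm \<dots> = norm (h w) * (2 * Im z / (norm (w - z1) * norm (w - z2)))"
    proof -
      have "z1 - z2 = 2 * Im z * \<i>" by (simp add: z1_def z2_def complex_eq_iff)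
      then show ?thesis using z(1) by (simp add: norm_mult norm_divide)
    qed
    also have "\<dots> \<le> M * (2 * Im z / (\<rho> * \<rho>))"
      using f1 \<rho> z(1) by (intro mult_mono h(2) wS divide_left_mono M0 mult_pos_pos) auto
    finally show ?thesis by (simp add: B_def power2_eq_square)
  qed
  have b2: "norm I2 \<le> B * (d - \<eta>)"
  proof -
    have "norm I2 \<le> B * norm (p3 - p2)"
      unfolding I2_def by (rule contour_integral_bound_linepath[OF int(2) B0])
        (rule Gb, use segs in blast, simp add: pd closed_segment_same_Re)
    also have "p3 - p2 = \<i> * of_real (d - \<eta>)" by (simp add: pd complex_eq_iff)
    finally show ?thesis using z \<rho> by (simp add: norm_mult del: of_real_diff)
  qed
  have b3: "norm I3 \<le> B * (b - a)"
  proof -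
    have "norm I3 \<le> B * norm (p4 - p3)"
      unfolding I3_def by (rule contour_integral_bound_linepath[OF int(3) B0])
        (rule Gb, use segs in blast, simp add: pd closed_segment_same_Im)
    also have "p4 - p3 = of_real (a - b)" by (simp add: pd complex_eq_iff)
    finally show ?thesis using z \<rho> by (simp add: norm_mult del: of_real_diff)
  qed
  have b4: "norm I4 \<le> B * (d - \<eta>)"
  proof -
    have "norm I4 \<le> B * norm (p1 - p4)"
      unfolding I4_def by (rule contour_integral_bound_linepath[OF int(4) B0])
        (rule Gb, use segs in blast, simp add: pd closed_segment_same_Re)
    also have "p1 - p4 = \<i> * of_real (\<eta> - d)" by (simp add: pd complex_eq_iff)
    finally show ?thesis using z \<rho> by (simp add: norm_mult del: of_real_diff)
  qed
  define J where "J = integral {a..b} (\<lambda>t. poisson z t *\<^sub>R h (Complex t \<eta>))"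
  have "2 * pi * \<i> * (h z1 - J) = I2 + (I3 + I4)"
    using sum bottom by (simp add: J_def algebra_simps)
  then have "norm (2 * pi * \<i> * (h z1 - J)) = norm (I2 + (I3 + I4))" by simp
  also have "\<dots> \<le> B * (d - \<eta>) + (B * (b - a) + B * (d - \<eta>))"
    using b2 b3 b4 by (intro order_trans[OF norm_triangle_ineq] add_mono)
  also have "\<dots> \<le> B * (b - a + 2 * d)" using B0 \<eta> by (simp add: algebra_simps)
  finally have "2 * pi * norm (h z1 - J) \<le> B * (b - a + 2 * d)" by (simp add: norm_mult)
  then have "norm (h z1 - J) \<le> B * (b - a + 2 * d) / (2 * pi)" by (simp add: field_simps)
  also have "\<dots> = M * (b - a + 2 * d) / (pi * \<rho>\<^sup>2) * Im z"
    using \<rho> by (simp add: B_def field_simps)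
  finally show ?thesis by (simp add: z1_def J_def)
qed

subsection \<open>Fatou's theorem\<close>

text \<open>A primitive of \<open>h\<close> extends to a Lipschitz function on the boundary. At every point where
  that function is differentiable, the Poisson integral of \<open>h\<close>, integrated by parts, converges.\<close>

lemma Fatou_stolz_limit:
  assumes ab: "a < b" and d: "d > 0"
    and S: "open S" "\<And>x y. a \<le> x \<Longrightarrow> x \<le> b \<Longrightarrow> 0 < y \<Longrightarrow> y \<le> d \<Longrightarrow> Complex x y \<in> S"
    and h: "h holomorphic_on S" "\<And>w. w \<in> S \<Longrightarrow> norm (h w) \<le> M"
  shows "AE x in lborel. a < x \<and> x < b \<longrightarrow>
           (\<exists>L. \<forall>c>0. (h \<longlongrightarrow> L) (at (of_real x) within stolz c x))"
proof -
  define K where "K = {w. a \<le> Re w \<and> Re w \<le> b \<and> 0 < Im w \<and> Im w \<le> d}"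
  have KS: "K \<subseteq> S"
  proof
    fix w assume "w \<in> K"
    then show "w \<in> S" using S(2)[of "Re w" "Im w"] by (simp add: K_def)
  qed
  have cK: "convex K"
  proof -
    have "K = {w. Re w \<ge> a} \<inter> {w. Re w \<le> b} \<inter> {w. Im w > 0} \<inter> {w. Im w \<le> d}" by (auto simp: K_def)
    then show ?thesis
      by (simp add: convex_Int convex_halfspace_Re_ge convex_halfspace_Re_le convex_halfspace_Im_gt convex_halfspace_Im_le)
  qed
  have hK: "h holomorphic_on K" by (rule holomorphic_on_subset[OF h(1) KS])
  have fd: "h field_differentiable at w" if "w \<in> S" for w
    by (rule holomorphic_on_imp_differentiable_at[OF h(1) S(1) that])
  \<comment> \<open>\<open>K\<close> is convex, so a primitive exists, and the bound on
    \<open>h\<close> makes it Lipschitz. It has boundary values at every point, where those of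
    \<open>h\<close> exist only almost everywhere.\<close>
  obtain \<Phi> where \<Phi>: "\<And>w. w \<in> K \<Longrightarrow> (\<Phi> has_field_derivative h w) (at w within K)"
    using holomorphic_convex_primitive[OF cK finite.emptyI holomorphic_on_imp_continuous_on[OF hK]]
      fd KS interior_subset[of K] by (metis Diff_iff subsetD)
  have M0: "M \<ge> 0" using order_trans[OF norm_ge_zero h(2)[OF S(2)[of a d]]] ab d by simp
  have lip: "norm (\<Phi> w - \<Phi> w') \<le> M * norm (w - w')" if "w \<in> K" "w' \<in> K" for w w'
    by (rule field_differentiable_bound[OF cK \<Phi> _ that]) (use h(2) KS in auto)
  define e where "e = (\<lambda>n. d / real (Suc n))"
  have e: "e n > 0" "e n \<le> d" for n using d by (auto simp: e_def field_simps)
  have e0: "e \<longlonglongrightarrow> 0" unfolding e_def by (rule LIMSEQ_Suc[OF lim_const_over_n])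
  have "\<exists>l. (\<lambda>n. \<Phi> (Complex t (e n))) \<longlonglongrightarrow> l" if t: "t \<in> {a..b}" for t
  proof -
    have "M-lipschitz_on {0<..d} (\<lambda>y. \<Phi> (Complex t y))"
    proof (rule lipschitz_onI)
      fix y y' assume y: "y \<in> {0<..d}" "y' \<in> {0<..d}"
      have "Complex t y - Complex t y' = \<i> * of_real (y - y')" by (simp add: complex_eq_iff)
      then have "norm (Complex t y - Complex t y') = \<bar>y - y'\<bar>" by (simp add: norm_mult del: of_real_diff)
      then show "dist (\<Phi> (Complex t y)) (\<Phi> (Complex t y')) \<le> M * dist y y'"
        using lip[of "Complex t y" "Complex t y'"] t y by (simp add: dist_norm K_def)
    qed (rule M0)
    then have uc: "uniformly_continuous_on {0<..d} (\<lambda>y. \<Phi> (Complex t y))" by (rule lipschitz_on_uniformly_continuous)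
    have "Cauchy (\<lambda>n. \<Phi> (Complex t (e n)))"
      by (rule uniformly_continuous_on_Cauchy[OF uc LIMSEQ_imp_Cauchy[OF e0]]) (use e in auto)
    then show ?thesis by (simp add: Cauchy_convergent_iff convergent_def)
  qed
  then obtain \<phi> where \<phi>: "\<And>t. t \<in> {a..b} \<Longrightarrow> (\<lambda>n. \<Phi> (Complex t (e n))) \<longlonglongrightarrow> \<phi> t" by metis
  have \<phi>\<Phi>: "norm (\<Phi> (Complex t y) - \<phi> t) \<le> M * y" if t: "t \<in> {a..b}" and y: "0 < y" "y \<le> d" for t y
  proof (rule tendsto_le[OF sequentially_bot])
    show "(\<lambda>n. norm (\<Phi> (Complex t y) - \<Phi> (Complex t (e n)))) \<longlonglongrightarrow> norm (\<Phi> (Complex t y) - \<phi> t)"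
      by (intro tendsto_intros \<phi> t)
    show "(\<lambda>n. M * \<bar>y - e n\<bar>) \<longlonglongrightarrow> M * y"
      using y by (auto intro!: tendsto_eq_intros e0)
    have "norm (\<Phi> (Complex t y) - \<Phi> (Complex t (e n))) \<le> M * \<bar>y - e n\<bar>" for n
    proof -
      have "Complex t y - Complex t (e n) = \<i> * of_real (y - e n)" by (simp add: complex_eq_iff)
      then have "norm (Complex t y - Complex t (e n)) = \<bar>y - e n\<bar>" by (simp add: norm_mult del: of_real_diff)
      then show ?thesis using lip[of "Complex t y" "Complex t (e n)"] t y e[of n] by (simp add: K_def)
    qed
    then show "\<forall>\<^sub>F n in sequentially. norm (\<Phi> (Complex t y) - \<Phi> (Complex t (e n))) \<le> M * \<bar>y - e n\<bar>" by simp
  qed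
  have lip\<phi>: "norm (\<phi> s - \<phi> t) \<le> M * \<bar>s - t\<bar>" if s: "s \<in> {a..b}" and t: "t \<in> {a..b}" for s t
  proof (rule tendsto_upperbound[OF _ _ sequentially_bot])
    show "(\<lambda>n. norm (\<Phi> (Complex s (e n)) - \<Phi> (Complex t (e n)))) \<longlonglongrightarrow> norm (\<phi> s - \<phi> t)"
      by (intro tendsto_intros \<phi> s t)
    have "norm (\<Phi> (Complex s (e n)) - \<Phi> (Complex t (e n))) \<le> M * \<bar>s - t\<bar>" for n
    proof -
      have "Complex s (e n) - Complex t (e n) = of_real (s - t)" by (simp add: complex_eq_iff)
      then have "norm (Complex s (e n) - Complex t (e n)) = \<bar>s - t\<bar>" by (simp del: of_real_diff)
      then show ?thesis using lip[of "Complex s (e n)" "Complex t (e n)"] s t e[of n] by (simp add: K_def)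
    qed
    then show "\<forall>\<^sub>F n in sequentially. norm (\<Phi> (Complex s (e n)) - \<Phi> (Complex t (e n))) \<le> M * \<bar>s - t\<bar>" by simp
  qed
  \<comment> \<open>Clamping the argument to [a, b] keeps the Lipschitz constant and produces a
    function on the whole line, to which the differentiability theorem applies.\<close>
  define \<phi>c where "\<phi>c = (\<lambda>x. \<phi> (max a (min b x)))"
  have lipc: "norm (\<phi>c s - \<phi>c t) \<le> M * \<bar>s - t\<bar>" for s t
  proof -
    have "norm (\<phi>c s - \<phi>c t) \<le> M * \<bar>max a (min b s) - max a (min b t)\<bar>"
      unfolding \<phi>c_def using ab by (intro lip\<phi>) auto
    also have "\<dots> \<le> M * \<bar>s - t\<bar>" using M0 ab by (intro mult_left_mono) (auto simp: max_def min_def)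
    finally show ?thesis .
  qed
  have contc: "continuous_on A \<phi>c" for A
  proof -
    have "M-lipschitz_on A \<phi>c" using lipc M0 by (intro lipschitz_onI) (auto simp: dist_norm)
    then show ?thesis by (rule lipschitz_on_continuous_on)
  qed
  have re: "AE x in lborel. (\<lambda>x. Re (\<phi>c x)) differentiable at x"
    by (rule lipschitz_AE_differentiable[of _ M])
      (use order_trans[OF abs_Re_le_cmod lipc] in simp)
  have im: "AE x in lborel. (\<lambda>x. Im (\<phi>c x)) differentiable at x"
    by (rule lipschitz_AE_differentiable[of _ M])
      (use order_trans[OF abs_Im_le_cmod lipc] in simp)
  show ?thesis using re im
  proof (eventually_elim, intro impI)
    fix x assume rd: "(\<lambda>x. Re (\<phi>c x)) differentiable at x" and id: "(\<lambda>x. Im (\<phi>c x)) differentiable at x"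
      and x: "a < x \<and> x < b"
    obtain r i where r: "((\<lambda>x. Re (\<phi>c x)) has_real_derivative r) (at x)" and i: "((\<lambda>x. Im (\<phi>c x)) has_real_derivative i) (at x)"
      using rd id unfolding real_differentiable_def by blast
    have der: "(\<phi>c has_vector_derivative Complex r i) (at x)"
    proof -
      have "((\<lambda>x. of_real (Re (\<phi>c x)) + \<i> * of_real (Im (\<phi>c x))) has_vector_derivative (of_real r + \<i> * of_real i)) (at x)"
        by (intro has_vector_derivative_add has_vector_derivative_mult_right has_vector_derivative_of_real r i)
      then show ?thesis by (simp add: complex_eq[symmetric] Complex_eq[symmetric])
    qed
    \<comment> \<open>Half the distance to the ends of the interval and to the top: a point within
      \<open>\<rho> / 2\<close> of x, raised by less than \<open>\<rho> / 2\<close>, still has the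
      margins of the rectangle estimate.\<close>
    define \<rho> where "\<rho> = min (min (x - a) (b - x)) d / 2"
    have \<rho>: "\<rho> > 0" "2 * \<rho> \<le> x - a" "2 * \<rho> \<le> b - x" "2 * \<rho> \<le> d" using x d by (auto simp: \<rho>_def)
    define C where "C = M * (b - a + 2 * d) / (pi * \<rho>\<^sup>2)"
    let ?E = "\<lambda>U z. poisson z b *\<^sub>R U b - poisson z a *\<^sub>R U a - integral {a..b} (\<lambda>t. poisson_deriv z t *\<^sub>R U t) :: complex"
    \<comment> \<open>At the heights \<open>e n\<close> the rectangle estimate compares
      \<open>h\<close> with its Poisson integral, and integration by parts expresses the latter by
      the primitive \<open>\<Phi>\<close>. The limit can be taken in that form because
      \<open>\<Phi>\<close> converges uniformly to its boundary values.\<close>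
    have near: "norm (h z - ?E \<phi>c z) \<le> C * Im z" if y: "Im z > 0" and zx: "dist z (of_real x) < \<rho> / 2" for z
    proof (rule tendsto_upperbound[OF _ _ sequentially_bot])
      have zr: "\<bar>Re z - x\<bar> < \<rho> / 2" "Im z < \<rho> / 2"
        using abs_Re_le_cmod[of "z - of_real x"] abs_Im_le_cmod[of "z - of_real x"] zx by (auto simp: dist_norm)
      have zS: "z \<in> S" using S(2)[of "Re z" "Im z"] zr y \<rho> by (auto simp: abs_if split: if_splits)
      have ih: "(\<lambda>n. h (z + \<i> * e n)) \<longlonglongrightarrow> h z"
      proof -
        have "isCont h z"
          by (rule field_differentiable_imp_continuous_at[OF holomorphic_on_imp_differentiable_at[OF h(1) S(1) zS]])
        moreover have "(\<lambda>n. z + \<i> * e n) \<longlonglongrightarrow> z + \<i> * of_real 0" by (intro tendsto_intros e0)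
        ultimately show ?thesis using isCont_tendsto_compose by fastforce
      qed
      define D where "D = integral {a..b} (\<lambda>t. \<bar>poisson_deriv z t\<bar>)"
      have iE: "(\<lambda>n. ?E (\<lambda>t. \<Phi> (Complex t (e n))) z) \<longlonglongrightarrow> ?E \<phi>c z"
      proof -
        have cU: "continuous_on {a..b} (\<lambda>t. \<Phi> (Complex t (e n)))" for n
        proof -
          have "continuous_on K \<Phi>" using \<Phi> DERIV_continuous_on by blast
          moreover have "continuous_on {a..b} (\<lambda>t. Complex t (e n))" unfolding Complex_eq by (intro continuous_intros)
          ultimately show ?thesis by (rule continuous_on_compose2) (use e in \<open>auto simp: K_def\<close>)
        qed
        have b: "norm (integral {a..b} (\<lambda>t. poisson_deriv z t *\<^sub>R \<Phi> (Complex t (e n))) - integral {a..b} (\<lambda>t. poisson_deriv z t *\<^sub>R \<phi>c t)) \<le> M * e n * D" for n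
        proof -
          have "integral {a..b} (\<lambda>t. poisson_deriv z t *\<^sub>R \<Phi> (Complex t (e n))) - integral {a..b} (\<lambda>t. poisson_deriv z t *\<^sub>R \<phi>c t)
              = integral {a..b} (\<lambda>t. poisson_deriv z t *\<^sub>R \<Phi> (Complex t (e n)) - poisson_deriv z t *\<^sub>R \<phi>c t)"
            by (intro integral_diff[symmetric] integrable_continuous_interval continuous_intros cU contc y)
          also have "norm \<dots> \<le> integral {a..b} (\<lambda>t. M * e n * \<bar>poisson_deriv z t\<bar>)"
          proof (rule integral_norm_bound_integral)
            fix t assume t: "t \<in> {a..b}"
            have "norm (\<Phi> (Complex t (e n)) - \<phi>c t) \<le> M * e n"
              using \<phi>\<Phi>[OF t e(1)[of n] e(2)[of n]] t by (simp add: \<phi>c_def min_absorb2 max_absorb2)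
            then show "norm (poisson_deriv z t *\<^sub>R \<Phi> (Complex t (e n)) - poisson_deriv z t *\<^sub>R \<phi>c t) \<le> M * e n * \<bar>poisson_deriv z t\<bar>"
              unfolding scaleR_diff_right[symmetric] norm_scaleR by (subst mult.commute) (rule mult_right_mono, auto)
          qed (intro integrable_continuous_interval continuous_intros cU contc y)+
          finally show ?thesis by (simp add: D_def)
        qed
        have "(\<lambda>n. integral {a..b} (\<lambda>t. poisson_deriv z t *\<^sub>R \<Phi> (Complex t (e n)))) \<longlonglongrightarrow> integral {a..b} (\<lambda>t. poisson_deriv z t *\<^sub>R \<phi>c t)"
        proof (rule LIM_zero_cancel[OF Lim_null_comparison])
          show "\<forall>\<^sub>F n in sequentially. norm (integral {a..b} (\<lambda>t. poisson_deriv z t *\<^sub>R \<Phi> (Complex t (e n))) - integral {a..b} (\<lambda>t. poisson_deriv z t *\<^sub>R \<phi>c t)) \<le> M * e n * D"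
            by (intro always_eventually allI b)
          show "(\<lambda>n. M * e n * D) \<longlonglongrightarrow> 0" by (auto intro!: tendsto_eq_intros e0)
        qed
        moreover have "\<phi>c a = \<phi> a" "\<phi>c b = \<phi> b" using ab by (auto simp: \<phi>c_def)
        ultimately show ?thesis using ab by (auto intro!: tendsto_intros \<phi>)
      qed
      show "(\<lambda>n. norm (h (z + \<i> * e n) - ?E (\<lambda>t. \<Phi> (Complex t (e n))) z)) \<longlonglongrightarrow> norm (h z - ?E \<phi>c z)"
        by (intro tendsto_norm tendsto_diff ih iE)
      have "\<forall>\<^sub>F n in sequentially. e n < \<rho> / 2" using order_tendstoD(2)[OF e0, of "\<rho> / 2"] \<rho> by simp
      then show "\<forall>\<^sub>F n in sequentially. norm (h (z + \<i> * e n) - ?E (\<lambda>t. \<Phi> (Complex t (e n))) z) \<le> C * Im z"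
      proof eventually_elim
        case (elim n)
        have en: "e n < d" using elim \<rho> by simp
        have "((\<lambda>t. poisson z t *\<^sub>R h (Complex t (e n))) has_integral ?E (\<lambda>t. \<Phi> (Complex t (e n))) z) {a..b}"
        proof (rule integration_by_parts_poisson_diff[OF y])
          show "continuous_on {a..b} (\<lambda>t. \<Phi> (Complex t (e n)))"
          proof -
            have "continuous_on K \<Phi>" using \<Phi> DERIV_continuous_on by blast
            moreover have "continuous_on {a..b} (\<lambda>t. Complex t (e n))" unfolding Complex_eq by (intro continuous_intros)
            ultimately show ?thesis by (rule continuous_on_compose2) (use e in \<open>auto simp: K_def\<close>)
          qed
          fix t assume t: "a < t" "t < b"
          define w where "w = Complex t (e n)"
          have "w \<in> box (Complex a 0) (Complex b d)" using t en e[of n] by (simp add: w_def in_box_complex_iff)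
          moreover have "box (Complex a 0) (Complex b d) \<subseteq> K" by (auto simp: in_box_complex_iff K_def)
          ultimately have wi: "w \<in> interior K" using interior_maximal open_box by blast
          then have "(\<Phi> has_field_derivative h w) (at w)"
            using \<Phi>[of w] interior_subset[of K] at_within_interior[OF wi] by auto
          moreover have "((\<lambda>t. Complex t (e n)) has_vector_derivative 1) (at t)"
            unfolding Complex_eq by (auto intro!: derivative_eq_intros)
          ultimately have "((\<Phi> \<circ> (\<lambda>t. Complex t (e n))) has_vector_derivative (1 * h w)) (at t)"
            unfolding w_def by (intro field_vector_diff_chain_at)
          then show "((\<lambda>t. \<Phi> (Complex t (e n))) has_vector_derivative h (Complex t (e n))) (at t)"
            by (simp add: o_def w_def)
        qed (use ab in simp)
        then have "integral {a..b} (\<lambda>t. poisson z t *\<^sub>R h (Complex t (e n))) = ?E (\<lambda>t. \<Phi> (Complex t (e n))) z"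
          by (rule integral_unique)
        moreover have "norm (h (z + \<i> * e n) - integral {a..b} (\<lambda>t. poisson z t *\<^sub>R h (Complex t (e n)))) \<le> M * (b - a + 2 * d) / (pi * \<rho>\<^sup>2) * Im z"
          by (rule poisson_rectangle_estimate[OF S h \<rho>(1) e(1) y]) (use zr \<rho> elim in \<open>auto simp: abs_if split: if_splits\<close>)
        ultimately show ?case by (simp add: C_def)
      qed
    qed
    have "(h \<longlongrightarrow> Complex r i) (at (of_real x) within stolz c x)" if c: "c > 0" for c
    proof -
      let ?F = "at (of_real x) within stolz c x"
      have 1: "(?E \<phi>c \<longlongrightarrow> Complex r i) ?F"
        using x by (intro poisson_by_parts_tendsto c contc der) auto
      have "((\<lambda>z. h z - ?E \<phi>c z) \<longlongrightarrow> 0) ?F"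
      proof (rule Lim_null_comparison)
        have "\<forall>\<^sub>F z in ?F. dist z (of_real x) < \<rho> / 2" using tendstoD[OF tendsto_ident_at, of "\<rho>/2"] \<rho> by auto
        then show "\<forall>\<^sub>F z in ?F. norm (h z - ?E \<phi>c z) \<le> C * Im z"
          using eventually_stolz[OF c, of x]
        proof eventually_elim
          case (elim z)
          show ?case by (rule near) (use elim in auto)
        qed
        show "((\<lambda>z. C * Im z) \<longlongrightarrow> 0) ?F" by (auto intro!: tendsto_eq_intros tendsto_Im_stolz)
      qed
      with 1 show ?thesis by (rule Lim_transform)
    qed
    then show "\<exists>L. \<forall>c>0. (h \<longlongrightarrow> L) (at (of_real x) within stolz c x)" by blast
  qed
qed

lemma integrable_continuous_times_bounded:
  fixes P u :: "real \<Rightarrow> real"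
  assumes P: "continuous_on {s..t} P" and [measurable]: "u \<in> borel_measurable borel" and u: "\<And>x. \<bar>u x\<bar> \<le> C"
  shows "(\<lambda>x. P x * u x) integrable_on {s..t}"
proof -
  obtain B where B: "\<And>x. x \<in> {s..t} \<Longrightarrow> \<bar>P x\<bar> \<le> B"
    using compact_imp_bounded[OF compact_continuous_image[OF P compact_Icc]] unfolding bounded_iff real_norm_def by blast
  have m: "(\<lambda>x. indicator {s..t} x *\<^sub>R P x * u x) \<in> borel_measurable borel"
    using borel_measurable_continuous_on_indicator[OF _ P] by measurable
  have "integrable lborel (\<lambda>x. indicator {s..t} x *\<^sub>R P x * u x)"
  proof (rule Bochner_Integration.integrable_bound)
    show "integrable lborel (\<lambda>x. B * C * indicator {s..t} x)"
      by (intro integrable_mult_right integrable_real_indicator) (auto simp: emeasure_lborel_Icc_eq)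
    have "\<bar>P x\<bar> * \<bar>u x\<bar> \<le> \<bar>B * C\<bar>" if "x \<in> {s..t}" for x
      by (rule order_trans[OF mult_mono abs_ge_self]) (use B[OF that] u[of x] abs_ge_zero[of "P x"] in linarith)+
    then show "AE x in lborel. norm (indicator {s..t} x *\<^sub>R P x * u x) \<le> norm (B * C * indicator {s..t} x)"
      by (auto simp: indicator_def abs_mult)
  qed (use m in simp)
  then have "set_integrable lborel {s..t} (\<lambda>x. P x * u x)" by (simp add: set_integrable_def mult.assoc)
  then show ?thesis by (rule set_borel_integral_eq_integral(1))
qed

text \<open>Almost every point of \<open>E\<close> is a density point, in terms of the harmonic measure.\<close>

lemma AE_poisson_complement_tendsto:
  fixes E :: "real set"
  assumes E: "E \<in> sets borel" and ab: "a < b"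
  shows "AE x in lborel. a < x \<and> x < b \<and> x \<in> E \<longrightarrow>
    (\<forall>c>0. ((\<lambda>z. integral {a..b} (\<lambda>t. poisson z t * indicator (-E) t)) \<longlongrightarrow> 0) (at (of_real x) within stolz c x))"
proof -
  define u :: "real \<Rightarrow> real" where "u = indicator (-E)"
  have um[measurable]: "u \<in> borel_measurable borel" using E unfolding u_def by measurable
  have int: "(\<lambda>t. P t * u t) integrable_on {s..t}" if P: "continuous_on {s..t} P" for P s t
    by (rule integrable_continuous_times_bounded[OF P um, of 1]) (simp add: u_def indicator_def)
  have uint: "u integrable_on {s..t}" for s t using int[of s t "\<lambda>_. 1"] by simp
  \<comment> \<open>The indefinite integral of the indicator of the complement has the indicator as
    its derivative almost everywhere, so at almost every point of \<open>E\<close> the derivative is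
    0.\<close>
  have "AE x in lborel. \<forall>a<x. ((\<lambda>s. integral {a..s} u) has_vector_derivative u x) (at x)"
    by (rule AE_indefinite_integral_has_vector_derivative) (rule uint)
  then show ?thesis
  proof (eventually_elim, intro impI allI)
    fix x c :: real
    assume D: "\<forall>a<x. ((\<lambda>s. integral {a..s} u) has_vector_derivative u x) (at x)"
      and x: "a < x \<and> x < b \<and> x \<in> E" and c: "c > 0"
    let ?F = "at (of_real x) within stolz c x"
    define U where "U = (\<lambda>s. integral {a..s} u)"
    have dU: "(U has_vector_derivative 0) (at x)" using D x by (simp add: U_def u_def)
    have cU: "continuous_on {a..b} U" unfolding U_def by (rule indefinite_integral_continuous_1[OF uint])
    \<comment> \<open>The limit lemma is about complex functions; the real primitive is embedded,
      and the real part is taken afterwards.\<close>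
    have "((\<lambda>z. poisson z b *\<^sub>R of_real (U b) - poisson z a *\<^sub>R of_real (U a) - integral {a..b} (\<lambda>t. poisson_deriv z t *\<^sub>R (of_real (U t) :: complex))) \<longlongrightarrow> of_real 0) ?F"
      by (rule poisson_by_parts_tendsto[OF c]) (use x has_vector_derivative_of_real[OF dU[folded has_real_derivative_iff_has_vector_derivative]] in \<open>auto intro!: continuous_intros cU\<close>)
    then have lim: "((\<lambda>z. Re (poisson z b *\<^sub>R of_real (U b) - poisson z a *\<^sub>R of_real (U a) - integral {a..b} (\<lambda>t. poisson_deriv z t *\<^sub>R (of_real (U t) :: complex)))) \<longlongrightarrow> 0) ?F"
      by (auto dest: tendsto_Re)
    show "((\<lambda>z. integral {a..b} (\<lambda>t. poisson z t * indicator (-E) t)) \<longlongrightarrow> 0) ?F"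
    proof (rule Lim_transform_eventually[OF lim])
      show "\<forall>\<^sub>F z in ?F. Re (poisson z b *\<^sub>R of_real (U b) - poisson z a *\<^sub>R of_real (U a) - integral {a..b} (\<lambda>t. poisson_deriv z t *\<^sub>R (of_real (U t) :: complex)))
         = integral {a..b} (\<lambda>t. poisson z t * indicator (-E) t)"
        using eventually_stolz[OF c, of x]
      proof eventually_elim
        case (elim z)
        then have y: "Im z > 0" by simp
        have i: "(\<lambda>t. poisson_deriv z t *\<^sub>R (of_real (U t) :: complex)) integrable_on {a..b}"
          by (intro integrable_continuous_interval continuous_intros cU y)
        have "Re (integral {a..b} (\<lambda>t. poisson_deriv z t *\<^sub>R (of_real (U t) :: complex))) = integral {a..b} (\<lambda>t. poisson_deriv z t * U t)"
          using integral_linear[OF i bounded_linear_Re] by (simp add: o_def)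
        \<comment> \<open>\<open>u\<close> is only measurable, so its primitive may lack a
          derivative at some points; this calls for the form of integration by parts for indefinite
          integrals.\<close>
        moreover have "integral {a..b} (\<lambda>t. poisson z t * u t) = poisson z b * integral {a..b} u - integral {a..b} (\<lambda>t. poisson_deriv z t * integral {a..t} u)"
        proof (rule integral_by_parts_absolutely_continuous[where M=1])
          show "(\<lambda>t. poisson z t * u t) integrable_on {s..t} \<or> \<not> {s..t} \<subseteq> {a..b}" for s t
            by (intro disjI1 int continuous_intros y)
          show "\<bar>u t\<bar> \<le> 1" for t by (simp add: u_def indicator_def)
        qed (use ab in \<open>auto intro!: poisson_has_deriv continuous_intros y simp: uint\<close>)
        ultimately show ?case by (simp add: U_def u_def[symmetric])
      qed
    qed
  qed
qed

text \<open>A bounded holomorphic function is dominated in modulus by the harmonic extension of a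
  majorant \<open>k\<close> of its boundary values, up to the O(Im z) of the rectangle estimate.
  That estimate is used at the heights \<open>e n\<close>, and dominated convergence gives the
  limit. Through \<open>k\<close> a bad set of boundary points can be charged with a larger bound
  than the rest.\<close>

lemma poisson_domination:
  assumes ab: "a < b"
    and S: "open S" "\<And>x y. a \<le> x \<Longrightarrow> x \<le> b \<Longrightarrow> 0 < y \<Longrightarrow> y \<le> d \<Longrightarrow> Complex x y \<in> S"
    and h: "h holomorphic_on S" "\<And>w. w \<in> S \<Longrightarrow> norm (h w) \<le> M"
    and \<rho>: "\<rho> > 0"
    and z: "Im z > 0" "a + \<rho> \<le> Re z" "Re z + \<rho> \<le> b" "Im z + 2 * \<rho> \<le> d"
    and e: "\<And>n. e n > (0::real)" "e \<longlonglongrightarrow> 0"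
    and k: "k \<in> borel_measurable borel" "\<And>t. 0 \<le> k t" "\<And>t. k t \<le> K"
    and lim: "AE t in lborel. a < t \<and> t < b \<longrightarrow> (\<exists>l. (\<lambda>n. h (Complex t (e n))) \<longlonglongrightarrow> l \<and> norm l \<le> k t)"
  shows "norm (h z) \<le> integral {a..b} (\<lambda>t. poisson z t * k t) + M * (b - a + 2 * d) / (pi * \<rho>\<^sup>2) * Im z"
proof -
  define C where "C = M * (b - a + 2 * d) / (pi * \<rho>\<^sup>2)"
  define P where "P = 1 / (pi * Im z)"
  have Pb: "poisson z t \<le> P" for t
  proof -
    have "pi * (Im z)\<^sup>2 \<le> pi * ((t - Re z)\<^sup>2 + (Im z)\<^sup>2)" by (intro mult_left_mono) auto
    then have "Im z * (pi * Im z) \<le> pi * ((t - Re z)\<^sup>2 + (Im z)\<^sup>2)" by (simp add: power2_eq_square mult_ac)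
    then show ?thesis using z(1) poisson_denom_pos[OF z(1), of t] by (simp add: poisson_def P_def divide_simps)
  qed
  have p0: "poisson z t \<ge> 0" for t by (rule poisson_nonneg[OF z(1)])
  have zS: "z \<in> S" using S(2)[of "Re z" "Im z"] z \<rho> by simp
  have pm[measurable]: "poisson z \<in> borel_measurable borel"
    by (intro borel_measurable_continuous_onI continuous_intros z)
  note k(1)[measurable]
  \<comment> \<open>The maximum with \<open>k\<close> makes the integrands converge exactly to
    \<open>poisson z t * k t\<close>, whatever the boundary limits are; no measurability of these
    limits has to be established.\<close>
  define g where "g = (\<lambda>n t. indicator {a..b} t * (poisson z t * max (norm (h (Complex t (e n)))) (k t)))"
  define g0 where "g0 = (\<lambda>t. indicator {a..b} t * (poisson z t * k t))"
  have "\<forall>\<^sub>F n in sequentially. e n < \<rho>" using order_tendstoD(2)[OF e(2)] \<rho> by simp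
  \<comment> \<open>Of the margin \<open>2 * \<rho>\<close> at the top, one half is spent on the
    shift by \<open>e n\<close> and the other half goes into the rectangle estimate.\<close>
  then obtain N where N: "\<And>n. n \<ge> N \<Longrightarrow> e n < \<rho>" by (auto simp: eventually_sequentially)
  have hcont: "continuous_on {a..b} (\<lambda>t. h (Complex t (e n)))" if "n \<ge> N" for n
  proof -
    have "continuous_on {a..b} (\<lambda>t. Complex t (e n))" unfolding Complex_eq by (intro continuous_intros)
    moreover have "(\<lambda>t. Complex t (e n)) ` {a..b} \<subseteq> S" using N[OF that] z \<rho> by (auto intro!: S(2) e)
    ultimately show ?thesis by (rule continuous_on_compose2[OF holomorphic_on_imp_continuous_on[OF h(1)]])
  qed
  have gm: "g n \<in> borel_measurable lborel" if "n \<ge> N" for n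
  proof -
    have [measurable]: "(\<lambda>t. indicator {a..b} t *\<^sub>R norm (h (Complex t (e n)))) \<in> borel_measurable borel"
      by (intro borel_measurable_continuous_on_indicator continuous_intros hcont that) simp
    have "g n = (\<lambda>t. poisson z t * max (indicator {a..b} t *\<^sub>R norm (h (Complex t (e n)))) (indicator {a..b} t * k t))"
      by (auto simp: g_def fun_eq_iff indicator_def)
    also have "\<dots> \<in> borel_measurable lborel" by measurable
    finally show ?thesis .
  qed
  have g0m: "g0 \<in> borel_measurable lborel" unfolding g0_def by measurable
  have hM: "norm (h (Complex t (e n))) \<le> M" if "n \<ge> N" "t \<in> {a..b}" for n t
    using N[OF that(1)] z \<rho> that by (intro h(2) S(2) e) auto
  have gb: "norm (g n t) \<le> indicator {a..b} t * (P * max M K)" if "n \<ge> N" for n t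
  proof (cases "t \<in> {a..b}")
    case True
    have "poisson z t * max (norm (h (Complex t (e n)))) (k t) \<le> P * max M K"
      using order_trans[OF p0 Pb] by (intro mult_mono Pb max.mono hM that True k) (auto simp: le_max_iff_disj)
    moreover have "0 \<le> poisson z t * max (norm (h (Complex t (e n)))) (k t)" by (intro mult_nonneg_nonneg p0) (simp add: le_max_iff_disj)
    ultimately show ?thesis using True by (simp add: g_def)
  qed (simp add: g_def)
  have wi: "integrable lborel (\<lambda>t. indicator {a..b} t * (P * max M K))"
    by (intro integrable_mult_left integrable_real_indicator) (auto simp: emeasure_lborel_Icc_eq)
  have gi: "integrable lborel (g n)" if "n \<ge> N" for n
    by (rule Bochner_Integration.integrable_bound[OF wi gm[OF that]]) (use gb[OF that] in \<open>auto intro!: AE_I2 order_trans[OF _ abs_ge_self]\<close>)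
  have conv: "(\<lambda>n. integral\<^sup>L lborel (g (n + N))) \<longlonglongrightarrow> integral\<^sup>L lborel g0"
  proof (rule integral_dominated_convergence[OF g0m _ wi])
    have "AE t in lborel. t \<noteq> a" "AE t in lborel. t \<noteq> b" by (rule AE_lborel_singleton)+
    with lim show "AE t in lborel. (\<lambda>n. g (n + N) t) \<longlonglongrightarrow> g0 t"
    proof eventually_elim
      case (elim t)
      show ?case
      proof (cases "t \<in> {a..b}")
        case True
        then obtain l where l: "(\<lambda>n. h (Complex t (e n))) \<longlonglongrightarrow> l" "norm l \<le> k t" using elim by auto
        have "(\<lambda>n. g n t) \<longlonglongrightarrow> indicator {a..b} t * (poisson z t * max (norm l) (k t))"
          unfolding g_def by (intro tendsto_intros l(1))
        then show ?thesis using l(2) by (intro LIMSEQ_ignore_initial_segment) (simp add: g0_def max_absorb2)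
      qed (simp add: g_def g0_def)
    qed
  qed (use gm gb in auto)
  have main: "norm (h (z + \<i> * e (n + N))) \<le> integral\<^sup>L lborel (g (n + N)) + C * Im z" for n
  proof -
    let ?m = "n + N"
    have cont: "continuous_on {a..b} (\<lambda>t. poisson z t * norm (h (Complex t (e ?m))))"
      by (intro continuous_intros hcont z) simp
    have "norm (h (z + \<i> * e ?m) - integral {a..b} (\<lambda>t. poisson z t *\<^sub>R h (Complex t (e ?m)))) \<le> C * Im z"
      unfolding C_def by (rule poisson_rectangle_estimate[OF S h \<rho> e(1) z(1-3)]) (use N[of ?m] z in auto)
    then have "norm (h (z + \<i> * e ?m)) \<le> norm (integral {a..b} (\<lambda>t. poisson z t *\<^sub>R h (Complex t (e ?m)))) + C * Im z"
      using norm_triangle_sub[of "h (z + \<i> * e ?m)" "integral {a..b} (\<lambda>t. poisson z t *\<^sub>R h (Complex t (e ?m)))"] by linarith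
    also have "norm (integral {a..b} (\<lambda>t. poisson z t *\<^sub>R h (Complex t (e ?m)))) \<le> integral {a..b} (\<lambda>t. poisson z t * norm (h (Complex t (e ?m))))"
      using p0 by (intro integral_norm_bound_integral integrable_continuous_interval cont continuous_intros hcont z) auto
    also have "\<dots> = (LINT t|lborel. indicator {a..b} t *\<^sub>R (poisson z t * norm (h (Complex t (e ?m)))))"
      using set_borel_integral_eq_integral(2)[OF borel_integrable_atLeastAtMost'[OF cont]] by (simp add: set_lebesgue_integral_def)
    also have "\<dots> \<le> integral\<^sup>L lborel (g ?m)"
    proof (rule integral_mono)
      show "integrable lborel (\<lambda>t. indicator {a..b} t *\<^sub>R (poisson z t * norm (h (Complex t (e ?m)))))"
        using borel_integrable_atLeastAtMost'[OF cont] by (simp add: set_integrable_def)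
      show "indicator {a..b} t *\<^sub>R (poisson z t * norm (h (Complex t (e ?m)))) \<le> g ?m t" for t
        using p0[of t] by (auto simp: g_def indicator_def intro!: mult_left_mono)
    qed (rule gi, simp)
    finally show ?thesis by simp
  qed
  have "norm (h z) \<le> integral\<^sup>L lborel g0 + C * Im z"
  proof (rule LIMSEQ_le[OF _ tendsto_add[OF conv tendsto_const]])
    have "isCont h z"
          by (rule field_differentiable_imp_continuous_at[OF holomorphic_on_imp_differentiable_at[OF h(1) S(1) zS]])
    moreover have "(\<lambda>n. z + \<i> * e (n + N)) \<longlonglongrightarrow> z + \<i> * of_real 0" by (intro tendsto_intros LIMSEQ_ignore_initial_segment e)
    ultimately have "(\<lambda>n. h (z + \<i> * e (n + N))) \<longlonglongrightarrow> h z" using isCont_tendsto_compose by fastforce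
    then show "(\<lambda>n. norm (h (z + \<i> * e (n + N)))) \<longlonglongrightarrow> norm (h z)" by (rule tendsto_norm)
  qed (use main in auto)
  moreover have "integral\<^sup>L lborel g0 = integral {a..b} (\<lambda>t. poisson z t * k t)"
  proof -
    have "set_integrable lborel {a..b} (\<lambda>t. poisson z t * k t)"
      unfolding set_integrable_def real_scaleR_def
    proof (rule Bochner_Integration.integrable_bound[OF wi])
      show "AE t in lborel. norm (indicator {a..b} t * (poisson z t * k t)) \<le> norm (indicator {a..b} t * (P * max M K))"
      proof (rule AE_I2)
        fix t
        have "poisson z t * k t \<le> P * max M K"
          using order_trans[OF p0 Pb] by (intro mult_mono Pb k) (auto simp: le_max_iff_disj k)
        moreover have "0 \<le> poisson z t * k t" using p0 k by simp
        ultimately show "norm (indicator {a..b} t * (poisson z t * k t)) \<le> norm (indicator {a..b} t * (P * max M K))"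
          by (auto simp: indicator_def)
      qed
    qed measurable
    from set_borel_integral_eq_integral(2)[OF this] show ?thesis by (simp add: g0_def set_lebesgue_integral_def)
  qed
  ultimately show ?thesis by (simp add: C_def)
qed

text \<open>Mapping the upper half-plane onto a neighbourhood of the upper boundary ray of a sector in a way
  that preserves the direction of the ray reverses the orientation, hence the conjugates.\<close>

definition semiholomorphic_on :: "(complex \<Rightarrow> complex) \<Rightarrow> complex set \<Rightarrow> bool" (infixl "semiholomorphic'_on" 50) where
  "h semiholomorphic_on S \<longleftrightarrow> h holomorphic_on S \<or> (\<lambda>w. cnj (h w)) holomorphic_on S"

lemma semiholomorphic_on_imp_continuous_on: "h semiholomorphic_on S \<Longrightarrow> continuous_on S h"
  unfolding semiholomorphic_on_def
  using holomorphic_on_imp_continuous_on continuous_on_cnj[of S "\<lambda>w. cnj (h w)"] by force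

lemma semiholomorphic_Fatou_stolz_limit:
  assumes ab: "a < b" and d: "d > 0"
    and S: "open S" "\<And>x y. a \<le> x \<Longrightarrow> x \<le> b \<Longrightarrow> 0 < y \<Longrightarrow> y \<le> d \<Longrightarrow> Complex x y \<in> S"
    and h: "h semiholomorphic_on S" "\<And>w. w \<in> S \<Longrightarrow> norm (h w) \<le> M"
  shows "AE x in lborel. a < x \<and> x < b \<longrightarrow>
           (\<exists>L. \<forall>c>0. (h \<longlongrightarrow> L) (at (of_real x) within stolz c x))"
  using h(1) unfolding semiholomorphic_on_def
proof
  assume *: "h holomorphic_on S"
  show ?thesis by (rule Fatou_stolz_limit[OF ab d S * h(2)])
next
  assume *: "(\<lambda>w. cnj (h w)) holomorphic_on S"
  have "AE x in lborel. a < x \<and> x < b \<longrightarrow>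
           (\<exists>L. \<forall>c>0. ((\<lambda>w. cnj (h w)) \<longlongrightarrow> L) (at (of_real x) within stolz c x))"
    by (rule Fatou_stolz_limit[OF ab d S *, of M]) (simp_all add: h(2))
  then show ?thesis
  proof (eventually_elim, intro impI)
    fix x assume *: "a < x \<and> x < b \<longrightarrow> (\<exists>L. \<forall>c>0. ((\<lambda>w. cnj (h w)) \<longlongrightarrow> L) (at (of_real x) within stolz c x))" "a < x \<and> x < b"
    then obtain L where L: "\<And>c. c > 0 \<Longrightarrow> ((\<lambda>w. cnj (h w)) \<longlongrightarrow> L) (at (of_real x) within stolz c x)" by blast
    have "(h \<longlongrightarrow> cnj L) (at (of_real x) within stolz c x)" if "c > 0" for c
      using tendsto_cnj[OF L[OF that]] by simp
    then show "\<exists>L. \<forall>c>0. (h \<longlongrightarrow> L) (at (of_real x) within stolz c x)" by blast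
  qed
qed

lemma semiholomorphic_poisson_domination:
  assumes ab: "a < b"
    and S: "open S" "\<And>x y. a \<le> x \<Longrightarrow> x \<le> b \<Longrightarrow> 0 < y \<Longrightarrow> y \<le> d \<Longrightarrow> Complex x y \<in> S"
    and h: "h semiholomorphic_on S" "\<And>w. w \<in> S \<Longrightarrow> norm (h w) \<le> M"
    and \<rho>: "\<rho> > 0"
    and z: "Im z > 0" "a + \<rho> \<le> Re z" "Re z + \<rho> \<le> b" "Im z + 2 * \<rho> \<le> d"
    and e: "\<And>n. e n > (0::real)" "e \<longlonglongrightarrow> 0"
    and k: "k \<in> borel_measurable borel" "\<And>t. 0 \<le> k t" "\<And>t. k t \<le> K"
    and lim: "AE t in lborel. a < t \<and> t < b \<longrightarrow> (\<exists>l. (\<lambda>n. h (Complex t (e n))) \<longlonglongrightarrow> l \<and> norm l \<le> k t)"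
  shows "norm (h z) \<le> integral {a..b} (\<lambda>t. poisson z t * k t) + M * (b - a + 2 * d) / (pi * \<rho>\<^sup>2) * Im z"
  using h(1) unfolding semiholomorphic_on_def
proof
  assume *: "h holomorphic_on S"
  show ?thesis by (rule poisson_domination[OF ab S * h(2) \<rho> z e k lim])
next
  assume *: "(\<lambda>w. cnj (h w)) holomorphic_on S"
  have "AE t in lborel. a < t \<and> t < b \<longrightarrow> (\<exists>l. (\<lambda>n. cnj (h (Complex t (e n)))) \<longlonglongrightarrow> l \<and> norm l \<le> k t)"
    using lim
  proof (eventually_elim, intro impI)
    fix t assume *: "a < t \<and> t < b \<longrightarrow> (\<exists>l. (\<lambda>n. h (Complex t (e n))) \<longlonglongrightarrow> l \<and> norm l \<le> k t)" "a < t \<and> t < b"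
    then obtain l where "(\<lambda>n. h (Complex t (e n))) \<longlonglongrightarrow> l \<and> norm l \<le> k t" by blast
    then show "\<exists>l. (\<lambda>n. cnj (h (Complex t (e n)))) \<longlonglongrightarrow> l \<and> norm l \<le> k t"
      by (intro exI[of _ "cnj l"]) (simp add: tendsto_cnj)
  qed
  from poisson_domination[OF ab S * _ \<rho> z e k this, of M] h(2) show ?thesis by simp
qed

section \<open>Equicontinuity of bounded families and Vitali's convergence theorem\<close>

lemma bounded_holomorphic_lipschitz:
  assumes h: "h holomorphic_on cball z (2 * r)" and r: "r > 0"
    and M: "\<And>w. w \<in> cball z (2 * r) \<Longrightarrow> norm (h w) \<le> M"
    and w: "w \<in> ball z r" "w' \<in> ball z r"
  shows "norm (h w - h w') \<le> M / r * norm (w - w')"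
proof (rule field_differentiable_bound[OF convex_ball, of z r h "deriv h"])
  fix v assume v: "v \<in> ball z r"
  have vb: "cball v r \<subseteq> cball z (2 * r)"
  proof
    fix u assume "u \<in> cball v r"
    then show "u \<in> cball z (2 * r)" using v dist_triangle[of z u v] by simp
  qed
  have hb: "h holomorphic_on ball z (2 * r)" by (rule holomorphic_on_subset[OF h]) auto
  have "(h has_field_derivative deriv h v) (at v)"
    by (rule holomorphic_derivI[OF hb]) (use v r in auto)
  then show "(h has_field_derivative deriv h v) (at v within ball z r)" by (rule has_field_derivative_at_within)
  have hv: "h holomorphic_on cball v r" by (rule holomorphic_on_subset[OF h vb])
  have "norm ((deriv ^^ 1) h v) \<le> fact 1 * M / r ^ 1"
  proof (rule Cauchy_inequality)
    show "h holomorphic_on ball v r" by (rule holomorphic_on_subset[OF hv]) auto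
    show "continuous_on (cball v r) h" by (rule holomorphic_on_imp_continuous_on[OF hv])
    show "norm (h x) \<le> M" if "norm (v - x) = r" for x
      using M[of x] vb that by (auto simp: dist_norm subset_iff)
  qed (rule r)
  then show "norm (deriv h v) \<le> M / r" by simp
qed (use w in auto)

text \<open>Convergence is asked for on a set that meets every nonempty open subset; this is what
  limits along a countable dense set provide. The common bound makes the family equi-Lipschitz near
  each point, so the sequence is Cauchy everywhere, and Montel's theorem shows that the limit is
  holomorphic.\<close>

lemma Vitali_convergence:
  fixes F :: "nat \<Rightarrow> complex \<Rightarrow> complex"
  assumes S: "open S" and F: "\<And>n. F n holomorphic_on S" and M: "\<And>n z. z \<in> S \<Longrightarrow> norm (F n z) \<le> M"
    and D: "\<And>X. open X \<Longrightarrow> X \<noteq> {} \<Longrightarrow> X \<subseteq> S \<Longrightarrow> \<exists>z\<in>X. convergent (\<lambda>n. F n z)"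
  shows "\<exists>G. G holomorphic_on S \<and> (\<forall>z\<in>S. (\<lambda>n. F n z) \<longlonglongrightarrow> G z)"
proof -
  have conv: "convergent (\<lambda>n. F n z)" if z: "z \<in> S" for z
  proof -
    obtain r where r: "r > 0" "cball z (2 * r) \<subseteq> S"
    proof -
      obtain e where "e > 0" "cball z e \<subseteq> S" using S z open_contains_cball by blast
      then show ?thesis using that[of "e / 2"] by simp
    qed
    have M0: "M \<ge> 0" using order_trans[OF norm_ge_zero M[OF z]] .
    have "Cauchy (\<lambda>n. F n z)"
    proof (rule metric_CauchyI)
      fix e :: real assume e: "e > 0"
      \<comment> \<open>Passing from z to a point of convergence within \<open>s\<close> costs at
        most \<open>M / r * s\<close>, which is less than e/3; the \<open>M + 1\<close> covers the
        case of a vanishing bound.\<close>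
      define s where "s = min r (e * r / (4 * (M + 1)))"
      have s: "s > 0" "s \<le> r" using r e M0 by (auto simp: s_def)
      have "ball z s \<noteq> {}" "ball z s \<subseteq> S" using s r by auto
      then obtain y where y: "y \<in> ball z s" "convergent (\<lambda>n. F n y)" using D[OF open_ball] by blast
      have sm: "M / r * s < e / 3"
      proof -
        have "M / r * s \<le> M / r * (e * r / (4 * (M + 1)))"
          using M0 r by (intro mult_left_mono) (auto simp: s_def)
        also have "\<dots> = e * (M / (4 * (M + 1)))" using r by simp
        also have "\<dots> < e * (1 / 3)" using e M0 by (intro mult_strict_left_mono) (auto simp: field_simps)
        finally show ?thesis by simp
      qed
      have yz: "norm (F n z - F n y) < e / 3" for n
      proof -
        have "norm (F n z - F n y) \<le> M / r * norm (z - y)"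
          by (rule bounded_holomorphic_lipschitz[OF holomorphic_on_subset[OF F r(2)] r(1)]) (use M r y s in auto)
        also have "\<dots> \<le> M / r * s" using y M0 r by (intro mult_left_mono) (auto simp: dist_norm)
        also note sm
        finally show ?thesis .
      qed
      have "Cauchy (\<lambda>n. F n y)" using y(2) by (simp add: Cauchy_convergent_iff)
      then obtain N where N: "\<And>m n. m \<ge> N \<Longrightarrow> n \<ge> N \<Longrightarrow> dist (F m y) (F n y) < e / 3"
        using metric_CauchyD[of "\<lambda>n. F n y" "e / 3"] e by (metis divide_pos_pos zero_less_numeral)
      show "\<exists>N. \<forall>m\<ge>N. \<forall>n\<ge>N. dist (F m z) (F n z) < e"
      proof (intro exI allI impI)
        fix m n assume mn: "m \<ge> N" "n \<ge> N"
        have "F m z - F n z = (F m z - F m y) + (F m y - F n y) - (F n z - F n y)" by simp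
        also have "norm \<dots> \<le> norm (F m z - F m y) + norm (F m y - F n y) + norm (F n z - F n y)"
          by (intro order_trans[OF norm_triangle_ineq4] add_right_mono norm_triangle_ineq)
        also have "\<dots> < e" using yz[of m] yz[of n] N[OF mn] by (simp add: dist_norm)
        finally show "dist (F m z) (F n z) < e" by (simp add: dist_norm)
      qed
    qed
    then show ?thesis by (simp add: Cauchy_convergent_iff)
  qed
  have rng: "range F \<subseteq> range F" by simp
  obtain g r where g: "g holomorphic_on S" "strict_mono (r :: nat \<Rightarrow> nat)" "\<And>x. x \<in> S \<Longrightarrow> (\<lambda>n. F (r n) x) \<longlonglongrightarrow> g x"
  proof (rule Montel[OF S _ _ rng])
    show "\<exists>B. \<forall>h\<in>range F. \<forall>z\<in>K. cmod (h z) \<le> B" if "K \<subseteq> S" for K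
      using M that by (intro exI[of _ M]) auto
  qed (use F in auto)
  have "(\<lambda>n. F n z) \<longlonglongrightarrow> g z" if z: "z \<in> S" for z
  proof -
    obtain l where l: "(\<lambda>n. F n z) \<longlonglongrightarrow> l" using conv[OF z] by (auto simp: convergent_def)
    have "(\<lambda>n. F (r n) z) \<longlonglongrightarrow> l" using LIMSEQ_subseq_LIMSEQ[OF l g(2)] by (simp add: o_def)
    with g(3)[OF z] have "g z = l" by (rule LIMSEQ_unique)
    with l show ?thesis by simp
  qed
  with g(1) show ?thesis by blast
qed

text \<open>On a vertical approach the distance to x equals the height, so every aperture above 1
  contains it.\<close>

lemma stolz_limit_vertical:
  assumes h: "(h \<longlongrightarrow> L) (at (of_real x) within stolz c x)" and c: "c > 1"
    and e: "\<And>n. e n > (0::real)" "e \<longlonglongrightarrow> 0"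
  shows "(\<lambda>n. h (Complex x (e n))) \<longlonglongrightarrow> L"
proof -
  have d: "Complex x (e n) - of_real x = \<i> * of_real (e n)" for n by (simp add: complex_eq_iff)
  have "filterlim (\<lambda>n. Complex x (e n)) (at (of_real x) within stolz c x) sequentially"
    unfolding filterlim_at
  proof
    show "\<forall>\<^sub>F n in sequentially. Complex x (e n) \<in> stolz c x \<and> Complex x (e n) \<noteq> of_real x"
    proof (intro always_eventually allI conjI)
      fix n
      show "Complex x (e n) \<in> stolz c x"
        unfolding stolz_def mem_Collect_eq dist_norm d using e(1)[of n] c by (simp add: norm_mult)
      show "Complex x (e n) \<noteq> of_real x" using e(1)[of n] by (simp add: complex_eq_iff)
    qed
    have "(\<lambda>n. of_real x + \<i> * of_real (e n)) \<longlonglongrightarrow> of_real x + \<i> * of_real 0" by (intro tendsto_intros e)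
    then show "(\<lambda>n. Complex x (e n)) \<longlonglongrightarrow> of_real x" by (simp add: Complex_eq)
  qed
  with h show ?thesis by (rule filterlim_compose)
qed

lemma open_stolz: "open (stolz c x)"
  unfolding stolz_def by (intro open_Collect_less continuous_intros)

lemma stolz_mono: "0 < c \<Longrightarrow> c \<le> c' \<Longrightarrow> stolz c x \<subseteq> stolz c' x"
proof
  fix z assume c: "0 < c" "c \<le> c'" and z: "z \<in> stolz c x"
  have "c * Im z \<le> c' * Im z" using stolz_Im_pos[OF z c(1)] c by (intro mult_right_mono) auto
  with z show "z \<in> stolz c' x" by (simp add: stolz_def)
qed

lemma stolz_translate: "of_real x + w \<in> stolz c x \<longleftrightarrow> w \<in> stolz c 0"
  by (simp add: stolz_def dist_norm)

subsection \<open>Fatou's theorem in two variables\<close>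

lemma countable_dense_subset:
  fixes S :: "'a::second_countable_topology set"
  obtains D :: "'a set" where "countable D" "\<And>X. open X \<Longrightarrow> X \<noteq> {} \<Longrightarrow> \<exists>d\<in>D. d \<in> X"
  using countable_dense_exists by (metis Int_iff ex_in_conv that)

text \<open>For almost every \<open>x1\<close> the limits \<open>G x1\<close> in the first variable are holomorphic in the
  second one and have boundary limits themselves. The sets \<open>E c \<epsilon> n \<mu>\<close>, on which \<open>G x1\<close> is
  uniformly \<open>\<epsilon>\<close>-close to \<open>\<mu>\<close> in a truncated approach region, cover almost everything, and at a
  density point of a section of such a set the Poisson integral of \<open>G\<close> is close to \<open>\<mu>\<close>.\<close>

lemma Fatou_two_variables:
  fixes g :: "complex \<times> complex \<Rightarrow> complex"
  assumes ab1: "a1 < b1" and d1: "d1 > 0" and ab2: "a2 < b2" and d2: "d2 > 0"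
    and S1: "open S1" "\<And>x y. a1 \<le> x \<Longrightarrow> x \<le> b1 \<Longrightarrow> 0 < y \<Longrightarrow> y \<le> d1 \<Longrightarrow> Complex x y \<in> S1"
    and S2: "open S2" "\<And>x y. a2 \<le> x \<Longrightarrow> x \<le> b2 \<Longrightarrow> 0 < y \<Longrightarrow> y \<le> d2 \<Longrightarrow> Complex x y \<in> S2"
    and gm: "g \<in> borel_measurable borel"
    and M: "\<And>z1 z2. z1 \<in> S1 \<Longrightarrow> z2 \<in> S2 \<Longrightarrow> norm (g (z1, z2)) \<le> M"
    and g1: "\<And>z2. z2 \<in> S2 \<Longrightarrow> (\<lambda>z1. g (z1, z2)) semiholomorphic_on S1"
    and g2: "(\<forall>z1\<in>S1. (\<lambda>z2. g (z1, z2)) holomorphic_on S2) \<or> (\<forall>z1\<in>S1. (\<lambda>z2. cnj (g (z1, z2))) holomorphic_on S2)"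
  shows "AE x2 in lborel. a2 < x2 \<and> x2 < b2 \<longrightarrow> (AE x1 in lborel. a1 < x1 \<and> x1 < b1 \<longrightarrow>
           (\<exists>L. \<forall>c>0. (g \<longlongrightarrow> L) (at (of_real x1, of_real x2) within stolz c x1 \<times> stolz c x2)))"
proof -
  have M0: "M \<ge> 0" using order_trans[OF norm_ge_zero M[OF S1(2)[of a1 d1] S2(2)[of a2 d2]]] ab1 d1 ab2 d2 by simp
  define e where "e = (\<lambda>n. d1 / real (Suc n))"
  have e: "\<And>n. e n > 0" "e \<longlonglongrightarrow> 0" "\<And>n. e n \<le> d1" unfolding e_def
    using d1 LIMSEQ_Suc[OF lim_const_over_n[of d1]] by (simp_all add: field_simps)
  \<comment> \<open>\<open>lim\<close> has some value also where the sequence diverges, which makes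
    \<open>G\<close> measurable as it stands; its values are used only for good
    \<open>x1\<close>.\<close>
  define G where "G = (\<lambda>x1 z2. lim (\<lambda>n. g (Complex x1 (e n), z2)))"
  \<comment> \<open>One countable dense set supplies the points \<open>z2\<close> at which limits in
    the first variable are required, the sample points of the approach regions and the candidate
    limits \<mu>. Countability keeps the exceptional sets null and the sets \<open>E\<close>
    measurable.\<close>
  obtain W :: "complex set" where W: "countable W" "\<And>X. open X \<Longrightarrow> X \<noteq> {} \<Longrightarrow> \<exists>w\<in>W. w \<in> X"
    using countable_dense_subset by metis
  have SI: "Complex x (e n) \<in> S1" if "a1 < x" "x < b1" for x n
    using that e by (intro S1(2)) auto
  define good where "good = (\<lambda>x1. a1 < x1 \<and> x1 < b1 \<and> (\<forall>z2\<in>W \<inter> S2. convergent (\<lambda>n. g (Complex x1 (e n), z2))))"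
  have good_AE: "AE x1 in lborel. a1 < x1 \<and> x1 < b1 \<longrightarrow> good x1"
  proof -
    have "AE x1 in lborel. \<forall>z2\<in>W \<inter> S2. a1 < x1 \<and> x1 < b1 \<longrightarrow> convergent (\<lambda>n. g (Complex x1 (e n), z2))"
    proof (rule AE_ball_countable'[rotated])
      show "countable (W \<inter> S2)" using W(1) by blast
      fix z2 assume z2: "z2 \<in> W \<inter> S2"
      have "AE x in lborel. a1 < x \<and> x < b1 \<longrightarrow> (\<exists>L. \<forall>c>0. ((\<lambda>z1. g (z1, z2)) \<longlongrightarrow> L) (at (of_real x) within stolz c x))"
        by (rule semiholomorphic_Fatou_stolz_limit[OF ab1 d1 S1 g1 M]) (use z2 in auto)
      then show "AE x1 in lborel. a1 < x1 \<and> x1 < b1 \<longrightarrow> convergent (\<lambda>n. g (Complex x1 (e n), z2))"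
      proof (eventually_elim, intro impI)
        fix x assume *: "a1 < x \<and> x < b1 \<longrightarrow> (\<exists>L. \<forall>c>0. ((\<lambda>z1. g (z1, z2)) \<longlongrightarrow> L) (at (of_real x) within stolz c x))" "a1 < x \<and> x < b1"
        then obtain L where "((\<lambda>z1. g (z1, z2)) \<longlongrightarrow> L) (at (of_real x) within stolz 2 x)" by (meson zero_less_numeral)
        from stolz_limit_vertical[OF this _ e(1,2)] show "convergent (\<lambda>n. g (Complex x (e n), z2))" by (auto simp: convergent_def)
      qed
    qed
    then show ?thesis by eventually_elim (auto simp: good_def)
  qed
  have Gsemi: "G x semiholomorphic_on S2" and Glim: "\<And>z2. z2 \<in> S2 \<Longrightarrow> (\<lambda>n. g (Complex x (e n), z2)) \<longlonglongrightarrow> G x z2"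
    if x: "good x" for x
  proof -
    have xab: "a1 < x" "x < b1" using x by (auto simp: good_def)
    have D: "\<exists>z\<in>X. convergent (\<lambda>n. g (Complex x (e n), z))" if "open X" "X \<noteq> {}" "X \<subseteq> S2" for X
      using W(2)[OF that(1,2)] that(3) x by (auto simp: good_def)
    have "\<exists>H. H semiholomorphic_on S2 \<and> (\<forall>z\<in>S2. (\<lambda>n. g (Complex x (e n), z)) \<longlonglongrightarrow> H z)"
      using g2
    proof
      assume h: "\<forall>z1\<in>S1. (\<lambda>z2. g (z1, z2)) holomorphic_on S2"
      have "\<exists>H. H holomorphic_on S2 \<and> (\<forall>z\<in>S2. (\<lambda>n. g (Complex x (e n), z)) \<longlonglongrightarrow> H z)"
        by (rule Vitali_convergence[OF S2(1), of _ M]) (use h SI[OF xab] M D in auto)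
      then show ?thesis unfolding semiholomorphic_on_def by blast
    next
      assume h: "\<forall>z1\<in>S1. (\<lambda>z2. cnj (g (z1, z2))) holomorphic_on S2"
      have D': "\<exists>z\<in>X. convergent (\<lambda>n. cnj (g (Complex x (e n), z)))" if X: "open X" "X \<noteq> {}" "X \<subseteq> S2" for X
      proof -
        obtain z l where "z \<in> X" "(\<lambda>n. g (Complex x (e n), z)) \<longlonglongrightarrow> l" using D[OF X] by (auto simp: convergent_def)
        then show ?thesis unfolding convergent_def using tendsto_cnj by blast
      qed
      have "\<exists>H. H holomorphic_on S2 \<and> (\<forall>z\<in>S2. (\<lambda>n. cnj (g (Complex x (e n), z))) \<longlonglongrightarrow> H z)"
        by (rule Vitali_convergence[OF S2(1), of _ M]) (use h SI[OF xab] M D' in auto)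
      then obtain H where H: "H holomorphic_on S2" "\<And>z. z \<in> S2 \<Longrightarrow> (\<lambda>n. cnj (g (Complex x (e n), z))) \<longlonglongrightarrow> H z" by blast
      have "(\<lambda>n. g (Complex x (e n), z)) \<longlonglongrightarrow> cnj (H z)" if "z \<in> S2" for z
        using tendsto_cnj[OF H(2)[OF that]] by simp
      moreover have "(\<lambda>z. cnj (H z)) semiholomorphic_on S2" using H(1) by (simp add: semiholomorphic_on_def)
      ultimately show ?thesis by blast
    qed
    then obtain H where H: "H semiholomorphic_on S2" "\<And>z. z \<in> S2 \<Longrightarrow> (\<lambda>n. g (Complex x (e n), z)) \<longlonglongrightarrow> H z" by blast
    have GH: "G x z = H z" if "z \<in> S2" for z unfolding G_def using H(2)[OF that] by (rule limI)
    show "\<And>z2. z2 \<in> S2 \<Longrightarrow> (\<lambda>n. g (Complex x (e n), z2)) \<longlonglongrightarrow> G x z2" using H(2) GH by simp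
    have "H holomorphic_on S2 \<longleftrightarrow> G x holomorphic_on S2" by (rule holomorphic_cong) (simp_all add: GH)
    moreover have "(\<lambda>w. cnj (H w)) holomorphic_on S2 \<longleftrightarrow> (\<lambda>w. cnj (G x w)) holomorphic_on S2"
      by (rule holomorphic_cong) (simp_all add: GH)
    ultimately show "G x semiholomorphic_on S2" using H(1) by (simp add: semiholomorphic_on_def)
  qed
  have GM: "norm (G x z) \<le> M" if "good x" "z \<in> S2" for x z
  proof (rule tendsto_upperbound[OF tendsto_norm[OF Glim[OF that]] _ sequentially_bot])
    show "\<forall>\<^sub>F n in sequentially. norm (g (Complex x (e n), z)) \<le> M"
      using that by (intro always_eventually allI M SI) (auto simp: good_def)
  qed
  define O' where "O' = (\<lambda>c n. stolz c 0 \<inter> ball 0 (1 / real (Suc n)))"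
  \<comment> \<open>Testing only the points of \<open>W\<close> makes the set Borel; by continuity
    of \<open>G x1\<close> on \<open>S2\<close> the inequality extends to all points of the
    truncated region there.\<close>
  define E where "E = (\<lambda>c \<epsilon> n \<mu>. {p :: real \<times> real. \<forall>w\<in>W \<inter> O' c n. norm (G (fst p) (of_real (snd p) + w) - \<mu>) \<le> \<epsilon>})"
  have Em: "E c \<epsilon> n \<mu> \<in> sets borel" for c \<epsilon> n \<mu>
  proof -
    have 1: "(\<lambda>p. g (Complex (fst p) (e m), of_real (snd p) + w)) \<in> borel_measurable borel" for m w
    proof (rule measurable_compose[OF _ gm])
      show "(\<lambda>p :: real \<times> real. (Complex (fst p) (e m), complex_of_real (snd p) + w)) \<in> borel \<rightarrow>\<^sub>M borel"
        unfolding Complex_eq by (intro borel_measurable_continuous_onI continuous_intros)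
    qed
    have [measurable]: "(\<lambda>p. G (fst p) (of_real (snd p) + w)) \<in> borel_measurable borel" for w
      unfolding G_def by (rule borel_measurable_lim_metric) (rule 1)
    have "{p \<in> space borel. \<forall>w\<in>W \<inter> O' c n. norm (G (fst p) (of_real (snd p) + w) - \<mu>) \<le> \<epsilon>} \<in> sets borel"
      by (rule sets.sets_Collect_countable_All') (use W(1) in auto)
    then show ?thesis by (simp add: E_def)
  qed
  have cover: "AE x2 in lborel. AE x1 in lborel. a1 < x1 \<and> x1 < b1 \<and> a2 < x2 \<and> x2 < b2 \<longrightarrow> (\<exists>n. \<exists>\<mu>\<in>W. (x1, x2) \<in> E c \<epsilon> n \<mu>)"
    if c: "c > 0" and \<epsilon>: "\<epsilon> > 0" for c \<epsilon>
  proof -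
    define P where "P = (\<lambda>x1 x2. a1 < x1 \<and> x1 < b1 \<and> a2 < x2 \<and> x2 < b2 \<longrightarrow> (\<exists>n. \<exists>\<mu>\<in>W. (x1, x2) \<in> E c \<epsilon> n \<mu>))"
    have Q: "{p. P (fst p) (snd p)} \<in> sets (borel :: (real \<times> real) measure)"
    proof -
      have "{p. P (fst p) (snd p)} = (- ({a1<..<b1} \<times> {a2<..<b2})) \<union> (\<Union>n. \<Union>\<mu>\<in>W. E c \<epsilon> n \<mu>)"
        by (auto simp: P_def)
      also have "\<dots> \<in> sets borel"
        by (intro sets.Un borel_comp borel_open open_Times open_greaterThanLessThan sets.countable_UN' sets.countable_UN W(1) Em image_subsetI) auto
      finally show ?thesis .
    qed
    \<comment> \<open>Fatou's theorem in the second variable gives the covering at fixed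
      \<open>x1\<close>. The density argument below freezes \<open>x2\<close> instead, so the two
      quantifiers have to be exchanged, and for this \<open>P\<close> must be measurable.\<close>
    have "AE x1 in lborel. AE x2 in lborel. P x1 x2"
      using good_AE
    proof eventually_elim
      case (elim x1)
      show ?case
      proof (cases "a1 < x1 \<and> x1 < b1")
        case True
        then have gd: "good x1" using elim by simp
        have "AE x in lborel. a2 < x \<and> x < b2 \<longrightarrow> (\<exists>L. \<forall>c>0. (G x1 \<longlongrightarrow> L) (at (of_real x) within stolz c x))"
          by (rule semiholomorphic_Fatou_stolz_limit[OF ab2 d2 S2 Gsemi[OF gd] GM[OF gd]])
        then show ?thesis
        proof eventually_elim
          case (elim x2)
          show ?case unfolding P_def
          proof
            assume x: "a1 < x1 \<and> x1 < b1 \<and> a2 < x2 \<and> x2 < b2"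
            then obtain L where "(G x1 \<longlongrightarrow> L) (at (of_real x2) within stolz c x2)" using elim c by blast
            then have "\<forall>\<^sub>F z in at (of_real x2) within stolz c x2. dist (G x1 z) L < \<epsilon> / 2" using \<epsilon> by (intro tendstoD) auto
            then obtain d where d: "d > 0" "\<And>z. z \<in> stolz c x2 \<Longrightarrow> z \<noteq> of_real x2 \<Longrightarrow> dist z (of_real x2) < d \<Longrightarrow> dist (G x1 z) L < \<epsilon> / 2"
              unfolding eventually_at by blast
            obtain n where n: "1 / real (Suc n) < d" using d(1) nat_approx_posE by blast
            obtain \<mu> where \<mu>: "\<mu> \<in> W" "dist L \<mu> < \<epsilon> / 2"
              using W(2)[of "ball L (\<epsilon> / 2)"] \<epsilon> by auto
            have "norm (G x1 (of_real x2 + w) - \<mu>) \<le> \<epsilon>" if w: "w \<in> O' c n" for w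
            proof -
              have ws: "w \<in> stolz c 0" "norm w < d" using w n by (auto simp: O'_def)
              have "w \<noteq> 0" using stolz_Im_pos[OF ws(1) c] by auto
              then have "dist (G x1 (of_real x2 + w)) L < \<epsilon> / 2"
                using ws by (intro d(2)) (simp_all add: stolz_translate dist_norm)
              then show ?thesis using \<mu>(2) dist_triangle[of "G x1 (of_real x2 + w)" \<mu> L] by (simp add: dist_norm)
            qed
            then show "\<exists>n. \<exists>\<mu>\<in>W. (x1, x2) \<in> E c \<epsilon> n \<mu>" using \<mu>(1) by (auto simp: E_def)
          qed
        qed
      qed (auto simp: P_def)
    qed
    moreover have "{p \<in> space (lborel \<Otimes>\<^sub>M lborel). P (fst p) (snd p)} \<in> sets (lborel \<Otimes>\<^sub>M lborel)"
      using Q unfolding lborel_prod by simp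
    ultimately have "AE x2 in lborel. AE x1 in lborel. P x1 x2"
      by (simp only: lborel_pair.AE_commute[symmetric])
    then show ?thesis by (simp add: P_def)
  qed
  \<comment> \<open>Apertures i + 2 and tolerances 1/(k + 1) are countably many and exhaust all
    apertures and tolerances, so one null set serves for all of them.\<close>
  have cover': "AE x2 in lborel. AE x1 in lborel. \<forall>i k :: nat. a1 < x1 \<and> x1 < b1 \<and> a2 < x2 \<and> x2 < b2 \<longrightarrow>
      (\<exists>n. \<exists>\<mu>\<in>W. (x1, x2) \<in> E (real i + 2) (1 / real (Suc k)) n \<mu>)"
    unfolding AE_all_countable by (intro allI cover) auto
  show ?thesis
    using cover'
  proof (eventually_elim, intro impI)
    fix x2 assume cov: "AE x1 in lborel. \<forall>i k :: nat. a1 < x1 \<and> x1 < b1 \<and> a2 < x2 \<and> x2 < b2 \<longrightarrow>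
      (\<exists>n. \<exists>\<mu>\<in>W. (x1, x2) \<in> E (real i + 2) (1 / real (Suc k)) n \<mu>)" and x2: "a2 < x2 \<and> x2 < b2"
    define Es where "Es = (\<lambda>c \<epsilon> n \<mu>. {t. (t, x2) \<in> E c \<epsilon> n \<mu>})"
    have Esm: "Es c \<epsilon> n \<mu> \<in> sets borel" for c \<epsilon> n \<mu>
    proof -
      have "(\<lambda>t::real. (t, x2)) \<in> borel \<rightarrow>\<^sub>M borel" by (intro borel_measurable_continuous_onI continuous_intros)
      from measurable_sets[OF this Em[of c \<epsilon> n \<mu>]] show ?thesis by (simp add: Es_def vimage_def)
    qed
    \<comment> \<open>At fixed \<open>x2\<close>, almost every point of each of these countably many
      sections is a density point of it.\<close>
    have dens: "AE x1 in lborel. \<forall>i k n. \<forall>\<mu>\<in>W. a1 < x1 \<and> x1 < b1 \<and> x1 \<in> Es (real (i::nat) + 2) (1 / real (Suc k)) n \<mu> \<longrightarrow>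
       (\<forall>c>0. ((\<lambda>z. integral {a1..b1} (\<lambda>t. poisson z t * indicator (- Es (real i + 2) (1 / real (Suc k)) n \<mu>) t)) \<longlongrightarrow> 0) (at (of_real x1) within stolz c x1))"
      unfolding AE_all_countable
      by (intro allI AE_ball_countable' W(1) AE_poisson_complement_tendsto Esm ab1)
    show "AE x1 in lborel. a1 < x1 \<and> x1 < b1 \<longrightarrow>
           (\<exists>L. \<forall>c>0. (g \<longlongrightarrow> L) (at (of_real x1, of_real x2) within stolz c x1 \<times> stolz c x2))"
      using cov dens
    proof (eventually_elim, intro impI)
      fix x1
      assume cv: "\<forall>i k :: nat. a1 < x1 \<and> x1 < b1 \<and> a2 < x2 \<and> x2 < b2 \<longrightarrow> (\<exists>n. \<exists>\<mu>\<in>W. (x1, x2) \<in> E (real i + 2) (1 / real (Suc k)) n \<mu>)"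
        and dn: "\<forall>i k n. \<forall>\<mu>\<in>W. a1 < x1 \<and> x1 < b1 \<and> x1 \<in> Es (real (i::nat) + 2) (1 / real (Suc k)) n \<mu> \<longrightarrow>
       (\<forall>c>0. ((\<lambda>z. integral {a1..b1} (\<lambda>t. poisson z t * indicator (- Es (real i + 2) (1 / real (Suc k)) n \<mu>) t)) \<longlongrightarrow> 0) (at (of_real x1) within stolz c x1))"
        and x1: "a1 < x1 \<and> x1 < b1"
      define \<rho> where "\<rho> = min (min (x1 - a1) (b1 - x1)) d1 / 4"
      have \<rho>: "\<rho> > 0" "4 * \<rho> \<le> x1 - a1" "4 * \<rho> \<le> b1 - x1" "4 * \<rho> \<le> d1" using x1 d1 by (auto simp: \<rho>_def)
      define \<rho>2 where "\<rho>2 = min (min (x2 - a2) (b2 - x2)) d2"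
      have \<rho>2: "\<rho>2 > 0" "\<rho>2 \<le> x2 - a2" "\<rho>2 \<le> b2 - x2" "\<rho>2 \<le> d2" using x2 d2 by (auto simp: \<rho>2_def)
      \<comment> \<open>One tolerance bounds the boundary values on the section; the other absorbs
        the harmonic measure of its complement together with the error of the rectangle
        estimate.\<close>
      have key: "\<exists>\<delta>>0. \<exists>\<mu>. \<forall>z1\<in>stolz (real i + 2) x1. \<forall>z2\<in>stolz (real i + 2) x2.
          dist z1 (of_real x1) < \<delta> \<longrightarrow> dist z2 (of_real x2) < \<delta> \<longrightarrow> norm (g (z1, z2) - \<mu>) \<le> 2 * (1 / real (Suc k))" for i k :: nat
      proof -
        define c where "c = real i + 2"
        have c: "c > 0" by (simp add: c_def)
        define \<epsilon> where "\<epsilon> = 1 / real (Suc k)"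
        have \<epsilon>: "\<epsilon> > 0" by (simp add: \<epsilon>_def)
        obtain n \<mu> where \<mu>: "\<mu> \<in> W" "(x1, x2) \<in> E c \<epsilon> n \<mu>" using cv x1 x2 unfolding c_def \<epsilon>_def by blast
        define B where "B = Es c \<epsilon> n \<mu>"
        have Bm: "B \<in> sets borel" by (simp add: B_def Esm)
        have "x1 \<in> B" using \<mu>(2) by (simp add: B_def Es_def)
        then have lim0: "((\<lambda>z. integral {a1..b1} (\<lambda>t. poisson z t * indicator (- B) t)) \<longlongrightarrow> 0) (at (of_real x1) within stolz c x1)"
          using dn \<mu>(1) x1 c unfolding B_def c_def \<epsilon>_def by blast
        define M' where "M' = M + norm \<mu>"
        define C where "C = M' * (b1 - a1 + 2 * d1) / (pi * \<rho>\<^sup>2)"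
        have M'0: "M' \<ge> 0" using M0 by (simp add: M'_def)
        have "((\<lambda>z. M' * integral {a1..b1} (\<lambda>t. poisson z t * indicator (- B) t) + C * Im z) \<longlongrightarrow> 0) (at (of_real x1) within stolz c x1)"
          by (auto intro!: tendsto_eq_intros lim0 tendsto_Im_stolz)
        then have "\<forall>\<^sub>F z in at (of_real x1) within stolz c x1. M' * integral {a1..b1} (\<lambda>t. poisson z t * indicator (- B) t) + C * Im z < \<epsilon>"
          using \<epsilon> by (rule order_tendstoD(2))
        then obtain d where d: "d > 0" "\<And>z. z \<in> stolz c x1 \<Longrightarrow> z \<noteq> of_real x1 \<Longrightarrow> dist z (of_real x1) < d \<Longrightarrow>
            M' * integral {a1..b1} (\<lambda>t. poisson z t * indicator (- B) t) + C * Im z < \<epsilon>"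
          unfolding eventually_at by blast
        define \<delta> where "\<delta> = min (min d \<rho>) (min \<rho>2 (1 / real (Suc n)))"
        have \<delta>: "\<delta> > 0" "\<delta> \<le> d" "\<delta> \<le> \<rho>" "\<delta> \<le> \<rho>2" "\<delta> \<le> 1 / real (Suc n)" using d \<rho> \<rho>2 by (auto simp: \<delta>_def)
        have "norm (g (z1, z2) - \<mu>) \<le> 2 * \<epsilon>"
          if z1: "z1 \<in> stolz c x1" "dist z1 (of_real x1) < \<delta>" and z2: "z2 \<in> stolz c x2" "dist z2 (of_real x2) < \<delta>" for z1 z2
        proof -
          have y1: "Im z1 > 0" and y2: "Im z2 > 0" using stolz_Im_pos c z1 z2 by blast+
          have r1: "\<bar>Re z1 - x1\<bar> < \<delta>" "\<bar>Im z1\<bar> < \<delta>"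
            using abs_Re_le_cmod[of "z1 - of_real x1"] abs_Im_le_cmod[of "z1 - of_real x1"] z1(2) by (auto simp: dist_norm)
          have r2: "\<bar>Re z2 - x2\<bar> < \<delta>" "\<bar>Im z2\<bar> < \<delta>"
            using abs_Re_le_cmod[of "z2 - of_real x2"] abs_Im_le_cmod[of "z2 - of_real x2"] z2(2) by (auto simp: dist_norm)
          have z2S: "z2 \<in> S2"
            using S2(2)[of "Re z2" "Im z2"] r2 y2 \<rho>2 \<delta> by (simp add: abs_less_iff)
          \<comment> \<open>A strict violation at \<open>z2\<close> would persist on an open set by
            continuity, and that set would contain a sample point from \<open>W\<close>.\<close>
          have Gle: "norm (G t z2 - \<mu>) \<le> \<epsilon>" if t: "good t" "t \<in> B" for t
          proof (rule ccontr)
            assume "\<not> norm (G t z2 - \<mu>) \<le> \<epsilon>"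
            then have gt: "norm (G t z2 - \<mu>) > \<epsilon>" by simp
            have "continuous_on S2 (G t)" by (rule semiholomorphic_on_imp_continuous_on[OF Gsemi[OF t(1)]])
            then obtain r where r: "r > 0" "\<And>w. w \<in> S2 \<Longrightarrow> dist w z2 < r \<Longrightarrow> dist (G t w) (G t z2) < norm (G t z2 - \<mu>) - \<epsilon>"
              using gt z2S unfolding continuous_on_iff by (metis diff_gt_0_iff_gt)
            obtain r' where r': "r' > 0" "ball z2 r' \<subseteq> S2" using S2(1) z2S openE by blast
            define X where "X = ball (z2 - of_real x2) (min r r')"
            have X: "open X" "z2 - of_real x2 \<in> X" using r r' by (auto simp: X_def)
            have XG: "norm (G t (of_real x2 + w) - \<mu>) > \<epsilon>" if w: "w \<in> X" for w
            proof -
              have dw: "dist (of_real x2 + w) z2 < min r r'"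
                using w by (simp add: X_def dist_norm norm_minus_commute algebra_simps)
              then have "of_real x2 + w \<in> S2" using r'(2) by (auto simp: dist_commute)
              then have "dist (G t (of_real x2 + w)) (G t z2) < norm (G t z2 - \<mu>) - \<epsilon>" using r(2) dw by simp
              moreover have "norm (G t z2 - \<mu>) \<le> dist (G t (of_real x2 + w)) (G t z2) + norm (G t (of_real x2 + w) - \<mu>)"
                using dist_triangle3[of "G t z2" \<mu> "G t (of_real x2 + w)"] by (simp add: dist_norm)
              ultimately show ?thesis by simp
            qed
            have "z2 - of_real x2 \<in> O' c n"
              using z2 \<delta> stolz_translate[of x2 "z2 - of_real x2" c] by (simp add: O'_def dist_norm norm_minus_commute)
            then have "X \<inter> O' c n \<noteq> {}" using X by blast
            moreover have "open (X \<inter> O' c n)" unfolding O'_def by (intro open_Int X open_stolz open_ball)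
            ultimately obtain w where "w \<in> W" "w \<in> X" "w \<in> O' c n" using W(2) by blast
            then have "w \<in> X" "norm (G t (of_real x2 + w) - \<mu>) \<le> \<epsilon>" using t(2) by (simp_all add: B_def Es_def E_def)
            with XG[of w] show False by linarith
          qed
          \<comment> \<open>The majorant in the first variable for the boundary values of g minus
            \<mu>: the tolerance on the section, the trivial bound \<open>M'\<close> off it.\<close>
          define k where "k = (\<lambda>t. \<epsilon> + M' * indicator (- B) t :: real)"
          have km: "k \<in> borel_measurable borel" unfolding k_def using Bm by measurable
          have 1: "norm (g (z1, z2) - \<mu>) \<le> integral {a1..b1} (\<lambda>t. poisson z1 t * k t) + M' * (b1 - a1 + 2 * d1) / (pi * \<rho>\<^sup>2) * Im z1"
          proof (rule semiholomorphic_poisson_domination[where h="\<lambda>z1. g (z1, z2) - \<mu>" and K="\<epsilon> + M'", OF ab1 S1 _ _ \<rho>(1) y1 _ _ _ e(1,2) km])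
            show "(\<lambda>z1. g (z1, z2) - \<mu>) semiholomorphic_on S1"
              using g1[OF z2S] unfolding semiholomorphic_on_def by (auto intro!: holomorphic_intros)
            show "norm (g (w, z2) - \<mu>) \<le> M'" if "w \<in> S1" for w
              unfolding M'_def using M[OF that z2S] by (intro order_trans[OF norm_triangle_ineq4] add_right_mono)
            show "a1 + \<rho> \<le> Re z1" "Re z1 + \<rho> \<le> b1" "Im z1 + 2 * \<rho> \<le> d1"
              using r1 \<rho> \<delta> by (simp_all add: abs_less_iff)
            show "0 \<le> k t" "k t \<le> \<epsilon> + M'" for t using \<epsilon> M'0 by (auto simp: k_def indicator_def)
            show "AE t in lborel. a1 < t \<and> t < b1 \<longrightarrow> (\<exists>l. (\<lambda>n. g (Complex t (e n), z2) - \<mu>) \<longlonglongrightarrow> l \<and> norm l \<le> k t)"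
              using good_AE
            proof (eventually_elim, intro impI)
              fix t assume "a1 < t \<and> t < b1 \<longrightarrow> good t" "a1 < t \<and> t < b1"
              then have gd: "good t" by simp
              have "norm (G t z2 - \<mu>) \<le> k t"
              proof (cases "t \<in> B")
                case True
                then show ?thesis using Gle[OF gd True] by (simp add: k_def)
              next
                case False
                have "norm (G t z2 - \<mu>) \<le> M'"
                  unfolding M'_def using GM[OF gd z2S] by (intro order_trans[OF norm_triangle_ineq4] add_right_mono)
                then show ?thesis using \<epsilon> False by (simp add: k_def)
              qed
              then show "\<exists>l. (\<lambda>n. g (Complex t (e n), z2) - \<mu>) \<longlonglongrightarrow> l \<and> norm l \<le> k t"
                by (intro exI[of _ "G t z2 - \<mu>"] conjI tendsto_intros Glim[OF gd z2S])
            qed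
          qed
          have 2: "integral {a1..b1} (\<lambda>t. poisson z1 t * k t) \<le> \<epsilon> + M' * integral {a1..b1} (\<lambda>t. poisson z1 t * indicator (- B) t)"
          proof -
            have i1: "(\<lambda>t. \<epsilon> * poisson z1 t) integrable_on {a1..b1}"
              by (intro integrable_continuous_interval continuous_intros y1)
            have i2: "(\<lambda>t. poisson z1 t * indicator (- B) t) integrable_on {a1..b1}"
              by (rule integrable_continuous_times_bounded[where C=1]) (use Bm in \<open>auto intro!: continuous_intros y1 simp: indicator_def\<close>)
            have "integral {a1..b1} (\<lambda>t. poisson z1 t * k t) = integral {a1..b1} (\<lambda>t. \<epsilon> * poisson z1 t + M' * (poisson z1 t * indicator (- B) t))"
              by (simp add: k_def algebra_simps)
            also have "\<dots> = \<epsilon> * integral {a1..b1} (poisson z1) + M' * integral {a1..b1} (\<lambda>t. poisson z1 t * indicator (- B) t)"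
              using integral_add[OF i1 integrable_on_cmult_left[OF i2, of M']] by simp
            also have "\<epsilon> * integral {a1..b1} (poisson z1) \<le> \<epsilon> * 1"
              using integral_poisson_le_1[OF y1] \<epsilon> by (intro mult_left_mono) auto
            finally show ?thesis by simp
          qed
          have 3: "M' * integral {a1..b1} (\<lambda>t. poisson z1 t * indicator (- B) t) + M' * (b1 - a1 + 2 * d1) / (pi * \<rho>\<^sup>2) * Im z1 < \<epsilon>"
          proof -
            have "z1 \<noteq> of_real x1" using y1 by auto
            then show ?thesis using d(2)[OF z1(1)] z1(2) \<delta> by (simp add: C_def)
          qed
          from 1 2 3 show ?thesis by linarith
        qed
        then show ?thesis using \<delta>(1) unfolding c_def \<epsilon>_def by blast
      qed
      define f where "f = (\<lambda>n. 1 / real (Suc n))"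
      have f: "\<And>n. f n > 0" "f \<longlonglongrightarrow> 0" unfolding f_def using lim_const_over_n[of 1, THEN LIMSEQ_Suc] by auto
      \<comment> \<open>The limit is located along one sequence, vertical in both variables and
        contained in all the sampled regions. It is Cauchy by \<open>key\<close>, with \<mu>
        depending on the tolerance, so its limit is the same for every aperture.\<close>
      define Z where "Z = (\<lambda>n. g (Complex x1 (f n), Complex x2 (f n)))"
      have vert: "Complex x (f n) \<in> stolz (real i + 2) x" "dist (Complex x (f n)) (of_real x) = f n" for x n and i :: nat
      proof -
        have "Complex x (f n) - of_real x = \<i> * of_real (f n)" by (simp add: complex_eq_iff)
        then show d: "dist (Complex x (f n)) (of_real x) = f n" using f(1)[of n] by (simp add: dist_norm norm_mult)
        have "1 * f n < (real i + 2) * f n" using f(1)[of n] by (intro mult_strict_right_mono) auto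
        then show "Complex x (f n) \<in> stolz (real i + 2) x" using d by (simp add: stolz_def)
      qed
      have "Cauchy Z"
      proof (rule metric_CauchyI)
        fix r :: real assume r: "r > 0"
        obtain k where k: "1 / real (Suc k) < r / 4" using r nat_approx_posE[of "r / 4"] by auto
        obtain \<delta> \<mu> where \<delta>: "\<delta> > 0" and b: "\<forall>z1\<in>stolz (real 0 + 2) x1. \<forall>z2\<in>stolz (real 0 + 2) x2.
          dist z1 (of_real x1) < \<delta> \<longrightarrow> dist z2 (of_real x2) < \<delta> \<longrightarrow> norm (g (z1, z2) - \<mu>) \<le> 2 * (1 / real (Suc k))"
          using key[of 0 k] by blast
        obtain N where N: "\<And>n. n \<ge> N \<Longrightarrow> f n < \<delta>" using order_tendstoD(2)[OF f(2) \<delta>] by (auto simp: eventually_sequentially)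
        have Zb: "norm (Z n - \<mu>) < r / 2" if "n \<ge> N" for n
        proof -
          have "norm (Z n - \<mu>) \<le> 2 * (1 / real (Suc k))"
            unfolding Z_def using b vert(1)[of _ n 0] vert(2)[of _ n] N[OF that] by auto
          then show ?thesis using k by linarith
        qed
        show "\<exists>N. \<forall>m\<ge>N. \<forall>n\<ge>N. dist (Z m) (Z n) < r"
        proof (intro exI allI impI)
          fix m n assume "m \<ge> N" "n \<ge> N"
          then show "dist (Z m) (Z n) < r"
            using Zb[of m] Zb[of n] dist_triangle2[of "Z m" "Z n" \<mu>] by (simp add: dist_norm)
        qed
      qed
      then obtain L where L: "Z \<longlonglongrightarrow> L" by (auto simp: Cauchy_convergent_iff convergent_def)
      have "(g \<longlongrightarrow> L) (at (of_real x1, of_real x2) within stolz c x1 \<times> stolz c x2)" if c: "c > 0" for c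
      proof -
        obtain i :: nat where i: "c \<le> real i + 2" by (metis real_arch_simple add_increasing2 zero_le_numeral)
        have "(g \<longlongrightarrow> L) (at (of_real x1, of_real x2) within stolz (real i + 2) x1 \<times> stolz (real i + 2) x2)"
        proof (rule tendstoI)
          fix r :: real assume r: "r > 0"
          obtain k where k: "1 / real (Suc k) < r / 4" using r nat_approx_posE[of "r / 4"] by auto
          obtain \<delta> \<mu> where \<delta>: "\<delta> > 0" and b: "\<forall>z1\<in>stolz (real i + 2) x1. \<forall>z2\<in>stolz (real i + 2) x2.
            dist z1 (of_real x1) < \<delta> \<longrightarrow> dist z2 (of_real x2) < \<delta> \<longrightarrow> norm (g (z1, z2) - \<mu>) \<le> 2 * (1 / real (Suc k))"
            using key[of i k] by blast
          have "norm (L - \<mu>) \<le> 2 * (1 / real (Suc k))"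
          proof (rule tendsto_upperbound[OF _ _ sequentially_bot])
            show "(\<lambda>n. norm (Z n - \<mu>)) \<longlonglongrightarrow> norm (L - \<mu>)" by (intro tendsto_intros L)
            show "\<forall>\<^sub>F n in sequentially. norm (Z n - \<mu>) \<le> 2 * (1 / real (Suc k))"
              using order_tendstoD(2)[OF f(2) \<delta>]
            proof eventually_elim
              case (elim n)
              then show ?case unfolding Z_def using b vert(1)[of _ n i] vert(2)[of _ n] by auto
            qed
          qed
          then have Lm: "norm (L - \<mu>) < r / 2" using k by linarith
          show "\<forall>\<^sub>F z in at (of_real x1, of_real x2) within stolz (real i + 2) x1 \<times> stolz (real i + 2) x2. dist (g z) L < r"
            unfolding eventually_at
          proof (intro exI[of _ \<delta>] conjI ballI impI \<delta>)
            fix z assume z: "z \<in> stolz (real i + 2) x1 \<times> stolz (real i + 2) x2"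
              "z \<noteq> (of_real x1, of_real x2) \<and> dist z (of_real x1, of_real x2) < \<delta>"
            obtain z1 z2 where zz: "z = (z1, z2)" by (cases z)
            have "dist z1 (of_real x1) < \<delta>" "dist z2 (of_real x2) < \<delta>"
              using z(2) dist_fst_le[of z "(of_real x1, of_real x2)"] dist_snd_le[of z "(of_real x1, of_real x2)"] by (auto simp: zz)
            then have "norm (g z - \<mu>) \<le> 2 * (1 / real (Suc k))" using b z(1) by (auto simp: zz)
            then have "norm (g z - \<mu>) < r / 2" using k by linarith
            then show "dist (g z) L < r" using Lm dist_triangle2[of "g z" L \<mu>] by (simp add: dist_norm)
          qed
        qed
        then show ?thesis
          by (rule tendsto_within_subset) (use stolz_mono[OF c i] in blast)
      qed
      then show "\<exists>L. \<forall>c>0. (g \<longlongrightarrow> L) (at (of_real x1, of_real x2) within stolz c x1 \<times> stolz c x2)" by blast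
    qed
  qed
qed

subsection \<open>Boundary values on the product of two sectors\<close>

text \<open>For z = r e^(i \<theta>) the imaginary parts are r sin (\<theta> + \<alpha>) and r sin
  (\<theta> - \<alpha>). With two linear inequalities in place of the argument, openness, shifts and
  distances are a matter of linear arithmetic.\<close>

lemma sector_iff:
  assumes \<alpha>: "0 < \<alpha>" "\<alpha> < pi / 2"
  shows "z \<in> sector \<alpha> \<longleftrightarrow> Im (z * cis \<alpha>) > 0 \<and> Im (z * cis (- \<alpha>)) < 0"
proof (cases "z = 0")
  case False
  define r \<theta> where "r = cmod z" and "\<theta> = Arg z"
  have r: "r > 0" using False by (simp add: r_def)
  have \<theta>: "- pi < \<theta>" "\<theta> \<le> pi" using Arg_bounded[of z] by (auto simp: \<theta>_def)
  have z: "z = rcis r \<theta>" by (simp add: r_def \<theta>_def rcis_cmod_Arg)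
  have i: "Im (z * cis \<alpha>) = r * sin (\<theta> + \<alpha>)" "Im (z * cis (- \<alpha>)) = r * sin (\<theta> - \<alpha>)"
    by (simp_all add: z rcis_def cis_mult[symmetric] sin_add sin_diff algebra_simps)
  have "\<bar>\<theta>\<bar> < \<alpha> \<longleftrightarrow> sin (\<theta> + \<alpha>) > 0 \<and> sin (\<theta> - \<alpha>) < 0"
  proof
    assume "\<bar>\<theta>\<bar> < \<alpha>"
    then have "sin (\<theta> + \<alpha>) > 0" "sin (\<alpha> - \<theta>) > 0" using \<alpha> by (auto intro!: sin_gt_zero)
    then show "sin (\<theta> + \<alpha>) > 0 \<and> sin (\<theta> - \<alpha>) < 0" using sin_minus[of "\<alpha> - \<theta>"] by simp
  next
    assume s: "sin (\<theta> + \<alpha>) > 0 \<and> sin (\<theta> - \<alpha>) < 0"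
    have "\<theta> < \<alpha>"
    proof (rule ccontr)
      assume "\<not> \<theta> < \<alpha>"
      then have "sin (\<theta> - \<alpha>) \<ge> 0" using \<theta> \<alpha> by (intro sin_ge_zero) auto
      with s show False by simp
    qed
    moreover have "- \<alpha> < \<theta>"
    proof (rule ccontr)
      assume "\<not> - \<alpha> < \<theta>"
      then have "sin (- (\<theta> + \<alpha>)) \<ge> 0" using \<theta> \<alpha> by (intro sin_ge_zero) auto
      with s sin_minus[of "\<theta> + \<alpha>"] show False by linarith
    qed
    ultimately show "\<bar>\<theta>\<bar> < \<alpha>" by simp
  qed
  then show ?thesis using False r unfolding i by (simp add: sector_def \<theta>_def zero_less_mult_iff mult_less_0_iff)
qed (simp add: sector_def)

lemma open_sector:
  assumes \<alpha>: "0 < \<alpha>" "\<alpha> < pi / 2"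
  shows "open (sector \<alpha>)"
proof -
  have "sector \<alpha> = {z. Im (z * cis \<alpha>) > 0} \<inter> {z. Im (z * cis (- \<alpha>)) < 0}"
    using sector_iff[OF \<alpha>] by blast
  then show ?thesis by (auto intro!: open_Int open_Collect_less continuous_intros)
qed

text \<open>The weak form of the same inequalities; the vertex belongs to it.\<close>

definition closed_sector :: "real \<Rightarrow> complex set" where
  "closed_sector \<alpha> = {z. Im (z * cis \<alpha>) \<ge> 0 \<and> Im (z * cis (- \<alpha>)) \<le> 0}"

text \<open>The shift moves both defining linear forms inwards by \<eta> sin \<alpha>, which a
  perturbation of smaller modulus cannot undo.\<close>

lemma closed_sector_shift_ball:
  assumes \<alpha>: "0 < \<alpha>" "\<alpha> < pi / 2" and z: "z \<in> closed_sector \<alpha>" and \<eta>: "\<eta> > 0"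
  shows "ball (z + of_real \<eta>) (\<eta> * sin \<alpha>) \<subseteq> sector \<alpha>"
proof
  fix w assume w: "w \<in> ball (z + of_real \<eta>) (\<eta> * sin \<alpha>)"
  define v where "v = w - (z + of_real \<eta>)"
  have v: "cmod v < \<eta> * sin \<alpha>" using w by (simp add: v_def dist_norm norm_minus_commute)
  have b: "\<bar>Im (v * cis \<beta>)\<bar> \<le> cmod v" for \<beta> using abs_Im_le_cmod[of "v * cis \<beta>"] by (simp add: norm_mult)
  have "w * cis \<beta> = z * cis \<beta> + of_real \<eta> * cis \<beta> + v * cis \<beta>" for \<beta> by (simp add: v_def algebra_simps)
  then have I: "Im (w * cis \<beta>) = Im (z * cis \<beta>) + \<eta> * sin \<beta> + Im (v * cis \<beta>)" for \<beta> by simp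
  have "Im (w * cis \<alpha>) > 0" using I[of \<alpha>] b[of \<alpha>] v z by (simp only: closed_sector_def mem_Collect_eq) linarith
  moreover have "Im (w * cis (-\<alpha>)) < 0" using I[of "-\<alpha>"] b[of "-\<alpha>"] v z by (simp only: closed_sector_def mem_Collect_eq sin_minus) linarith
  ultimately show "w \<in> sector \<alpha>" using sector_iff[OF \<alpha>] by blast
qed

lemma closed_sector_shift:
  assumes \<alpha>: "0 < \<alpha>" "\<alpha> < pi / 2" and z: "z \<in> closed_sector \<alpha>" and \<eta>: "\<eta> > 0"
  shows "z + of_real \<eta> \<in> sector \<alpha>"
proof -
  have "sin \<alpha> > 0" using \<alpha> by (intro sin_gt_zero) auto
  then show ?thesis using closed_sector_shift_ball[OF assms] \<eta> by (auto simp: subset_iff)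
qed

lemma sector_subset_closed_sector:
  assumes \<alpha>: "0 < \<alpha>" "\<alpha> < pi / 2" shows "sector \<alpha> \<subseteq> closed_sector \<alpha>"
  using sector_iff[OF \<alpha>] by (force simp: closed_sector_def)

text \<open>An isometry taking the positive axis to the boundary ray and the upper side of the axis
  to the side on which the sector lies.\<close>

definition boundary_map :: "real \<Rightarrow> sign \<Rightarrow> complex \<Rightarrow> complex" where
  "boundary_map \<alpha> s w = cis (sign_val s * \<alpha>) * (if s = Pos then cnj w else w)"

definition boundary_inv :: "real \<Rightarrow> sign \<Rightarrow> complex \<Rightarrow> complex" where
  "boundary_inv \<alpha> s z = (if s = Pos then cnj (cis (- sign_val s * \<alpha>) * z) else cis (- sign_val s * \<alpha>) * z)"

lemma boundary_map_inv [simp]: "boundary_map \<alpha> s (boundary_inv \<alpha> s z) = z"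
  by (cases s) (simp_all add: boundary_map_def boundary_inv_def cis_cnj mult.assoc[symmetric] cis_mult)

lemma boundary_map_of_real: "boundary_map \<alpha> s (of_real x) = cis (sign_val s * \<alpha>) * of_real x"
  by (simp add: boundary_map_def)

lemma dist_boundary_map [simp]: "dist (boundary_map \<alpha> s w) (boundary_map \<alpha> s w') = dist w w'"
proof -
  have "boundary_map \<alpha> s w - boundary_map \<alpha> s w' = boundary_map \<alpha> s (w - w')"
    by (simp add: boundary_map_def algebra_simps)
  moreover have "cmod (boundary_map \<alpha> s (w - w')) = cmod (w - w')"
    by (simp add: boundary_map_def norm_mult del: complex_cnj_diff)
  ultimately show ?thesis by (simp only: dist_norm)
qed

lemma norm_boundary_map [simp]: "cmod (boundary_map \<alpha> s w) = cmod w"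
  by (simp add: boundary_map_def norm_mult)

lemma continuous_on_boundary_map [continuous_intros]:
  "continuous_on A h \<Longrightarrow> continuous_on A (\<lambda>x. boundary_map \<alpha> s (h x))"
  unfolding boundary_map_def by (cases s) (auto intro!: continuous_intros)

text \<open>Seen from one boundary ray, the other one has direction 2 \<alpha>; a point lies between
  them if Im w > 0 and Im w cos (2 \<alpha>) < Re w sin (2 \<alpha>), and the left side is at most
  Im w.\<close>

lemma boundary_map_sector:
  assumes \<alpha>: "0 < \<alpha>" "\<alpha> < pi / 2" and w: "Im w > 0" "Im w < Re w * sin (2 * \<alpha>)"
  shows "boundary_map \<alpha> s w \<in> sector \<alpha>"
proof -
  have c: "\<bar>Im w * cos (2 * \<alpha>)\<bar> \<le> Im w * 1"
    unfolding abs_mult using w by (intro mult_mono) auto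
  have e: "cis \<alpha> * cis \<alpha> = cis (2 * \<alpha>)" "cis (-\<alpha>) * cis (-\<alpha>) = cis (- (2 * \<alpha>))" "cis \<alpha> * cis (-\<alpha>) = 1" "cis (-\<alpha>) * cis \<alpha> = 1"
    by (simp_all add: cis_mult)
  show ?thesis
  proof (cases s)
    case Pos
    have z: "boundary_map \<alpha> s w * cis \<alpha> = cis (2 * \<alpha>) * cnj w" "boundary_map \<alpha> s w * cis (-\<alpha>) = cnj w"
      using e by (simp_all add: boundary_map_def Pos mult_ac)
    have "Im (boundary_map \<alpha> s w * cis \<alpha>) = Re w * sin (2 * \<alpha>) - Im w * cos (2 * \<alpha>)"
      unfolding z by simp
    moreover have "Im (boundary_map \<alpha> s w * cis (-\<alpha>)) = - Im w" unfolding z by simp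
    ultimately show ?thesis using c w unfolding sector_iff[OF \<alpha>] by linarith
  next
    case Neg
    have z: "boundary_map \<alpha> s w * cis (-\<alpha>) = cis (- (2 * \<alpha>)) * w" "boundary_map \<alpha> s w * cis \<alpha> = w"
      using e by (simp_all add: boundary_map_def Neg mult_ac)
    have "Im (boundary_map \<alpha> s w * cis (-\<alpha>)) = Im w * cos (2 * \<alpha>) - Re w * sin (2 * \<alpha>)"
      unfolding z by simp
    moreover have "Im (boundary_map \<alpha> s w * cis \<alpha>) = Im w" unfolding z by simp
    ultimately show ?thesis using c w unfolding sector_iff[OF \<alpha>] by linarith
  qed
qed

lemma ray_closed_sector:
  assumes \<alpha>: "0 < \<alpha>" "\<alpha> < pi / 2" and x: "x \<ge> 0"
  shows "cis (sign_val s * \<alpha>) * of_real x \<in> closed_sector \<alpha>"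
proof -
  have s2: "sin (2 * \<alpha>) \<ge> 0" using \<alpha> by (intro sin_ge_zero) auto
  have e: "cis (sign_val s * \<alpha>) * of_real x * cis \<beta> = of_real x * cis (sign_val s * \<alpha> + \<beta>)" for \<beta>
    by (simp add: cis_mult[symmetric] mult_ac)
  show ?thesis using s2 x unfolding closed_sector_def mem_Collect_eq e
    by (cases s) (simp_all add: mult_nonneg_nonneg)
qed

lemma ray_frontier_sector:
  assumes \<alpha>: "0 < \<alpha>" "\<alpha> < pi / 2" and x: "x \<ge> 0"
  shows "cis (sign_val s * \<alpha>) * of_real x \<in> frontier (sector \<alpha>)"
proof -
  let ?z = "cis (sign_val s * \<alpha>) * of_real x"
  have "?z + of_real (1 / real (Suc n)) \<in> sector \<alpha>" for n
    by (rule closed_sector_shift[OF \<alpha> ray_closed_sector[OF \<alpha> x]]) simp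
  moreover have "(\<lambda>n. ?z + of_real (1 / real (Suc n))) \<longlonglongrightarrow> ?z + of_real 0"
    by (intro tendsto_intros LIMSEQ_Suc[OF lim_const_over_n])
  ultimately have "?z \<in> closure (sector \<alpha>)" unfolding closure_sequential by (intro exI[of _ "\<lambda>n. ?z + of_real (1 / real (Suc n))"]) simp
  moreover have "?z \<notin> sector \<alpha>"
  proof -
    have e: "?z * cis \<beta> = of_real x * cis (sign_val s * \<alpha> + \<beta>)" for \<beta>
      by (simp add: cis_mult[symmetric] mult_ac)
    show ?thesis unfolding sector_iff[OF \<alpha>] e by (cases s) simp_all
  qed
  ultimately show ?thesis using open_sector[OF \<alpha>] by (simp add: frontier_def interior_open)
qed

lemma Im_boundary_inv_pos:
  assumes \<alpha>: "0 < \<alpha>" "\<alpha> < pi / 2" and z: "z \<in> sector \<alpha>"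
  shows "Im (boundary_inv \<alpha> s z) > 0"
  using z unfolding sector_iff[OF \<alpha>] by (cases s) (simp_all add: boundary_inv_def mult.commute)

text \<open>The distance to the whole frontier is at most the distance to the foot of the
  perpendicular on this ray, which is the height Im w. Staying closer than x to the boundary point
  keeps the foot on the ray instead of its extension beyond the vertex.\<close>

lemma nontangential_region_stolz:
  assumes \<alpha>: "0 < \<alpha>" "\<alpha> < pi / 2" and x: "x > 0" and c: "c > 0"
    and z: "z \<in> nontangential_region \<alpha> c (cis (sign_val s * \<alpha>) * of_real x)"
    and near: "dist z (cis (sign_val s * \<alpha>) * of_real x) < x"
  shows "boundary_inv \<alpha> s z \<in> stolz c x"
proof -
  define w where "w = boundary_inv \<alpha> s z"
  have zw: "z = boundary_map \<alpha> s w" by (simp add: w_def)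
  have zs: "z \<in> sector \<alpha>" and zd: "dist z (cis (sign_val s * \<alpha>) * of_real x) < c * infdist z (frontier (sector \<alpha>))"
    using z by (auto simp: nontangential_region_def)
  have y: "Im w > 0" using Im_boundary_inv_pos[OF \<alpha> zs] by (simp add: w_def)
  have d: "dist z (cis (sign_val s * \<alpha>) * of_real x) = dist w (of_real x)"
    unfolding zw boundary_map_of_real[symmetric] by simp
  have "dist w (of_real x) < x" using near by (simp only: d)
  then have "\<bar>Re w - x\<bar> < x" using abs_Re_le_cmod[of "w - of_real x"] by (simp add: dist_norm)
  then have Rw: "Re w \<ge> 0" by linarith
  have "infdist z (frontier (sector \<alpha>)) \<le> dist z (cis (sign_val s * \<alpha>) * of_real (Re w))"
    by (rule infdist_le[OF ray_frontier_sector[OF \<alpha> Rw]])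
  also have "\<dots> = dist w (of_real (Re w))"
    unfolding zw boundary_map_of_real[symmetric] by simp
  also have "\<dots> = Im w"
  proof -
    have "w - of_real (Re w) = \<i> * of_real (Im w)" by (simp add: complex_eq_iff)
    then show ?thesis using y by (simp add: dist_norm norm_mult)
  qed
  finally have "c * infdist z (frontier (sector \<alpha>)) \<le> c * Im w" using c by simp
  then show ?thesis using zd unfolding d by (simp add: stolz_def w_def)
qed

text \<open>The shifted point is at distance \<eta> from its boundary point and at least \<eta> sin
  \<alpha> from the frontier, which accounts for the threshold 1 / sin \<alpha>.\<close>

lemma shifted_ray_in_nontangential_region:
  assumes \<alpha>: "0 < \<alpha>" "\<alpha> < pi / 2" and x: "x \<ge> 0" and \<eta>: "\<eta> > 0" and c: "c > 1 / sin \<alpha>"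
  shows "cis (sign_val s * \<alpha>) * of_real x + of_real \<eta> \<in> nontangential_region \<alpha> c (cis (sign_val s * \<alpha>) * of_real x)"
proof -
  let ?\<zeta> = "cis (sign_val s * \<alpha>) * of_real x"
  have sp: "sin \<alpha> > 0" using \<alpha> by (intro sin_gt_zero) auto
  have ne: "frontier (sector \<alpha>) \<noteq> {}" using ray_frontier_sector[OF \<alpha> x] by blast
  have "\<eta> * sin \<alpha> \<le> infdist (?\<zeta> + of_real \<eta>) (frontier (sector \<alpha>))"
    unfolding infdist_notempty[OF ne]
  proof (rule cINF_greatest[OF ne])
    fix w assume "w \<in> frontier (sector \<alpha>)"
    then have "w \<notin> sector \<alpha>" using open_sector[OF \<alpha>] by (simp add: frontier_def interior_open)
    then have "w \<notin> ball (?\<zeta> + of_real \<eta>) (\<eta> * sin \<alpha>)"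
      using closed_sector_shift_ball[OF \<alpha> ray_closed_sector[OF \<alpha> x] \<eta>] by blast
    then show "\<eta> * sin \<alpha> \<le> dist (?\<zeta> + of_real \<eta>) w" by simp
  qed
  then have "c * (\<eta> * sin \<alpha>) \<le> c * infdist (?\<zeta> + of_real \<eta>) (frontier (sector \<alpha>))"
  proof (rule mult_left_mono)
    have "0 < 1 / sin \<alpha>" using sp by simp
    with c show "0 \<le> c" by linarith
  qed
  moreover have "\<eta> < c * (\<eta> * sin \<alpha>)"
  proof -
    have "1 < c * sin \<alpha>" using c sp by (simp add: field_simps)
    from mult_strict_left_mono[OF this \<eta>] show ?thesis by (simp add: mult_ac)
  qed
  moreover have "dist (?\<zeta> + of_real \<eta>) ?\<zeta> = \<eta>" using \<eta> by (simp add: dist_norm)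
  ultimately show ?thesis
    using closed_sector_shift[OF \<alpha> ray_closed_sector[OF \<alpha> x] \<eta>] by (simp add: nontangential_region_def)
qed

lemma has_nontangential_limit_shift:
  assumes \<alpha>1: "0 < \<alpha>1" "\<alpha>1 < pi / 2" and \<alpha>2: "0 < \<alpha>2" "\<alpha>2 < pi / 2" and x: "x1 \<ge> 0" "x2 \<ge> 0"
    and L: "has_nontangential_limit \<alpha>1 \<alpha>2 f (cis (sign_val s1 * \<alpha>1) * of_real x1, cis (sign_val s2 * \<alpha>2) * of_real x2) L"
    and \<eta>: "\<And>n. \<eta> n > 0" "\<eta> \<longlonglongrightarrow> 0"
  shows "(\<lambda>n. f (cis (sign_val s1 * \<alpha>1) * of_real x1 + of_real (\<eta> n), cis (sign_val s2 * \<alpha>2) * of_real x2 + of_real (\<eta> n))) \<longlonglongrightarrow> L"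
proof -
  define \<zeta>1 \<zeta>2 where "\<zeta>1 = cis (sign_val s1 * \<alpha>1) * of_real x1" and "\<zeta>2 = cis (sign_val s2 * \<alpha>2) * of_real x2"
  \<comment> \<open>Above 1 and above both thresholds, so that one aperture serves for both
    variables.\<close>
  define c where "c = 1 / sin \<alpha>1 + 1 / sin \<alpha>2 + 1"
  have sp: "sin \<alpha>1 > 0" "sin \<alpha>2 > 0" using \<alpha>1 \<alpha>2 by (auto intro!: sin_gt_zero)
  have c: "c > 1" "c > 1 / sin \<alpha>1" "c > 1 / sin \<alpha>2" using sp by (auto simp: c_def intro!: add_pos_pos add_strict_increasing2)
  have "(f \<longlongrightarrow> L) (at (\<zeta>1, \<zeta>2) within (nontangential_region \<alpha>1 c \<zeta>1 \<times> nontangential_region \<alpha>2 c \<zeta>2))"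
    using L c(1) by (simp add: has_nontangential_limit_def \<zeta>1_def \<zeta>2_def)
  moreover have "filterlim (\<lambda>n. (\<zeta>1 + of_real (\<eta> n), \<zeta>2 + of_real (\<eta> n))) (at (\<zeta>1, \<zeta>2) within (nontangential_region \<alpha>1 c \<zeta>1 \<times> nontangential_region \<alpha>2 c \<zeta>2)) sequentially"
    unfolding filterlim_at
  proof
    show "\<forall>\<^sub>F n in sequentially. (\<zeta>1 + of_real (\<eta> n), \<zeta>2 + of_real (\<eta> n)) \<in> nontangential_region \<alpha>1 c \<zeta>1 \<times> nontangential_region \<alpha>2 c \<zeta>2 \<and>
        (\<zeta>1 + of_real (\<eta> n), \<zeta>2 + of_real (\<eta> n)) \<noteq> (\<zeta>1, \<zeta>2)"
    proof (intro always_eventually allI conjI SigmaI)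
      fix n
      show "\<zeta>1 + of_real (\<eta> n) \<in> nontangential_region \<alpha>1 c \<zeta>1" unfolding \<zeta>1_def
        by (rule shifted_ray_in_nontangential_region[OF \<alpha>1 x(1) \<eta>(1) c(2)])
      show "\<zeta>2 + of_real (\<eta> n) \<in> nontangential_region \<alpha>2 c \<zeta>2" unfolding \<zeta>2_def
        by (rule shifted_ray_in_nontangential_region[OF \<alpha>2 x(2) \<eta>(1) c(3)])
      show "(\<zeta>1 + of_real (\<eta> n), \<zeta>2 + of_real (\<eta> n)) \<noteq> (\<zeta>1, \<zeta>2)" using \<eta>(1)[of n] by simp
    qed
    have "(\<lambda>n. (\<zeta>1 + of_real (\<eta> n), \<zeta>2 + of_real (\<eta> n))) \<longlonglongrightarrow> (\<zeta>1 + of_real 0, \<zeta>2 + of_real 0)"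
      by (intro tendsto_intros \<eta>)
    then show "(\<lambda>n. (\<zeta>1 + of_real (\<eta> n), \<zeta>2 + of_real (\<eta> n))) \<longlonglongrightarrow> (\<zeta>1, \<zeta>2)" by simp
  qed
  ultimately show ?thesis unfolding \<zeta>1_def[symmetric] \<zeta>2_def[symmetric] by (rule filterlim_compose)
qed

text \<open>Uniqueness has to be proved before the definite description can be used: for large
  apertures the shifts run inside the approach regions, and two limits agree along them.\<close>

lemma boundary_value_eq:
  assumes \<alpha>1: "0 < \<alpha>1" "\<alpha>1 < pi / 2" and \<alpha>2: "0 < \<alpha>2" "\<alpha>2 < pi / 2" and x: "x1 \<ge> 0" "x2 \<ge> 0"
    and L: "has_nontangential_limit \<alpha>1 \<alpha>2 f (cis (sign_val s1 * \<alpha>1) * of_real x1, cis (sign_val s2 * \<alpha>2) * of_real x2) L"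
  shows "boundary_value \<alpha>1 \<alpha>2 f (cis (sign_val s1 * \<alpha>1) * of_real x1, cis (sign_val s2 * \<alpha>2) * of_real x2) = L"
  unfolding boundary_value_def
proof (rule the_equality[where P="has_nontangential_limit \<alpha>1 \<alpha>2 f (cis (sign_val s1 * \<alpha>1) * of_real x1, cis (sign_val s2 * \<alpha>2) * of_real x2)", OF L])
  fix L' assume L': "has_nontangential_limit \<alpha>1 \<alpha>2 f (cis (sign_val s1 * \<alpha>1) * of_real x1, cis (sign_val s2 * \<alpha>2) * of_real x2) L'"
  define \<eta> where "\<eta> = (\<lambda>n. 1 / real (Suc n))"
  have \<eta>: "\<And>n. \<eta> n > 0" "\<eta> \<longlonglongrightarrow> 0" unfolding \<eta>_def using LIMSEQ_Suc[OF lim_const_over_n[of 1]] by auto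
  from LIMSEQ_unique[OF has_nontangential_limit_shift[OF \<alpha>1 \<alpha>2 x L' \<eta>] has_nontangential_limit_shift[OF \<alpha>1 \<alpha>2 x L \<eta>]]
  show "L' = L" .
qed

section \<open>Transfer of Fatou's theorem from the half-plane to the sectors\<close>

lemma analytic2_on_imp_continuous_on: "analytic2_on f S \<Longrightarrow> continuous_on S f"
  unfolding analytic2_on_def continuous_on_eq_continuous_within by (blast intro: has_derivative_continuous)

lemma analytic2_on_imp_holomorphic_fst:
  assumes f: "analytic2_on f (S1 \<times> S2)" and z2: "z2 \<in> S2"
  shows "(\<lambda>z1. f (z1, z2)) holomorphic_on S1"
  unfolding holomorphic_on_def
proof
  fix z1 assume z1: "z1 \<in> S1"
  obtain a b where ab: "(f has_derivative (\<lambda>h. a * fst h + b * snd h)) (at (z1, z2) within S1 \<times> S2)"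
    using f z1 z2 unfolding analytic2_on_def by blast
  have "((\<lambda>z. (z, z2)) has_derivative (\<lambda>h. (h, 0))) (at z1 within S1)" by (auto intro!: derivative_eq_intros)
  moreover have "(f has_derivative (\<lambda>h. a * fst h + b * snd h)) (at (z1, z2) within (\<lambda>z. (z, z2)) ` S1)"
    by (rule has_derivative_subset[OF ab]) (use z2 in auto)
  ultimately have "((\<lambda>z. f (z, z2)) has_derivative (\<lambda>h. a * fst (h, 0 :: complex) + b * snd (h, 0 :: complex))) (at z1 within S1)"
    by (rule has_derivative_in_compose)
  then have "((\<lambda>z. f (z, z2)) has_field_derivative a) (at z1 within S1)" by (simp add: has_field_derivative_def)
  then show "(\<lambda>z1. f (z1, z2)) field_differentiable at z1 within S1" by (auto simp: field_differentiable_def)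
qed

lemma analytic2_on_imp_holomorphic_snd:
  assumes f: "analytic2_on f (S1 \<times> S2)" and z1: "z1 \<in> S1"
  shows "(\<lambda>z2. f (z1, z2)) holomorphic_on S2"
  unfolding holomorphic_on_def
proof
  fix z2 assume z2: "z2 \<in> S2"
  obtain a b where ab: "(f has_derivative (\<lambda>h. a * fst h + b * snd h)) (at (z1, z2) within S1 \<times> S2)"
    using f z1 z2 unfolding analytic2_on_def by blast
  have "((\<lambda>z. (z1, z)) has_derivative (\<lambda>h. (0, h))) (at z2 within S2)" by (auto intro!: derivative_eq_intros)
  moreover have "(f has_derivative (\<lambda>h. a * fst h + b * snd h)) (at (z1, z2) within (\<lambda>z. (z1, z)) ` S2)"
    by (rule has_derivative_subset[OF ab]) (use z1 in auto)
  ultimately have "((\<lambda>z. f (z1, z)) has_derivative (\<lambda>h. a * fst (0 :: complex, h) + b * snd (0 :: complex, h))) (at z2 within S2)"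
    by (rule has_derivative_in_compose)
  then have "((\<lambda>z. f (z1, z)) has_field_derivative b) (at z2 within S2)" by (simp add: has_field_derivative_def)
  then show "(\<lambda>z2. f (z1, z2)) field_differentiable at z2 within S2" by (auto simp: field_differentiable_def)
qed

lemma holomorphic_boundary_map_Neg:
  assumes h: "h holomorphic_on T" and S: "boundary_map \<alpha> Neg ` S \<subseteq> T"
  shows "(\<lambda>w. h (boundary_map \<alpha> Neg w)) holomorphic_on S"
proof -
  have "(boundary_map \<alpha> Neg) holomorphic_on S" unfolding boundary_map_def[abs_def] by (simp add: holomorphic_intros)
  from holomorphic_on_compose_gen[OF this h S] show ?thesis by (simp add: o_def)
qed

text \<open>For the upper ray the boundary map is a conjugation followed by a rotation; conjugating
  the values as well makes the composite holomorphic again.\<close>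

lemma holomorphic_boundary_map_Pos:
  assumes h: "h holomorphic_on T" and S: "boundary_map \<alpha> Pos ` S \<subseteq> T" "open S"
  shows "(\<lambda>w. cnj (h (boundary_map \<alpha> Pos w))) holomorphic_on S"
proof -
  have "(\<lambda>v. cis \<alpha> * v) holomorphic_on cnj ` S" by (intro holomorphic_intros)
  moreover have "(\<lambda>v. cis \<alpha> * v) ` (cnj ` S) \<subseteq> T" using S(1) by (auto simp: boundary_map_def)
  ultimately have "h \<circ> (\<lambda>v. cis \<alpha> * v) holomorphic_on cnj ` S" using h by (intro holomorphic_on_compose_gen)
  from holomorphic_on_compose_cnj_cnj[OF this S(2)] show ?thesis by (simp add: o_def boundary_map_def)
qed

lemma semiholomorphic_boundary_map:
  assumes h: "h holomorphic_on T" and S: "boundary_map \<alpha> s ` S \<subseteq> T" "open S"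
  shows "(\<lambda>w. h (boundary_map \<alpha> s w)) semiholomorphic_on S"
  using holomorphic_boundary_map_Pos[OF h] holomorphic_boundary_map_Neg[OF h] S
  unfolding semiholomorphic_on_def by (cases s) auto

text \<open>Over a compact piece of the rays the boundary maps carry rectangles into the sectors,
  and f is bounded there, so the two-variable theorem applies. Conversely, close to the boundary
  point the nontangential regions of the sectors are contained in images of Stolz regions.\<close>

lemma AE_nontangential_limit_local:
  assumes \<alpha>1: "0 < \<alpha>1" "\<alpha>1 < pi / 2" and \<alpha>2: "0 < \<alpha>2" "\<alpha>2 < pi / 2"
    and f: "analytic2_on f (sector \<alpha>1 \<times> sector \<alpha>2)" and fe: "finite_exp_type \<alpha>1 \<alpha>2 h1 h2 f"
    and h: "0 \<le> h1" "0 \<le> h2" and ab: "0 < a" "a < b"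
  shows "AE x2 in lborel. a < x2 \<and> x2 < b \<longrightarrow> (AE x1 in lborel. a < x1 \<and> x1 < b \<longrightarrow>
    (\<exists>L. has_nontangential_limit \<alpha>1 \<alpha>2 f (cis (sign_val s1 * \<alpha>1) * of_real x1, cis (sign_val s2 * \<alpha>2) * of_real x2) L))"
proof -
  \<comment> \<open>Half of a height below which a rectangle over [a, b] stays under the other
    boundary ray.\<close>
  define d where "d = (\<lambda>\<alpha>. a * sin (2 * \<alpha>) / 2)"
  \<comment> \<open>The truncation in modulus makes f bounded on the product of the two
    sets.\<close>
  define S where "S = (\<lambda>\<alpha> s. {w. boundary_map \<alpha> s w \<in> sector \<alpha> \<and> cmod w < b + d \<alpha> + 1})"
  have d0: "d \<alpha> > 0" if "0 < \<alpha>" "\<alpha> < pi / 2" for \<alpha>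
    using that ab by (auto simp: d_def intro!: mult_pos_pos sin_gt_zero)
  have So: "open (S \<alpha> s)" if "0 < \<alpha>" "\<alpha> < pi / 2" for \<alpha> s
  proof -
    have "open (boundary_map \<alpha> s -` sector \<alpha>)"
      by (intro open_vimage open_sector that continuous_on_boundary_map continuous_on_id)
    moreover have "open {w. cmod w < b + d \<alpha> + 1}" by (intro open_Collect_less continuous_intros)
    moreover have "S \<alpha> s = boundary_map \<alpha> s -` sector \<alpha> \<inter> {w. cmod w < b + d \<alpha> + 1}" by (auto simp: S_def)
    ultimately show ?thesis by (simp add: open_Int)
  qed
  have Sr: "Complex x y \<in> S \<alpha> s" if "0 < \<alpha>" "\<alpha> < pi / 2" "a \<le> x" "x \<le> b" "0 < y" "y \<le> d \<alpha>" for \<alpha> s x y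
  proof -
    have s2: "sin (2 * \<alpha>) > 0" using that by (intro sin_gt_zero) auto
    have "d \<alpha> < a * sin (2 * \<alpha>)" using s2 ab by (simp add: d_def)
    also have "\<dots> \<le> x * sin (2 * \<alpha>)" using s2 that by (intro mult_right_mono) auto
    finally have "boundary_map \<alpha> s (Complex x y) \<in> sector \<alpha>" using that by (intro boundary_map_sector) auto
    moreover have "cmod (Complex x y) \<le> \<bar>x\<bar> + \<bar>y\<bar>" using cmod_le[of "Complex x y"] by simp
    then have "cmod (Complex x y) < b + d \<alpha> + 1" using that ab by simp
    ultimately show ?thesis by (simp add: S_def)
  qed
  define S1 S2 where "S1 = S \<alpha>1 s1" and "S2 = S \<alpha>2 s2"
  have SS: "boundary_map \<alpha>1 s1 ` S1 \<subseteq> sector \<alpha>1" "boundary_map \<alpha>2 s2 ` S2 \<subseteq> sector \<alpha>2"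
    by (auto simp: S1_def S2_def S_def)
  have oS: "open S1" "open S2" using So[OF \<alpha>1, of s1] So[OF \<alpha>2, of s2] by (simp_all add: S1_def S2_def)
  define F where "F = (\<lambda>p. f (boundary_map \<alpha>1 s1 (fst p), boundary_map \<alpha>2 s2 (snd p)))"
  \<comment> \<open>Extended by zero, the function is Borel on the whole space, as the measurability
    arguments in two variables require.\<close>
  define g where "g = (\<lambda>p. indicator (S1 \<times> S2) p *\<^sub>R F p)"
  have gF: "g (w1, w2) = f (boundary_map \<alpha>1 s1 w1, boundary_map \<alpha>2 s2 w2)" if "w1 \<in> S1" "w2 \<in> S2" for w1 w2
    using that by (simp add: g_def F_def)
  have contF: "continuous_on (S1 \<times> S2) F"
    unfolding F_def
    by (rule continuous_on_compose2[OF analytic2_on_imp_continuous_on[OF f]]) (use SS in \<open>auto intro!: continuous_intros\<close>)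
  have gm: "g \<in> borel_measurable borel" unfolding g_def
    by (rule borel_measurable_continuous_on_indicator[OF _ contF]) (intro borel_open open_Times oS)
  obtain k where k: "k \<ge> 0" "\<And>z1 z2. z1 \<in> sector \<alpha>1 \<Longrightarrow> z2 \<in> sector \<alpha>2 \<Longrightarrow> cmod (f (z1, z2)) \<le> k * exp ((h1 + 1) * cmod z1 + (h2 + 1) * cmod z2)"
    using fe unfolding finite_exp_type_def by (meson zero_less_one)
  define M where "M = k * exp ((h1 + 1) * (b + d \<alpha>1 + 1) + (h2 + 1) * (b + d \<alpha>2 + 1))"
  have M: "norm (g (w1, w2)) \<le> M" if w: "w1 \<in> S1" "w2 \<in> S2" for w1 w2
  proof -
    have "cmod (f (boundary_map \<alpha>1 s1 w1, boundary_map \<alpha>2 s2 w2)) \<le> k * exp ((h1 + 1) * cmod w1 + (h2 + 1) * cmod w2)"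
      using k(2)[of "boundary_map \<alpha>1 s1 w1" "boundary_map \<alpha>2 s2 w2"] SS w by auto
    also have "\<dots> \<le> M" unfolding M_def
      by (intro mult_left_mono k iffD2[OF exp_le_cancel_iff] add_mono) (use w h in \<open>auto simp: S1_def S2_def S_def\<close>)
    finally show ?thesis using gF[OF w] by simp
  qed
  have g1: "(\<lambda>z1. g (z1, z2)) semiholomorphic_on S1" if z2: "z2 \<in> S2" for z2
  proof -
    have "boundary_map \<alpha>2 s2 z2 \<in> sector \<alpha>2" using SS z2 by blast
    from semiholomorphic_boundary_map[OF analytic2_on_imp_holomorphic_fst[OF f this] SS(1) oS(1)]
    have F1: "(\<lambda>w. f (boundary_map \<alpha>1 s1 w, boundary_map \<alpha>2 s2 z2)) semiholomorphic_on S1" .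
    have "(\<lambda>z1. g (z1, z2)) holomorphic_on S1 \<longleftrightarrow> (\<lambda>w. f (boundary_map \<alpha>1 s1 w, boundary_map \<alpha>2 s2 z2)) holomorphic_on S1"
      by (rule holomorphic_cong) (simp_all add: gF z2)
    moreover have "(\<lambda>z1. cnj (g (z1, z2))) holomorphic_on S1 \<longleftrightarrow> (\<lambda>w. cnj (f (boundary_map \<alpha>1 s1 w, boundary_map \<alpha>2 s2 z2))) holomorphic_on S1"
      by (rule holomorphic_cong) (simp_all add: gF z2)
    ultimately show ?thesis using F1 by (simp add: semiholomorphic_on_def)
  qed
  have g2: "(\<forall>z1\<in>S1. (\<lambda>z2. g (z1, z2)) holomorphic_on S2) \<or> (\<forall>z1\<in>S1. (\<lambda>z2. cnj (g (z1, z2))) holomorphic_on S2)"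
  proof (cases s2)
    case Pos
    have "(\<lambda>z2. cnj (g (z1, z2))) holomorphic_on S2" if z1: "z1 \<in> S1" for z1
    proof -
      have "boundary_map \<alpha>1 s1 z1 \<in> sector \<alpha>1" using SS z1 by blast
      from holomorphic_boundary_map_Pos[OF analytic2_on_imp_holomorphic_snd[OF f this] SS(2)[unfolded Pos] oS(2)]
      have F2: "(\<lambda>w. cnj (f (boundary_map \<alpha>1 s1 z1, boundary_map \<alpha>2 s2 w))) holomorphic_on S2" by (simp add: Pos)
      show ?thesis by (rule holomorphic_transform[OF F2]) (simp add: gF z1)
    qed
    then show ?thesis by blast
  next
    case Neg
    have "(\<lambda>z2. g (z1, z2)) holomorphic_on S2" if z1: "z1 \<in> S1" for z1
    proof -
      have "boundary_map \<alpha>1 s1 z1 \<in> sector \<alpha>1" using SS z1 by blast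
      from holomorphic_boundary_map_Neg[OF analytic2_on_imp_holomorphic_snd[OF f this] SS(2)[unfolded Neg]]
      have F2: "(\<lambda>w. f (boundary_map \<alpha>1 s1 z1, boundary_map \<alpha>2 s2 w)) holomorphic_on S2" by (simp add: Neg)
      show ?thesis by (rule holomorphic_transform[OF F2]) (simp add: gF z1)
    qed
    then show ?thesis by blast
  qed
  have "AE x2 in lborel. a < x2 \<and> x2 < b \<longrightarrow> (AE x1 in lborel. a < x1 \<and> x1 < b \<longrightarrow>
           (\<exists>L. \<forall>c>0. (g \<longlongrightarrow> L) (at (of_real x1, of_real x2) within stolz c x1 \<times> stolz c x2)))"
    by (rule Fatou_two_variables[OF ab(2) d0[OF \<alpha>1] ab(2) d0[OF \<alpha>2] oS(1) _ oS(2) _ gm M g1 g2])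
      (use Sr[OF \<alpha>1, of _ _ s1] Sr[OF \<alpha>2, of _ _ s2] in \<open>simp_all add: S1_def S2_def\<close>)
  then show ?thesis
  proof (eventually_elim, intro impI)
    fix x2 assume x2: "a < x2 \<and> x2 < b" and
      *: "a < x2 \<and> x2 < b \<longrightarrow> (AE x1 in lborel. a < x1 \<and> x1 < b \<longrightarrow>
           (\<exists>L. \<forall>c>0. (g \<longlongrightarrow> L) (at (of_real x1, of_real x2) within stolz c x1 \<times> stolz c x2)))"
    have "AE x1 in lborel. a < x1 \<and> x1 < b \<longrightarrow>
           (\<exists>L. \<forall>c>0. (g \<longlongrightarrow> L) (at (of_real x1, of_real x2) within stolz c x1 \<times> stolz c x2))" using * x2 by blast
    then show "AE x1 in lborel. a < x1 \<and> x1 < b \<longrightarrow>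
      (\<exists>L. has_nontangential_limit \<alpha>1 \<alpha>2 f (cis (sign_val s1 * \<alpha>1) * of_real x1, cis (sign_val s2 * \<alpha>2) * of_real x2) L)"
    proof (eventually_elim, intro impI)
      fix x1 assume x1: "a < x1 \<and> x1 < b" and
        **: "a < x1 \<and> x1 < b \<longrightarrow> (\<exists>L. \<forall>c>0. (g \<longlongrightarrow> L) (at (of_real x1, of_real x2) within stolz c x1 \<times> stolz c x2))"
      obtain L where L: "\<And>c. c > 0 \<Longrightarrow> (g \<longlongrightarrow> L) (at (of_real x1, of_real x2) within stolz c x1 \<times> stolz c x2)" using ** x1 by blast
      let ?\<zeta>1 = "cis (sign_val s1 * \<alpha>1) * of_real x1" and ?\<zeta>2 = "cis (sign_val s2 * \<alpha>2) * of_real x2"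
      have "(f \<longlongrightarrow> L) (at (?\<zeta>1, ?\<zeta>2) within (nontangential_region \<alpha>1 c ?\<zeta>1 \<times> nontangential_region \<alpha>2 c ?\<zeta>2))" if c: "c > 1" for c
      proof (rule tendstoI)
        fix r :: real assume r: "r > 0"
        have c0: "c > 0" using c by simp
        obtain \<delta> where \<delta>: "\<delta> > 0" and D: "\<And>w. w \<in> stolz c x1 \<times> stolz c x2 \<Longrightarrow> w \<noteq> (of_real x1, of_real x2) \<Longrightarrow> dist w (of_real x1, of_real x2) < \<delta> \<Longrightarrow> dist (g w) L < r"
          using tendstoD[OF L[OF c0] r] unfolding eventually_at by blast
        \<comment> \<open>Half of \<delta> passes from the coordinates to the product distance;
          \<open>x1\<close> and \<open>x2\<close> keep the feet of the perpendiculars on the rays; 1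
          keeps the points inside the truncation.\<close>
        define \<delta>' where "\<delta>' = min (\<delta> / 2) (min (min x1 x2) 1)"
        have \<delta>': "\<delta>' > 0" "2 * \<delta>' \<le> \<delta>" "\<delta>' \<le> x1" "\<delta>' \<le> x2" "\<delta>' \<le> 1" using \<delta> x1 x2 ab by (auto simp: \<delta>'_def)
        show "\<forall>\<^sub>F z in at (?\<zeta>1, ?\<zeta>2) within (nontangential_region \<alpha>1 c ?\<zeta>1 \<times> nontangential_region \<alpha>2 c ?\<zeta>2). dist (f z) L < r"
          unfolding eventually_at
        proof (intro exI[of _ \<delta>'] conjI ballI impI \<delta>'(1))
          fix z assume z: "z \<in> nontangential_region \<alpha>1 c ?\<zeta>1 \<times> nontangential_region \<alpha>2 c ?\<zeta>2" "z \<noteq> (?\<zeta>1, ?\<zeta>2) \<and> dist z (?\<zeta>1, ?\<zeta>2) < \<delta>'"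
          obtain z1 z2 where zz: "z = (z1, z2)" by (cases z)
          have zr: "z1 \<in> nontangential_region \<alpha>1 c ?\<zeta>1" "z2 \<in> nontangential_region \<alpha>2 c ?\<zeta>2" using z(1) by (auto simp: zz)
          have zd: "dist z1 ?\<zeta>1 < \<delta>'" "dist z2 ?\<zeta>2 < \<delta>'"
            using z(2) dist_fst_le[of z "(?\<zeta>1, ?\<zeta>2)"] dist_snd_le[of z "(?\<zeta>1, ?\<zeta>2)"] by (auto simp: zz)
          define w1 w2 where "w1 = boundary_inv \<alpha>1 s1 z1" and "w2 = boundary_inv \<alpha>2 s2 z2"
          have zw: "z1 = boundary_map \<alpha>1 s1 w1" "z2 = boundary_map \<alpha>2 s2 w2" by (simp_all add: w1_def w2_def)
          have w: "w1 \<in> stolz c x1" "w2 \<in> stolz c x2" unfolding w1_def w2_def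
            using zr zd \<delta>' x1 x2 ab c0
            by (intro nontangential_region_stolz[OF \<alpha>1] nontangential_region_stolz[OF \<alpha>2]; simp)+
          have wd: "dist w1 (of_real x1) < \<delta>'" "dist w2 (of_real x2) < \<delta>'"
            using zd unfolding zw boundary_map_of_real[symmetric] by simp_all
          have "dist (w1, w2) (of_real x1, of_real x2) \<le> dist w1 (of_real x1) + dist w2 (of_real x2)"
            unfolding dist_Pair_Pair by (rule sqrt_sum_squares_le_sum) auto
          then have dw: "dist (w1, w2) (of_real x1, of_real x2) < \<delta>" using wd \<delta>' by linarith
          have "w1 \<noteq> of_real x1" using stolz_Im_pos[OF w(1) c0] by auto
          then have gL: "dist (g (w1, w2)) L < r" using w dw by (intro D) auto
          have "cmod w1 < b + d \<alpha>1 + 1"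
            using wd(1) \<delta>' x1 d0[OF \<alpha>1] norm_triangle_sub[of w1 "of_real x1"] ab by (simp add: dist_norm)
          moreover have "cmod w2 < b + d \<alpha>2 + 1"
            using wd(2) \<delta>' x2 d0[OF \<alpha>2] norm_triangle_sub[of w2 "of_real x2"] ab by (simp add: dist_norm)
          moreover have "z1 \<in> sector \<alpha>1" "z2 \<in> sector \<alpha>2" using zr by (auto simp: nontangential_region_def)
          ultimately have "w1 \<in> S1" "w2 \<in> S2" by (auto simp: S1_def S2_def S_def zw)
          then show "dist (f z) L < r" using gL gF[of w1 w2] by (simp add: zz zw)
        qed
      qed
      then show "\<exists>L. has_nontangential_limit \<alpha>1 \<alpha>2 f (?\<zeta>1, ?\<zeta>2) L" unfolding has_nontangential_limit_def by auto
    qed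
  qed
qed

text \<open>The intervals from 1/(n + 1) to n + 2 are nonempty and exhaust the positive axis; the
  same n can be taken for both variables.\<close>

lemma AE_nontangential_limit:
  assumes \<alpha>1: "0 < \<alpha>1" "\<alpha>1 < pi / 2" and \<alpha>2: "0 < \<alpha>2" "\<alpha>2 < pi / 2"
    and f: "analytic2_on f (sector \<alpha>1 \<times> sector \<alpha>2)" and fe: "finite_exp_type \<alpha>1 \<alpha>2 h1 h2 f"
    and h: "0 \<le> h1" "0 \<le> h2"
  shows "AE x2 in lborel. AE x1 in lborel. 0 < x1 \<and> 0 < x2 \<longrightarrow>
    (\<exists>L. has_nontangential_limit \<alpha>1 \<alpha>2 f (cis (sign_val s1 * \<alpha>1) * of_real x1, cis (sign_val s2 * \<alpha>2) * of_real x2) L)"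
proof -
  let ?P = "\<lambda>x1 x2. \<exists>L. has_nontangential_limit \<alpha>1 \<alpha>2 f (cis (sign_val s1 * \<alpha>1) * of_real x1, cis (sign_val s2 * \<alpha>2) * of_real x2) L"
  have "AE x2 in lborel. \<forall>n. 1 / real (Suc n) < x2 \<and> x2 < real n + 2 \<longrightarrow> (AE x1 in lborel. 1 / real (Suc n) < x1 \<and> x1 < real n + 2 \<longrightarrow> ?P x1 x2)"
    unfolding AE_all_countable
  proof
    fix n
    have "1 / real (Suc n) \<le> 1" by simp
    then have "1 / real (Suc n) < real n + 2" by linarith
    then show "AE x2 in lborel. 1 / real (Suc n) < x2 \<and> x2 < real n + 2 \<longrightarrow> (AE x1 in lborel. 1 / real (Suc n) < x1 \<and> x1 < real n + 2 \<longrightarrow> ?P x1 x2)"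
      by (intro AE_nontangential_limit_local[OF \<alpha>1 \<alpha>2 f fe h]) auto
  qed
  then show ?thesis
  proof eventually_elim
    case (elim x2)
    have "AE x1 in lborel. \<forall>n. 1 / real (Suc n) < x2 \<and> x2 < real n + 2 \<longrightarrow> 1 / real (Suc n) < x1 \<and> x1 < real n + 2 \<longrightarrow> ?P x1 x2"
      unfolding AE_all_countable
    proof
      fix n
      show "AE x1 in lborel. 1 / real (Suc n) < x2 \<and> x2 < real n + 2 \<longrightarrow> 1 / real (Suc n) < x1 \<and> x1 < real n + 2 \<longrightarrow> ?P x1 x2"
        using elim[rule_format, of n] by (cases "1 / real (Suc n) < x2 \<and> x2 < real n + 2") auto
    qed
    then show ?case
    proof (eventually_elim, intro impI)
      fix x1 assume *: "\<forall>n. 1 / real (Suc n) < x2 \<and> x2 < real n + 2 \<longrightarrow> 1 / real (Suc n) < x1 \<and> x1 < real n + 2 \<longrightarrow> ?P x1 x2"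
        and x: "0 < x1 \<and> 0 < x2"
      have m: "min x1 x2 > 0" using x by simp
      obtain n1 where n1: "1 / real (Suc n1) < min x1 x2" using nat_approx_posE[OF m] by blast
      obtain n2 :: nat where n2: "max x1 x2 \<le> real n2" using real_arch_simple by blast
      define n where "n = max n1 n2"
      have "1 / real (Suc n) \<le> 1 / real (Suc n1)" by (simp add: n_def frac_le)
      moreover have "real n2 \<le> real n" by (simp add: n_def)
      ultimately show "?P x1 x2" using *[rule_format, of n] n1 n2 by simp
    qed
  qed
qed

subsection \<open>Cauchy integrals and Laplace inversion on a sector\<close>

lemma set_integrable_exp_neg:
  fixes c :: real
  assumes "c > 0"
  shows "set_integrable lborel {0..} (\<lambda>t. exp (- c * t))"
proof -
  have lim: "((\<lambda>t. - exp (- c * t) / c) \<longlongrightarrow> 0) at_top"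
  proof -
    have "filterlim (\<lambda>t. - c * t) at_bot at_top"
      using assms by (intro filterlim_tendsto_neg_mult_at_bot[OF tendsto_const _ filterlim_ident]) auto
    then have "((\<lambda>t. exp (- c * t)) \<longlongrightarrow> 0) at_top" by (rule filterlim_compose[OF exp_at_bot])
    then have "((\<lambda>t. - exp (- c * t) / c) \<longlongrightarrow> - 0 / c) at_top" using assms by (intro tendsto_intros) auto
    then show ?thesis by simp
  qed
  have "(\<integral>\<^sup>+t. ennreal (exp (- c * t)) * indicator {0..} t \<partial>lborel) = ennreal (0 - (- exp (- c * 0) / c))"
    by (rule nn_integral_FTC_atLeast[OF _ _ _ lim]) (use assms in \<open>auto intro!: derivative_eq_intros\<close>)
  then have "(\<integral>\<^sup>+t. ennreal (indicator {0..} t *\<^sub>R exp (- c * t)) \<partial>lborel) < \<infinity>"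
    by (simp add: mult.commute ennreal_mult'' ennreal_indicator)
  then show ?thesis unfolding set_integrable_def by (intro integrableI_nonneg) auto
qed

lemma set_integrable_exp_bound:
  fixes f :: "real \<Rightarrow> complex"
  assumes c: "c > 0" and f: "continuous_on {0..} f" and b: "\<And>t. t \<ge> 0 \<Longrightarrow> norm (f t) \<le> K * exp (- c * t)"
  shows "set_integrable lborel {0..} f"
  unfolding set_integrable_def
proof (rule Bochner_Integration.integrable_bound)
  show "integrable lborel (\<lambda>t. K * (indicator {0..} t *\<^sub>R exp (- c * t)))"
    using set_integrable_exp_neg[OF c] unfolding set_integrable_def by (rule integrable_mult_right)
  show "(\<lambda>t. indicator {0..} t *\<^sub>R f t) \<in> borel_measurable lborel"
    using borel_measurable_continuous_on_indicator[OF _ f] by simp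
  show "AE t in lborel. norm (indicator {0..} t *\<^sub>R f t) \<le> norm (K * (indicator {0..} t *\<^sub>R exp (- c * t)))"
    using b order_trans[OF b abs_ge_self] by (auto simp: indicator_def)
qed

lemma tendsto_integral_Icc_at_top:
  fixes f :: "real \<Rightarrow> complex"
  assumes f: "set_integrable lborel {0..} f"
  shows "((\<lambda>R. integral {0..R} f) \<longlongrightarrow> (LINT t:{0..}|lborel. f t)) at_top"
proof -
  have "((\<lambda>R. LINT t|lborel. indicator {..R} t *\<^sub>R (indicator {0..} t *\<^sub>R f t)) \<longlongrightarrow> (LINT t|lborel. indicator {0..} t *\<^sub>R f t)) at_top"
    using f by (intro tendsto_integral_at_top) (auto simp: set_integrable_def)
  moreover have "(LINT t|lborel. indicator {..R} t *\<^sub>R (indicator {0..} t *\<^sub>R f t)) = integral {0..R} f" for R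
  proof -
    have "set_integrable lborel {0..R} f" by (rule set_integrable_subset[OF f]) auto
    from set_borel_integral_eq_integral(2)[OF this]
    have "integral {0..R} f = (LINT t|lborel. indicator {0..R} t *\<^sub>R f t)" by (simp add: set_lebesgue_integral_def)
    also have "\<dots> = (LINT t|lborel. indicator {..R} t *\<^sub>R (indicator {0..} t *\<^sub>R f t))"
      by (rule Bochner_Integration.integral_cong) (auto simp: indicator_def)
    finally show ?thesis by simp
  qed
  ultimately show ?thesis by (simp add: set_lebesgue_integral_def)
qed

lemma LINT_exp_half_line:
  assumes \<beta>: "Re \<beta> < 0"
  shows "set_integrable lborel {0..} (\<lambda>t. exp (\<beta> * of_real t))" "(LINT t:{0..}|lborel. exp (\<beta> * of_real t)) = - 1 / \<beta>"
proof -
  show i: "set_integrable lborel {0..} (\<lambda>t. exp (\<beta> * of_real t))"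
    by (rule set_integrable_exp_bound[where c="- Re \<beta>" and K=1]) (use \<beta> in \<open>auto intro!: continuous_intros\<close>)
  have \<beta>0: "\<beta> \<noteq> 0" using \<beta> by auto
  have J: "integral {0..R} (\<lambda>t. exp (\<beta> * of_real t)) = exp (\<beta> * of_real R) / \<beta> - 1 / \<beta>" if "R \<ge> 0" for R
  proof (rule integral_unique)
    have "((\<lambda>t. exp (\<beta> * of_real t)) has_integral exp (\<beta> * of_real R) / \<beta> - exp (\<beta> * of_real 0) / \<beta>) {0..R}"
    proof (rule fundamental_theorem_of_calculus[OF that])
      fix t assume "t \<in> {0..R}"
      have "((\<lambda>z. exp (\<beta> * z) / \<beta>) has_field_derivative exp (\<beta> * of_real t)) (at (of_real t))"
        using \<beta>0 by (auto intro!: derivative_eq_intros)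
      from has_vector_derivative_real_field[OF this]
      show "((\<lambda>t. exp (\<beta> * of_real t) / \<beta>) has_vector_derivative exp (\<beta> * of_real t)) (at t within {0..R})"
        by (rule has_vector_derivative_at_within)
    qed
    then show "((\<lambda>t. exp (\<beta> * of_real t)) has_integral exp (\<beta> * of_real R) / \<beta> - 1 / \<beta>) {0..R}" by simp
  qed
  have ev: "\<forall>\<^sub>F R in at_top. exp (\<beta> * of_real R) / \<beta> - 1 / \<beta> = integral {0..R} (\<lambda>t. exp (\<beta> * of_real t))"
    using eventually_ge_at_top[of "0::real"] by eventually_elim (simp add: J)
  have "((\<lambda>R. exp (\<beta> * of_real R)) \<longlongrightarrow> 0) at_top"
  proof (rule Lim_null_comparison)
    show "\<forall>\<^sub>F R in at_top. norm (exp (\<beta> * of_real R)) \<le> exp (Re \<beta> * R)" by simp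
    have "filterlim (\<lambda>t. Re \<beta> * t) at_bot at_top"
      using \<beta> by (intro filterlim_tendsto_neg_mult_at_bot[OF tendsto_const _ filterlim_ident]) auto
    then show "((\<lambda>t. exp (Re \<beta> * t)) \<longlongrightarrow> 0) at_top" by (rule filterlim_compose[OF exp_at_bot])
  qed
  then have "((\<lambda>R. exp (\<beta> * of_real R) / \<beta> - 1 / \<beta>) \<longlongrightarrow> 0 / \<beta> - 1 / \<beta>) at_top" using \<beta>0 by (intro tendsto_intros)
  then have "((\<lambda>R. exp (\<beta> * of_real R) / \<beta> - 1 / \<beta>) \<longlongrightarrow> - 1 / \<beta>) at_top" by simp
  from tendsto_unique[OF _ tendsto_integral_Icc_at_top[OF i] Lim_transform_eventually[OF this ev]]
  show "(LINT t:{0..}|lborel. exp (\<beta> * of_real t)) = - 1 / \<beta>" by simp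
qed

text \<open>The closed sector is the convex cone spanned by its boundary rays; the coefficients are
  the two defining linear forms divided by sin (2 \<alpha>).\<close>

lemma closed_sector_decomp:
  assumes \<alpha>: "0 < \<alpha>" "\<alpha> < pi / 2" and z: "z \<in> closed_sector \<alpha>"
  obtains s t where "s \<ge> 0" "t \<ge> 0" "z = of_real s * cis \<alpha> + of_real t * cis (- \<alpha>)"
    "(s + t) * cos \<alpha> = Re z" "(s - t) * sin \<alpha> = Im z"
proof -
  have sp: "sin \<alpha> > 0" "cos \<alpha> > 0" using \<alpha> by (auto intro!: sin_gt_zero cos_gt_zero)
  define S where "S = 2 * sin \<alpha> * cos \<alpha>"
  have S: "S > 0" using sp by (simp add: S_def)
  define s t where "s = Im (z * cis \<alpha>) / S" and "t = - Im (z * cis (- \<alpha>)) / S"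
  have st: "s \<ge> 0" "t \<ge> 0" using z S by (auto simp: s_def t_def closed_sector_def)
  have e: "(s + t) * S = 2 * Re z * sin \<alpha>" "(s - t) * S = 2 * Im z * cos \<alpha>"
    using S by (simp_all add: s_def t_def add_divide_distrib[symmetric] diff_divide_distrib[symmetric])
  have 1: "(s + t) * cos \<alpha> = Re z" "(s - t) * sin \<alpha> = Im z"
    using e sp by (simp_all add: S_def)
  have "z = of_real s * cis \<alpha> + of_real t * cis (- \<alpha>)"
    using 1 by (simp add: complex_eq_iff algebra_simps)
  with st 1 show ?thesis using that by blast
qed

text \<open>A linear form on a cone is controlled by its values on the extreme rays, and the
  coefficients of z add up to at least |z|. Decay on the two rays is therefore decay on the
  sector.\<close>

lemma closed_sector_Re_le:
  assumes \<alpha>: "0 < \<alpha>" "\<alpha> < pi / 2" and z: "z \<in> closed_sector \<alpha>"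
    and w: "\<And>s. Re (\<omega> * cis (sign_val s * \<alpha>)) \<le> - c" and c: "c \<ge> 0"
  shows "Re (\<omega> * z) \<le> - c * cmod z"
proof -
  obtain s t where st: "s \<ge> 0" "t \<ge> 0" and zz: "z = of_real s * cis \<alpha> + of_real t * cis (- \<alpha>)"
    using closed_sector_decomp[OF \<alpha> z] by metis
  have "cmod z \<le> cmod (of_real s * cis \<alpha>) + cmod (of_real t * cis (- \<alpha>))" unfolding zz by (rule norm_triangle_ineq)
  then have zn: "cmod z \<le> s + t" using st by (simp add: norm_mult)
  have "\<omega> * z = of_real s * (\<omega> * cis \<alpha>) + of_real t * (\<omega> * cis (- \<alpha>))" by (simp add: zz algebra_simps)
  then have "Re (\<omega> * z) = s * Re (\<omega> * cis \<alpha>) + t * Re (\<omega> * cis (- \<alpha>))" by simp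
  also have "\<dots> \<le> s * (- c) + t * (- c)"
    using st w[of Pos] w[of Neg] by (intro add_mono mult_left_mono) auto
  also have "\<dots> = - c * (s + t)" by (simp add: algebra_simps)
  also have "\<dots> \<le> - c * cmod z" using zn c by (simp add: mult_left_mono)
  finally show ?thesis .
qed

section \<open>Cauchy's theorem and formula on an unbounded sector\<close>

lemma convex_closed_sector: "convex (closed_sector \<alpha>)"
  unfolding closed_sector_def convex_def
proof (intro ballI allI impI, clarify)
  fix x y :: complex and u v :: real
  assume "0 \<le> Im (x * cis \<alpha>)" "Im (x * cis (- \<alpha>)) \<le> 0" "0 \<le> Im (y * cis \<alpha>)" "Im (y * cis (- \<alpha>)) \<le> 0" "0 \<le> u" "0 \<le> v"
  note * = this
  have eq: "Im ((u *\<^sub>R x + v *\<^sub>R y) * cis \<beta>) = u * Im (x * cis \<beta>) + v * Im (y * cis \<beta>)" for \<beta>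
    by (simp add: algebra_simps)
  show "0 \<le> Im ((u *\<^sub>R x + v *\<^sub>R y) * cis \<alpha>) \<and> Im ((u *\<^sub>R x + v *\<^sub>R y) * cis (- \<alpha>)) \<le> 0"
    unfolding eq by (intro conjI add_nonneg_nonneg add_nonpos_nonpos mult_nonneg_nonneg mult_nonneg_nonpos *)
qed

lemma interior_closed_sector:
  assumes \<alpha>: "0 < \<alpha>" "\<alpha> < pi / 2"
  shows "interior (closed_sector \<alpha>) = sector \<alpha>"
proof
  show "interior (closed_sector \<alpha>) \<subseteq> sector \<alpha>"
  proof
    fix x assume "x \<in> interior (closed_sector \<alpha>)"
    then obtain e where e: "e > 0" "ball x e \<subseteq> closed_sector \<alpha>" unfolding mem_interior by blast
    have "x - of_real (e / 2) \<in> ball x e" using e(1) by (simp add: dist_norm)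
    then have "x - of_real (e / 2) \<in> closed_sector \<alpha>" using e(2) by blast
    then have "x - of_real (e / 2) + of_real (e / 2) \<in> sector \<alpha>" by (rule closed_sector_shift[OF \<alpha>]) (use e in simp)
    then show "x \<in> sector \<alpha>" by simp
  qed
  show "sector \<alpha> \<subseteq> interior (closed_sector \<alpha>)"
    by (rule interior_maximal[OF sector_subset_closed_sector[OF \<alpha>] open_sector[OF \<alpha>]])
qed

text \<open>The counterclockwise boundary of the truncated sector, with the chord in place of the
  arc: it consists of segments in a convex set, and the real part is constant on the chord.\<close>

definition sector_triangle :: "real \<Rightarrow> real \<Rightarrow> real \<Rightarrow> complex" where
  "sector_triangle \<alpha> R = linepath 0 (cis (- \<alpha>) * of_real R) +++ linepath (cis (- \<alpha>) * of_real R) (cis \<alpha> * of_real R) +++ linepath (cis \<alpha> * of_real R) 0"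

lemma chord_sector:
  assumes \<alpha>: "0 < \<alpha>" "\<alpha> < pi / 2" and R: "R \<ge> 0"
    and w: "w \<in> closed_segment (cis (- \<alpha>) * of_real R) (cis \<alpha> * of_real R)"
  shows "w \<in> closed_sector \<alpha>" "Re w = R * cos \<alpha>" "cmod w \<ge> R * cos \<alpha>"
proof -
  have ends: "cis (- \<alpha>) * of_real R \<in> closed_sector \<alpha>" "cis \<alpha> * of_real R \<in> closed_sector \<alpha>"
    using ray_closed_sector[OF \<alpha> R, of Neg] ray_closed_sector[OF \<alpha> R, of Pos] by simp_all
  show "w \<in> closed_sector \<alpha>"
    using closed_segment_subset[OF ends convex_closed_sector] w by blast
  obtain u where wu: "w = (1 - u) *\<^sub>R (cis (- \<alpha>) * of_real R) + u *\<^sub>R (cis \<alpha> * of_real R)" using w by (auto simp: in_segment)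
  show Re: "Re w = R * cos \<alpha>" unfolding wu by (simp add: algebra_simps del: scaleR_collapse)
  show "cmod w \<ge> R * cos \<alpha>" using complex_Re_le_cmod[of w] Re by simp
qed

text \<open>The chord has length at most 2 R and carries an integrand of order exp (- c R cos
  \<alpha>), so only the rays remain in the limit. Continuity and bounds are required on the rays
  and on far chords separately because the integrand may have a pole inside the sector.\<close>

lemma sector_triangle_limit:
  assumes \<alpha>: "0 < \<alpha>" "\<alpha> < pi / 2" and c: "c > 0"
    and Fs: "\<And>s. continuous_on {0..} (\<lambda>t. F (cis (sign_val s * \<alpha>) * of_real t))"
    and Fc: "\<And>R. R \<ge> Rm \<Longrightarrow> continuous_on (closed_segment (cis (- \<alpha>) * of_real R) (cis \<alpha> * of_real R)) F"
    and b: "\<And>s t. t \<ge> 0 \<Longrightarrow> cmod (F (cis (sign_val s * \<alpha>) * of_real t)) \<le> K * exp (- c * t)"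
    and bc: "\<And>w R. R \<ge> Rm \<Longrightarrow> w \<in> closed_segment (cis (- \<alpha>) * of_real R) (cis \<alpha> * of_real R) \<Longrightarrow> cmod (F w) \<le> K * exp (- c * cmod w)"
    and I: "\<And>R. R \<ge> Rm \<Longrightarrow> (F has_contour_integral I) (sector_triangle \<alpha> R)"
  shows "I = (LINT t:{0..}|lborel. F (cis (- \<alpha>) * of_real t) * cis (- \<alpha>)) - (LINT t:{0..}|lborel. F (cis \<alpha> * of_real t) * cis \<alpha>)"
proof -
  have sp: "cos \<alpha> > 0" using \<alpha> by (auto intro!: cos_gt_zero)
  have K0: "K \<ge> 0" using order_trans[OF norm_ge_zero b[of 0 Pos]] by simp
  have si: "set_integrable lborel {0..} (\<lambda>t. F (cis (sign_val s * \<alpha>) * of_real t) * cis (sign_val s * \<alpha>))" for s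
    by (rule set_integrable_exp_bound[OF c, of _ K]) (use Fs b in \<open>auto intro!: continuous_intros simp: norm_mult\<close>)
  have lim: "((\<lambda>R. integral {0..R} (\<lambda>t. F (cis (sign_val s * \<alpha>) * of_real t) * cis (sign_val s * \<alpha>))) \<longlongrightarrow>
     (LINT t:{0..}|lborel. F (cis (sign_val s * \<alpha>) * of_real t) * cis (sign_val s * \<alpha>))) at_top" for s
    by (rule tendsto_integral_Icc_at_top[OF si])
  define J where "J = (\<lambda>s R. integral {0..R} (\<lambda>t. F (cis (sign_val s * \<alpha>) * of_real t) * cis (sign_val s * \<alpha>)))"
  define E where "E = (\<lambda>R. I - J Neg R + J Pos R)"
  have Eb: "norm (E R) \<le> K * exp (- c * (R * cos \<alpha>)) * (2 * R)" if R: "R \<ge> Rm" "R > 0" for R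
  proof -
    define a b where "a = cis (- \<alpha>) * complex_of_real R" and "b = cis \<alpha> * complex_of_real R"
    have ray: "(F has_contour_integral J s R) (linepath 0 (cis (sign_val s * \<alpha>) * of_real R))" for s
    proof -
      have "((\<lambda>t. F (0 + cis (sign_val s * \<alpha>) * of_real t) * cis (sign_val s * \<alpha>)) has_integral J s R) {0..R}"
        unfolding J_def add_0_left
        by (intro integrable_integral integrable_continuous_interval continuous_intros continuous_on_subset[OF Fs]) simp
      from has_contour_integral_linepath_affine[THEN iffD2, OF R(2) this] show ?thesis by simp
    qed
    have r1: "(F has_contour_integral J Neg R) (linepath 0 a)" using ray[of Neg] by (simp add: a_def)
    have r3: "(F has_contour_integral - J Pos R) (linepath b 0)"
      using has_contour_integral_reversepath[OF _ ray[of Pos]] by (simp add: b_def)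
    have "F contour_integrable_on linepath a b"
      unfolding a_def b_def by (intro contour_integrable_continuous_linepath Fc R)
    then have r2: "(F has_contour_integral contour_integral (linepath a b) F) (linepath a b)" by (rule has_contour_integral_integral)
    have "(F has_contour_integral (J Neg R + (contour_integral (linepath a b) F + - J Pos R))) (sector_triangle \<alpha> R)"
      unfolding sector_triangle_def a_def[symmetric] b_def[symmetric]
      by (intro has_contour_integral_join r1 r2 r3) auto
    from contour_integral_unique[OF this] contour_integral_unique[OF I[OF R(1)]]
    have "E R = contour_integral (linepath a b) F" by (simp add: E_def)
    moreover have "norm (contour_integral (linepath a b) F) \<le> K * exp (- c * (R * cos \<alpha>)) * norm (b - a)"
    proof (rule has_contour_integral_bound_linepath[OF r2])
      fix w assume w: "w \<in> closed_segment a b"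
      have "cmod (F w) \<le> K * exp (- c * cmod w)" using bc[OF R(1)] w by (simp add: a_def b_def)
      also have "\<dots> \<le> K * exp (- c * (R * cos \<alpha>))"
      proof -
        have "- c * cmod w \<le> - c * (R * cos \<alpha>)"
          using mult_left_mono[OF chord_sector(3)[OF \<alpha> _ w[unfolded a_def b_def]], of c] R c by simp
        then show ?thesis using K0 by (intro mult_left_mono) auto
      qed
      finally show "cmod (F w) \<le> K * exp (- c * (R * cos \<alpha>))" .
    qed (use K0 in auto)
    moreover have "norm (b - a) \<le> 2 * R"
      using norm_triangle_ineq4[of b a] R by (simp add: a_def b_def norm_mult)
    then have "K * exp (- c * (R * cos \<alpha>)) * norm (b - a) \<le> K * exp (- c * (R * cos \<alpha>)) * (2 * R)"
      using K0 by (intro mult_left_mono) auto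
    ultimately show ?thesis by simp
  qed
  have "(E \<longlongrightarrow> 0) at_top"
  proof (rule Lim_null_comparison)
    show "\<forall>\<^sub>F R in at_top. norm (E R) \<le> 2 * K * (R / exp (c * cos \<alpha> * R))"
      using eventually_ge_at_top[of Rm] eventually_gt_at_top[of 0]
      by eventually_elim (use Eb in \<open>simp add: exp_minus field_simps\<close>)
    have "((\<lambda>R. R ^ 1 / exp R) \<longlongrightarrow> (0::real)) at_top" by (rule tendsto_power_div_exp_0)
    moreover have "filterlim (\<lambda>R. c * cos \<alpha> * R) at_top at_top"
      using c sp by (intro filterlim_tendsto_pos_mult_at_top[OF tendsto_const _ filterlim_ident]) auto
    ultimately have "((\<lambda>R. (c * cos \<alpha> * R) ^ 1 / exp (c * cos \<alpha> * R)) \<longlongrightarrow> 0) at_top" by (rule filterlim_compose)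
    then have "((\<lambda>R. 2 * K / (c * cos \<alpha>) * ((c * cos \<alpha> * R) ^ 1 / exp (c * cos \<alpha> * R))) \<longlongrightarrow> 2 * K / (c * cos \<alpha>) * 0) at_top"
      by (intro tendsto_intros)
    then show "((\<lambda>R. 2 * K * (R / exp (c * cos \<alpha> * R))) \<longlongrightarrow> 0) at_top" using c sp by (simp add: mult.assoc)
  qed
  moreover have "(E \<longlongrightarrow> I - (LINT t:{0..}|lborel. F (cis (sign_val Neg * \<alpha>) * of_real t) * cis (sign_val Neg * \<alpha>))
      + (LINT t:{0..}|lborel. F (cis (sign_val Pos * \<alpha>) * of_real t) * cis (sign_val Pos * \<alpha>))) at_top"
    unfolding E_def J_def by (intro tendsto_intros lim)
  ultimately have "I - (LINT t:{0..}|lborel. F (cis (sign_val Neg * \<alpha>) * of_real t) * cis (sign_val Neg * \<alpha>))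
      + (LINT t:{0..}|lborel. F (cis (sign_val Pos * \<alpha>) * of_real t) * cis (sign_val Pos * \<alpha>)) = 0"
    using tendsto_unique[OF trivial_limit_at_top_linorder] by blast
  then show ?thesis by (simp add: algebra_simps)
qed

lemma sector_triangle_subset:
  assumes \<alpha>: "0 < \<alpha>" "\<alpha> < pi / 2" and R: "R \<ge> 0"
  shows "path_image (sector_triangle \<alpha> R) \<subseteq> closed_sector \<alpha>"
proof -
  have ends: "0 \<in> closed_sector \<alpha>" "cis (- \<alpha>) * of_real R \<in> closed_sector \<alpha>" "cis \<alpha> * of_real R \<in> closed_sector \<alpha>"
    using ray_closed_sector[OF \<alpha> R, of Neg] ray_closed_sector[OF \<alpha> R, of Pos] ray_closed_sector[OF \<alpha> order_refl, of Pos] by simp_all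
  show ?thesis unfolding sector_triangle_def
    using closed_segment_subset[OF _ _ convex_closed_sector] ends by (simp add: path_image_join)
qed

lemma ray_integrals_agree:
  assumes \<alpha>: "0 < \<alpha>" "\<alpha> < pi / 2" and c: "c > 0"
    and cont: "continuous_on (closed_sector \<alpha>) F" and hol: "F holomorphic_on sector \<alpha>"
    and b: "\<And>w. w \<in> closed_sector \<alpha> \<Longrightarrow> cmod (F w) \<le> K * exp (- c * cmod w)"
  shows "(LINT t:{0..}|lborel. F (cis (sign_val s * \<alpha>) * of_real t) * cis (sign_val s * \<alpha>)) =
         (LINT t:{0..}|lborel. F (cis (sign_val s' * \<alpha>) * of_real t) * cis (sign_val s' * \<alpha>))"
proof -
  have "0 = (LINT t:{0..}|lborel. F (cis (- \<alpha>) * of_real t) * cis (- \<alpha>)) - (LINT t:{0..}|lborel. F (cis \<alpha> * of_real t) * cis \<alpha>)"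
  proof (rule sector_triangle_limit[OF \<alpha> c, where Rm=0 and K=K])
    show "continuous_on {0..} (\<lambda>t. F (cis (sign_val s * \<alpha>) * of_real t))" for s
      by (rule continuous_on_compose2[OF cont]) (use ray_closed_sector[OF \<alpha>, of _ s] in \<open>auto intro!: continuous_intros\<close>)
    show "continuous_on (closed_segment (cis (- \<alpha>) * of_real R) (cis \<alpha> * of_real R)) F" if "0 \<le> R" for R
      using chord_sector(1)[OF \<alpha> that] by (intro continuous_on_subset[OF cont]) blast
    show "cmod (F (cis (sign_val s * \<alpha>) * of_real t)) \<le> K * exp (- c * t)" if "t \<ge> 0" for s t
      using b[OF ray_closed_sector[OF \<alpha> that, of s]] that by (simp add: norm_mult)
    show "cmod (F w) \<le> K * exp (- c * cmod w)" if "0 \<le> R" "w \<in> closed_segment (cis (- \<alpha>) * of_real R) (cis \<alpha> * of_real R)" for w R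
      by (rule b[OF chord_sector(1)[OF \<alpha> that]])
    show "(F has_contour_integral 0) (sector_triangle \<alpha> R)" if "0 \<le> R" for R
    proof (rule Cauchy_theorem_convex[OF cont convex_closed_sector finite.emptyI])
      show "F field_differentiable at x" if "x \<in> interior (closed_sector \<alpha>) - {}" for x
        using that holomorphic_on_imp_differentiable_at[OF hol open_sector[OF \<alpha>]] by (simp add: interior_closed_sector[OF \<alpha>])
      show "path_image (sector_triangle \<alpha> R) \<subseteq> closed_sector \<alpha>" by (rule sector_triangle_subset[OF \<alpha> that])
      show "valid_path (sector_triangle \<alpha> R)" unfolding sector_triangle_def by (intro valid_path_join) auto
      show "pathfinish (sector_triangle \<alpha> R) = pathstart (sector_triangle \<alpha> R)" by (simp add: sector_triangle_def)
    qed
  qed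
  then show ?thesis by (cases s; cases s') simp_all
qed

lemma triangle_interior:
  assumes \<alpha>: "0 < \<alpha>" "\<alpha> < pi / 2" and z: "z \<in> sector \<alpha>" and R: "Re z < R * cos \<alpha>"
  shows "z \<in> interior (convex hull {0, cis (- \<alpha>) * of_real R, cis \<alpha> * of_real R})"
proof (rule interiorI)
  have sp: "cos \<alpha> > 0" using \<alpha> by (auto intro!: cos_gt_zero)
  let ?T = "sector \<alpha> \<inter> {w. Re w < R * cos \<alpha>}"
  show "open ?T" by (intro open_Int open_sector[OF \<alpha>] open_Collect_less continuous_intros)
  show "z \<in> ?T" using z R by simp
  show "?T \<subseteq> convex hull {0, cis (- \<alpha>) * of_real R, cis \<alpha> * of_real R}"
  proof
    fix w assume w: "w \<in> ?T"
    then have wc: "w \<in> closed_sector \<alpha>" using sector_subset_closed_sector[OF \<alpha>] by blast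
    obtain s t where st: "s \<ge> 0" "t \<ge> 0" "w = of_real s * cis \<alpha> + of_real t * cis (- \<alpha>)" "(s + t) * cos \<alpha> = Re w"
      using closed_sector_decomp[OF \<alpha> wc] by metis
    have "(s + t) * cos \<alpha> < R * cos \<alpha>" using w st(4) by simp
    then have lt: "s + t < R" using sp by simp
    then have R0: "R > 0" using st by simp
    have "w = (1 - t / R - s / R) *\<^sub>R 0 + (t / R) *\<^sub>R (cis (- \<alpha>) * of_real R) + (s / R) *\<^sub>R (cis \<alpha> * of_real R)"
      using R0 by (simp add: st(3) scaleR_conv_of_real)
    moreover have "(s + t) / R \<le> 1" using lt R0 by simp
    then have "0 \<le> 1 - t / R - s / R" by (simp add: add_divide_distrib)
    ultimately show "w \<in> convex hull {0, cis (- \<alpha>) * of_real R, cis \<alpha> * of_real R}"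
      unfolding convex_hull_3 using st R0
      by (intro CollectI exI[of _ "1 - t / R - s / R"] exI[of _ "t / R"] exI[of _ "s / R"]) auto
  qed
qed

lemma sector_Cauchy_formula:
  assumes \<alpha>: "0 < \<alpha>" "\<alpha> < pi / 2" and c: "c > 0"
    and cont: "continuous_on (closed_sector \<alpha>) F" and hol: "F holomorphic_on sector \<alpha>"
    and b: "\<And>w. w \<in> closed_sector \<alpha> \<Longrightarrow> cmod (F w) \<le> K * exp (- c * cmod w)" and z: "z \<in> sector \<alpha>"
  shows "2 * pi * \<i> * F z = (LINT t:{0..}|lborel. F (cis (- \<alpha>) * of_real t) / (cis (- \<alpha>) * of_real t - z) * cis (- \<alpha>))
      - (LINT t:{0..}|lborel. F (cis \<alpha> * of_real t) / (cis \<alpha> * of_real t - z) * cis \<alpha>)"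
proof -
  have sp: "cos \<alpha> > 0" using \<alpha> by (auto intro!: cos_gt_zero)
  obtain \<delta> where \<delta>: "\<delta> > 0" "ball z \<delta> \<subseteq> sector \<alpha>" using open_sector[OF \<alpha>] z openE by blast
  have ray_notin: "cis (sign_val s * \<alpha>) * of_real t \<notin> sector \<alpha>" if "t \<ge> 0" for s t
    using ray_frontier_sector[OF \<alpha> that, of s] open_sector[OF \<alpha>] by (simp add: frontier_def interior_open)
  have far: "\<delta> \<le> cmod (cis (sign_val s * \<alpha>) * of_real t - z)" if "t \<ge> 0" for s t
    using ray_notin[OF that, of s] \<delta>(2) by (auto simp: dist_norm norm_minus_commute not_less[symmetric] mem_ball)
  \<comment> \<open>From this radius on the chord lies at least \<open>\<delta>\<close> to the right
    of z, so it keeps as far from the pole as the rays do.\<close>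
  define R0 where "R0 = (Re z + \<delta>) / cos \<alpha>"
  have Rez: "Re z \<ge> 0"
  proof -
    have "z \<in> closed_sector \<alpha>" using z sector_subset_closed_sector[OF \<alpha>] by blast
    then obtain s t where "s \<ge> 0" "t \<ge> 0" "(s + t) * cos \<alpha> = Re z" using closed_sector_decomp[OF \<alpha>] by metis
    then show ?thesis using sp by (metis add_nonneg_nonneg less_imp_le mult_nonneg_nonneg)
  qed
  have R0: "R0 > 0" using Rez \<delta> sp by (simp add: R0_def)
  have chord: "w \<in> closed_sector \<alpha>" "\<delta> \<le> cmod (w - z)"
    if "R \<ge> R0" "w \<in> closed_segment (cis (- \<alpha>) * of_real R) (cis \<alpha> * of_real R)" for w R
  proof -
    have Rp: "R \<ge> 0" using that R0 by simp
    show "w \<in> closed_sector \<alpha>" by (rule chord_sector(1)[OF \<alpha> Rp that(2)])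
    have "R0 * cos \<alpha> \<le> R * cos \<alpha>" using that sp by (intro mult_right_mono) auto
    then have "Re z + \<delta> \<le> Re w" using chord_sector(2)[OF \<alpha> Rp that(2)] sp by (simp add: R0_def)
    then show "\<delta> \<le> cmod (w - z)" using complex_Re_le_cmod[of "w - z"] by simp
  qed
  have K0: "K \<ge> 0" using order_trans[OF norm_ge_zero b[of 0]] by (simp add: closed_sector_def)
  have dv: "cmod (F w / (w - z)) \<le> K / \<delta> * exp (- c * cmod w)" if "w \<in> closed_sector \<alpha>" "\<delta> \<le> cmod (w - z)" for w
  proof -
    have "cmod (F w / (w - z)) = cmod (F w) / cmod (w - z)" by (simp add: norm_divide)
    also have "\<dots> \<le> (K * exp (- c * cmod w)) / \<delta>" using that \<delta> b K0 by (intro frac_le) auto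
    finally show ?thesis by simp
  qed
  show ?thesis
  proof (rule sector_triangle_limit[OF \<alpha> c, where Rm=R0 and K="K / \<delta>"])
    show "continuous_on {0..} (\<lambda>t. F (cis (sign_val s * \<alpha>) * of_real t) / (cis (sign_val s * \<alpha>) * of_real t - z))" for s
    proof (intro continuous_on_divide)
      show "continuous_on {0..} (\<lambda>t. F (cis (sign_val s * \<alpha>) * of_real t))"
        by (rule continuous_on_compose2[OF cont]) (use ray_closed_sector[OF \<alpha>, of _ s] in \<open>auto intro!: continuous_intros\<close>)
      show "\<forall>t\<in>{0..}. cis (sign_val s * \<alpha>) * of_real t - z \<noteq> 0" using far[of _ s] \<delta>(1) by force
    qed (intro continuous_intros)
    show "continuous_on (closed_segment (cis (- \<alpha>) * of_real R) (cis \<alpha> * of_real R)) (\<lambda>w. F w / (w - z))" if R: "R \<ge> R0" for R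
    proof (intro continuous_on_divide)
      show "continuous_on (closed_segment (cis (- \<alpha>) * of_real R) (cis \<alpha> * of_real R)) F"
        using chord(1)[OF R] by (intro continuous_on_subset[OF cont]) blast
      show "\<forall>w\<in>closed_segment (cis (- \<alpha>) * of_real R) (cis \<alpha> * of_real R). w - z \<noteq> 0" using chord(2)[OF R] \<delta>(1) by force
    qed (intro continuous_intros)
    show "cmod (F (cis (sign_val s * \<alpha>) * of_real t) / (cis (sign_val s * \<alpha>) * of_real t - z)) \<le> K / \<delta> * exp (- c * t)" if "t \<ge> 0" for s t
      using dv[OF ray_closed_sector[OF \<alpha> that, of s] far[OF that, of s]] that by (simp add: norm_mult)
    show "cmod (F w / (w - z)) \<le> K / \<delta> * exp (- c * cmod w)" if "R \<ge> R0" "w \<in> closed_segment (cis (- \<alpha>) * of_real R) (cis \<alpha> * of_real R)" for w R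
      by (rule dv[OF chord[OF that]])
    show "((\<lambda>w. F w / (w - z)) has_contour_integral 2 * pi * \<i> * F z) (sector_triangle \<alpha> R)" if R: "R \<ge> R0" for R
    proof -
      have Rp: "R > 0" using R R0 by simp
      have "R0 * cos \<alpha> \<le> R * cos \<alpha>" using R sp by (intro mult_right_mono) auto
      then have "Re z < R * cos \<alpha>" using sp \<delta>(1) by (simp add: R0_def)
      then have zi: "z \<in> interior (convex hull {0, cis (- \<alpha>) * of_real R, cis \<alpha> * of_real R})" by (rule triangle_interior[OF \<alpha> z])
      have wn: "winding_number (sector_triangle \<alpha> R) z = 1"
      proof -
        \<comment> \<open>This sign decides between the winding numbers 1 and -1; it is positive
          because z lies above the lower ray.\<close>
        have "Im ((cis (- \<alpha>) * of_real R - 0) * cnj (cis (- \<alpha>) * of_real R - z)) = R * Im (z * cis \<alpha>)"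
          using Rp by (simp add: algebra_simps)
        moreover have "R * Im (z * cis \<alpha>) > 0" using Rp z unfolding sector_iff[OF \<alpha>] by simp
        ultimately show ?thesis unfolding sector_triangle_def using winding_number_triangle[OF zi] by simp
      qed
      have "((\<lambda>w. F w / (w - z)) has_contour_integral (2 * pi * \<i> * winding_number (sector_triangle \<alpha> R) z * F z)) (sector_triangle \<alpha> R)"
      proof (rule Cauchy_integral_formula_weak[OF convex_closed_sector finite.emptyI cont])
        show "F field_differentiable at x" if "x \<in> interior (closed_sector \<alpha>) - {}" for x
          using that holomorphic_on_imp_differentiable_at[OF hol open_sector[OF \<alpha>]] by (simp add: interior_closed_sector[OF \<alpha>])
        show "z \<in> interior (closed_sector \<alpha>) - {}" using z by (simp add: interior_closed_sector[OF \<alpha>])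
        show "valid_path (sector_triangle \<alpha> R)" unfolding sector_triangle_def by (intro valid_path_join) auto
        show "pathfinish (sector_triangle \<alpha> R) = pathstart (sector_triangle \<alpha> R)" by (simp add: sector_triangle_def)
        have ray: "z \<notin> closed_segment 0 (cis (sign_val s * \<alpha>) * of_real R)" for s
        proof
          assume "z \<in> closed_segment 0 (cis (sign_val s * \<alpha>) * of_real R)"
          then obtain u where u: "0 \<le> u" "z = u *\<^sub>R (cis (sign_val s * \<alpha>) * of_real R)" by (auto simp: in_segment)
          then have "z = cis (sign_val s * \<alpha>) * of_real (u * R)" by (simp add: scaleR_conv_of_real mult_ac)
          then show False using ray_notin[of "u * R" s] u Rp z by simp
        qed
        have "z \<notin> path_image (sector_triangle \<alpha> R)"
          using ray[of Pos] ray[of Neg] chord(2)[OF R, of z] \<delta>(1)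
          by (auto simp: sector_triangle_def path_image_join closed_segment_commute)
        then show "path_image (sector_triangle \<alpha> R) \<subseteq> closed_sector \<alpha> - {z}"
          using sector_triangle_subset[OF \<alpha>, of R] Rp by auto
      qed
      then show ?thesis by (simp add: wn)
    qed
  qed
qed

section \<open>The legs of the curve and the kernel of the inversion\<close>

abbreviation ray :: "real \<Rightarrow> sign \<Rightarrow> complex" where
  "ray \<alpha> s \<equiv> cis (sign_val s * \<alpha>)"

text \<open>The two legs of the curve \<open>\<Gamma>\<close>, parametrized by \<open>t \<ge> 0\<close>; \<open>Pos\<close> belongs to the positive half of
  the parameter line. On the leg \<open>s\<close> the real part of \<open>\<omega> * ray \<alpha> s\<close> is constant.\<close>

definition Gamma_leg :: "real \<Rightarrow> real \<Rightarrow> sign \<Rightarrow> real \<Rightarrow> complex" where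
  "Gamma_leg \<alpha> p s t = of_real p + \<i> * of_real (sign_val s) * cis (- (sign_val s * \<alpha>)) * of_real t"

text \<open>The derivative of the curve in its own parameter. The sign in \<open>Gamma_leg\<close>
  comes from reversing the negative half of the parameter line and therefore does not occur
  here.\<close>

definition leg_dir :: "real \<Rightarrow> sign \<Rightarrow> complex" where
  "leg_dir \<alpha> s = \<i> * cis (- (sign_val s * \<alpha>))"

lemma sign_val_sq [simp]: "sign_val s * sign_val s = 1" by (cases s) auto
lemma abs_sign_val [simp]: "\<bar>sign_val s\<bar> = 1" by (cases s) auto

lemma norm_leg_dir [simp]: "cmod (leg_dir \<alpha> s) = 1" by (simp add: leg_dir_def norm_mult)

lemma Re_Gamma_leg_ray: "Re (Gamma_leg \<alpha> p s t * (ray \<alpha> s * of_real r)) = p * cos \<alpha> * r"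
proof -
  have "cis (- (sign_val s * \<alpha>)) * ray \<alpha> s = 1" by (simp add: cis_mult)
  then have "Gamma_leg \<alpha> p s t * (ray \<alpha> s * of_real r) = of_real (p * r) * ray \<alpha> s + \<i> * of_real (sign_val s * t * r)"
    by (simp add: Gamma_leg_def algebra_simps)
  moreover have "cos (sign_val s * \<alpha>) = cos \<alpha>" by (cases s) auto
  ultimately show ?thesis by simp
qed

text \<open>The signed distance of z from the line through the boundary ray, |z| sin (\<alpha> - arg
  z) or |z| sin (\<alpha> + arg z); it is the rate at which exp (-\<omega> z) decays along the
  leg.\<close>

definition leg_decay :: "real \<Rightarrow> sign \<Rightarrow> complex \<Rightarrow> real" where
  "leg_decay \<alpha> s z = - sign_val s * Im (z * cis (- (sign_val s * \<alpha>)))"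

lemma leg_decay_pos:
  assumes "0 < \<alpha>" "\<alpha> < pi / 2" "z \<in> sector \<alpha>" shows "leg_decay \<alpha> s z > 0"
  using assms(3) unfolding sector_iff[OF assms(1,2)] leg_decay_def by (cases s) auto

lemma Re_Gamma_leg_mult: "Re (Gamma_leg \<alpha> p s t * z) = p * Re z + leg_decay \<alpha> s z * t"
  by (simp add: Gamma_leg_def leg_decay_def algebra_simps)

text \<open>The factor that multiplies the boundary value at the point with parameter \<open>r\<close> of the boundary ray
  when the Laplace transform is inserted into the integral over the leg \<open>s\<close> of \<open>\<Gamma>\<close>.\<close>

definition inv_kernel :: "real \<Rightarrow> real \<Rightarrow> complex \<Rightarrow> sign \<Rightarrow> real \<Rightarrow> real \<Rightarrow> complex" where
  "inv_kernel \<alpha> p z s t r = ray \<alpha> s * exp (Gamma_leg \<alpha> p s t * (ray \<alpha> s * of_real r - z)) * leg_dir \<alpha> s"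

text \<open>The modulus separates into an exponential in r and one in t, so all later estimates are
  products of one-variable exponentials.\<close>

lemma norm_inv_kernel:
  "cmod (inv_kernel \<alpha> p z s t r) = exp (p * cos \<alpha> * r) * (exp (- p * Re z) * exp (- leg_decay \<alpha> s z * t))"
proof -
  have "cmod (inv_kernel \<alpha> p z s t r) = exp (Re (Gamma_leg \<alpha> p s t * (ray \<alpha> s * of_real r)) - Re (Gamma_leg \<alpha> p s t * z))"
    by (simp add: inv_kernel_def norm_mult right_diff_distrib)
  then show ?thesis unfolding Re_Gamma_leg_ray Re_Gamma_leg_mult[of _ _ _ _ z] by (simp add: exp_add[symmetric])
qed

lemma continuous_on_inv_kernel: "continuous_on A (\<lambda>q. inv_kernel \<alpha> p z s (fst q) (snd q))"
  unfolding inv_kernel_def Gamma_leg_def by (intro continuous_intros)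

text \<open>Along the leg the exponent is p w plus a multiple of t with negative real part, where w
  is the boundary point minus z. The factor exp (p w) is 1 at w = 0, so it does not disturb Cauchy's
  formula; the sign orients the two rays as the boundary of the sector.\<close>

lemma inv_kernel_t_integral:
  assumes \<alpha>: "0 < \<alpha>" "\<alpha> < pi / 2" and z: "z \<in> sector \<alpha>"
  shows "(LINT t:{0..}|lborel. inv_kernel \<alpha> p z s t r) =
    - of_real (sign_val s) * (exp (of_real p * (ray \<alpha> s * of_real r - z)) / (ray \<alpha> s * of_real r - z) * ray \<alpha> s)"
proof -
  define w where "w = ray \<alpha> s * of_real r - z"
  define \<beta> where "\<beta> = \<i> * of_real (sign_val s) * cis (- (sign_val s * \<alpha>)) * w"
  have "Re \<beta> = - leg_decay \<alpha> s z"
  proof -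
    have "cis (- (sign_val s * \<alpha>)) * ray \<alpha> s = 1" by (simp add: cis_mult)
    then have "\<beta> = \<i> * of_real (sign_val s * r) - \<i> * of_real (sign_val s) * (cis (- (sign_val s * \<alpha>)) * z)"
      by (simp add: \<beta>_def w_def algebra_simps)
    then have "Re \<beta> = Re (\<i> * of_real (sign_val s * r) - \<i> * of_real (sign_val s) * (cis (- (sign_val s * \<alpha>)) * z))"
      by (rule arg_cong)
    also have "\<dots> = sign_val s * Im (cis (- (sign_val s * \<alpha>)) * z)" by simp
    finally show ?thesis by (simp add: leg_decay_def mult.commute)
  qed
  then have \<beta>: "Re \<beta> < 0" using leg_decay_pos[OF \<alpha> z] by simp
  then have \<beta>0: "\<beta> \<noteq> 0" by auto
  then have w0: "w \<noteq> 0" by (auto simp: \<beta>_def)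
  have e: "inv_kernel \<alpha> p z s t r = (ray \<alpha> s * exp (of_real p * w) * leg_dir \<alpha> s) * exp (\<beta> * of_real t)" for t
  proof -
    have "Gamma_leg \<alpha> p s t * w = of_real p * w + \<beta> * of_real t" by (simp add: Gamma_leg_def \<beta>_def algebra_simps)
    then show ?thesis unfolding inv_kernel_def w_def[symmetric] by (simp add: exp_add)
  qed
  have sb: "leg_dir \<alpha> s / \<beta> = of_real (sign_val s) / w"
  proof -
    have "leg_dir \<alpha> s * w = of_real (sign_val s) * \<beta>"
      by (cases s) (simp_all add: \<beta>_def leg_dir_def)
    then show ?thesis using \<beta>0 w0 by (simp add: field_simps)
  qed
  have "(LINT t:{0..}|lborel. inv_kernel \<alpha> p z s t r) = (ray \<alpha> s * exp (of_real p * w) * leg_dir \<alpha> s) * (- 1 / \<beta>)"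
    unfolding e set_integral_mult_right LINT_exp_half_line(2)[OF \<beta>] ..
  also have "\<dots> = - (ray \<alpha> s * exp (of_real p * w)) * (leg_dir \<alpha> s / \<beta>)" by simp
  finally show ?thesis unfolding sb w_def by simp
qed

section \<open>Interchange of integrals and inversion in one variable\<close>

lemma integrable_lborel_product:
  fixes f g :: "real \<Rightarrow> real"
  assumes f: "integrable lborel f" and g: "integrable lborel g"
  shows "integrable (lborel \<Otimes>\<^sub>M lborel) (\<lambda>q. f (fst q) * g (snd q))"
proof (rule lborel_pair.Fubini_integrable)
  show "(\<lambda>q. f (fst q) * g (snd q)) \<in> borel_measurable (lborel \<Otimes>\<^sub>M lborel)"
    using f g by measurable
  have "integrable lborel (\<lambda>x. norm (f x) * (LINT y|lborel. norm (g y)))"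
    by (intro integrable_mult_left integrable_norm f)
  then show "integrable lborel (\<lambda>x. LINT y|lborel. norm (f (fst (x, y)) * g (snd (x, y))))"
    by (simp add: abs_mult)
  show "AE x in lborel. integrable lborel (\<lambda>y. f (fst (x, y)) * g (snd (x, y)))"
    using g by simp
qed

text \<open>Measurability is required of the function cut off to the quadrant, where alone the
  integrands are controlled. The second part serves to add the contributions of different legs under
  an integral sign.\<close>

lemma Fubini_half_lines:
  fixes h :: "real \<times> real \<Rightarrow> complex"
  assumes h: "(\<lambda>q. indicator ({0..} \<times> {0..}) q *\<^sub>R h q) \<in> borel_measurable borel" and cd: "c > 0" "d > 0"
    and b: "\<And>t r. t \<ge> 0 \<Longrightarrow> r \<ge> 0 \<Longrightarrow> cmod (h (t, r)) \<le> K * exp (- c * t) * exp (- d * r)"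
  shows "(LINT t:{0..}|lborel. LINT r:{0..}|lborel. h (t, r)) = (LINT r:{0..}|lborel. LINT t:{0..}|lborel. h (t, r))"
    and "set_integrable lborel {0..} (\<lambda>r. LINT t:{0..}|lborel. h (t, r))"
proof -
  define H where "H = (\<lambda>q. indicator ({0..} \<times> {0..}) q *\<^sub>R h q)"
  have Hm: "H \<in> borel_measurable borel" using h by (simp add: H_def)
  have ec: "integrable lborel (\<lambda>t. indicator {0..} t *\<^sub>R exp (- c * t))" "integrable lborel (\<lambda>t. indicator {0..} t *\<^sub>R exp (- d * t))"
    using set_integrable_exp_neg cd unfolding set_integrable_def by blast+
  have "integrable (lborel \<Otimes>\<^sub>M lborel) (\<lambda>q. K * ((indicator {0..} (fst q) *\<^sub>R exp (- c * fst q)) * (indicator {0..} (snd q) *\<^sub>R exp (- d * snd q))))"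
    by (intro integrable_mult_right integrable_lborel_product ec)
  then have "integrable (lborel \<Otimes>\<^sub>M lborel) H"
  proof (rule Bochner_Integration.integrable_bound)
    show "H \<in> borel_measurable (lborel \<Otimes>\<^sub>M lborel)" using Hm unfolding lborel_prod by simp
    show "AE q in lborel \<Otimes>\<^sub>M lborel. norm (H q) \<le> norm (K * ((indicator {0..} (fst q) *\<^sub>R exp (- c * fst q)) * (indicator {0..} (snd q) *\<^sub>R exp (- d * snd q))))"
    proof (rule AE_I2)
      fix q :: "real \<times> real"
      obtain t r where q: "q = (t, r)" by (cases q)
      show "norm (H q) \<le> norm (K * ((indicator {0..} (fst q) *\<^sub>R exp (- c * fst q)) * (indicator {0..} (snd q) *\<^sub>R exp (- d * snd q))))"
        using order_trans[OF b[of t r] abs_ge_self] by (auto simp: q H_def indicator_def mult.assoc)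
    qed
  qed
  then have i: "integrable (lborel \<Otimes>\<^sub>M lborel) (case_prod (\<lambda>t r. H (t, r)))" by (simp add: case_prod_beta')
  have r: "(LINT t|lborel. H (t, r)) = indicator {0..} r *\<^sub>R (LINT t:{0..}|lborel. h (t, r))" for r
    unfolding set_lebesgue_integral_def H_def by (cases "r \<ge> 0") (simp_all add: indicator_times)
  have t: "(LINT r|lborel. H (t, r)) = indicator {0..} t *\<^sub>R (LINT r:{0..}|lborel. h (t, r))" for t
    unfolding set_lebesgue_integral_def H_def by (cases "t \<ge> 0") (simp_all add: indicator_times)
  have "(LINT t|lborel. LINT r|lborel. H (t, r)) = (LINT r|lborel. LINT t|lborel. H (t, r))"
    using lborel_pair.Fubini_integral[OF i] by simp
  then show "(LINT t:{0..}|lborel. LINT r:{0..}|lborel. h (t, r)) = (LINT r:{0..}|lborel. LINT t:{0..}|lborel. h (t, r))"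
    unfolding r t set_lebesgue_integral_def .
  show "set_integrable lborel {0..} (\<lambda>r. LINT t:{0..}|lborel. h (t, r))"
    using lborel_pair.integrable_snd[OF i] unfolding r set_integrable_def .
qed

lemma borel_measurable_quadrant:
  fixes h :: "real \<times> real \<Rightarrow> complex"
  assumes "continuous_on ({0..} \<times> {0..}) h"
  shows "(\<lambda>q. indicator ({0..} \<times> {0..}) q *\<^sub>R h q) \<in> borel_measurable borel"
  by (rule borel_measurable_continuous_on_indicator[OF _ assms]) (intro borel_closed closed_Times closed_atLeast)

text \<open>After the interchange each leg gives the Cauchy integral of
  \<open>g w * exp (p * (w - z))\<close> over one boundary ray. This function has the value g z at z
  and decays because p cos \<alpha> is below -H; the two rays together are the boundary of the
  sector.\<close>

lemma Laplace_inversion_sector: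
  assumes \<alpha>: "0 < \<alpha>" "\<alpha> < pi / 2" and pH: "p * cos \<alpha> < - H" and H: "H \<ge> 0"
    and cont: "continuous_on (closed_sector \<alpha>) g" and hol: "g holomorphic_on sector \<alpha>"
    and b: "\<And>w. w \<in> closed_sector \<alpha> \<Longrightarrow> cmod (g w) \<le> K * exp (H * cmod w)" and z: "z \<in> sector \<alpha>"
  shows "(\<Sum>s\<in>{Pos, Neg}. LINT t:{0..}|lborel. LINT r:{0..}|lborel. g (ray \<alpha> s * of_real r) * inv_kernel \<alpha> p z s t r) = 2 * pi * \<i> * g z"
proof -
  define c where "c = - p * cos \<alpha> - H"
  have c: "c > 0" using pH by (simp add: c_def)
  have K0: "K \<ge> 0" using order_trans[OF norm_ge_zero b[of 0]] by (simp add: closed_sector_def)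
  define F where "F = (\<lambda>w. g w * exp (of_real p * (w - z)))"
  have swap: "(LINT t:{0..}|lborel. LINT r:{0..}|lborel. g (ray \<alpha> s * of_real r) * inv_kernel \<alpha> p z s t r)
     = - of_real (sign_val s) * (LINT r:{0..}|lborel. F (ray \<alpha> s * of_real r) / (ray \<alpha> s * of_real r - z) * ray \<alpha> s)" for s
  proof -
    have "(LINT t:{0..}|lborel. LINT r:{0..}|lborel. g (ray \<alpha> s * of_real r) * inv_kernel \<alpha> p z s t r)
      = (LINT r:{0..}|lborel. LINT t:{0..}|lborel. g (ray \<alpha> s * of_real r) * inv_kernel \<alpha> p z s t r)"
    proof (rule Fubini_half_lines(1)[of "\<lambda>q. g (ray \<alpha> s * of_real (snd q)) * inv_kernel \<alpha> p z s (fst q) (snd q)", simplified fst_conv snd_conv, OF borel_measurable_quadrant])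
      show "continuous_on ({0..} \<times> {0..}) (\<lambda>q. g (ray \<alpha> s * of_real (snd q)) * inv_kernel \<alpha> p z s (fst q) (snd q))"
        by (intro continuous_on_mult continuous_on_inv_kernel continuous_on_compose2[OF cont])
          (use ray_closed_sector[OF \<alpha>, of _ s] in \<open>auto intro!: continuous_intros\<close>)
      show "leg_decay \<alpha> s z > 0" by (rule leg_decay_pos[OF \<alpha> z])
      show "c > 0" by (rule c)
      show "cmod (g (ray \<alpha> s * of_real r) * inv_kernel \<alpha> p z s t r) \<le> (K * exp (- p * Re z)) * exp (- leg_decay \<alpha> s z * t) * exp (- c * r)"
        if "t \<ge> 0" "r \<ge> 0" for t r
      proof -
        have "cmod (g (ray \<alpha> s * of_real r)) \<le> K * exp (H * r)"
          using b[OF ray_closed_sector[OF \<alpha> that(2), of s]] that by (simp add: norm_mult)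
        then have "cmod (g (ray \<alpha> s * of_real r) * inv_kernel \<alpha> p z s t r) \<le> K * exp (H * r) * (exp (p * cos \<alpha> * r) * (exp (- p * Re z) * exp (- leg_decay \<alpha> s z * t)))"
          unfolding norm_mult norm_inv_kernel by (intro mult_right_mono) auto
        also have "\<dots> = (K * exp (- p * Re z)) * exp (- leg_decay \<alpha> s z * t) * (exp (H * r) * exp (p * cos \<alpha> * r))" by (simp only: mult_ac)
        also have "exp (H * r) * exp (p * cos \<alpha> * r) = exp (- c * r)" by (simp add: exp_add[symmetric] c_def algebra_simps)
        finally show ?thesis .
      qed
    qed
    also have "\<dots> = (LINT r:{0..}|lborel. - of_real (sign_val s) * (F (ray \<alpha> s * of_real r) / (ray \<alpha> s * of_real r - z) * ray \<alpha> s))"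
    proof -
      have "g (ray \<alpha> s * of_real r) * (- of_real (sign_val s) * (exp (of_real p * (ray \<alpha> s * of_real r - z)) / (ray \<alpha> s * of_real r - z) * ray \<alpha> s))
          = - of_real (sign_val s) * (F (ray \<alpha> s * of_real r) / (ray \<alpha> s * of_real r - z) * ray \<alpha> s)" for r
        by (simp add: F_def)
      then show ?thesis by (simp only: set_integral_mult_right inv_kernel_t_integral[OF \<alpha> z])
    qed
    also have "\<dots> = - of_real (sign_val s) * (LINT r:{0..}|lborel. F (ray \<alpha> s * of_real r) / (ray \<alpha> s * of_real r - z) * ray \<alpha> s)"
      by (rule set_integral_mult_right)
    finally show ?thesis .
  qed
  have "2 * pi * \<i> * F z = (LINT t:{0..}|lborel. F (cis (- \<alpha>) * of_real t) / (cis (- \<alpha>) * of_real t - z) * cis (- \<alpha>))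
      - (LINT t:{0..}|lborel. F (cis \<alpha> * of_real t) / (cis \<alpha> * of_real t - z) * cis \<alpha>)"
  proof (rule sector_Cauchy_formula[OF \<alpha> c _ _ _ z, where K="K * exp (- p * Re z)"])
    show "continuous_on (closed_sector \<alpha>) F" unfolding F_def by (intro continuous_intros cont)
    show "F holomorphic_on sector \<alpha>" unfolding F_def by (intro holomorphic_intros hol)
    fix w assume w: "w \<in> closed_sector \<alpha>"
    have cp: "cos \<alpha> > 0" using \<alpha> by (auto intro!: cos_gt_zero)
    have "p * cos \<alpha> < 0" using pH H by linarith
    then have p: "p < 0" using cp by (simp add: mult_less_0_iff)
    have "Re (of_real p * w) \<le> - (- p * cos \<alpha>) * cmod w"
    proof (rule closed_sector_Re_le[OF \<alpha> w])
      show "Re (of_real p * cis (sign_val s * \<alpha>)) \<le> - (- p * cos \<alpha>)" for s by (cases s) auto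
      show "0 \<le> - p * cos \<alpha>" using \<open>p * cos \<alpha> < 0\<close> by simp
    qed
    then have "Re (of_real p * (w - z)) \<le> p * cos \<alpha> * cmod w - p * Re z" by (simp add: algebra_simps)
    then have "cmod (F w) \<le> K * exp (H * cmod w) * exp (p * cos \<alpha> * cmod w - p * Re z)"
      unfolding F_def norm_mult norm_exp_eq_Re using b[OF w] K0 by (intro mult_mono) auto
    also have "\<dots> = K * exp (- p * Re z) * exp (- c * cmod w)"
      by (simp add: exp_add[symmetric] c_def algebra_simps mult_exp_exp)
    finally show "cmod (F w) \<le> K * exp (- p * Re z) * exp (- c * cmod w)" .
  qed
  then show ?thesis unfolding swap by (simp add: F_def)
qed

section \<open>Measurability and domination of iterated integrals, and inversion in two
  variables\<close>

lemma continuous_on_inv_kernel' [continuous_intros]: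
  "continuous_on A f \<Longrightarrow> continuous_on A g \<Longrightarrow> continuous_on A (\<lambda>q. inv_kernel \<alpha> p z s (f q) (g q))"
  unfolding inv_kernel_def Gamma_leg_def by (intro continuous_intros)

lemma inv_kernel_measurable [measurable]:
  "(\<lambda>q. inv_kernel \<alpha> p z s (fst q) (snd q)) \<in> borel_measurable (borel \<Otimes>\<^sub>M borel)"
  unfolding borel_prod by (intro borel_measurable_continuous_onI continuous_intros)

lemma inv_kernel_measurable' [measurable (raw)]:
  assumes [measurable]: "f \<in> borel_measurable M" "g \<in> borel_measurable M"
  shows "(\<lambda>q. inv_kernel \<alpha> p z s (f q) (g q)) \<in> borel_measurable M"
proof -
  have "(\<lambda>q. (f q, g q)) \<in> M \<rightarrow>\<^sub>M borel \<Otimes>\<^sub>M borel" by measurable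
  from measurable_compose[OF this inv_kernel_measurable] show ?thesis by simp
qed

lemma LINT_exp_neg: "c > 0 \<Longrightarrow> (LINT t:{0..}|lborel. exp (- c * t)) = 1 / (c :: real)"
proof -
  assume c: "c > 0"
  have "complex_of_real (LINT t:{0..}|lborel. exp (- c * t)) = (LINT t:{0..}|lborel. exp (complex_of_real (- c) * of_real t))"
    unfolding set_lebesgue_integral_def integral_complex_of_real[symmetric]
    by (intro Bochner_Integration.integral_cong refl) (simp add: scaleR_conv_of_real exp_of_real[symmetric])
  also have "\<dots> = complex_of_real (1 / c)" using LINT_exp_half_line(2)[of "complex_of_real (- c)"] c by simp
  finally show ?thesis by (simp only: of_real_eq_iff)
qed

lemma norm_LINT_exp_bound:
  fixes f :: "real \<Rightarrow> complex"
  assumes c: "c > 0" and b: "\<And>t. t \<ge> 0 \<Longrightarrow> cmod (f t) \<le> K * exp (- c * t)"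
  shows "cmod (LINT t:{0..}|lborel. f t) \<le> K / c"
proof -
  have K0: "K \<ge> 0" using order_trans[OF norm_ge_zero b[of 0]] by simp
  show ?thesis
  proof (cases "set_integrable lborel {0..} f")
    case True
    have "cmod (LINT t:{0..}|lborel. f t) \<le> (LINT t|lborel. norm (indicator {0..} t *\<^sub>R f t))"
      unfolding set_lebesgue_integral_def by (rule integral_norm_bound)
    also have "\<dots> \<le> (LINT t|lborel. K * (indicator {0..} t *\<^sub>R exp (- c * t)))"
    proof (rule integral_mono)
      show "integrable lborel (\<lambda>t. norm (indicator {0..} t *\<^sub>R f t))" using True unfolding set_integrable_def by (rule integrable_norm)
      show "integrable lborel (\<lambda>t. K * (indicator {0..} t *\<^sub>R exp (- c * t)))"
        using set_integrable_exp_neg[OF c] unfolding set_integrable_def by (rule integrable_mult_right)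
      show "norm (indicator {0..} t *\<^sub>R f t) \<le> K * (indicator {0..} t *\<^sub>R exp (- c * t))" for t
        using b[of t] by (auto simp: indicator_def)
    qed
    also have "\<dots> = K * (LINT t:{0..}|lborel. exp (- c * t))" by (simp add: set_lebesgue_integral_def)
    finally show ?thesis using LINT_exp_neg[OF c] by simp
  next
    case False
    \<comment> \<open>The integral of a non-integrable function is 0 by convention, and the bound is
      nonnegative.\<close>
    then have "(LINT t:{0..}|lborel. f t) = 0" by (simp add: set_lebesgue_integral_def set_integrable_def not_integrable_integral_eq)
    then show ?thesis using K0 c by simp
  qed
qed

lemma dominated_convergence_half_line:
  fixes f :: "nat \<Rightarrow> real \<Rightarrow> complex"
  assumes [measurable]: "\<And>n. f n \<in> borel_measurable borel" "g \<in> borel_measurable borel" and c: "c > 0"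
    and b: "\<And>n t. t \<ge> 0 \<Longrightarrow> cmod (f n t) \<le> K * exp (- c * t)"
    and lim: "AE t in lborel. t \<ge> 0 \<longrightarrow> (\<lambda>n. f n t) \<longlonglongrightarrow> g t"
  shows "(\<lambda>n. LINT t:{0..}|lborel. f n t) \<longlonglongrightarrow> (LINT t:{0..}|lborel. g t)"
  unfolding set_lebesgue_integral_def
proof (rule integral_dominated_convergence)
  show "integrable lborel (\<lambda>t. K * (indicator {0..} t *\<^sub>R exp (- c * t)))"
    using set_integrable_exp_neg[OF c] unfolding set_integrable_def by (rule integrable_mult_right)
  show "AE t in lborel. (\<lambda>n. indicator {0..} t *\<^sub>R f n t) \<longlonglongrightarrow> indicator {0..} t *\<^sub>R g t"
    using lim by eventually_elim (auto simp: indicator_def)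
  show "AE t in lborel. norm (indicator {0..} t *\<^sub>R f n t) \<le> K * (indicator {0..} t *\<^sub>R exp (- c * t))" for n
    using b by (auto simp: indicator_def)
qed measurable

lemma borel_measurable_set_LINT:
  fixes h :: "'a \<Rightarrow> real \<Rightarrow> complex"
  assumes "(\<lambda>q. h (fst q) (snd q)) \<in> borel_measurable (M \<Otimes>\<^sub>M borel)"
  shows "(\<lambda>x. LINT r:{0..}|lborel. h x r) \<in> borel_measurable M"
proof -
  have [measurable]: "(\<lambda>q. h (fst q) (snd q)) \<in> borel_measurable (M \<Otimes>\<^sub>M lborel)" using assms by simp
  have "case_prod (\<lambda>x r. indicator {0..} r *\<^sub>R h x r) \<in> borel_measurable (M \<Otimes>\<^sub>M lborel)"
    unfolding case_prod_beta' by measurable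
  then show ?thesis unfolding set_lebesgue_integral_def by (rule lborel.borel_measurable_lebesgue_integral)
qed

text \<open>The order t1, t2, r2, r1 is that of the transform inserted into the curve integrals.
  Once r1 has been moved outside r2 and t2, the inside is, for each fixed r1, the one-variable
  formula in the second variable; what remains is that formula in the first.\<close>

lemma Laplace_inversion_two:
  fixes F :: "complex \<times> complex \<Rightarrow> complex"
  assumes \<alpha>1: "0 < \<alpha>1" "\<alpha>1 < pi / 2" and \<alpha>2: "0 < \<alpha>2" "\<alpha>2 < pi / 2"
    and p: "p1 * cos \<alpha>1 < - H1" "p2 * cos \<alpha>2 < - H2" and H: "H1 \<ge> 0" "H2 \<ge> 0"
    and cont: "continuous_on (closed_sector \<alpha>1 \<times> closed_sector \<alpha>2) F"
    and hol1: "\<And>w2. w2 \<in> closed_sector \<alpha>2 \<Longrightarrow> (\<lambda>w1. F (w1, w2)) holomorphic_on sector \<alpha>1"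
    and hol2: "\<And>w1. w1 \<in> closed_sector \<alpha>1 \<Longrightarrow> (\<lambda>w2. F (w1, w2)) holomorphic_on sector \<alpha>2"
    and b: "\<And>w1 w2. w1 \<in> closed_sector \<alpha>1 \<Longrightarrow> w2 \<in> closed_sector \<alpha>2 \<Longrightarrow> cmod (F (w1, w2)) \<le> K * exp (H1 * cmod w1 + H2 * cmod w2)"
    and z: "z1 \<in> sector \<alpha>1" "z2 \<in> sector \<alpha>2"
  shows "(\<Sum>s1\<in>{Pos, Neg}. LINT t1:{0..}|lborel. \<Sum>s2\<in>{Pos, Neg}. LINT t2:{0..}|lborel.
      LINT r2:{0..}|lborel. LINT r1:{0..}|lborel.
        F (ray \<alpha>1 s1 * of_real r1, ray \<alpha>2 s2 * of_real r2) * inv_kernel \<alpha>1 p1 z1 s1 t1 r1 * inv_kernel \<alpha>2 p2 z2 s2 t2 r2)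
    = (2 * pi * \<i>)\<^sup>2 * F (z1, z2)"
proof -
  define c1 c2 where "c1 = - p1 * cos \<alpha>1 - H1" and "c2 = - p2 * cos \<alpha>2 - H2"
  have c: "c1 > 0" "c2 > 0" using p by (auto simp: c1_def c2_def)
  have rc1: "ray \<alpha>1 s * of_real r \<in> closed_sector \<alpha>1" if "r \<ge> 0" for s r using ray_closed_sector[OF \<alpha>1 that] .
  have rc2: "ray \<alpha>2 s * of_real r \<in> closed_sector \<alpha>2" if "r \<ge> 0" for s r using ray_closed_sector[OF \<alpha>2 that] .
  have zs: "z1 \<in> closed_sector \<alpha>1" "z2 \<in> closed_sector \<alpha>2"
    using z sector_subset_closed_sector[OF \<alpha>1] sector_subset_closed_sector[OF \<alpha>2] by auto
  have cont1: "continuous_on (closed_sector \<alpha>1) (\<lambda>w1. F (w1, w2))" if "w2 \<in> closed_sector \<alpha>2" for w2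
    by (rule continuous_on_compose2[OF cont]) (use that in \<open>auto intro!: continuous_intros\<close>)
  have cont2: "continuous_on (closed_sector \<alpha>2) (\<lambda>w2. F (w1, w2))" if "w1 \<in> closed_sector \<alpha>1" for w1
    by (rule continuous_on_compose2[OF cont]) (use that in \<open>auto intro!: continuous_intros\<close>)
  define \<Phi> where "\<Phi> = (\<lambda>s1 s2 q. F (ray \<alpha>1 s1 * of_real (snd q), ray \<alpha>2 s2 * of_real (fst q)))"
  have cont\<Phi>: "continuous_on ({0..} \<times> {0..}) (\<Phi> s1 s2)" for s1 s2
    unfolding \<Phi>_def by (rule continuous_on_compose2[OF cont]) (use rc1 rc2 in \<open>auto intro!: continuous_intros\<close>)
  \<comment> \<open>Cut off to the quadrant, outside of which nothing is known about F, so that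
    joint measurability is available.\<close>
  define \<Psi> where "\<Psi> = (\<lambda>s1 s2 q. indicator ({0..} \<times> {0..}) q *\<^sub>R \<Phi> s1 s2 q)"
  have \<Psi>m [measurable]: "\<Psi> s1 s2 \<in> borel_measurable (borel \<Otimes>\<^sub>M borel)" for s1 s2
    unfolding \<Psi>_def borel_prod by (rule borel_measurable_quadrant[OF cont\<Phi>])
  define D1 D2 where "D1 = exp (- p1 * Re z1)" and "D2 = exp (- p2 * Re z2)"
  define d1 d2 where "d1 = (\<lambda>s. leg_decay \<alpha>1 s z1)" and "d2 = (\<lambda>s. leg_decay \<alpha>2 s z2)"
  have d: "d1 s > 0" "d2 s > 0" for s using leg_decay_pos[OF \<alpha>1 z(1)] leg_decay_pos[OF \<alpha>2 z(2)] by (auto simp: d1_def d2_def)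
  let ?k1 = "\<lambda>s t r. inv_kernel \<alpha>1 p1 z1 s t r" and ?k2 = "\<lambda>s t r. inv_kernel \<alpha>2 p2 z2 s t r"
  have full: "cmod (\<Phi> s1 s2 (r2, r1) * ?k1 s1 t1 r1 * ?k2 s2 t2 r2)
     \<le> (K * D1 * D2) * exp (- d1 s1 * t1) * exp (- d2 s2 * t2) * exp (- c1 * r1) * exp (- c2 * r2)"
    if "r1 \<ge> 0" "r2 \<ge> 0" for s1 s2 r1 r2 t1 t2
  proof -
    have "cmod (\<Phi> s1 s2 (r2, r1)) \<le> K * exp (H1 * r1 + H2 * r2)"
      using b[OF rc1[OF that(1), of s1] rc2[OF that(2), of s2]] that by (simp add: \<Phi>_def norm_mult)
    then have "cmod (\<Phi> s1 s2 (r2, r1) * ?k1 s1 t1 r1 * ?k2 s2 t2 r2) \<le> K * exp (H1 * r1 + H2 * r2)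
        * (exp (p1 * cos \<alpha>1 * r1) * (D1 * exp (- d1 s1 * t1))) * (exp (p2 * cos \<alpha>2 * r2) * (D2 * exp (- d2 s2 * t2)))"
      unfolding norm_mult norm_inv_kernel D1_def D2_def d1_def d2_def by (intro mult_right_mono) auto
    also have "\<dots> = (K * D1 * D2) * exp (- d1 s1 * t1) * exp (- d2 s2 * t2) * ((exp (H1 * r1) * exp (p1 * cos \<alpha>1 * r1)) * (exp (H2 * r2) * exp (p2 * cos \<alpha>2 * r2)))"
      by (simp only: exp_add mult_ac)
    also have "exp (H1 * r1) * exp (p1 * cos \<alpha>1 * r1) = exp (- c1 * r1)" by (simp add: exp_add[symmetric] c1_def algebra_simps)
    also have "exp (H2 * r2) * exp (p2 * cos \<alpha>2 * r2) = exp (- c2 * r2)" by (simp add: exp_add[symmetric] c2_def algebra_simps)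
    finally show ?thesis by (simp only: mult.assoc)
  qed
  have inner: "(\<Sum>s2\<in>{Pos, Neg}. LINT t2:{0..}|lborel. LINT r2:{0..}|lborel. LINT r1:{0..}|lborel. \<Phi> s1 s2 (r2, r1) * ?k1 s1 t1 r1 * ?k2 s2 t2 r2)
      = (LINT r1:{0..}|lborel. (2 * pi * \<i>) * (F (ray \<alpha>1 s1 * of_real r1, z2) * ?k1 s1 t1 r1))" if t1: "t1 \<ge> 0" for s1 t1
  proof -
    define G where "G = (\<lambda>s2 q. LINT r2:{0..}|lborel. \<Phi> s1 s2 (r2, snd q) * ?k1 s1 t1 (snd q) * ?k2 s2 (fst q) r2)"
    have swap1: "(LINT r2:{0..}|lborel. LINT r1:{0..}|lborel. \<Phi> s1 s2 (r2, r1) * ?k1 s1 t1 r1 * ?k2 s2 t2 r2)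
        = (LINT r1:{0..}|lborel. G s2 (t2, r1))" for s2 t2
      unfolding G_def fst_conv snd_conv
    proof (rule Fubini_half_lines(1)[of "\<lambda>q. \<Phi> s1 s2 q * ?k1 s1 t1 (snd q) * ?k2 s2 t2 (fst q)", simplified fst_conv snd_conv, OF borel_measurable_quadrant c(2,1)])
      show "continuous_on ({0..} \<times> {0..}) (\<lambda>q. \<Phi> s1 s2 q * ?k1 s1 t1 (snd q) * ?k2 s2 t2 (fst q))"
        by (intro continuous_intros cont\<Phi>)
      show "cmod (\<Phi> s1 s2 (r2, r1) * ?k1 s1 t1 r1 * ?k2 s2 t2 r2) \<le> ((K * D1 * D2) * exp (- d1 s1 * t1) * exp (- d2 s2 * t2)) * exp (- c2 * r2) * exp (- c1 * r1)"
        if "r2 \<ge> 0" "r1 \<ge> 0" for r2 r1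
        using full[OF that(2,1), of s1 s2 t1 t2] by (simp only: mult_ac)
    qed
    have Gb: "cmod (G s2 (t2, r1)) \<le> (K * D1 * D2 * exp (- d1 s1 * t1) / c2) * exp (- d2 s2 * t2) * exp (- c1 * r1)" if "r1 \<ge> 0" for s2 t2 r1
    proof -
      have "cmod (G s2 (t2, r1)) \<le> ((K * D1 * D2) * exp (- d1 s1 * t1) * exp (- d2 s2 * t2) * exp (- c1 * r1)) / c2"
        unfolding G_def fst_conv snd_conv by (rule norm_LINT_exp_bound[OF c(2)]) (use full[OF that] in auto)
      then show ?thesis by (simp add: mult_ac)
    qed
    have Gm: "(\<lambda>q. indicator ({0..} \<times> {0..}) q *\<^sub>R G s2 q) \<in> borel_measurable borel" for s2
    proof -
      have "(\<lambda>q. \<Psi> s1 s2 (snd q, snd (fst q)) * ?k1 s1 t1 (snd (fst q)) * ?k2 s2 (fst (fst q)) (snd q)) \<in> borel_measurable ((borel \<Otimes>\<^sub>M borel) \<Otimes>\<^sub>M borel)"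
        by measurable
      then have "(\<lambda>q. LINT r2:{0..}|lborel. \<Psi> s1 s2 (r2, snd q) * ?k1 s1 t1 (snd q) * ?k2 s2 (fst q) r2) \<in> borel_measurable (borel \<Otimes>\<^sub>M borel)"
        by (rule borel_measurable_set_LINT)
      then have m: "(\<lambda>q. LINT r2:{0..}|lborel. \<Psi> s1 s2 (r2, snd q) * ?k1 s1 t1 (snd q) * ?k2 s2 (fst q) r2) \<in> borel_measurable borel"
        unfolding borel_prod .
      have eq: "indicator ({0..} \<times> {0..}) q *\<^sub>R G s2 q = indicator ({0..} \<times> {0..}) q *\<^sub>R (LINT r2:{0..}|lborel. \<Psi> s1 s2 (r2, snd q) * ?k1 s1 t1 (snd q) * ?k2 s2 (fst q) r2)" for q
        unfolding G_def set_lebesgue_integral_def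
        by (cases "q \<in> {0..} \<times> {0..}") (auto simp: \<Psi>_def indicator_def intro!: Bochner_Integration.integral_cong)
      have ind: "indicator ({0..} \<times> {0..}) \<in> borel_measurable (borel :: (real \<times> real) measure)"
        by (intro borel_measurable_indicator borel_closed closed_Times closed_atLeast)
      show ?thesis unfolding eq by (rule borel_measurable_scaleR[OF ind m])
    qed
    have swap2: "(LINT t2:{0..}|lborel. LINT r1:{0..}|lborel. G s2 (t2, r1)) = (LINT r1:{0..}|lborel. LINT t2:{0..}|lborel. G s2 (t2, r1))" for s2
      by (rule Fubini_half_lines(1)[OF Gm d(2) c(1) Gb])
    \<comment> \<open>Integrability in r1 is what allows the two legs to be added under the
      integral; the inversion holds for their sum only.\<close>
    have int2: "set_integrable lborel {0..} (\<lambda>r1. LINT t2:{0..}|lborel. G s2 (t2, r1))" for s2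
      by (rule Fubini_half_lines(2)[OF Gm d(2) c(1) Gb])
    have "(\<Sum>s2\<in>{Pos, Neg}. LINT t2:{0..}|lborel. LINT r2:{0..}|lborel. LINT r1:{0..}|lborel. \<Phi> s1 s2 (r2, r1) * ?k1 s1 t1 r1 * ?k2 s2 t2 r2)
       = (\<Sum>s2\<in>{Pos, Neg}. LINT r1:{0..}|lborel. LINT t2:{0..}|lborel. G s2 (t2, r1))"
      unfolding swap1 by (intro sum.cong refl swap2)
    also have "\<dots> = (LINT r1:{0..}|lborel. (LINT t2:{0..}|lborel. G Pos (t2, r1)) + (LINT t2:{0..}|lborel. G Neg (t2, r1)))"
      using set_integral_add(2)[OF int2[of Pos] int2[of Neg]] by simp
    also have "\<dots> = (LINT r1:{0..}|lborel. (2 * pi * \<i>) * (F (ray \<alpha>1 s1 * of_real r1, z2) * ?k1 s1 t1 r1))"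
    proof (rule set_lebesgue_integral_cong)
      show "\<forall>r1. r1 \<in> {0..} \<longrightarrow> (LINT t2:{0..}|lborel. G Pos (t2, r1)) + (LINT t2:{0..}|lborel. G Neg (t2, r1))
          = (2 * pi * \<i>) * (F (ray \<alpha>1 s1 * of_real r1, z2) * ?k1 s1 t1 r1)"
      proof (intro allI impI)
        fix r1 :: real assume "r1 \<in> {0..}"
        then have r1: "r1 \<ge> 0" by simp
        let ?w = "ray \<alpha>1 s1 * of_real r1"
        have e: "G s2 (t2, r1) = ?k1 s1 t1 r1 * (LINT r2:{0..}|lborel. F (?w, ray \<alpha>2 s2 * of_real r2) * ?k2 s2 t2 r2)" for s2 t2
          unfolding G_def fst_conv snd_conv \<Phi>_def set_integral_mult_right[symmetric] by (simp add: mult_ac)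
        have "(\<Sum>s\<in>{Pos, Neg}. LINT t:{0..}|lborel. LINT r:{0..}|lborel. F (?w, ray \<alpha>2 s * of_real r) * ?k2 s t r) = 2 * pi * \<i> * F (?w, z2)"
        proof (rule Laplace_inversion_sector[OF \<alpha>2 p(2) H(2) cont2[OF rc1[OF r1]] hol2[OF rc1[OF r1]] _ z(2), where K="K * exp (H1 * r1)"])
          fix w assume "w \<in> closed_sector \<alpha>2"
          from b[OF rc1[OF r1, of s1] this] show "cmod (F (?w, w)) \<le> K * exp (H1 * r1) * exp (H2 * cmod w)"
            using r1 by (simp add: norm_mult exp_add mult.assoc)
        qed
        then show "(LINT t2:{0..}|lborel. G Pos (t2, r1)) + (LINT t2:{0..}|lborel. G Neg (t2, r1)) = (2 * pi * \<i>) * (F (?w, z2) * ?k1 s1 t1 r1)"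
          unfolding e set_integral_mult_right by (simp add: distrib_left[symmetric] mult_ac)
      qed
    qed simp
    finally show ?thesis .
  qed
  have "(\<Sum>s1\<in>{Pos, Neg}. LINT t1:{0..}|lborel. \<Sum>s2\<in>{Pos, Neg}. LINT t2:{0..}|lborel. LINT r2:{0..}|lborel. LINT r1:{0..}|lborel.
       \<Phi> s1 s2 (r2, r1) * ?k1 s1 t1 r1 * ?k2 s2 t2 r2)
     = (\<Sum>s1\<in>{Pos, Neg}. LINT t1:{0..}|lborel. LINT r1:{0..}|lborel. (2 * pi * \<i>) * (F (ray \<alpha>1 s1 * of_real r1, z2) * ?k1 s1 t1 r1))"
    by (intro sum.cong refl set_lebesgue_integral_cong) (use inner in auto)
  also have "\<dots> = (2 * pi * \<i>) * (\<Sum>s1\<in>{Pos, Neg}. LINT t1:{0..}|lborel. LINT r1:{0..}|lborel. F (ray \<alpha>1 s1 * of_real r1, z2) * ?k1 s1 t1 r1)"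
    unfolding set_integral_mult_right sum_distrib_left ..
  also have "(\<Sum>s1\<in>{Pos, Neg}. LINT t1:{0..}|lborel. LINT r1:{0..}|lborel. F (ray \<alpha>1 s1 * of_real r1, z2) * ?k1 s1 t1 r1) = 2 * pi * \<i> * F (z1, z2)"
  proof (rule Laplace_inversion_sector[OF \<alpha>1 p(1) H(1) cont1[OF zs(2)] hol1[OF zs(2)] _ z(1), where K="K * exp (H2 * cmod z2)"])
    fix w assume "w \<in> closed_sector \<alpha>1"
    from b[OF this zs(2)] show "cmod (F (w, z2)) \<le> K * exp (H2 * cmod z2) * exp (H1 * cmod w)"
      by (simp add: exp_add mult_ac)
  qed
  finally show ?thesis by (simp add: \<Phi>_def power2_eq_square)
qed

subsection \<open>Functions of exponential type\<close>

text \<open>Convergence is assumed almost everywhere in iterated form, as the boundary values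
  provide it; dominated convergence is used for the inner integral and then for the outer
  one.\<close>

lemma dominated_convergence_quadrant:
  fixes \<Phi> :: "nat \<Rightarrow> real \<times> real \<Rightarrow> complex" and \<kappa>1 \<kappa>2 :: "real \<Rightarrow> complex"
  assumes [measurable]: "\<And>n. \<Phi> n \<in> borel_measurable (borel \<Otimes>\<^sub>M borel)" "B \<in> borel_measurable (borel \<Otimes>\<^sub>M borel)"
      "\<kappa>1 \<in> borel_measurable borel" "\<kappa>2 \<in> borel_measurable borel"
    and c: "c1 > 0" "c2 > 0"
    and b: "\<And>n r1 r2. r1 \<ge> 0 \<Longrightarrow> r2 \<ge> 0 \<Longrightarrow> cmod (\<Phi> n (r2, r1) * \<kappa>1 r1 * \<kappa>2 r2) \<le> C * exp (- c1 * r1) * exp (- c2 * r2)"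
    and lim: "AE r2 in lborel. AE r1 in lborel. r1 \<ge> 0 \<and> r2 \<ge> 0 \<longrightarrow> (\<lambda>n. \<Phi> n (r2, r1)) \<longlonglongrightarrow> B (r2, r1)"
  shows "(\<lambda>n. LINT r2:{0..}|lborel. LINT r1:{0..}|lborel. \<Phi> n (r2, r1) * \<kappa>1 r1 * \<kappa>2 r2)
     \<longlonglongrightarrow> (LINT r2:{0..}|lborel. LINT r1:{0..}|lborel. B (r2, r1) * \<kappa>1 r1 * \<kappa>2 r2)"
proof (rule dominated_convergence_half_line[OF _ _ c(2)])
  have m: "(\<lambda>r2. LINT r1:{0..}|lborel. \<Psi> (r2, r1) * \<kappa>1 r1 * \<kappa>2 r2) \<in> borel_measurable borel"
    if [measurable]: "\<Psi> \<in> borel_measurable (borel \<Otimes>\<^sub>M borel)" for \<Psi>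
    by (rule borel_measurable_set_LINT) measurable
  show "(\<lambda>r2. LINT r1:{0..}|lborel. \<Phi> n (r2, r1) * \<kappa>1 r1 * \<kappa>2 r2) \<in> borel_measurable borel" for n
    by (rule m) measurable
  show "(\<lambda>r2. LINT r1:{0..}|lborel. B (r2, r1) * \<kappa>1 r1 * \<kappa>2 r2) \<in> borel_measurable borel"
    by (rule m) measurable
  show "cmod (LINT r1:{0..}|lborel. \<Phi> n (r2, r1) * \<kappa>1 r1 * \<kappa>2 r2) \<le> C / c1 * exp (- c2 * r2)" if "r2 \<ge> 0" for n r2
  proof -
    have "cmod (LINT r1:{0..}|lborel. \<Phi> n (r2, r1) * \<kappa>1 r1 * \<kappa>2 r2) \<le> (C * exp (- c2 * r2)) / c1"
    proof (rule norm_LINT_exp_bound[OF c(1)])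
      fix r1 :: real assume "r1 \<ge> 0"
      from b[OF this that, of n] show "cmod (\<Phi> n (r2, r1) * \<kappa>1 r1 * \<kappa>2 r2) \<le> C * exp (- c2 * r2) * exp (- c1 * r1)"
        by (simp only: mult_ac)
    qed
    then show ?thesis by simp
  qed
  show "AE r2 in lborel. 0 \<le> r2 \<longrightarrow> (\<lambda>n. LINT r1:{0..}|lborel. \<Phi> n (r2, r1) * \<kappa>1 r1 * \<kappa>2 r2)
     \<longlonglongrightarrow> (LINT r1:{0..}|lborel. B (r2, r1) * \<kappa>1 r1 * \<kappa>2 r2)"
    using lim
  proof (eventually_elim, intro impI)
    fix r2 :: real assume l: "AE r1 in lborel. r1 \<ge> 0 \<and> r2 \<ge> 0 \<longrightarrow> (\<lambda>n. \<Phi> n (r2, r1)) \<longlonglongrightarrow> B (r2, r1)" and r2: "0 \<le> r2"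
    show "(\<lambda>n. LINT r1:{0..}|lborel. \<Phi> n (r2, r1) * \<kappa>1 r1 * \<kappa>2 r2) \<longlonglongrightarrow> (LINT r1:{0..}|lborel. B (r2, r1) * \<kappa>1 r1 * \<kappa>2 r2)"
    proof (rule dominated_convergence_half_line[OF _ _ c(1)])
      show "cmod (\<Phi> n (r2, r1) * \<kappa>1 r1 * \<kappa>2 r2) \<le> (C * exp (- c2 * r2)) * exp (- c1 * r1)" if "r1 \<ge> 0" for n r1
        using b[OF that r2, of n] by (simp only: mult_ac)
      show "AE r1 in lborel. 0 \<le> r1 \<longrightarrow> (\<lambda>n. \<Phi> n (r2, r1) * \<kappa>1 r1 * \<kappa>2 r2) \<longlonglongrightarrow> B (r2, r1) * \<kappa>1 r1 * \<kappa>2 r2"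
        using l by eventually_elim (auto intro!: tendsto_intros simp: r2)
    qed measurable
  qed
qed

text \<open>An integrand made from boundary values is unspecified on a null set and need not be
  Borel; for the completed measure, equality almost everywhere with a Borel function is
  enough.\<close>

lemma lebesgue_LINT_half_line_eq:
  fixes F G :: "real \<Rightarrow> complex"
  assumes [measurable]: "G \<in> borel_measurable borel" and ae: "AE t in lborel. t \<ge> 0 \<longrightarrow> F t = G t"
  shows "set_lebesgue_integral lebesgue {0..} F = (LINT t:{0..}|lborel. G t)"
proof -
  have Gm: "(\<lambda>t. indicator {0..} t *\<^sub>R G t) \<in> borel_measurable lborel" by measurable
  have Gl: "(\<lambda>t. indicator {0..} t *\<^sub>R G t) \<in> borel_measurable lebesgue" using Gm by (rule measurable_completion)
  have ae': "AE t in lebesgue. indicator {0..} t *\<^sub>R G t = indicator {0..} t *\<^sub>R F t"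
    unfolding AE_completion_iff using ae by eventually_elim (auto simp: indicator_def)
  have Fl: "(\<lambda>t. indicator {0..} t *\<^sub>R F t) \<in> borel_measurable lebesgue" by (rule borel_measurable_AE[OF Gl ae'])
  have "(LINT t|lebesgue. indicator {0..} t *\<^sub>R F t) = (LINT t|lebesgue. indicator {0..} t *\<^sub>R G t)"
    by (rule integral_cong_AE[OF Fl Gl]) (use ae' in eventually_elim, auto)
  also have "\<dots> = (LINT t|lborel. indicator {0..} t *\<^sub>R G t)" by (rule integral_completion[OF Gm])
  finally show ?thesis by (simp add: set_lebesgue_integral_def)
qed

locale sector_transform =
  fixes \<alpha>1 \<alpha>2 h1 h2 :: real and f :: "complex \<times> complex \<Rightarrow> complex"
  assumes \<alpha>1: "0 < \<alpha>1" "\<alpha>1 < pi / 2" and \<alpha>2: "0 < \<alpha>2" "\<alpha>2 < pi / 2"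
    and analytic: "analytic2_on f (sector \<alpha>1 \<times> sector \<alpha>2)"
    and h: "0 \<le> h1" "0 \<le> h2" and exp_type: "finite_exp_type \<alpha>1 \<alpha>2 h1 h2 f"
begin

definition \<eta> :: "nat \<Rightarrow> real" where "\<eta> n = 1 / real (Suc n)"

lemma \<eta>: "\<eta> n > 0" "\<eta> n \<le> 1" "\<eta> \<longlonglongrightarrow> 0"
  unfolding \<eta>_def[abs_def] using LIMSEQ_Suc[OF lim_const_over_n[of 1]] by auto

text \<open>The shifts of \<open>f\<close> are continuous up to the boundary; in \<open>\<Phi>\<close> and \<open>B\<close> the pair \<open>q\<close> is \<open>(r2, r1)\<close>,
  in the order of integration.\<close>

definition F :: "nat \<Rightarrow> complex \<times> complex \<Rightarrow> complex" where
  "F n w = f (fst w + of_real (\<eta> n), snd w + of_real (\<eta> n))"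

lemma shift_sector:
  "w1 \<in> closed_sector \<alpha>1 \<Longrightarrow> w1 + of_real (\<eta> n) \<in> sector \<alpha>1"
  "w2 \<in> closed_sector \<alpha>2 \<Longrightarrow> w2 + of_real (\<eta> n) \<in> sector \<alpha>2"
  using closed_sector_shift[OF \<alpha>1 _ \<eta>(1)] closed_sector_shift[OF \<alpha>2 _ \<eta>(1)] by auto

lemma continuous_F: "continuous_on (closed_sector \<alpha>1 \<times> closed_sector \<alpha>2) (F n)"
  unfolding F_def
  by (rule continuous_on_compose2[OF analytic2_on_imp_continuous_on[OF analytic]])
    (auto intro!: continuous_intros shift_sector)

lemma holomorphic_F1: "w2 \<in> closed_sector \<alpha>2 \<Longrightarrow> (\<lambda>w1. F n (w1, w2)) holomorphic_on sector \<alpha>1"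
proof -
  assume w2: "w2 \<in> closed_sector \<alpha>2"
  have "(\<lambda>w1. w1 + of_real (\<eta> n)) holomorphic_on sector \<alpha>1" by (intro holomorphic_intros)
  moreover have "(\<lambda>w1. w1 + of_real (\<eta> n)) ` sector \<alpha>1 \<subseteq> sector \<alpha>1"
    using shift_sector(1) sector_subset_closed_sector[OF \<alpha>1] by blast
  ultimately show ?thesis
    using holomorphic_on_compose_gen[OF _ analytic2_on_imp_holomorphic_fst[OF analytic shift_sector(2)[OF w2]], of "\<lambda>w1. w1 + of_real (\<eta> n)" "sector \<alpha>1" n]
    by (simp add: F_def o_def)
qed

lemma holomorphic_F2: "w1 \<in> closed_sector \<alpha>1 \<Longrightarrow> (\<lambda>w2. F n (w1, w2)) holomorphic_on sector \<alpha>2"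
proof -
  assume w1: "w1 \<in> closed_sector \<alpha>1"
  have "(\<lambda>w2. w2 + of_real (\<eta> n)) holomorphic_on sector \<alpha>2" by (intro holomorphic_intros)
  moreover have "(\<lambda>w2. w2 + of_real (\<eta> n)) ` sector \<alpha>2 \<subseteq> sector \<alpha>2"
    using shift_sector(2) sector_subset_closed_sector[OF \<alpha>2] by blast
  ultimately show ?thesis
    using holomorphic_on_compose_gen[OF _ analytic2_on_imp_holomorphic_snd[OF analytic shift_sector(1)[OF w1]], of "\<lambda>w2. w2 + of_real (\<eta> n)" "sector \<alpha>2" n]
    by (simp add: F_def o_def)
qed

text \<open>Uniform in n because the shift is at most 1: it costs the factor exp (H1 + H2).\<close>

lemma F_bound:
  assumes H: "H1 > h1" "H2 > h2"
  obtains K where "K \<ge> 0" "\<And>n w1 w2. w1 \<in> closed_sector \<alpha>1 \<Longrightarrow> w2 \<in> closed_sector \<alpha>2 \<Longrightarrow>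
    cmod (F n (w1, w2)) \<le> K * exp (H1 * cmod w1 + H2 * cmod w2)"
proof -
  define \<epsilon> where "\<epsilon> = min (H1 - h1) (H2 - h2)"
  have \<epsilon>: "\<epsilon> > 0" "h1 + \<epsilon> \<le> H1" "h2 + \<epsilon> \<le> H2" using H by (auto simp: \<epsilon>_def)
  obtain k where k: "k \<ge> 0" "\<And>z1 z2. z1 \<in> sector \<alpha>1 \<Longrightarrow> z2 \<in> sector \<alpha>2 \<Longrightarrow>
     cmod (f (z1, z2)) \<le> k * exp ((h1 + \<epsilon>) * cmod z1 + (h2 + \<epsilon>) * cmod z2)"
    using exp_type \<epsilon>(1) unfolding finite_exp_type_def by meson
  show thesis
  proof
    show "k * exp (H1 + H2) \<ge> 0" using k by simp
    fix n w1 w2 assume w: "w1 \<in> closed_sector \<alpha>1" "w2 \<in> closed_sector \<alpha>2"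
    have n1: "cmod (w + of_real (\<eta> n)) \<le> cmod w + 1" for w
      using norm_triangle_ineq[of w "of_real (\<eta> n)"] \<eta>(1,2)[of n] by simp
    have "cmod (F n (w1, w2)) \<le> k * exp ((h1 + \<epsilon>) * cmod (w1 + of_real (\<eta> n)) + (h2 + \<epsilon>) * cmod (w2 + of_real (\<eta> n)))"
      unfolding F_def fst_conv snd_conv by (intro k(2) shift_sector w)
    also have "\<dots> \<le> k * exp (H1 * (cmod w1 + 1) + H2 * (cmod w2 + 1))"
      using \<epsilon> h n1 by (intro mult_left_mono k iffD2[OF exp_le_cancel_iff] add_mono mult_mono) auto
    also have "\<dots> = k * exp (H1 + H2) * exp (H1 * cmod w1 + H2 * cmod w2)"
      by (simp add: exp_add algebra_simps)
    finally show "cmod (F n (w1, w2)) \<le> k * exp (H1 + H2) * exp (H1 * cmod w1 + H2 * cmod w2)" .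
  qed
qed

definition \<Phi> :: "sign \<Rightarrow> sign \<Rightarrow> nat \<Rightarrow> real \<times> real \<Rightarrow> complex" where
  "\<Phi> s1 s2 n q = indicator ({0..} \<times> {0..}) q *\<^sub>R F n (ray \<alpha>1 s1 * of_real (snd q), ray \<alpha>2 s2 * of_real (fst q))"

text \<open>The Borel representative of the boundary values: as a pointwise \<open>lim\<close> of
  Borel functions it is measurable on all pairs, while \<open>boundary_value\<close> is under
  control almost everywhere only.\<close>

definition B :: "sign \<Rightarrow> sign \<Rightarrow> real \<times> real \<Rightarrow> complex" where
  "B s1 s2 q = lim (\<lambda>n. \<Phi> s1 s2 n q)"

lemma \<Phi>_eq: "r1 \<ge> 0 \<Longrightarrow> r2 \<ge> 0 \<Longrightarrow> \<Phi> s1 s2 n (r2, r1) = F n (ray \<alpha>1 s1 * of_real r1, ray \<alpha>2 s2 * of_real r2)"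
  by (simp add: \<Phi>_def)

lemma \<Phi>_measurable [measurable]: "\<Phi> s1 s2 n \<in> borel_measurable (borel \<Otimes>\<^sub>M borel)"
  unfolding \<Phi>_def[abs_def] borel_prod
  by (rule borel_measurable_quadrant, rule continuous_on_compose2[OF continuous_F])
    (use ray_closed_sector[OF \<alpha>1] ray_closed_sector[OF \<alpha>2] in \<open>auto intro!: continuous_intros\<close>)

lemma B_measurable [measurable]: "B s1 s2 \<in> borel_measurable (borel \<Otimes>\<^sub>M borel)"
  unfolding B_def[abs_def] by (rule borel_measurable_lim_metric) measurable

lemma \<Phi>_bound:
  assumes H: "H1 > h1" "H2 > h2"
  obtains K where "K \<ge> 0" "\<And>s1 s2 n r1 r2. r1 \<ge> 0 \<Longrightarrow> r2 \<ge> 0 \<Longrightarrow> cmod (\<Phi> s1 s2 n (r2, r1)) \<le> K * exp (H1 * r1 + H2 * r2)"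
proof -
  obtain K where K: "K \<ge> 0" "\<And>n w1 w2. w1 \<in> closed_sector \<alpha>1 \<Longrightarrow> w2 \<in> closed_sector \<alpha>2 \<Longrightarrow>
    cmod (F n (w1, w2)) \<le> K * exp (H1 * cmod w1 + H2 * cmod w2)" using F_bound[OF H] by metis
  show thesis
  proof
    fix s1 s2 n and r1 r2 :: real assume r: "r1 \<ge> 0" "r2 \<ge> 0"
    show "cmod (\<Phi> s1 s2 n (r2, r1)) \<le> K * exp (H1 * r1 + H2 * r2)"
      unfolding \<Phi>_eq[OF r]
      using K(2)[OF ray_closed_sector[OF \<alpha>1 r(1), of s1] ray_closed_sector[OF \<alpha>2 r(2), of s2], of n] r by (simp add: norm_mult)
  qed (rule K)
qed

text \<open>The pairs with a vanishing coordinate, where a vertex is hit, form a null set and are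
  discarded together with the exceptional pairs of Fatou's theorem.\<close>

lemma AE_boundary:
  "AE r2 in lborel. AE r1 in lborel. r1 \<ge> 0 \<and> r2 \<ge> 0 \<longrightarrow> r1 > 0 \<and> r2 > 0 \<and>
     (\<lambda>n. \<Phi> s1 s2 n (r2, r1)) \<longlonglongrightarrow> B s1 s2 (r2, r1) \<and>
     has_nontangential_limit \<alpha>1 \<alpha>2 f (ray \<alpha>1 s1 * of_real r1, ray \<alpha>2 s2 * of_real r2) (B s1 s2 (r2, r1)) \<and>
     boundary_value \<alpha>1 \<alpha>2 f (ray \<alpha>1 s1 * of_real r1, ray \<alpha>2 s2 * of_real r2) = B s1 s2 (r2, r1)"
  using AE_nontangential_limit[OF \<alpha>1 \<alpha>2 analytic exp_type h, of s1 s2] AE_lborel_singleton[of "0::real"]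
proof eventually_elim
  case (elim r2)
  from elim(1) AE_lborel_singleton[of "0::real"] show ?case
  proof (eventually_elim, intro impI)
    fix r1 :: real assume l: "0 < r1 \<and> 0 < r2 \<longrightarrow> (\<exists>L. has_nontangential_limit \<alpha>1 \<alpha>2 f (ray \<alpha>1 s1 * of_real r1, ray \<alpha>2 s2 * of_real r2) L)"
      and r: "r1 \<noteq> 0" "r1 \<ge> 0 \<and> r2 \<ge> 0"
    have r12: "r1 > 0" "r2 > 0" "r1 \<ge> 0" "r2 \<ge> 0" using r elim(2) by auto
    then obtain L where L: "has_nontangential_limit \<alpha>1 \<alpha>2 f (ray \<alpha>1 s1 * of_real r1, ray \<alpha>2 s2 * of_real r2) L" using l by blast
    have lim: "(\<lambda>n. \<Phi> s1 s2 n (r2, r1)) \<longlonglongrightarrow> L"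
      unfolding \<Phi>_eq[OF r12(3,4)] F_def fst_conv snd_conv
      by (rule has_nontangential_limit_shift[OF \<alpha>1 \<alpha>2 r12(3,4) L \<eta>(1,3)])
    then have BL: "B s1 s2 (r2, r1) = L" unfolding B_def by (rule limI)
    show "r1 > 0 \<and> r2 > 0 \<and> (\<lambda>n. \<Phi> s1 s2 n (r2, r1)) \<longlonglongrightarrow> B s1 s2 (r2, r1) \<and>
     has_nontangential_limit \<alpha>1 \<alpha>2 f (ray \<alpha>1 s1 * of_real r1, ray \<alpha>2 s2 * of_real r2) (B s1 s2 (r2, r1)) \<and>
     boundary_value \<alpha>1 \<alpha>2 f (ray \<alpha>1 s1 * of_real r1, ray \<alpha>2 s2 * of_real r2) = B s1 s2 (r2, r1)"
      unfolding BL using r12 lim L boundary_value_eq[OF \<alpha>1 \<alpha>2 r12(3,4) L] by (simp add: BL)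
  qed
qed

lemma AE_\<Phi>_tendsto:
  "AE r2 in lborel. AE r1 in lborel. r1 \<ge> 0 \<and> r2 \<ge> 0 \<longrightarrow> (\<lambda>n. \<Phi> s1 s2 n (r2, r1)) \<longlonglongrightarrow> B s1 s2 (r2, r1)"
  using AE_boundary[of s1 s2]
proof eventually_elim
  case (elim r2)
  then show ?case by eventually_elim simp
qed

section \<open>The transform and the inversion formula in terms of the Borel boundary values\<close>

definition boundary_laplace :: "sign \<Rightarrow> sign \<Rightarrow> complex \<Rightarrow> complex \<Rightarrow> complex" where
  "boundary_laplace s1 s2 \<omega>1 \<omega>2 = (LINT r2:{0..}|lborel. LINT r1:{0..}|lborel.
     B s1 s2 (r2, r1) * (exp (\<omega>1 * (ray \<alpha>1 s1 * of_real r1)) * ray \<alpha>1 s1) * (exp (\<omega>2 * (ray \<alpha>2 s2 * of_real r2)) * ray \<alpha>2 s2))"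

lemma laplace_integral_eq:
  "laplace_integral \<alpha>1 \<alpha>2 f s1 s2 \<omega>1 \<omega>2 = - 1 / (4 * of_real pi ^ 2) * boundary_laplace s1 s2 \<omega>1 \<omega>2"
proof -
  have "ray_integral (sign_val s2 * \<alpha>2) (\<lambda>\<zeta>2. ray_integral (sign_val s1 * \<alpha>1) (\<lambda>\<zeta>1.
         boundary_value \<alpha>1 \<alpha>2 f (\<zeta>1, \<zeta>2) * exp (\<omega>1 * \<zeta>1 + \<omega>2 * \<zeta>2))) = boundary_laplace s1 s2 \<omega>1 \<omega>2"
    unfolding boundary_laplace_def ray_integral_def
  proof (rule lebesgue_LINT_half_line_eq)
    show "(\<lambda>r2. LINT r1:{0..}|lborel. B s1 s2 (r2, r1) * (exp (\<omega>1 * (ray \<alpha>1 s1 * of_real r1)) * ray \<alpha>1 s1) * (exp (\<omega>2 * (ray \<alpha>2 s2 * of_real r2)) * ray \<alpha>2 s2)) \<in> borel_measurable borel"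
      by (rule borel_measurable_set_LINT) measurable
    show "AE r2 in lborel. 0 \<le> r2 \<longrightarrow>
       set_lebesgue_integral lebesgue {0..} (\<lambda>t. boundary_value \<alpha>1 \<alpha>2 f (ray \<alpha>1 s1 * of_real t, ray \<alpha>2 s2 * of_real r2) *
           exp (\<omega>1 * (ray \<alpha>1 s1 * of_real t) + \<omega>2 * (ray \<alpha>2 s2 * of_real r2)) * ray \<alpha>1 s1) * ray \<alpha>2 s2 =
       (LINT r1:{0..}|lborel. B s1 s2 (r2, r1) * (exp (\<omega>1 * (ray \<alpha>1 s1 * of_real r1)) * ray \<alpha>1 s1) * (exp (\<omega>2 * (ray \<alpha>2 s2 * of_real r2)) * ray \<alpha>2 s2))"
      using AE_boundary[of s1 s2]
    proof (eventually_elim, intro impI)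
      fix r2 :: real
      assume ae: "AE r1 in lborel. r1 \<ge> 0 \<and> r2 \<ge> 0 \<longrightarrow> r1 > 0 \<and> r2 > 0 \<and>
         (\<lambda>n. \<Phi> s1 s2 n (r2, r1)) \<longlonglongrightarrow> B s1 s2 (r2, r1) \<and>
         has_nontangential_limit \<alpha>1 \<alpha>2 f (ray \<alpha>1 s1 * of_real r1, ray \<alpha>2 s2 * of_real r2) (B s1 s2 (r2, r1)) \<and>
         boundary_value \<alpha>1 \<alpha>2 f (ray \<alpha>1 s1 * of_real r1, ray \<alpha>2 s2 * of_real r2) = B s1 s2 (r2, r1)" and r2: "0 \<le> r2"
      have "set_lebesgue_integral lebesgue {0..} (\<lambda>t. boundary_value \<alpha>1 \<alpha>2 f (ray \<alpha>1 s1 * of_real t, ray \<alpha>2 s2 * of_real r2) *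
           exp (\<omega>1 * (ray \<alpha>1 s1 * of_real t) + \<omega>2 * (ray \<alpha>2 s2 * of_real r2)) * ray \<alpha>1 s1)
         = (LINT t:{0..}|lborel. B s1 s2 (r2, t) * exp (\<omega>1 * (ray \<alpha>1 s1 * of_real t) + \<omega>2 * (ray \<alpha>2 s2 * of_real r2)) * ray \<alpha>1 s1)"
      proof (rule lebesgue_LINT_half_line_eq)
        show "AE t in lborel. 0 \<le> t \<longrightarrow> boundary_value \<alpha>1 \<alpha>2 f (ray \<alpha>1 s1 * of_real t, ray \<alpha>2 s2 * of_real r2) *
           exp (\<omega>1 * (ray \<alpha>1 s1 * of_real t) + \<omega>2 * (ray \<alpha>2 s2 * of_real r2)) * ray \<alpha>1 s1 =
           B s1 s2 (r2, t) * exp (\<omega>1 * (ray \<alpha>1 s1 * of_real t) + \<omega>2 * (ray \<alpha>2 s2 * of_real r2)) * ray \<alpha>1 s1"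
          using ae by eventually_elim (simp add: r2)
      qed measurable
      then show "set_lebesgue_integral lebesgue {0..} (\<lambda>t. boundary_value \<alpha>1 \<alpha>2 f (ray \<alpha>1 s1 * of_real t, ray \<alpha>2 s2 * of_real r2) *
           exp (\<omega>1 * (ray \<alpha>1 s1 * of_real t) + \<omega>2 * (ray \<alpha>2 s2 * of_real r2)) * ray \<alpha>1 s1) * ray \<alpha>2 s2 =
       (LINT r1:{0..}|lborel. B s1 s2 (r2, r1) * (exp (\<omega>1 * (ray \<alpha>1 s1 * of_real r1)) * ray \<alpha>1 s1) * (exp (\<omega>2 * (ray \<alpha>2 s2 * of_real r2)) * ray \<alpha>2 s2))"
        by (simp only: set_integral_mult_left[symmetric]) (simp add: exp_add mult_ac)
    qed
  qed
  then show ?thesis by (simp add: laplace_integral_def)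
qed

text \<open>The Laplace integral already multiplied by exp (-\<omega>1 z1 - \<omega>2 z2) and by the
  directions of the legs; with an arbitrary \<open>\<Psi>\<close>, so that shifts and boundary
  values are treated alike.\<close>

definition kernel_integral :: "real \<Rightarrow> real \<Rightarrow> complex \<Rightarrow> complex \<Rightarrow> (real \<times> real \<Rightarrow> complex) \<Rightarrow> sign \<Rightarrow> sign \<Rightarrow> real \<Rightarrow> real \<Rightarrow> complex" where
  "kernel_integral p1 p2 z1 z2 \<Psi> s1 s2 t1 t2 = (LINT r2:{0..}|lborel. LINT r1:{0..}|lborel.
     \<Psi> (r2, r1) * inv_kernel \<alpha>1 p1 z1 s1 t1 r1 * inv_kernel \<alpha>2 p2 z2 s2 t2 r2)"

lemma kernel_integral_measurable:
  assumes [measurable]: "\<Psi> \<in> borel_measurable (borel \<Otimes>\<^sub>M borel)"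
  shows "(\<lambda>t. kernel_integral p1 p2 z1 z2 \<Psi> s1 s2 (fst t) (snd t)) \<in> borel_measurable (borel \<Otimes>\<^sub>M borel)"
  unfolding kernel_integral_def
proof (rule borel_measurable_set_LINT)
  show "(\<lambda>q. LINT r1:{0..}|lborel. \<Psi> (snd q, r1) * inv_kernel \<alpha>1 p1 z1 s1 (fst (fst q)) r1 * inv_kernel \<alpha>2 p2 z2 s2 (snd (fst q)) (snd q))
    \<in> borel_measurable ((borel \<Otimes>\<^sub>M borel) \<Otimes>\<^sub>M borel)"
    by (rule borel_measurable_set_LINT) measurable
qed

lemma kernel_integral_convergence:
  assumes p: "p1 * cos \<alpha>1 < - h1" "p2 * cos \<alpha>2 < - h2" and z: "z1 \<in> sector \<alpha>1" "z2 \<in> sector \<alpha>2"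
  obtains C where
    "\<And>s1 s2 n t1 t2. cmod (kernel_integral p1 p2 z1 z2 (\<Phi> s1 s2 n) s1 s2 t1 t2) \<le> C * exp (- leg_decay \<alpha>1 s1 z1 * t1) * exp (- leg_decay \<alpha>2 s2 z2 * t2)"
    "\<And>s1 s2 t1 t2. (\<lambda>n. kernel_integral p1 p2 z1 z2 (\<Phi> s1 s2 n) s1 s2 t1 t2) \<longlonglongrightarrow> kernel_integral p1 p2 z1 z2 (B s1 s2) s1 s2 t1 t2"
    "\<And>s1 s2 t1 t2. cmod (kernel_integral p1 p2 z1 z2 (B s1 s2) s1 s2 t1 t2) \<le> C * exp (- leg_decay \<alpha>1 s1 z1 * t1) * exp (- leg_decay \<alpha>2 s2 z2 * t2)"
proof -
  \<comment> \<open>Midway between the type of f and -p cos \<alpha>: above the type, so the bound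
    on the shifts holds, and below the decay of the kernel, so \<open>c1\<close> and
    \<open>c2\<close> are positive.\<close>
  define H1 H2 where "H1 = (h1 - p1 * cos \<alpha>1) / 2" and "H2 = (h2 - p2 * cos \<alpha>2) / 2"
  have H: "H1 > h1" "H2 > h2" "p1 * cos \<alpha>1 < - H1" "p2 * cos \<alpha>2 < - H2" "H1 \<ge> 0" "H2 \<ge> 0"
    using p h by (auto simp: H1_def H2_def field_simps)
  obtain K where K: "K \<ge> 0" "\<And>s1 s2 n r1 r2. r1 \<ge> 0 \<Longrightarrow> r2 \<ge> 0 \<Longrightarrow> cmod (\<Phi> s1 s2 n (r2, r1)) \<le> K * exp (H1 * r1 + H2 * r2)"
    using \<Phi>_bound[OF H(1,2)] by metis
  define c1 c2 where "c1 = - p1 * cos \<alpha>1 - H1" and "c2 = - p2 * cos \<alpha>2 - H2"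
  have c: "c1 > 0" "c2 > 0" using H by (auto simp: c1_def c2_def)
  define D1 D2 where "D1 = exp (- p1 * Re z1)" and "D2 = exp (- p2 * Re z2)"
  define d1 d2 where "d1 = (\<lambda>s. leg_decay \<alpha>1 s z1)" and "d2 = (\<lambda>s. leg_decay \<alpha>2 s z2)"
  let ?k1 = "\<lambda>s t r. inv_kernel \<alpha>1 p1 z1 s t r" and ?k2 = "\<lambda>s t r. inv_kernel \<alpha>2 p2 z2 s t r"
  have full: "cmod (\<Phi> s1 s2 n (r2, r1) * ?k1 s1 t1 r1 * ?k2 s2 t2 r2)
     \<le> ((K * D1 * D2) * exp (- d1 s1 * t1) * exp (- d2 s2 * t2)) * exp (- c1 * r1) * exp (- c2 * r2)"
    if "r1 \<ge> 0" "r2 \<ge> 0" for s1 s2 n r1 r2 t1 t2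
  proof -
    have "cmod (\<Phi> s1 s2 n (r2, r1) * ?k1 s1 t1 r1 * ?k2 s2 t2 r2) \<le> K * exp (H1 * r1 + H2 * r2)
        * (exp (p1 * cos \<alpha>1 * r1) * (D1 * exp (- d1 s1 * t1))) * (exp (p2 * cos \<alpha>2 * r2) * (D2 * exp (- d2 s2 * t2)))"
      unfolding norm_mult norm_inv_kernel D1_def D2_def d1_def d2_def using K(2)[OF that] by (intro mult_right_mono) auto
    also have "\<dots> = (K * D1 * D2) * exp (- d1 s1 * t1) * exp (- d2 s2 * t2) * ((exp (H1 * r1) * exp (p1 * cos \<alpha>1 * r1)) * (exp (H2 * r2) * exp (p2 * cos \<alpha>2 * r2)))"
      by (simp only: exp_add mult_ac)
    also have "exp (H1 * r1) * exp (p1 * cos \<alpha>1 * r1) = exp (- c1 * r1)" by (simp add: exp_add[symmetric] c1_def algebra_simps)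
    also have "exp (H2 * r2) * exp (p2 * cos \<alpha>2 * r2) = exp (- c2 * r2)" by (simp add: exp_add[symmetric] c2_def algebra_simps)
    finally show ?thesis by (simp only: mult.assoc)
  qed
  define m where "m = (\<lambda>s1 s2 n t1 t2. kernel_integral p1 p2 z1 z2 (\<Phi> s1 s2 n) s1 s2 t1 t2)"
  define m0 where "m0 = (\<lambda>s1 s2 t1 t2. kernel_integral p1 p2 z1 z2 (B s1 s2) s1 s2 t1 t2)"
  have mlim: "(\<lambda>n. m s1 s2 n t1 t2) \<longlonglongrightarrow> m0 s1 s2 t1 t2" for s1 s2 t1 t2
    unfolding m_def m0_def kernel_integral_def
    by (rule dominated_convergence_quadrant[OF _ _ _ _ c full AE_\<Phi>_tendsto]) measurable
  have mb: "cmod (m s1 s2 n t1 t2) \<le> (K * D1 * D2 / c1 / c2) * exp (- d1 s1 * t1) * exp (- d2 s2 * t2)" for s1 s2 n t1 t2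
  proof -
    have "cmod (m s1 s2 n t1 t2) \<le> ((K * D1 * D2) * exp (- d1 s1 * t1) * exp (- d2 s2 * t2)) / c1 / c2"
      unfolding m_def kernel_integral_def
    proof (rule norm_LINT_exp_bound[OF c(2)])
      fix r2 :: real assume r2: "r2 \<ge> 0"
      have "cmod (LINT r1:{0..}|lborel. \<Phi> s1 s2 n (r2, r1) * ?k1 s1 t1 r1 * ?k2 s2 t2 r2) \<le>
         ((K * D1 * D2) * exp (- d1 s1 * t1) * exp (- d2 s2 * t2) * exp (- c2 * r2)) / c1"
      proof (rule norm_LINT_exp_bound[OF c(1)])
        fix r1 :: real assume "r1 \<ge> 0"
        from full[OF this r2, of s1 s2 n t1 t2]
        show "cmod (\<Phi> s1 s2 n (r2, r1) * ?k1 s1 t1 r1 * ?k2 s2 t2 r2) \<le> ((K * D1 * D2) * exp (- d1 s1 * t1) * exp (- d2 s2 * t2) * exp (- c2 * r2)) * exp (- c1 * r1)"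
          by (simp only: mult_ac)
      qed
      then show "cmod (LINT r1:{0..}|lborel. \<Phi> s1 s2 n (r2, r1) * ?k1 s1 t1 r1 * ?k2 s2 t2 r2) \<le>
         ((K * D1 * D2) * exp (- d1 s1 * t1) * exp (- d2 s2 * t2)) / c1 * exp (- c2 * r2)" by simp
    qed
    then show ?thesis by simp
  qed
  show thesis
  proof
    show mb': "cmod (kernel_integral p1 p2 z1 z2 (\<Phi> s1 s2 n) s1 s2 t1 t2) \<le> (K * D1 * D2 / c1 / c2) * exp (- leg_decay \<alpha>1 s1 z1 * t1) * exp (- leg_decay \<alpha>2 s2 z2 * t2)" for s1 s2 n t1 t2
      using mb[of s1 s2 n t1 t2] by (simp only: m_def d1_def d2_def)
    show ml: "(\<lambda>n. kernel_integral p1 p2 z1 z2 (\<Phi> s1 s2 n) s1 s2 t1 t2) \<longlonglongrightarrow> kernel_integral p1 p2 z1 z2 (B s1 s2) s1 s2 t1 t2" for s1 s2 t1 t2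
      using mlim[of s1 s2 t1 t2] by (simp only: m_def m0_def)
    show "cmod (kernel_integral p1 p2 z1 z2 (B s1 s2) s1 s2 t1 t2) \<le> (K * D1 * D2 / c1 / c2) * exp (- leg_decay \<alpha>1 s1 z1 * t1) * exp (- leg_decay \<alpha>2 s2 z2 * t2)" for s1 s2 t1 t2
      by (rule tendsto_upperbound[OF tendsto_norm[OF ml] _ sequentially_bot]) (intro always_eventually allI mb')
  qed
qed

lemma kernel_integral_measurable_section:
  assumes \<Psi>: "\<Psi> \<in> borel_measurable (borel \<Otimes>\<^sub>M borel)"
  shows "(\<lambda>t2. kernel_integral p1 p2 z1 z2 \<Psi> s1 s2 t1 t2) \<in> borel_measurable borel"
proof -
  have "(\<lambda>t2. (t1, t2)) \<in> borel \<rightarrow>\<^sub>M borel \<Otimes>\<^sub>M borel" by measurable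
  from measurable_compose[OF this kernel_integral_measurable[OF \<Psi>]] show ?thesis by simp
qed

text \<open>The formula for the shifts passes to the limit through all four integrals: the two over
  the rays by convergence of the kernel integrals, the two over the legs by their decay, uniform in
  n. On the right side continuity of f at an interior point finishes the argument.\<close>

lemma boundary_inversion:
  assumes p: "p1 * cos \<alpha>1 < - h1" "p2 * cos \<alpha>2 < - h2" and z: "z1 \<in> sector \<alpha>1" "z2 \<in> sector \<alpha>2"
  shows "(\<Sum>s1\<in>{Pos, Neg}. LINT t1:{0..}|lborel. \<Sum>s2\<in>{Pos, Neg}. LINT t2:{0..}|lborel. kernel_integral p1 p2 z1 z2 (B s1 s2) s1 s2 t1 t2)
     = (2 * pi * \<i>)\<^sup>2 * f (z1, z2)"
proof -
  define H1 H2 where "H1 = (h1 - p1 * cos \<alpha>1) / 2" and "H2 = (h2 - p2 * cos \<alpha>2) / 2"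
  have H: "H1 > h1" "H2 > h2" "p1 * cos \<alpha>1 < - H1" "p2 * cos \<alpha>2 < - H2" "H1 \<ge> 0" "H2 \<ge> 0"
    using p h by (auto simp: H1_def H2_def field_simps)
  obtain K' where K': "\<And>n w1 w2. w1 \<in> closed_sector \<alpha>1 \<Longrightarrow> w2 \<in> closed_sector \<alpha>2 \<Longrightarrow>
    cmod (F n (w1, w2)) \<le> K' * exp (H1 * cmod w1 + H2 * cmod w2)" using F_bound[OF H(1,2)] by metis
  define m where "m = (\<lambda>s1 s2 n t1 t2. kernel_integral p1 p2 z1 z2 (\<Phi> s1 s2 n) s1 s2 t1 t2)"
  define m0 where "m0 = (\<lambda>s1 s2 t1 t2. kernel_integral p1 p2 z1 z2 (B s1 s2) s1 s2 t1 t2)"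
  define d1 d2 where "d1 = (\<lambda>s. leg_decay \<alpha>1 s z1)" and "d2 = (\<lambda>s. leg_decay \<alpha>2 s z2)"
  have d: "d1 s > 0" "d2 s > 0" for s using leg_decay_pos[OF \<alpha>1 z(1)] leg_decay_pos[OF \<alpha>2 z(2)] by (auto simp: d1_def d2_def)
  obtain C where mb: "\<And>s1 s2 n t1 t2. cmod (m s1 s2 n t1 t2) \<le> C * exp (- d1 s1 * t1) * exp (- d2 s2 * t2)"
    and mlim: "\<And>s1 s2 t1 t2. (\<lambda>n. m s1 s2 n t1 t2) \<longlonglongrightarrow> m0 s1 s2 t1 t2"
    using kernel_integral_convergence[OF p z] unfolding m_def m0_def d1_def d2_def by metis
  have mm1: "(\<lambda>t2. m s1 s2 n t1 t2) \<in> borel_measurable borel" "(\<lambda>t2. m0 s1 s2 t1 t2) \<in> borel_measurable borel" for s1 s2 n t1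
    unfolding m_def m0_def by (rule kernel_integral_measurable_section, measurable)+
  have mm2: "(\<lambda>t1. \<Sum>s2\<in>{Pos, Neg}. LINT t2:{0..}|lborel. m s1 s2 n t1 t2) \<in> borel_measurable borel"
     "(\<lambda>t1. \<Sum>s2\<in>{Pos, Neg}. LINT t2:{0..}|lborel. m0 s1 s2 t1 t2) \<in> borel_measurable borel" for s1 n
    unfolding m_def m0_def
    by (intro borel_measurable_sum borel_measurable_set_LINT kernel_integral_measurable \<Phi>_measurable B_measurable)+
  have lim2: "(\<lambda>n. \<Sum>s2\<in>{Pos, Neg}. LINT t2:{0..}|lborel. m s1 s2 n t1 t2) \<longlonglongrightarrow> (\<Sum>s2\<in>{Pos, Neg}. LINT t2:{0..}|lborel. m0 s1 s2 t1 t2)" for s1 t1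
    by (intro tendsto_sum dominated_convergence_half_line[OF mm1 d(2) mb]) (simp add: mlim)
  have b2: "cmod (\<Sum>s2\<in>{Pos, Neg}. LINT t2:{0..}|lborel. m s1 s2 n t1 t2) \<le> (\<Sum>s2\<in>{Pos, Neg}. C / d2 s2) * exp (- d1 s1 * t1)" for s1 n t1
  proof -
    have "cmod (LINT t2:{0..}|lborel. m s1 s2 n t1 t2) \<le> ((C) * exp (- d1 s1 * t1)) / d2 s2" for s2
      by (rule norm_LINT_exp_bound[OF d(2) mb])
    then show ?thesis unfolding sum_distrib_right by (intro sum_norm_le) simp
  qed
  have lim1: "(\<lambda>n. \<Sum>s1\<in>{Pos, Neg}. LINT t1:{0..}|lborel. \<Sum>s2\<in>{Pos, Neg}. LINT t2:{0..}|lborel. m s1 s2 n t1 t2)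
     \<longlonglongrightarrow> (\<Sum>s1\<in>{Pos, Neg}. LINT t1:{0..}|lborel. \<Sum>s2\<in>{Pos, Neg}. LINT t2:{0..}|lborel. m0 s1 s2 t1 t2)"
    by (intro tendsto_sum dominated_convergence_half_line[OF mm2 d(1) b2]) (simp add: lim2 del: sum.insert)
  have "(\<Sum>s1\<in>{Pos, Neg}. LINT t1:{0..}|lborel. \<Sum>s2\<in>{Pos, Neg}. LINT t2:{0..}|lborel. m s1 s2 n t1 t2) = (2 * pi * \<i>)\<^sup>2 * F n (z1, z2)" for n
  proof -
    have "m s1 s2 n t1 t2 = (LINT r2:{0..}|lborel. LINT r1:{0..}|lborel.
        F n (ray \<alpha>1 s1 * of_real r1, ray \<alpha>2 s2 * of_real r2) * inv_kernel \<alpha>1 p1 z1 s1 t1 r1 * inv_kernel \<alpha>2 p2 z2 s2 t2 r2)" for s1 s2 t1 t2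
      unfolding m_def kernel_integral_def by (intro set_lebesgue_integral_cong allI impI) (auto simp: \<Phi>_eq)
    then show ?thesis
      using Laplace_inversion_two[OF \<alpha>1 \<alpha>2 H(3-6) continuous_F holomorphic_F1 holomorphic_F2 K' z] by simp
  qed
  moreover have "(\<lambda>n. (2 * pi * \<i>)\<^sup>2 * F n (z1, z2)) \<longlonglongrightarrow> (2 * pi * \<i>)\<^sup>2 * f (z1, z2)"
  proof -
    have "isCont f (z1, z2)"
      using analytic2_on_imp_continuous_on[OF analytic] z open_sector[OF \<alpha>1] open_sector[OF \<alpha>2]
      by (simp add: continuous_on_eq_continuous_at open_Times)
    moreover have "(\<lambda>n. (z1 + of_real (\<eta> n), z2 + of_real (\<eta> n))) \<longlonglongrightarrow> (z1 + of_real 0, z2 + of_real 0)"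
      by (intro tendsto_intros \<eta>)
    ultimately have "(\<lambda>n. F n (z1, z2)) \<longlonglongrightarrow> f (z1, z2)"
      unfolding F_def using isCont_tendsto_compose[of "(z1, z2)" f] by simp
    then show ?thesis by (intro tendsto_intros)
  qed
  ultimately have "(\<Sum>s1\<in>{Pos, Neg}. LINT t1:{0..}|lborel. \<Sum>s2\<in>{Pos, Neg}. LINT t2:{0..}|lborel. m0 s1 s2 t1 t2) = (2 * pi * \<i>)\<^sup>2 * f (z1, z2)"
    using LIMSEQ_unique[OF lim1] by simp
  then show ?thesis by (simp only: m0_def)
qed

end

subsection \<open>Independence of the choice of rays\<close>

lemma norm_exp_minus_linear: "norm (exp z - 1 - z) \<le> exp (norm z) * (norm z)\<^sup>2" for z :: complex
  using Taylor_exp_field[of z 1] by (simp add: numeral_2_eq_2 diff_diff_eq)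

text \<open>A margin \<open>\<delta>\<close> in the exponent of the majorant dominates the second
  order remainder: half of it covers the exponential factor for |h| \<le> \<delta>/2, the other half
  the quadratic factor. The derivative at 0 suffices, since other points are reached by putting an
  exponential into \<open>u\<close>.\<close>

lemma exp_integral_has_field_derivative:
  fixes u v :: "'a \<Rightarrow> complex" and w :: "'a \<Rightarrow> real"
  assumes [measurable]: "u \<in> borel_measurable M" "v \<in> borel_measurable M"
    and vw: "\<And>q. cmod (v q) \<le> w q" and \<delta>: "\<delta> > 0"
    and int: "integrable M (\<lambda>q. cmod (u q) * exp (\<delta> * w q))"
  shows "((\<lambda>h. LINT q|M. u q * exp (- (h * v q))) has_field_derivative (LINT q|M. - (u q * v q))) (at 0)"
proof -
  define C where "C = (LINT q|M. cmod (u q) * exp (\<delta> * w q))"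
  have w0: "w q \<ge> 0" for q using order_trans[OF norm_ge_zero vw] .
  have i0: "integrable M u"
  proof (rule Bochner_Integration.integrable_bound[OF int])
    show "AE q in M. norm (u q) \<le> norm (cmod (u q) * exp (\<delta> * w q))"
    proof (rule AE_I2)
      fix q
      have "cmod (u q) * 1 \<le> cmod (u q) * exp (\<delta> * w q)" using w0[of q] \<delta> by (intro mult_left_mono) auto
      then show "norm (u q) \<le> norm (cmod (u q) * exp (\<delta> * w q))" by simp
    qed
  qed measurable
  have i1: "integrable M (\<lambda>q. u q * v q)"
  proof (rule Bochner_Integration.integrable_bound)
    show "integrable M (\<lambda>q. 1 / \<delta> * (cmod (u q) * exp (\<delta> * w q)))" using int by (rule integrable_mult_right)
    show "AE q in M. norm (u q * v q) \<le> norm (1 / \<delta> * (cmod (u q) * exp (\<delta> * w q)))"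
    proof (rule AE_I2)
      fix q
      have "\<delta> * w q \<le> exp (\<delta> * w q)" using exp_ge_add_one_self[of "\<delta> * w q"] by linarith
      then have "w q \<le> 1 / \<delta> * exp (\<delta> * w q)" using \<delta> by (simp add: field_simps)
      then have "cmod (u q) * cmod (v q) \<le> cmod (u q) * (1 / \<delta> * exp (\<delta> * w q))"
        using vw[of q] by (intro mult_left_mono) auto
      then show "norm (u q * v q) \<le> norm (1 / \<delta> * (cmod (u q) * exp (\<delta> * w q)))" using \<delta> by (simp add: norm_mult)
    qed
  qed measurable
  have est: "cmod ((LINT q|M. u q * exp (- (h * v q))) - (LINT q|M. u q) - (LINT q|M. - (u q * v q)) * h) \<le> (cmod h)\<^sup>2 * (8 / \<delta>\<^sup>2 * C)"
    if h: "cmod h \<le> \<delta> / 2" for h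
  proof -
    have hw: "cmod (h * v q) \<le> \<delta> / 2 * w q" for q
      unfolding norm_mult using h vw[of q] \<delta> by (intro mult_mono) auto
    have iE: "integrable M (\<lambda>q. u q * exp (- (h * v q)))"
    proof (rule Bochner_Integration.integrable_bound[OF int])
      show "AE q in M. norm (u q * exp (- (h * v q))) \<le> norm (cmod (u q) * exp (\<delta> * w q))"
      proof (rule AE_I2)
        fix q
        have "cmod (exp (- (h * v q))) \<le> exp (cmod (h * v q))"
          using norm_exp[of "- (h * v q)"] by simp
        also have "\<dots> \<le> exp (\<delta> * w q)"
          using hw[of q] w0[of q] \<delta> by (intro iffD2[OF exp_le_cancel_iff] order_trans[OF hw]) (simp add: mult_right_mono)
        finally show "norm (u q * exp (- (h * v q))) \<le> norm (cmod (u q) * exp (\<delta> * w q))"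
          by (simp add: norm_mult mult_left_mono)
      qed
    qed measurable
    have "(LINT q|M. u q * exp (- (h * v q))) - (LINT q|M. u q) - (LINT q|M. - (u q * v q)) * h
       = (LINT q|M. u q * exp (- (h * v q)) - u q - (- (u q * v q)) * h)"
      using iE i0 i1 by simp
    also have "cmod \<dots> \<le> (LINT q|M. (cmod h)\<^sup>2 * (8 / \<delta>\<^sup>2) * (cmod (u q) * exp (\<delta> * w q)))"
    proof (rule order_trans[OF integral_norm_bound integral_mono])
      show "integrable M (\<lambda>q. cmod (u q * exp (- (h * v q)) - u q - (- (u q * v q)) * h))"
        using iE i0 i1 by (intro integrable_norm Bochner_Integration.integrable_diff integrable_mult_left integrable_minus)
      show "integrable M (\<lambda>q. (cmod h)\<^sup>2 * (8 / \<delta>\<^sup>2) * (cmod (u q) * exp (\<delta> * w q)))" using int by (rule integrable_mult_right)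
      fix q
      have "u q * exp (- (h * v q)) - u q - (- (u q * v q)) * h = u q * (exp (- (h * v q)) - 1 - (- (h * v q)))"
        by (simp add: algebra_simps)
      moreover have "cmod (exp (- (h * v q)) - 1 - (- (h * v q))) \<le> (cmod h)\<^sup>2 * (8 / \<delta>\<^sup>2) * exp (\<delta> * w q)"
      proof -
        have "cmod (exp (- (h * v q)) - 1 - (- (h * v q))) \<le> exp (cmod (h * v q)) * (cmod (h * v q))\<^sup>2"
          using norm_exp_minus_linear[of "- (h * v q)"] by simp
        also have "\<dots> \<le> exp (\<delta> / 2 * w q) * ((cmod h)\<^sup>2 * (w q)\<^sup>2)"
          unfolding power_mult_distrib[symmetric] norm_mult
          using hw[of q] vw[of q] by (intro mult_mono power_mono) (auto simp: norm_mult intro: mult_left_mono)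
        \<comment> \<open>The quadratic term of the series, (\<delta> w / 2)^2 / 2, is at most exp
          (\<delta> w / 2), whence the 8.\<close>
        also have "(w q)\<^sup>2 \<le> 8 / \<delta>\<^sup>2 * exp (\<delta> / 2 * w q)"
        proof -
          have "1 + \<delta> / 2 * w q + (\<delta> / 2 * w q)\<^sup>2 / 2 \<le> exp (\<delta> / 2 * w q)"
            using w0[of q] \<delta> by (intro exp_lower_Taylor_quadratic) simp
          moreover have "0 \<le> \<delta> / 2 * w q" using w0[of q] \<delta> by simp
          ultimately have "(\<delta> / 2 * w q)\<^sup>2 / 2 \<le> exp (\<delta> / 2 * w q)" by linarith
          then show ?thesis using \<delta> by (simp add: field_simps power2_eq_square)
        qed
        then have "exp (\<delta> / 2 * w q) * ((cmod h)\<^sup>2 * (w q)\<^sup>2) \<le> exp (\<delta> / 2 * w q) * ((cmod h)\<^sup>2 * (8 / \<delta>\<^sup>2 * exp (\<delta> / 2 * w q)))"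
          by (intro mult_left_mono) auto
        also have "\<dots> = (cmod h)\<^sup>2 * (8 / \<delta>\<^sup>2) * (exp (\<delta> / 2 * w q) * exp (\<delta> / 2 * w q))" by (simp only: mult_ac)
        also have "exp (\<delta> / 2 * w q) * exp (\<delta> / 2 * w q) = exp (\<delta> * w q)" by (simp add: exp_add[symmetric])
        finally show ?thesis .
      qed
      ultimately show "norm (u q * exp (- (h * v q)) - u q - (- (u q * v q)) * h) \<le> (cmod h)\<^sup>2 * (8 / \<delta>\<^sup>2) * (cmod (u q) * exp (\<delta> * w q))"
        using mult_left_mono[of "cmod (exp (- (h * v q)) - 1 - (- (h * v q)))" "(cmod h)\<^sup>2 * (8 / \<delta>\<^sup>2) * exp (\<delta> * w q)" "cmod (u q)"]
        by (simp only: norm_mult) (simp add: mult_ac)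
    qed
    also have "\<dots> = (cmod h)\<^sup>2 * (8 / \<delta>\<^sup>2 * C)" by (simp add: C_def)
    finally show ?thesis .
  qed
  have C0: "C \<ge> 0" unfolding C_def by (rule integral_nonneg_AE) simp
  show ?thesis
    unfolding has_field_derivative_def has_derivative_at_alt
  proof (intro conjI allI impI bounded_linear_mult_right)
    fix e :: real assume e: "e > 0"
    define d where "d = min (\<delta> / 2) (e / (8 / \<delta>\<^sup>2 * C + 1))"
    have p: "8 / \<delta>\<^sup>2 * C + 1 > 0" using C0 \<delta> by (intro add_nonneg_pos) auto
    show "\<exists>d>0. \<forall>y. norm (y - 0) < d \<longrightarrow> norm ((LINT q|M. u q * exp (- (y * v q))) - (LINT q|M. u q * exp (- (0 * v q))) - (LINT q|M. - (u q * v q)) * (y - 0)) \<le> e * norm (y - 0)"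
    proof (intro exI[of _ d] conjI allI impI)
      show "d > 0" using \<delta> e p by (simp add: d_def)
      fix y :: complex assume y: "norm (y - 0) < d"
      have yd: "cmod y \<le> \<delta> / 2" "cmod y \<le> e / (8 / \<delta>\<^sup>2 * C + 1)" using y by (auto simp: d_def)
      have "cmod y * (8 / \<delta>\<^sup>2 * C) \<le> cmod y * (8 / \<delta>\<^sup>2 * C + 1)" by (intro mult_left_mono) auto
      also have "\<dots> \<le> e" using yd(2) p by (simp add: pos_le_divide_eq)
      finally have "(cmod y)\<^sup>2 * (8 / \<delta>\<^sup>2 * C) \<le> e * cmod y"
        using mult_right_mono[of "cmod y * (8 / \<delta>\<^sup>2 * C)" e "cmod y"] by (simp add: power2_eq_square mult_ac)
      with est[OF yd(1)]
      show "norm ((LINT q|M. u q * exp (- (y * v q))) - (LINT q|M. u q * exp (- (0 * v q))) - (LINT q|M. - (u q * v q)) * (y - 0)) \<le> e * norm (y - 0)"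
        by simp
    qed
  qed
qed

lemma integrable_quadrant_exp:
  fixes u :: "real \<times> real \<Rightarrow> complex"
  assumes [measurable]: "u \<in> borel_measurable (lborel \<Otimes>\<^sub>M lborel)" and c: "c1 > 0" "c2 > 0"
    and b: "AE q in lborel \<Otimes>\<^sub>M lborel. cmod (u q) \<le> K * ((indicator {0..} (fst q) * exp (- c2 * fst q)) * (indicator {0..} (snd q) * exp (- c1 * snd q)))"
  shows "integrable (lborel \<Otimes>\<^sub>M lborel) u"
proof (rule Bochner_Integration.integrable_bound)
  have e: "integrable lborel (\<lambda>t. indicator {0..} t * exp (- c1 * t))" "integrable lborel (\<lambda>t. indicator {0..} t * exp (- c2 * t))"
    using set_integrable_exp_neg[OF c(1)] set_integrable_exp_neg[OF c(2)] unfolding set_integrable_def by simp_all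
  show "integrable (lborel \<Otimes>\<^sub>M lborel) (\<lambda>q. K * ((indicator {0..} (fst q) * exp (- c2 * fst q)) * (indicator {0..} (snd q) * exp (- c1 * snd q))))"
    by (intro integrable_mult_right integrable_lborel_product e)
  show "AE q in lborel \<Otimes>\<^sub>M lborel. norm (u q) \<le> norm (K * ((indicator {0..} (fst q) * exp (- c2 * fst q)) * (indicator {0..} (snd q) * exp (- c1 * snd q))))"
    using b by eventually_elim (use abs_ge_self order_trans in \<open>fastforce\<close>)
qed measurable

locale sector_transform_bounds = sector_transform +
  fixes A1 A2 :: "sign \<Rightarrow> real"
  assumes A: "\<And>s1 s2 \<epsilon>. \<epsilon> > 0 \<Longrightarrow> \<exists>k. \<forall>z1 z2 L.
           z1 \<noteq> 0 \<and> Arg z1 = sign_val s1 * \<alpha>1 \<and> z2 \<noteq> 0 \<and> Arg z2 = sign_val s2 * \<alpha>2 \<and>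
           has_nontangential_limit \<alpha>1 \<alpha>2 f (z1, z2) L \<longrightarrow>
             cmod L \<le> k * exp ((A1 s1 + \<epsilon>) * cmod z1 + (A2 s2 + \<epsilon>) * cmod z2)"
begin

lemma Arg_ray:
  assumes "0 < \<alpha>" "\<alpha> < pi / 2" "r > 0"
  shows "Arg (ray \<alpha> s * of_real r) = sign_val s * \<alpha>"
proof (rule Arg_unique[of r])
  show "of_real r * exp (\<i> * of_real (sign_val s * \<alpha>)) = ray \<alpha> s * of_real r" by (simp add: cis_conv_exp mult.commute)
  show "- pi < sign_val s * \<alpha>" "sign_val s * \<alpha> \<le> pi" using assms by (cases s; simp)+
qed (rule assms)

text \<open>The growth hypothesis speaks of nontangential limits, with which \<open>B\<close> agrees
  almost everywhere. The bound is put on the product measure because it dominates a double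
  integral.\<close>

lemma B_bound:
  assumes \<epsilon>: "\<epsilon> > 0"
  obtains k where "AE q in lborel \<Otimes>\<^sub>M lborel. snd q \<ge> 0 \<and> fst q \<ge> 0 \<longrightarrow>
     cmod (B s1 s2 q) \<le> k * exp ((A1 s1 + \<epsilon>) * snd q + (A2 s2 + \<epsilon>) * fst q)"
proof -
  obtain k where k: "\<And>z1 z2 L. z1 \<noteq> 0 \<Longrightarrow> Arg z1 = sign_val s1 * \<alpha>1 \<Longrightarrow> z2 \<noteq> 0 \<Longrightarrow> Arg z2 = sign_val s2 * \<alpha>2 \<Longrightarrow>
           has_nontangential_limit \<alpha>1 \<alpha>2 f (z1, z2) L \<Longrightarrow>
             cmod L \<le> k * exp ((A1 s1 + \<epsilon>) * cmod z1 + (A2 s2 + \<epsilon>) * cmod z2)"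
    using A[OF \<epsilon>, of s1 s2] by blast
  have "AE r2 in lborel. AE r1 in lborel. snd (r2, r1) \<ge> 0 \<and> fst (r2, r1) \<ge> 0 \<longrightarrow>
     cmod (B s1 s2 (r2, r1)) \<le> k * exp ((A1 s1 + \<epsilon>) * snd (r2, r1) + (A2 s2 + \<epsilon>) * fst (r2, r1))"
    using AE_boundary[of s1 s2]
  proof eventually_elim
    case (elim r2)
    then show ?case
    proof (eventually_elim, intro impI)
      fix r1 assume *: "r1 \<ge> 0 \<and> r2 \<ge> 0 \<longrightarrow> r1 > 0 \<and> r2 > 0 \<and>
         (\<lambda>n. \<Phi> s1 s2 n (r2, r1)) \<longlonglongrightarrow> B s1 s2 (r2, r1) \<and>
         has_nontangential_limit \<alpha>1 \<alpha>2 f (ray \<alpha>1 s1 * of_real r1, ray \<alpha>2 s2 * of_real r2) (B s1 s2 (r2, r1)) \<and>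
         boundary_value \<alpha>1 \<alpha>2 f (ray \<alpha>1 s1 * of_real r1, ray \<alpha>2 s2 * of_real r2) = B s1 s2 (r2, r1)"
        and "snd (r2, r1) \<ge> 0 \<and> fst (r2, r1) \<ge> 0"
      then have r: "r1 > 0" "r2 > 0" and L: "has_nontangential_limit \<alpha>1 \<alpha>2 f (ray \<alpha>1 s1 * of_real r1, ray \<alpha>2 s2 * of_real r2) (B s1 s2 (r2, r1))" by auto
      show "cmod (B s1 s2 (r2, r1)) \<le> k * exp ((A1 s1 + \<epsilon>) * snd (r2, r1) + (A2 s2 + \<epsilon>) * fst (r2, r1))"
        using k[OF _ Arg_ray[OF \<alpha>1 r(1)] _ Arg_ray[OF \<alpha>2 r(2)] L] r by (simp add: norm_mult)
    qed
  qed
  moreover have "{q \<in> space (lborel \<Otimes>\<^sub>M lborel). snd q \<ge> 0 \<and> fst q \<ge> 0 \<longrightarrow>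
     cmod (B s1 s2 q) \<le> k * exp ((A1 s1 + \<epsilon>) * snd q + (A2 s2 + \<epsilon>) * fst q)} \<in> sets (lborel \<Otimes>\<^sub>M lborel)"
    by measurable
  ultimately have "AE q in lborel \<Otimes>\<^sub>M lborel. snd q \<ge> 0 \<and> fst q \<ge> 0 \<longrightarrow>
     cmod (B s1 s2 q) \<le> k * exp ((A1 s1 + \<epsilon>) * snd q + (A2 s2 + \<epsilon>) * fst q)"
    by (intro lborel_pair.AE_pair_measure)
  then show thesis by (rule that)
qed

text \<open>The translations of both arguments for which the integral over the rays s1, s2 still
  converges absolutely. As an intersection of two half-planes in one complex parameter it is convex,
  which suits the identity theorem.\<close>

definition admissible :: "complex \<Rightarrow> complex \<Rightarrow> sign \<Rightarrow> sign \<Rightarrow> complex set" where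
  "admissible \<omega>1 \<omega>2 s1 s2 = {l. Re ((\<omega>1 - l) * ray \<alpha>1 s1) < - A1 s1 \<and> Re ((\<omega>2 - l) * ray \<alpha>2 s2) < - A2 s2}"

lemma open_admissible: "open (admissible \<omega>1 \<omega>2 s1 s2)"
  unfolding admissible_def by (intro open_Collect_conj open_Collect_less continuous_intros)

lemma convex_admissible: "convex (admissible \<omega>1 \<omega>2 s1 s2)"
proof -
  have e: "Re ((\<omega> - l) * e) < - a \<longleftrightarrow> inner (cnj e) l > Re (\<omega> * e) + a" for \<omega> l e a
    by (simp add: inner_complex_def algebra_simps)
  have "admissible \<omega>1 \<omega>2 s1 s2 = {l. inner (cnj (ray \<alpha>1 s1)) l > Re (\<omega>1 * ray \<alpha>1 s1) + A1 s1} \<inter> {l. inner (cnj (ray \<alpha>2 s2)) l > Re (\<omega>2 * ray \<alpha>2 s2) + A2 s2}"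
    unfolding admissible_def e by blast
  then show ?thesis by (simp add: convex_Int convex_halfspace_gt)
qed

text \<open>In the double integral l occurs only in the factor exp (- l v), where v is the sum of
  the two boundary points, so differentiation under the integral sign applies at every admissible
  l.\<close>

lemma boundary_laplace_holomorphic: "(\<lambda>l. boundary_laplace s1 s2 (\<omega>1 - l) (\<omega>2 - l)) holomorphic_on admissible \<omega>1 \<omega>2 s1 s2"
proof -
  let ?M = "lborel \<Otimes>\<^sub>M lborel :: (real \<times> real) measure"
  define e1 e2 where "e1 = ray \<alpha>1 s1" and "e2 = ray \<alpha>2 s2"
  define u where "u = (\<lambda>q :: real \<times> real. indicator {0..} (fst q) *\<^sub>R (indicator {0..} (snd q) *\<^sub>R
     (B s1 s2 q * (exp (\<omega>1 * (e1 * of_real (snd q))) * e1) * (exp (\<omega>2 * (e2 * of_real (fst q))) * e2))))"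
  define v where "v = (\<lambda>q :: real \<times> real. e1 * of_real (snd q) + e2 * of_real (fst q))"
  define w where "w = (\<lambda>q :: real \<times> real. \<bar>snd q\<bar> + \<bar>fst q\<bar>)"
  have um[measurable]: "u \<in> borel_measurable ?M" unfolding u_def by measurable
  have vm[measurable]: "v \<in> borel_measurable ?M" unfolding v_def by measurable
  have wm[measurable]: "w \<in> borel_measurable ?M" unfolding w_def by measurable
  have vw: "cmod (v q) \<le> w q" for q
    unfolding v_def w_def by (rule order_trans[OF norm_triangle_ineq]) (simp add: e1_def e2_def norm_mult)
  have int: "\<exists>\<delta>>0. integrable ?M (\<lambda>q. cmod (u q * exp (- (l * v q))) * exp (\<delta> * w q))" if l: "l \<in> admissible \<omega>1 \<omega>2 s1 s2" for l
  proof -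
    define x1 x2 where "x1 = Re ((\<omega>1 - l) * e1)" and "x2 = Re ((\<omega>2 - l) * e2)"
    \<comment> \<open>One third of the gap goes into the bound on \<open>B\<close>, one third into
      the margin for differentiation, and at least one third is left as decay.\<close>
    define \<epsilon> where "\<epsilon> = min (- A1 s1 - x1) (- A2 s2 - x2) / 3"
    have "x1 < - A1 s1" "x2 < - A2 s2" using l by (auto simp: admissible_def x1_def x2_def e1_def e2_def)
    then have \<epsilon>: "\<epsilon> > 0" "3 * \<epsilon> \<le> - A1 s1 - x1" "3 * \<epsilon> \<le> - A2 s2 - x2" by (auto simp: \<epsilon>_def)
    define c1 c2 where "c1 = - (A1 s1 + x1 + 2 * \<epsilon>)" and "c2 = - (A2 s2 + x2 + 2 * \<epsilon>)"
    have c: "c1 > 0" "c2 > 0" using \<epsilon> by (auto simp: c1_def c2_def)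
    obtain k where k: "AE q in ?M. snd q \<ge> 0 \<and> fst q \<ge> 0 \<longrightarrow> cmod (B s1 s2 q) \<le> k * exp ((A1 s1 + \<epsilon>) * snd q + (A2 s2 + \<epsilon>) * fst q)"
      using B_bound[OF \<epsilon>(1)] by blast
    have "integrable ?M (\<lambda>q. of_real (cmod (u q * exp (- (l * v q))) * exp (\<epsilon> * w q)) :: complex)"
    proof (rule integrable_quadrant_exp[OF _ c])
      show "AE q in ?M. cmod (of_real (cmod (u q * exp (- (l * v q))) * exp (\<epsilon> * w q)) :: complex)
          \<le> k * ((indicator {0..} (fst q) * exp (- c2 * fst q)) * (indicator {0..} (snd q) * exp (- c1 * snd q)))"
        using k
      proof eventually_elim
        case (elim q)
        show ?case
        proof (cases "fst q \<ge> 0 \<and> snd q \<ge> 0")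
          case True
          have "u q * exp (- (l * v q)) = B s1 s2 q * (e1 * e2) * (exp (\<omega>1 * (e1 * of_real (snd q))) * exp (\<omega>2 * (e2 * of_real (fst q))) * exp (- (l * v q)))"
            using True by (simp add: u_def mult_ac)
          also have "exp (\<omega>1 * (e1 * of_real (snd q))) * exp (\<omega>2 * (e2 * of_real (fst q))) * exp (- (l * v q))
             = exp (((\<omega>1 - l) * e1) * of_real (snd q) + ((\<omega>2 - l) * e2) * of_real (fst q))"
            by (simp add: exp_add[symmetric] v_def algebra_simps)
          finally have "cmod (u q * exp (- (l * v q))) = cmod (B s1 s2 q) * exp (x1 * snd q + x2 * fst q)"
            by (simp add: norm_mult e1_def e2_def x1_def x2_def)
          also have "\<dots> \<le> k * exp ((A1 s1 + \<epsilon>) * snd q + (A2 s2 + \<epsilon>) * fst q) * exp (x1 * snd q + x2 * fst q)"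
            using elim True by (intro mult_right_mono) auto
          finally have "cmod (u q * exp (- (l * v q))) * exp (\<epsilon> * w q) \<le>
              k * exp ((A1 s1 + \<epsilon>) * snd q + (A2 s2 + \<epsilon>) * fst q) * exp (x1 * snd q + x2 * fst q) * exp (\<epsilon> * w q)"
            by (intro mult_right_mono) auto
          also have "\<dots> = k * (exp (- c2 * fst q) * exp (- c1 * snd q))"
            using True by (simp add: w_def mult.assoc exp_add[symmetric]) (simp add: c1_def c2_def algebra_simps)
          finally show ?thesis using True by (simp add: abs_mult indicator_def del: of_real_mult)
        next
          case False
          then have "u q = 0" by (auto simp: u_def)
          then show ?thesis using False by (auto simp: indicator_def)
        qed
      qed
    qed measurable
    then have "integrable ?M (\<lambda>q. cmod (u q * exp (- (l * v q))) * exp (\<epsilon> * w q))"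
      by (simp only: complex_of_real_integrable_eq)
    then show ?thesis using \<epsilon>(1) by blast
  qed
  define P where "P = (\<lambda>l. LINT q|?M. u q * exp (- (l * v q)))"
  have LBP: "boundary_laplace s1 s2 (\<omega>1 - l) (\<omega>2 - l) = P l" if l: "l \<in> admissible \<omega>1 \<omega>2 s1 s2" for l
  proof -
    obtain \<delta> where \<delta>: "\<delta> > 0" "integrable ?M (\<lambda>q. cmod (u q * exp (- (l * v q))) * exp (\<delta> * w q))" using int[OF l] by blast
    have i: "integrable ?M (\<lambda>q. u q * exp (- (l * v q)))"
    proof (rule Bochner_Integration.integrable_bound[OF \<delta>(2)])
      show "AE q in ?M. norm (u q * exp (- (l * v q))) \<le> norm (cmod (u q * exp (- (l * v q))) * exp (\<delta> * w q))"
      proof (rule AE_I2)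
        fix q
        have "cmod (u q * exp (- (l * v q))) * 1 \<le> cmod (u q * exp (- (l * v q))) * exp (\<delta> * w q)"
          using \<delta>(1) by (intro mult_left_mono) (auto simp: w_def)
        then show "norm (u q * exp (- (l * v q))) \<le> norm (cmod (u q * exp (- (l * v q))) * exp (\<delta> * w q))" by simp
      qed
    qed measurable
    have "P l = (LINT r2|lborel. LINT r1|lborel. u (r2, r1) * exp (- (l * v (r2, r1))))"
      unfolding P_def by (rule lborel_pair.integral_fst'[OF i, symmetric])
    also have "\<dots> = boundary_laplace s1 s2 (\<omega>1 - l) (\<omega>2 - l)"
      unfolding boundary_laplace_def set_lebesgue_integral_def
    proof (intro Bochner_Integration.integral_cong refl)
      fix r2 :: real
      have "u (r2, r1) * exp (- (l * v (r2, r1))) = indicator {0..} r2 *\<^sub>R (indicator {0..} r1 *\<^sub>R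
         (B s1 s2 (r2, r1) * (exp ((\<omega>1 - l) * (e1 * of_real r1)) * e1) * (exp ((\<omega>2 - l) * (e2 * of_real r2)) * e2)))" for r1
      proof -
        have e: "exp ((\<omega>1 - l) * (e1 * of_real r1)) * exp ((\<omega>2 - l) * (e2 * of_real r2))
          = exp (\<omega>1 * (e1 * of_real r1)) * exp (\<omega>2 * (e2 * of_real r2)) * exp (- (l * v (r2, r1)))"
          by (simp add: exp_add[symmetric] v_def algebra_simps)
        have "B s1 s2 (r2, r1) * (exp ((\<omega>1 - l) * (e1 * of_real r1)) * e1) * (exp ((\<omega>2 - l) * (e2 * of_real r2)) * e2)
          = B s1 s2 (r2, r1) * e1 * e2 * (exp ((\<omega>1 - l) * (e1 * of_real r1)) * exp ((\<omega>2 - l) * (e2 * of_real r2)))"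
          by (simp only: mult_ac)
        also note e
        finally show ?thesis by (simp only: u_def fst_conv snd_conv) (simp add: mult_ac)
      qed
      then show "(LINT r1|lborel. u (r2, r1) * exp (- (l * v (r2, r1)))) = indicator {0..} r2 *\<^sub>R (LINT r1|lborel. indicator {0..} r1 *\<^sub>R
         (B s1 s2 (r2, r1) * (exp ((\<omega>1 - l) * (ray \<alpha>1 s1 * of_real r1)) * ray \<alpha>1 s1) * (exp ((\<omega>2 - l) * (ray \<alpha>2 s2 * of_real r2)) * ray \<alpha>2 s2)))"
        by (simp only: e1_def[symmetric] e2_def[symmetric] integral_scaleR_right)
    qed
    finally show ?thesis by simp
  qed
  have "P holomorphic_on admissible \<omega>1 \<omega>2 s1 s2"
    unfolding holomorphic_on_open[OF open_admissible]
  proof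
    fix l assume l: "l \<in> admissible \<omega>1 \<omega>2 s1 s2"
    obtain \<delta> where \<delta>: "\<delta> > 0" "integrable ?M (\<lambda>q. cmod (u q * exp (- (l * v q))) * exp (\<delta> * w q))" using int[OF l] by blast
    have m: "(\<lambda>q. u q * exp (- (l * v q))) \<in> borel_measurable ?M" by measurable
    from exp_integral_has_field_derivative[OF m vm vw \<delta>]
    have "((\<lambda>h. LINT q|?M. u q * exp (- (l * v q)) * exp (- (h * v q))) has_field_derivative (LINT q|?M. - (u q * exp (- (l * v q)) * v q))) (at 0)" .
    moreover have "u q * exp (- (l * v q)) * exp (- (h * v q)) = u q * exp (- ((h + l) * v q))" for q h
      by (simp only: mult.assoc exp_add[symmetric]) (simp add: algebra_simps)
    ultimately have "((\<lambda>h. P (h + l)) has_field_derivative (LINT q|?M. - (u q * exp (- (l * v q)) * v q))) (at 0)" by (simp add: P_def)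
    then have "(P has_field_derivative (LINT q|?M. - (u q * exp (- (l * v q)) * v q))) (at l)"
      using DERIV_shift[of P _ 0 l] by simp
    then show "\<exists>f'. (P has_field_derivative f') (at l)" by blast
  qed
  then show ?thesis by (rule holomorphic_transform) (simp add: LBP)
qed

text \<open>The additional 1 gives the integrand of the shifts the decay exp (-|w|) in each variable
  on the whole closed sector. The ray of the inner variable is changed by Cauchy's theorem; after an
  interchange of the integrals the other variable is the inner one.\<close>

lemma boundary_laplace_eq_far_left:
  assumes H: "H1 > h1" "H2 > h2"
    and w: "\<And>s. Re (\<omega>1 * ray \<alpha>1 s) \<le> - (H1 + 1)" "\<And>s. Re (\<omega>2 * ray \<alpha>2 s) \<le> - (H2 + 1)"
  shows "boundary_laplace s1 s2 \<omega>1 \<omega>2 = boundary_laplace s1' s2' \<omega>1 \<omega>2"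
proof -
  have H0: "H1 \<ge> 0" "H2 \<ge> 0" using H h by auto
  obtain K where K: "K \<ge> 0" "\<And>n w1 w2. w1 \<in> closed_sector \<alpha>1 \<Longrightarrow> w2 \<in> closed_sector \<alpha>2 \<Longrightarrow>
    cmod (F n (w1, w2)) \<le> K * exp (H1 * cmod w1 + H2 * cmod w2)" using F_bound[OF H] by metis
  have rc1: "ray \<alpha>1 s * of_real r \<in> closed_sector \<alpha>1" if "r \<ge> 0" for s r using ray_closed_sector[OF \<alpha>1 that] .
  have rc2: "ray \<alpha>2 s * of_real r \<in> closed_sector \<alpha>2" if "r \<ge> 0" for s r using ray_closed_sector[OF \<alpha>2 that] .
  have Rw1: "Re (\<omega>1 * w) \<le> - (H1 + 1) * cmod w" if "w \<in> closed_sector \<alpha>1" for w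
    by (rule closed_sector_Re_le[OF \<alpha>1 that w(1)]) (use H0 in simp)
  have Rw2: "Re (\<omega>2 * w) \<le> - (H2 + 1) * cmod w" if "w \<in> closed_sector \<alpha>2" for w
    by (rule closed_sector_Re_le[OF \<alpha>2 that w(2)]) (use H0 in simp)
  define E where "E = (\<lambda>n w. F n w * exp (\<omega>1 * fst w) * exp (\<omega>2 * snd w))"
  have Eb: "cmod (E n (w1, w2)) \<le> K * exp (- 1 * cmod w1) * exp (- 1 * cmod w2)" if "w1 \<in> closed_sector \<alpha>1" "w2 \<in> closed_sector \<alpha>2" for n w1 w2
  proof -
    have "cmod (E n (w1, w2)) \<le> K * exp (H1 * cmod w1 + H2 * cmod w2) * exp (- (H1 + 1) * cmod w1) * exp (- (H2 + 1) * cmod w2)"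
      unfolding E_def norm_mult fst_conv snd_conv norm_exp_eq_Re
      using K Rw1[OF that(1)] Rw2[OF that(2)] that by (intro mult_mono iffD2[OF exp_le_cancel_iff]) auto
    also have "\<dots> = K * exp (- 1 * cmod w1) * exp (- 1 * cmod w2)"
      by (simp add: mult.assoc exp_add[symmetric]) (simp add: algebra_simps)
    finally show ?thesis .
  qed
  have Econt: "continuous_on (closed_sector \<alpha>1 \<times> closed_sector \<alpha>2) (E n)" for n
    unfolding E_def by (intro continuous_intros continuous_F)
  have Ehol1: "(\<lambda>w1. E n (w1, w2)) holomorphic_on sector \<alpha>1" if "w2 \<in> closed_sector \<alpha>2" for n w2
    unfolding E_def fst_conv snd_conv by (intro holomorphic_intros holomorphic_F1 that)
  have Ehol2: "(\<lambda>w2. E n (w1, w2)) holomorphic_on sector \<alpha>2" if "w1 \<in> closed_sector \<alpha>1" for n w1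
    unfolding E_def fst_conv snd_conv by (intro holomorphic_intros holomorphic_F2 that)
  define Q where "Q = (\<lambda>s1 s2 n. LINT r2:{0..}|lborel. LINT r1:{0..}|lborel.
     E n (ray \<alpha>1 s1 * of_real r1, ray \<alpha>2 s2 * of_real r2) * ray \<alpha>1 s1 * ray \<alpha>2 s2)"
  have Qlim: "Q s1 s2 \<longlonglongrightarrow> boundary_laplace s1 s2 \<omega>1 \<omega>2" for s1 s2
  proof -
    have b: "cmod (\<Phi> s1 s2 n (r2, r1) * (exp (\<omega>1 * (ray \<alpha>1 s1 * of_real r1)) * ray \<alpha>1 s1) * (exp (\<omega>2 * (ray \<alpha>2 s2 * of_real r2)) * ray \<alpha>2 s2))
       \<le> K * exp (- 1 * r1) * exp (- 1 * r2)" if r: "r1 \<ge> 0" "r2 \<ge> 0" for n r1 r2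
      using Eb[OF rc1[OF r(1), of s1] rc2[OF r(2), of s2], of n] r by (simp add: \<Phi>_eq E_def norm_mult mult_ac)
    have "(\<lambda>n. LINT r2:{0..}|lborel. LINT r1:{0..}|lborel. \<Phi> s1 s2 n (r2, r1) * (exp (\<omega>1 * (ray \<alpha>1 s1 * of_real r1)) * ray \<alpha>1 s1) * (exp (\<omega>2 * (ray \<alpha>2 s2 * of_real r2)) * ray \<alpha>2 s2))
       \<longlonglongrightarrow> boundary_laplace s1 s2 \<omega>1 \<omega>2"
      unfolding boundary_laplace_def by (rule dominated_convergence_quadrant[OF _ _ _ _ zero_less_one zero_less_one b AE_\<Phi>_tendsto]) measurable
    moreover have "(LINT r2:{0..}|lborel. LINT r1:{0..}|lborel. \<Phi> s1 s2 n (r2, r1) * (exp (\<omega>1 * (ray \<alpha>1 s1 * of_real r1)) * ray \<alpha>1 s1) * (exp (\<omega>2 * (ray \<alpha>2 s2 * of_real r2)) * ray \<alpha>2 s2)) = Q s1 s2 n" for n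
      unfolding Q_def by (intro set_lebesgue_integral_cong allI impI) (auto simp: \<Phi>_eq E_def mult_ac)
    ultimately show ?thesis by simp
  qed
  have c1: "Q s1 s2 n = Q s1' s2 n" for s1 s1' s2 n
    unfolding Q_def
  proof (rule set_lebesgue_integral_cong)
    show "\<forall>r2. r2 \<in> {0..} \<longrightarrow> (LINT r1:{0..}|lborel. E n (ray \<alpha>1 s1 * of_real r1, ray \<alpha>2 s2 * of_real r2) * ray \<alpha>1 s1 * ray \<alpha>2 s2)
        = (LINT r1:{0..}|lborel. E n (ray \<alpha>1 s1' * of_real r1, ray \<alpha>2 s2 * of_real r2) * ray \<alpha>1 s1' * ray \<alpha>2 s2)"
    proof (intro allI impI)
      fix r2 :: real assume "r2 \<in> {0..}"
      then have r2: "ray \<alpha>2 s2 * of_real r2 \<in> closed_sector \<alpha>2" using rc2 by simp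
      have "(LINT r1:{0..}|lborel. E n (ray \<alpha>1 s1 * of_real r1, ray \<alpha>2 s2 * of_real r2) * ray \<alpha>1 s1)
        = (LINT r1:{0..}|lborel. E n (ray \<alpha>1 s1' * of_real r1, ray \<alpha>2 s2 * of_real r2) * ray \<alpha>1 s1')"
      proof (rule ray_integrals_agree[OF \<alpha>1 zero_less_one _ Ehol1[OF r2], where K="K * exp (- 1 * cmod (ray \<alpha>2 s2 * of_real r2))"])
        show "continuous_on (closed_sector \<alpha>1) (\<lambda>w1. E n (w1, ray \<alpha>2 s2 * of_real r2))"
          by (rule continuous_on_compose2[OF Econt]) (use r2 in \<open>auto intro!: continuous_intros\<close>)
        show "cmod (E n (w, ray \<alpha>2 s2 * of_real r2)) \<le> K * exp (- 1 * cmod (ray \<alpha>2 s2 * of_real r2)) * exp (- 1 * cmod w)" if "w \<in> closed_sector \<alpha>1" for w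
          using Eb[OF that r2, of n] by (simp only: mult_ac)
      qed
      then show "(LINT r1:{0..}|lborel. E n (ray \<alpha>1 s1 * of_real r1, ray \<alpha>2 s2 * of_real r2) * ray \<alpha>1 s1 * ray \<alpha>2 s2)
        = (LINT r1:{0..}|lborel. E n (ray \<alpha>1 s1' * of_real r1, ray \<alpha>2 s2 * of_real r2) * ray \<alpha>1 s1' * ray \<alpha>2 s2)"
        by (simp only: set_integral_mult_left)
    qed
  qed simp
  have swap: "Q s1 s2 n = (LINT r1:{0..}|lborel. LINT r2:{0..}|lborel. E n (ray \<alpha>1 s1 * of_real r1, ray \<alpha>2 s2 * of_real r2) * ray \<alpha>1 s1 * ray \<alpha>2 s2)" for s1 s2 n
    unfolding Q_def
  proof (rule Fubini_half_lines(1)[of "\<lambda>q. E n (ray \<alpha>1 s1 * of_real (snd q), ray \<alpha>2 s2 * of_real (fst q)) * ray \<alpha>1 s1 * ray \<alpha>2 s2", simplified fst_conv snd_conv, OF borel_measurable_quadrant zero_less_one zero_less_one])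
    show "continuous_on ({0..} \<times> {0..}) (\<lambda>q. E n (ray \<alpha>1 s1 * of_real (snd q), ray \<alpha>2 s2 * of_real (fst q)) * ray \<alpha>1 s1 * ray \<alpha>2 s2)"
      by (intro continuous_on_mult continuous_on_const continuous_on_compose2[OF Econt]) (use rc1 rc2 in \<open>auto intro!: continuous_intros\<close>)
    show "cmod (E n (ray \<alpha>1 s1 * of_real r, ray \<alpha>2 s2 * of_real t) * ray \<alpha>1 s1 * ray \<alpha>2 s2) \<le> K * exp (- 1 * t) * exp (- 1 * r)" if "t \<ge> 0" "r \<ge> 0" for t r
      using Eb[OF rc1[OF that(2), of s1] rc2[OF that(1), of s2], of n] that by (simp add: norm_mult mult_ac)
  qed
  have c2: "Q s1 s2 n = Q s1 s2' n" for s1 s2 s2' n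
    unfolding swap
  proof (rule set_lebesgue_integral_cong)
    show "\<forall>r1. r1 \<in> {0..} \<longrightarrow> (LINT r2:{0..}|lborel. E n (ray \<alpha>1 s1 * of_real r1, ray \<alpha>2 s2 * of_real r2) * ray \<alpha>1 s1 * ray \<alpha>2 s2)
        = (LINT r2:{0..}|lborel. E n (ray \<alpha>1 s1 * of_real r1, ray \<alpha>2 s2' * of_real r2) * ray \<alpha>1 s1 * ray \<alpha>2 s2')"
    proof (intro allI impI)
      fix r1 :: real assume "r1 \<in> {0..}"
      then have r1: "ray \<alpha>1 s1 * of_real r1 \<in> closed_sector \<alpha>1" using rc1 by simp
      have e: "E n (ray \<alpha>1 s1 * of_real r1, ray \<alpha>2 s * of_real r2) * ray \<alpha>1 s1 * ray \<alpha>2 s = (E n (ray \<alpha>1 s1 * of_real r1, ray \<alpha>2 s * of_real r2) * ray \<alpha>2 s) * ray \<alpha>1 s1" for s r2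
        by (simp only: mult_ac)
      have "(LINT r2:{0..}|lborel. E n (ray \<alpha>1 s1 * of_real r1, ray \<alpha>2 s2 * of_real r2) * ray \<alpha>2 s2)
        = (LINT r2:{0..}|lborel. E n (ray \<alpha>1 s1 * of_real r1, ray \<alpha>2 s2' * of_real r2) * ray \<alpha>2 s2')"
      proof (rule ray_integrals_agree[OF \<alpha>2 zero_less_one _ Ehol2[OF r1], where K="K * exp (- 1 * cmod (ray \<alpha>1 s1 * of_real r1))"])
        show "continuous_on (closed_sector \<alpha>2) (\<lambda>w2. E n (ray \<alpha>1 s1 * of_real r1, w2))"
          by (rule continuous_on_compose2[OF Econt]) (use r1 in \<open>auto intro!: continuous_intros\<close>)
        show "cmod (E n (ray \<alpha>1 s1 * of_real r1, w)) \<le> K * exp (- 1 * cmod (ray \<alpha>1 s1 * of_real r1)) * exp (- 1 * cmod w)" if "w \<in> closed_sector \<alpha>2" for w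
          by (rule Eb[OF r1 that])
      qed
      then show "(LINT r2:{0..}|lborel. E n (ray \<alpha>1 s1 * of_real r1, ray \<alpha>2 s2 * of_real r2) * ray \<alpha>1 s1 * ray \<alpha>2 s2)
        = (LINT r2:{0..}|lborel. E n (ray \<alpha>1 s1 * of_real r1, ray \<alpha>2 s2' * of_real r2) * ray \<alpha>1 s1 * ray \<alpha>2 s2')"
        unfolding e by (simp only: set_integral_mult_left)
    qed
  qed simp
  have "Q s1 s2 = Q s1' s2'" using c1 c2 by (metis ext)
  then show ?thesis using LIMSEQ_unique[OF Qlim[of s1 s2]] Qlim[of s1' s2'] by simp
qed

text \<open>Moving both arguments to the left leads into the region where Cauchy's theorem applies to the
  shifts of \<open>f\<close>; the identity theorem carries the equality back.\<close>

lemma boundary_laplace_agree: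
  assumes w1: "\<omega>1 \<in> half_plane \<alpha>1 A1 s1" "\<omega>1 \<in> half_plane \<alpha>1 A1 s1'"
    and w2: "\<omega>2 \<in> half_plane \<alpha>2 A2 s2" "\<omega>2 \<in> half_plane \<alpha>2 A2 s2'"
  shows "boundary_laplace s1 s2 \<omega>1 \<omega>2 = boundary_laplace s1' s2' \<omega>1 \<omega>2"
proof -
  define T where "T = admissible \<omega>1 \<omega>2 s1 s2 \<inter> admissible \<omega>1 \<omega>2 s1' s2'"
  define D where "D = (\<lambda>l. boundary_laplace s1 s2 (\<omega>1 - l) (\<omega>2 - l) - boundary_laplace s1' s2' (\<omega>1 - l) (\<omega>2 - l))"
  have oT: "open T" unfolding T_def by (intro open_Int open_admissible)
  have cT: "connected T" unfolding T_def by (intro convex_connected convex_Int convex_admissible)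
  have hD: "D holomorphic_on T" unfolding D_def T_def
    by (intro holomorphic_on_diff holomorphic_on_subset[OF boundary_laplace_holomorphic]) auto
  have cp: "cos \<alpha>1 > 0" "cos \<alpha>2 > 0" using \<alpha>1 \<alpha>2 by (auto intro!: cos_gt_zero)
  have Rl: "Re ((\<omega> - of_real x) * ray \<alpha> s) = Re (\<omega> * ray \<alpha> s) - x * cos \<alpha>" for \<omega> x \<alpha> s
    by (cases s) (simp_all add: algebra_simps)
  \<comment> \<open>Subtracting x \<ge> 0 lowers the real part against each ray by x cos \<alpha>,
    so nonnegative translations remain admissible.\<close>
  have realT: "of_real x \<in> T" if "x \<ge> 0" for x
    using w1 w2 cp that mult_nonneg_nonneg[of x "cos \<alpha>1"] mult_nonneg_nonneg[of x "cos \<alpha>2"]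
    unfolding T_def admissible_def half_plane_def Int_iff mem_Collect_eq Rl by linarith
  define m1 m2 where "m1 = (\<Sum>s\<in>{Pos, Neg}. \<bar>Re (\<omega>1 * ray \<alpha>1 s)\<bar>)" and "m2 = (\<Sum>s\<in>{Pos, Neg}. \<bar>Re (\<omega>2 * ray \<alpha>2 s)\<bar>)"
  have m: "Re (\<omega>1 * ray \<alpha>1 s) \<le> m1" "Re (\<omega>2 * ray \<alpha>2 s) \<le> m2" for s by (cases s; simp add: m1_def m2_def)+
  \<comment> \<open>From here on the real parts against both rays are below the threshold of the
    comparison far to the left, used with h1 + 1 and h2 + 1.\<close>
  define X where "X = \<bar>m1 + h1 + 2\<bar> / cos \<alpha>1 + \<bar>m2 + h2 + 2\<bar> / cos \<alpha>2"
  have X0: "X \<ge> 0" using cp by (simp add: X_def)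
  have D0: "D (of_real x) = 0" if x: "x \<ge> X" for x
  proof -
    have "\<bar>m1 + h1 + 2\<bar> / cos \<alpha>1 \<le> x" "\<bar>m2 + h2 + 2\<bar> / cos \<alpha>2 \<le> x" using x cp by (auto simp: X_def intro: order_trans[rotated])
    then have "\<bar>m1 + h1 + 2\<bar> \<le> x * cos \<alpha>1" "\<bar>m2 + h2 + 2\<bar> \<le> x * cos \<alpha>2" using cp by (simp_all add: pos_divide_le_eq)
    then have "Re ((\<omega>1 - of_real x) * ray \<alpha>1 s) \<le> - ((h1 + 1) + 1)" "Re ((\<omega>2 - of_real x) * ray \<alpha>2 s) \<le> - ((h2 + 1) + 1)" for s
      unfolding Rl using m[of s] by linarith+
    then have "boundary_laplace s1 s2 (\<omega>1 - of_real x) (\<omega>2 - of_real x) = boundary_laplace s1' s2' (\<omega>1 - of_real x) (\<omega>2 - of_real x)"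
      by (intro boundary_laplace_eq_far_left[of "h1 + 1" "h2 + 1"]) auto
    then show ?thesis by (simp add: D_def)
  qed
  \<comment> \<open>\<open>T\<close> is convex, hence connected; it contains a half-line on which
    \<open>D\<close> vanishes and the point 0, which stands for the original arguments.\<close>
  have "D 0 = 0"
  proof (rule analytic_continuation[OF hD oT cT, of "of_real ` {X..}" "of_real X"])
    show "complex_of_real ` {X..} \<subseteq> T" using realT X0 by auto
    show "complex_of_real X \<in> T" by (rule realT[OF X0])
    show "complex_of_real X islimpt complex_of_real ` {X..}"
      unfolding islimpt_approachable
    proof (intro allI impI)
      fix e :: real assume "e > 0"
      then show "\<exists>x'\<in>complex_of_real ` {X..}. x' \<noteq> complex_of_real X \<and> dist x' (complex_of_real X) < e"
        by (intro bexI[of _ "complex_of_real (X + e / 2)"]) (auto simp: dist_norm intro!: image_eqI[of _ _ "X + e / 2"])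
    qed
    show "0 \<in> T" using realT[of 0] by simp
  qed (use D0 in auto)
  then show ?thesis by (simp add: D_def)
qed

text \<open>The agreement of the integrals is what gives the definite description a value; any pair
  of half-planes containing the arguments may then be used to compute it.\<close>

lemma concatenated_laplace_eq:
  assumes "\<omega>1 \<in> half_plane \<alpha>1 A1 s1" "\<omega>2 \<in> half_plane \<alpha>2 A2 s2"
  shows "concatenated_laplace \<alpha>1 \<alpha>2 A1 A2 f \<omega>1 \<omega>2 = - 1 / (4 * of_real pi ^ 2) * boundary_laplace s1 s2 \<omega>1 \<omega>2"
  unfolding concatenated_laplace_def
proof (rule the_equality)
  show "\<forall>s1' s2'. \<omega>1 \<in> half_plane \<alpha>1 A1 s1' \<longrightarrow> \<omega>2 \<in> half_plane \<alpha>2 A2 s2' \<longrightarrow>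
        - 1 / (4 * of_real pi ^ 2) * boundary_laplace s1 s2 \<omega>1 \<omega>2 = laplace_integral \<alpha>1 \<alpha>2 f s1' s2' \<omega>1 \<omega>2"
    unfolding laplace_integral_eq using boundary_laplace_agree[OF assms(1) _ assms(2)] by metis
qed (use assms in \<open>simp add: laplace_integral_eq\<close>)

end

subsection \<open>The inversion formula\<close>

lemma set_integrable_exp_bound_borel:
  fixes g :: "real \<Rightarrow> complex"
  assumes g: "g \<in> borel_measurable borel" and c: "c > 0"
    and b: "\<And>t. cmod (g t) \<le> K * exp (- c * t)"
  shows "set_integrable lborel {0..} g"
proof -
  have "set_integrable lborel {0..} (\<lambda>t. K * exp (- c * t))"
    using set_integrable_exp_neg[OF c] by (rule set_integrable_mult_right)
  then show ?thesis
  proof (rule set_integrable_bound)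
    show "set_borel_measurable lborel {0..} g" unfolding set_borel_measurable_def using g by measurable
    show "AE t in lborel. t \<in> {0..} \<longrightarrow> norm (g t) \<le> norm (K * exp (- c * t))"
      using order_trans[OF b abs_ge_self] by auto
  qed
qed

section \<open>The curve in terms of its legs\<close>

lemma Gamma_curve_eq:
  assumes "sign_val s * u > 0"
  shows "Gamma_curve \<alpha> p u = of_real p + leg_dir \<alpha> s * of_real u"
  using assms by (cases s) (auto simp: Gamma_curve_def leg_dir_def)

lemma Gamma_leg_eq: "Gamma_leg \<alpha> p s t = of_real p + leg_dir \<alpha> s * of_real (sign_val s * t)"
  by (simp add: Gamma_leg_def leg_dir_def mult_ac)

lemma Gamma_curve_leg: "t > 0 \<Longrightarrow> Gamma_curve \<alpha> p (sign_val s * t) = Gamma_leg \<alpha> p s t"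
  unfolding Gamma_leg_eq by (rule Gamma_curve_eq) (simp add: mult.assoc[symmetric])

lemma vector_derivative_Gamma_curve:
  assumes "sign_val s * u > 0"
  shows "vector_derivative (Gamma_curve \<alpha> p) (at u) = leg_dir \<alpha> s"
proof (rule vector_derivative_at, rule has_vector_derivative_transform_within_open)
  show "((\<lambda>u. of_real p + leg_dir \<alpha> s * of_real u) has_vector_derivative leg_dir \<alpha> s) (at u)"
    by (auto intro!: derivative_eq_intros)
  show "open {u. sign_val s * u > 0}" by (intro open_Collect_less continuous_intros)
qed (use assms in \<open>simp_all add: Gamma_curve_eq\<close>)

text \<open>At the corner, parameter 0, the derivative of the curve is unspecified and the two
  half-lines overlap, but this is a null set. Reflecting the negative half-line has Jacobian 1 and
  leaves \<open>leg_dir\<close> as it is.\<close>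

lemma curve_integral_Gamma_curve:
  assumes G: "\<And>s. set_integrable lborel {0..} (G s)"
    and eq: "\<And>s t. t > 0 \<Longrightarrow> h (Gamma_leg \<alpha> p s t) * leg_dir \<alpha> s = G s t"
  shows "curve_integral (Gamma_curve \<alpha> p) h = (\<Sum>s\<in>{Pos, Neg}. LINT t:{0..}|lborel. G s t)"
proof -
  define g where "g = (\<lambda>u. \<Sum>s\<in>{Pos, Neg}. indicator {0..} (sign_val s * u) *\<^sub>R G s (sign_val s * u))"
  have sv: "sign_val s \<noteq> 0" for s by (cases s) auto
  have i: "integrable lborel (\<lambda>u. indicator {0..} (sign_val s * u) *\<^sub>R G s (sign_val s * u))" for s
    using lborel_integrable_real_affine[OF G[of s, unfolded set_integrable_def] sv[of s], of 0] by simp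
  have "integral\<^sup>L lborel g = (\<Sum>s\<in>{Pos, Neg}. LINT u|lborel. indicator {0..} (sign_val s * u) *\<^sub>R G s (sign_val s * u))"
    unfolding g_def by (rule Bochner_Integration.integral_sum[OF i])
  also have "\<dots> = (\<Sum>s\<in>{Pos, Neg}. LINT t:{0..}|lborel. G s t)"
  proof (rule sum.cong[OF refl])
    fix s
    show "(LINT u|lborel. indicator {0..} (sign_val s * u) *\<^sub>R G s (sign_val s * u)) = (LINT t:{0..}|lborel. G s t)"
      using lborel_integral_real_affine[OF sv[of s], of "\<lambda>t. indicator {0..} t *\<^sub>R G s t" 0]
      by (simp add: set_lebesgue_integral_def)
  qed
  finally have ig: "integral\<^sup>L lborel g = (\<Sum>s\<in>{Pos, Neg}. LINT t:{0..}|lborel. G s t)" .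
  have "integrable lborel g" unfolding g_def by (intro Bochner_Integration.integrable_sum i)
  then have gm: "g \<in> borel_measurable lborel" by (rule borel_measurable_integrable)
  have gl: "g \<in> borel_measurable lebesgue" using gm by (rule measurable_completion)
  have ae: "AE u in lebesgue. g u = h (Gamma_curve \<alpha> p u) * vector_derivative (Gamma_curve \<alpha> p) (at u)"
    unfolding AE_completion_iff using AE_lborel_singleton[of "0::real"]
  proof eventually_elim
    fix u :: real assume u: "u \<noteq> 0"
    define s where "s = (if u > 0 then Pos else Neg)"
    have su: "sign_val s * u > 0" using u by (auto simp: s_def)
    have gu: "g u = G s (sign_val s * u)" using u by (auto simp: g_def s_def indicator_def)
    have "Gamma_leg \<alpha> p s (sign_val s * u) = Gamma_curve \<alpha> p u"
      using Gamma_curve_leg[OF su, of \<alpha> p s] by (simp add: mult.assoc[symmetric])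
    then show "g u = h (Gamma_curve \<alpha> p u) * vector_derivative (Gamma_curve \<alpha> p) (at u)"
      using eq[OF su, of s] by (simp add: gu vector_derivative_Gamma_curve[OF su])
  qed
  have fl: "(\<lambda>u. h (Gamma_curve \<alpha> p u) * vector_derivative (Gamma_curve \<alpha> p) (at u)) \<in> borel_measurable lebesgue"
    by (rule borel_measurable_AE[OF gl ae])
  have "curve_integral (Gamma_curve \<alpha> p) h = integral\<^sup>L lebesgue g"
    unfolding curve_integral_def by (rule integral_cong_AE[OF fl gl]) (use ae in eventually_elim, simp)
  also have "\<dots> = integral\<^sup>L lborel g" by (rule integral_completion[OF gm])
  finally show ?thesis unfolding ig .
qed

text \<open>Far out on each leg the curve leaves one of the two half-planes.\<close>

lemma Gamma_curve_Omega:
  assumes \<alpha>: "0 < \<alpha>" "\<alpha> < pi / 2" and sub: "range (Gamma_curve \<alpha> p) \<subseteq> Omega \<alpha> A"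
  shows "Gamma_leg \<alpha> p s t \<in> half_plane \<alpha> A s"
proof -
  define s' where "s' = (case s of Pos \<Rightarrow> Neg | Neg \<Rightarrow> Pos)"
  have Re': "Re (Gamma_leg \<alpha> p s u * ray \<alpha> s') = p * cos \<alpha> + sin (2 * \<alpha>) * u" for u
    unfolding sin_double by (cases s) (simp_all add: s'_def Gamma_leg_def algebra_simps)
  have s2: "sin (2 * \<alpha>) > 0" using \<alpha> by (intro sin_gt_zero) auto
  define u where "u = (\<bar>p * cos \<alpha>\<bar> + \<bar>A s'\<bar>) / sin (2 * \<alpha>) + 1"
  have u: "u > 0" unfolding u_def using s2 by (intro add_nonneg_pos) auto
  have "sin (2 * \<alpha>) * u = \<bar>p * cos \<alpha>\<bar> + \<bar>A s'\<bar> + sin (2 * \<alpha>)" using s2 by (simp add: u_def field_simps)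
  then have "Gamma_leg \<alpha> p s u \<notin> half_plane \<alpha> A s'" unfolding half_plane_def mem_Collect_eq Re' using s2 by linarith
  moreover have "Gamma_leg \<alpha> p s u \<in> Omega \<alpha> A" using sub Gamma_curve_leg[OF u, of \<alpha> p s] by (metis rangeI subsetD)
  ultimately have "Gamma_leg \<alpha> p s u \<in> half_plane \<alpha> A s" by (cases s) (auto simp: Omega_def s'_def)
  \<comment> \<open>Against its own ray the real part is constant along the leg, so membership at
    the single parameter \<open>u\<close> gives it at every t.\<close>
  then show ?thesis
    using Re_Gamma_leg_ray[of \<alpha> p s u 1] Re_Gamma_leg_ray[of \<alpha> p s t 1] by (simp add: half_plane_def)
qed

context sector_transform_bounds
begin

text \<open>The exponent of the kernel splits into the Laplace exponent and -\<omega> z, and the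
  latter does not depend on the ray parameters.\<close>

lemma kernel_integral_eq:
  "kernel_integral p1 p2 z1 z2 (B s1 s2) s1 s2 t1 t2 =
    boundary_laplace s1 s2 (Gamma_leg \<alpha>1 p1 s1 t1) (Gamma_leg \<alpha>2 p2 s2 t2) * exp (- Gamma_leg \<alpha>1 p1 s1 t1 * z1 - Gamma_leg \<alpha>2 p2 s2 t2 * z2) * leg_dir \<alpha>2 s2 * leg_dir \<alpha>1 s1"
proof -
  define g1 g2 where "g1 = Gamma_leg \<alpha>1 p1 s1 t1" and "g2 = Gamma_leg \<alpha>2 p2 s2 t2"
  have "B s1 s2 (r2, r1) * inv_kernel \<alpha>1 p1 z1 s1 t1 r1 * inv_kernel \<alpha>2 p2 z2 s2 t2 r2 =
     B s1 s2 (r2, r1) * (exp (g1 * (ray \<alpha>1 s1 * of_real r1)) * ray \<alpha>1 s1) * (exp (g2 * (ray \<alpha>2 s2 * of_real r2)) * ray \<alpha>2 s2)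
       * (exp (- g1 * z1 - g2 * z2) * leg_dir \<alpha>2 s2 * leg_dir \<alpha>1 s1)" for r1 r2
  proof -
    have "exp (- g1 * z1 - g2 * z2) = exp (- (g1 * z1)) * exp (- (g2 * z2))"
      by (simp add: exp_add[symmetric])
    moreover have "exp (g * (y - z)) = exp (g * y) * exp (- (g * z))" for g y z :: complex
      by (simp add: exp_add[symmetric] right_diff_distrib)
    ultimately show ?thesis unfolding inv_kernel_def g1_def[symmetric] g2_def[symmetric] by (simp only: mult_ac)
  qed
  then have "kernel_integral p1 p2 z1 z2 (B s1 s2) s1 s2 t1 t2 = boundary_laplace s1 s2 g1 g2 * (exp (- g1 * z1 - g2 * z2) * leg_dir \<alpha>2 s2 * leg_dir \<alpha>1 s1)"
    unfolding kernel_integral_def boundary_laplace_def by (simp only: set_integral_mult_left)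
  then show ?thesis by (simp only: g1_def g2_def mult.assoc)
qed

lemma inversion:
  assumes p: "p1 * cos \<alpha>1 < - h1" "p2 * cos \<alpha>2 < - h2"
    and sub: "range (Gamma_curve \<alpha>1 p1) \<subseteq> Omega \<alpha>1 A1" "range (Gamma_curve \<alpha>2 p2) \<subseteq> Omega \<alpha>2 A2"
    and z: "z1 \<in> sector \<alpha>1" "z2 \<in> sector \<alpha>2"
  shows "f (z1, z2) =
      curve_integral (Gamma_curve \<alpha>1 p1) (\<lambda>\<omega>1.
        curve_integral (Gamma_curve \<alpha>2 p2) (\<lambda>\<omega>2.
          concatenated_laplace \<alpha>1 \<alpha>2 A1 A2 f \<omega>1 \<omega>2 * exp (- \<omega>1 * z1 - \<omega>2 * z2)))"
proof -
  define \<kappa> :: complex where "\<kappa> = - 1 / (4 * of_real pi ^ 2)"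
  define m where "m = (\<lambda>s1 s2 t1 t2. kernel_integral p1 p2 z1 z2 (B s1 s2) s1 s2 t1 t2)"
  define d1 d2 where "d1 = (\<lambda>s. leg_decay \<alpha>1 s z1)" and "d2 = (\<lambda>s. leg_decay \<alpha>2 s z2)"
  have d: "d1 s > 0" "d2 s > 0" for s using leg_decay_pos[OF \<alpha>1 z(1)] leg_decay_pos[OF \<alpha>2 z(2)] by (auto simp: d1_def d2_def)
  obtain C where mb: "\<And>s1 s2 t1 t2. cmod (m s1 s2 t1 t2) \<le> C * exp (- d1 s1 * t1) * exp (- d2 s2 * t2)"
    using kernel_integral_convergence[OF p z] unfolding m_def d1_def d2_def by metis
  have m2: "(\<lambda>t2. m s1 s2 t1 t2) \<in> borel_measurable borel" for s1 s2 t1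
    unfolding m_def by (rule kernel_integral_measurable_section[OF B_measurable])
  have m1: "(\<lambda>t1. \<Sum>s2\<in>{Pos, Neg}. LINT t2:{0..}|lborel. m s1 s2 t1 t2) \<in> borel_measurable borel" for s1
    unfolding m_def by (intro borel_measurable_sum borel_measurable_set_LINT kernel_integral_measurable B_measurable)
  have i2: "set_integrable lborel {0..} (m s1 s2 t1)" for s1 s2 t1
    by (rule set_integrable_exp_bound_borel[OF m2 d(2) mb])
  have gd: "leg_dir \<alpha> s \<noteq> 0" for \<alpha> s using norm_leg_dir[of \<alpha> s] by force
  have b1: "cmod (\<Sum>s2\<in>{Pos, Neg}. LINT t2:{0..}|lborel. m s1 s2 t1 t2) \<le> (\<Sum>s2\<in>{Pos, Neg}. C / d2 s2) * exp (- d1 s1 * t1)" for s1 t1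
  proof -
    have "cmod (LINT t2:{0..}|lborel. m s1 s2 t1 t2) \<le> (C * exp (- d1 s1 * t1)) / d2 s2" for s2
      by (rule norm_LINT_exp_bound[OF d(2) mb])
    then show ?thesis unfolding sum_distrib_right by (intro sum_norm_le) simp
  qed
  define I where "I = (\<lambda>\<omega>1. curve_integral (Gamma_curve \<alpha>2 p2) (\<lambda>\<omega>2.
          concatenated_laplace \<alpha>1 \<alpha>2 A1 A2 f \<omega>1 \<omega>2 * exp (- \<omega>1 * z1 - \<omega>2 * z2)))"
  have I: "I (Gamma_leg \<alpha>1 p1 s1 t1) * leg_dir \<alpha>1 s1 = \<kappa> * (\<Sum>s2\<in>{Pos, Neg}. LINT t2:{0..}|lborel. m s1 s2 t1 t2)" for s1 t1
  proof -
    \<comment> \<open>\<open>m\<close> contains both leg directions, the inner curve integral only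
      the second one; the division by the first is undone by the outer integral.\<close>
    have "I (Gamma_leg \<alpha>1 p1 s1 t1) = (\<Sum>s2\<in>{Pos, Neg}. LINT t2:{0..}|lborel. \<kappa> / leg_dir \<alpha>1 s1 * m s1 s2 t1 t2)"
      unfolding I_def
    proof (rule curve_integral_Gamma_curve)
      show "set_integrable lborel {0..} (\<lambda>t2. \<kappa> / leg_dir \<alpha>1 s1 * m s1 s2 t1 t2)" for s2
        using i2 by (rule set_integrable_mult_right)
      fix s2 t2
      show "concatenated_laplace \<alpha>1 \<alpha>2 A1 A2 f (Gamma_leg \<alpha>1 p1 s1 t1) (Gamma_leg \<alpha>2 p2 s2 t2) *
         exp (- Gamma_leg \<alpha>1 p1 s1 t1 * z1 - Gamma_leg \<alpha>2 p2 s2 t2 * z2) * leg_dir \<alpha>2 s2 = \<kappa> / leg_dir \<alpha>1 s1 * m s1 s2 t1 t2"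
        \<comment> \<open>On the legs s1, s2 the transform is evaluated with the rays of the same
          signs, whose half-planes contain these legs.\<close>
        unfolding concatenated_laplace_eq[OF Gamma_curve_Omega[OF \<alpha>1 sub(1), of s1 t1] Gamma_curve_Omega[OF \<alpha>2 sub(2), of s2 t2]]
          m_def kernel_integral_eq \<kappa>_def[symmetric]
        using gd[of \<alpha>1 s1] by simp
    qed
    also have "\<dots> = \<kappa> / leg_dir \<alpha>1 s1 * (\<Sum>s2\<in>{Pos, Neg}. LINT t2:{0..}|lborel. m s1 s2 t1 t2)"
      unfolding sum_distrib_left set_integral_mult_right ..
    finally show ?thesis using gd[of \<alpha>1 s1] by simp
  qed
  have "curve_integral (Gamma_curve \<alpha>1 p1) I = (\<Sum>s1\<in>{Pos, Neg}. LINT t1:{0..}|lborel. \<kappa> * (\<Sum>s2\<in>{Pos, Neg}. LINT t2:{0..}|lborel. m s1 s2 t1 t2))"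
  proof (rule curve_integral_Gamma_curve[OF _ I])
    show "set_integrable lborel {0..} (\<lambda>t1. \<kappa> * (\<Sum>s2\<in>{Pos, Neg}. LINT t2:{0..}|lborel. m s1 s2 t1 t2))" for s1
      by (intro set_integrable_mult_right set_integrable_exp_bound_borel[OF m1 d(1) b1])
  qed
  also have "\<dots> = \<kappa> * ((2 * pi * \<i>)\<^sup>2 * f (z1, z2))"
    unfolding boundary_inversion[OF p z, symmetric] m_def sum_distrib_left[of \<kappa> _ "{Pos, Neg}", symmetric] set_integral_mult_right ..
  also have "\<dots> = f (z1, z2)" by (simp add: \<kappa>_def power_mult_distrib)
  finally show ?thesis unfolding I_def ..
qed

end

theorem theorem1p1p9:
  fixes \<alpha>1 \<alpha>2 h1 h2 p1 p2 :: real
    and A1 A2 :: "sign \<Rightarrow> real"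
    and f :: "complex \<times> complex \<Rightarrow> complex"
  assumes "0 < \<alpha>1" "\<alpha>1 < pi / 2" "0 < \<alpha>2" "\<alpha>2 < pi / 2"
    and "f \<in> Exp_class \<alpha>1 \<alpha>2"
    and "0 \<le> h1" "0 \<le> h2"
    and "finite_exp_type \<alpha>1 \<alpha>2 h1 h2 f"
    and "\<And>s1 s2 \<epsilon>. \<epsilon> > 0 \<Longrightarrow> \<exists>k. \<forall>z1 z2 L.
           z1 \<noteq> 0 \<and> Arg z1 = sign_val s1 * \<alpha>1 \<and> z2 \<noteq> 0 \<and> Arg z2 = sign_val s2 * \<alpha>2 \<and>
           has_nontangential_limit \<alpha>1 \<alpha>2 f (z1, z2) L \<longrightarrow>
             cmod L \<le> k * exp ((A1 s1 + \<epsilon>) * cmod z1 + (A2 s2 + \<epsilon>) * cmod z2)"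
    and "p1 * cos \<alpha>1 < - h1" "p2 * cos \<alpha>2 < - h2"
    and "range (Gamma_curve \<alpha>1 p1) \<subseteq> Omega \<alpha>1 A1"
    and "range (Gamma_curve \<alpha>2 p2) \<subseteq> Omega \<alpha>2 A2"
  shows "\<forall>z1\<in>sector \<alpha>1. \<forall>z2\<in>sector \<alpha>2.
    f (z1, z2) =
      curve_integral (Gamma_curve \<alpha>1 p1) (\<lambda>\<omega>1.
        curve_integral (Gamma_curve \<alpha>2 p2) (\<lambda>\<omega>2.
          concatenated_laplace \<alpha>1 \<alpha>2 A1 A2 f \<omega>1 \<omega>2 * exp (- \<omega>1 * z1 - \<omega>2 * z2)))"
proof -
  interpret sector_transform_bounds \<alpha>1 \<alpha>2 h1 h2 f A1 A2
    using assms(1-9) by unfold_locales (auto simp: Exp_class_def)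
  show ?thesis using inversion assms(10-13) by blast
qed

end
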